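(* Let $M=[0,1]$, and let $D_\epsilon$, $p_1$, $w_1$ be the differential operator and Sturm–Liouville coefficients on $[0,1]$ given in the context, with $M_+=\{x\in[0,1]: p_1(x)>0\}$. There exists a constant $\epsilon_0>0$ such that for all $0<\epsilon\le\epsilon_0$, the set of $C^2(M)$ solutions $u$ of the eigenvalue equation $D_\epsilon u=\lambda u$ on $M$ ($\lambda\in\mathbb{C}$) coincides with the set of eigenfunctions $u$ of $D_\epsilon$ satisfying the condition (Q) for every $y\in\partial M_+$, $\displaystyle\lim_{x\to y}p_1(x)u'(x)=0$. If (Q) holds (i.e. is imposed as the boundary condition for $D_\epsilon$), then: 1. $D_\epsilon$ is self-adjoint on $L^2(M_+,w_1)$. 2. The spectrum is discrete, with $\sigma(D_\epsilon)\subset[0,\infty)$. 3. The constant functions form the kernel of $D_\epsilon$.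
   Context: For small $\epsilon>0$, $D_\epsilon$ is the operator on $[0,1]$ given by $D_\epsilon f(x)=\phi_2(x)f''(x)+\phi_1(x)f'(x)$, where $$\phi_2(x)=\begin{cases}\frac1{12}\left(1-4\frac{x}{\epsilon}+\left(\frac{x}{\epsilon}\right)^2\right), & x\in[0,\epsilon],\\ -\frac16, & x\in[\epsilon,1-\epsilon],\\ \frac1{12}\left(1-4\frac{1-x}{\epsilon}+\left(\frac{1-x}{\epsilon}\right)^2\right), & x\in[1-\epsilon,1],\end{cases}$$ $$\phi_1(x)=\begin{cases}-6\left(1-\frac{x}{\epsilon}\right)\left(1+\frac{x}{\epsilon}\right)^{-3}, & x\in[0,\epsilon],\\ 0,& x\in[\epsilon,1-\epsilon],\\ 6\left(1-\frac{1-x}{\epsilon}\right)\left(1+\frac{1-x}{\epsilon}\right)^{-3}, & x\in[1-\epsilon,1].\end{cases}$$ Set $x_0=(2-\sqrt3)\epsilon$ and, for $x\in[0,\epsilon]$, $$g(x)=\operatorname{sgn}(x-x_0)\,|x-x_0|^{(4+2\sqrt3)\epsilon}\,|x-4\epsilon+x_0|^{(4-2\sqrt3)\epsilon}\,(x+\epsilon)^{-8\epsilon}\,e^{\frac{12\epsilon^3}{(\epsilon+x)^2}+\frac{12\epsilon^2}{\epsilon+x}}.$$ Define $p_1(x)=\frac{g(x)}{6g(\epsilon)}$ on $[0,\epsilon]$, $p_1(x)=\frac16$ on $[\epsilon,1-\epsilon]$, $p_1(x)=\frac{g(1-x)}{6g(\epsilon)}$ on $[1-\epsilon,1]$, and $w_1(x)=-p_1(x)/\phi_2(x)$.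 Almost everywhere on $[0,1]$, the equation $D_\epsilon u=\lambda u$ is equivalent to the Sturm–Liouville equation $-(p_1u')'=\lambda w_1u$. One has $M_+=(x_0,1-x_0)$ and $\partial M_+=\{x_0,1-x_0\}$. $L^2(M_+,w_1)$ is the weighted space with inner product $\int_{M_+}u\overline{v}\,w_1\,dx$. Absent a $C^2$ requirement, an eigenfunction of $D_\epsilon$ is a nontrivial solution of $-(p_1u')'=\lambda w_1u$ almost everywhere on $[0,1]$ in the usual Sturm–Liouville (quasi-derivative) sense: $u$ and the quasi-derivative $p_1u'$ are absolutely continuous. *)

theory Defs
  imports "HOL-Analysis.Analysis"
begin

section \<open>Coefficients\<close>

definition phi2 :: "real \<Rightarrow> real \<Rightarrow> real" where
  "phi2 \<epsilon> x =
     (if x \<le> \<epsilon> then (1/12) * (1 - 4 * (x/\<epsilon>) + (x/\<epsilon>)\<^sup>2)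
      else if x \<le> 1 - \<epsilon> then - (1/6)
      else (1/12) * (1 - 4 * ((1 - x)/\<epsilon>) + ((1 - x)/\<epsilon>)\<^sup>2))"

definition phi1 :: "real \<Rightarrow> real \<Rightarrow> real" where
  "phi1 \<epsilon> x =
     (if x \<le> \<epsilon> then - 6 * (1 - x/\<epsilon>) / (1 + x/\<epsilon>) ^ 3
      else if x \<le> 1 - \<epsilon> then 0
      else 6 * (1 - (1 - x)/\<epsilon>) / (1 + (1 - x)/\<epsilon>) ^ 3)"

definition x0 :: "real \<Rightarrow> real" where
  "x0 \<epsilon> = (2 - sqrt 3) * \<epsilon>"

definition g :: "real \<Rightarrow> real \<Rightarrow> real" where
  "g \<epsilon> x = sgn (x - x0 \<epsilon>)
     * \<bar>x - x0 \<epsilon>\<bar> powr ((4 + 2 * sqrt 3) * \<epsilon>)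
     * \<bar>x - 4 * \<epsilon> + x0 \<epsilon>\<bar> powr ((4 - 2 * sqrt 3) * \<epsilon>)
     * (x + \<epsilon>) powr (- 8 * \<epsilon>)
     * exp (12 * \<epsilon> ^ 3 / (\<epsilon> + x)\<^sup>2 + 12 * \<epsilon>\<^sup>2 / (\<epsilon> + x))"

definition p1 :: "real \<Rightarrow> real \<Rightarrow> real" where
  "p1 \<epsilon> x =
     (if x \<le> \<epsilon> then g \<epsilon> x / (6 * g \<epsilon> \<epsilon>)
      else if x \<le> 1 - \<epsilon> then 1/6
      else g \<epsilon> (1 - x) / (6 * g \<epsilon> \<epsilon>))"

text \<open>At the two zeros of \<^term>\<open>phi2 \<epsilon>\<close> division by zero gives the value 0, which is irrelevant:
  \<^term>\<open>w1 \<epsilon>\<close> is only used almost everywhere.\<close>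

definition w1 :: "real \<Rightarrow> real \<Rightarrow> real" where
  "w1 \<epsilon> x = - p1 \<epsilon> x / phi2 \<epsilon> x"

definition M_plus :: "real \<Rightarrow> real set" where
  "M_plus \<epsilon> = {x \<in> {0..1}. p1 \<epsilon> x > 0}"

section \<open>The differential expression and its eigenfunctions\<close>

text \<open>All derivatives are taken within the set on which the function is considered, so values
  outside that set play no role and derivatives at endpoints of an interval are one-sided.\<close>

definition deriv_on :: "real set \<Rightarrow> (real \<Rightarrow> complex) \<Rightarrow> real \<Rightarrow> complex" where
  "deriv_on S u x = vector_derivative u (at x within S)"

definition D_expr :: "real \<Rightarrow> real set \<Rightarrow> (real \<Rightarrow> complex) \<Rightarrow> real \<Rightarrow> complex" where
  "D_expr \<epsilon> S u x = phi2 \<epsilon> x *\<^sub>R deriv_on S (deriv_on S u) x + phi1 \<epsilon> x *\<^sub>R deriv_on S u x"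

definition C2_on :: "real set \<Rightarrow> (real \<Rightarrow> complex) \<Rightarrow> bool" where
  "C2_on S u \<longleftrightarrow> (\<exists>u' u''. (\<forall>x\<in>S. (u has_vector_derivative u' x) (at x within S)) \<and>
     (\<forall>x\<in>S. (u' has_vector_derivative u'' x) (at x within S)) \<and> continuous_on S u'')"

definition abs_cont_on :: "real set \<Rightarrow> (real \<Rightarrow> complex) \<Rightarrow> bool" where
  "abs_cont_on I f \<longleftrightarrow>
     (\<forall>e>0. \<exists>d>0. \<forall>(n::nat) a b.
        (\<forall>i<n. a i \<le> b i \<and> {a i..b i} \<subseteq> I) \<and>
        (\<forall>i<n. \<forall>j<n. i \<noteq> j \<longrightarrow> {a i<..<b i} \<inter> {a j<..<b j} = {}) \<and>
        (\<Sum>i<n. b i - a i) < d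
        \<longrightarrow> (\<Sum>i<n. norm (f (b i) - f (a i))) < e)"

text \<open>For a compact interval this is absolute continuity on the whole interval.\<close>

definition loc_abs_cont_on :: "real set \<Rightarrow> (real \<Rightarrow> complex) \<Rightarrow> bool" where
  "loc_abs_cont_on I f \<longleftrightarrow> (\<forall>a b. {a..b} \<subseteq> I \<longrightarrow> abs_cont_on {a..b} f)"

text \<open>\<^term>\<open>v\<close> is the quasi-derivative \<open>p u'\<close>. Since \<open>u'\<close> exists only almost everywhere, \<open>p u'\<close>
  is identified with its (unique) absolutely continuous representative \<^term>\<open>v\<close>.\<close>

definition quasi_derivative ::
  "(real \<Rightarrow> real) \<Rightarrow> real set \<Rightarrow> (real \<Rightarrow> complex) \<Rightarrow> (real \<Rightarrow> complex) \<Rightarrow> bool" where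
  "quasi_derivative p I u v \<longleftrightarrow> loc_abs_cont_on I u \<and> loc_abs_cont_on I v \<and>
     (AE x in lebesgue_on I. \<exists>u'. (u has_vector_derivative u') (at x within I) \<and> v x = p x *\<^sub>R u')"

definition eigenfunction :: "real \<Rightarrow> complex \<Rightarrow> (real \<Rightarrow> complex) \<Rightarrow> bool" where
  "eigenfunction \<epsilon> z u \<longleftrightarrow> (\<exists>x\<in>{0..1}. u x \<noteq> 0) \<and>
     (\<exists>v. quasi_derivative (p1 \<epsilon>) {0..1} u v \<and>
        (AE x in lebesgue_on {0..1}. \<exists>v'. (v has_vector_derivative v') (at x within {0..1}) \<and>
           - v' = z * (w1 \<epsilon> x *\<^sub>R u x)))"

text \<open>Condition (Q) for a function considered on \<^term>\<open>S\<close>, where \<^term>\<open>S\<close> is \<open>[0,1]\<close> (two-sided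
  limits, as the boundary points are interior to \<open>[0,1]\<close>) or \<open>M_+\<close> (limits from inside).\<close>

definition cond_Q :: "real \<Rightarrow> real set \<Rightarrow> (real \<Rightarrow> complex) \<Rightarrow> bool" where
  "cond_Q \<epsilon> S u \<longleftrightarrow>
     (\<forall>y \<in> frontier (M_plus \<epsilon>). ((\<lambda>x. p1 \<epsilon> x *\<^sub>R deriv_on S u x) \<longlongrightarrow> 0) (at y within S))"

section \<open>Unbounded operators on complex \<open>L\<^sup>2\<close> spaces\<close>

text \<open>Elements of \<open>L\<^sup>2\<close> are represented by functions modulo equality almost everywhere; an unbounded
  operator is represented by its graph, a set of pairs of functions saturated under this
  equivalence.\<close>

definition L2 :: "'a measure \<Rightarrow> ('a \<Rightarrow> complex) set" where
  "L2 M = {f \<in> borel_measurable M. integrable M (\<lambda>x. (norm (f x))\<^sup>2)}"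

definition L2_inner :: "'a measure \<Rightarrow> ('a \<Rightarrow> complex) \<Rightarrow> ('a \<Rightarrow> complex) \<Rightarrow> complex" where
  "L2_inner M f h = (\<integral>x. f x * cnj (h x) \<partial>M)"

definition L2_norm :: "'a measure \<Rightarrow> ('a \<Rightarrow> complex) \<Rightarrow> real" where
  "L2_norm M f = sqrt (\<integral>x. (norm (f x))\<^sup>2 \<partial>M)"

type_synonym 'a fun_graph = "(('a \<Rightarrow> complex) \<times> ('a \<Rightarrow> complex)) set"

definition L2_operator :: "'a measure \<Rightarrow> 'a fun_graph \<Rightarrow> bool" where
  "L2_operator M T \<longleftrightarrow> T \<subseteq> L2 M \<times> L2 M \<and>
     (\<forall>(u, f)\<in>T. \<forall>v\<in>L2 M. \<forall>h\<in>L2 M.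
        (AE x in M. u x = v x) \<and> (AE x in M. f x = h x) \<longrightarrow> (v, h) \<in> T) \<and>
     (\<lambda>_. 0, \<lambda>_. 0) \<in> T \<and>
     (\<forall>(u, f)\<in>T. \<forall>(v, h)\<in>T. \<forall>c. (\<lambda>x. c * u x + v x, \<lambda>x. c * f x + h x) \<in> T) \<and>
     (\<forall>(u, f)\<in>T. \<forall>(v, h)\<in>T. (AE x in M. u x = v x) \<longrightarrow> (AE x in M. f x = h x))"

definition densely_defined :: "'a measure \<Rightarrow> 'a fun_graph \<Rightarrow> bool" where
  "densely_defined M T \<longleftrightarrow>
     (\<forall>f\<in>L2 M. \<forall>e>0. \<exists>u\<in>Domain T. L2_norm M (\<lambda>x. f x - u x) < e)"

definition L2_adjoint :: "'a measure \<Rightarrow> 'a fun_graph \<Rightarrow> 'a fun_graph" where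
  "L2_adjoint M T =
     {(v, h) \<in> L2 M \<times> L2 M. \<forall>(u, f)\<in>T. L2_inner M f v = L2_inner M u h}"

definition self_adjoint :: "'a measure \<Rightarrow> 'a fun_graph \<Rightarrow> bool" where
  "self_adjoint M T \<longleftrightarrow> L2_operator M T \<and> densely_defined M T \<and> L2_adjoint M T = T"

text \<open>\<^term>\<open>z\<close> is in the resolvent set iff \<open>T - z\<close> is a bijection from the domain onto \<open>L\<^sup>2\<close> with
  bounded inverse.\<close>

definition L2_resolvent_set :: "'a measure \<Rightarrow> 'a fun_graph \<Rightarrow> complex set" where
  "L2_resolvent_set M T = {z.
     (\<forall>(u, f)\<in>T. (AE x in M. f x - z * u x = 0) \<longrightarrow> (AE x in M. u x = 0)) \<and>
     (\<forall>h\<in>L2 M. \<exists>(u, f)\<in>T. AE x in M. f x - z * u x = h x) \<and>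
     (\<exists>C. \<forall>(u, f)\<in>T. L2_norm M u \<le> C * L2_norm M (\<lambda>x. f x - z * u x))}"

definition L2_spectrum :: "'a measure \<Rightarrow> 'a fun_graph \<Rightarrow> complex set" where
  "L2_spectrum M T = - L2_resolvent_set M T"

definition L2_eigenspace :: "'a measure \<Rightarrow> 'a fun_graph \<Rightarrow> complex \<Rightarrow> ('a \<Rightarrow> complex) set" where
  "L2_eigenspace M T z = {u. \<exists>f. (u, f) \<in> T \<and> (AE x in M. f x = z * u x)}"

abbreviation L2_kernel :: "'a measure \<Rightarrow> 'a fun_graph \<Rightarrow> ('a \<Rightarrow> complex) set" where
  "L2_kernel M T \<equiv> {u. \<exists>f. (u, f) \<in> T \<and> (AE x in M. f x = 0)}"

text \<open>Discreteness in the usual sense for self-adjoint operators: the spectrum consists of isolated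
  points which are eigenvalues of finite multiplicity.\<close>

definition discrete_spectrum :: "'a measure \<Rightarrow> 'a fun_graph \<Rightarrow> bool" where
  "discrete_spectrum M T \<longleftrightarrow>
     (\<forall>z \<in> L2_spectrum M T. z isolated_in L2_spectrum M T \<and>
        (\<exists>u \<in> L2_eigenspace M T z. \<not> (AE x in M. u x = 0)) \<and>
        (\<exists>B. finite B \<and> B \<subseteq> L2_eigenspace M T z \<and>
           (\<forall>u \<in> L2_eigenspace M T z. \<exists>c. AE x in M. u x = (\<Sum>b\<in>B. c b * b x))))"

section \<open>The operator on \<open>L\<^sup>2(M_+, w_1)\<close> with boundary condition (Q)\<close>

definition mu_plus :: "real \<Rightarrow> real measure" where
  "mu_plus \<epsilon> = density (lebesgue_on (M_plus \<epsilon>)) (\<lambda>x. ennreal (w1 \<epsilon> x))"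

text \<open>The Sturm--Liouville maximal domain, restricted by (Q).\<close>

definition dom_Q :: "real \<Rightarrow> (real \<Rightarrow> complex) set" where
  "dom_Q \<epsilon> = {u \<in> L2 (mu_plus \<epsilon>).
     (\<exists>v. quasi_derivative (p1 \<epsilon>) (M_plus \<epsilon>) u v) \<and>
     D_expr \<epsilon> (M_plus \<epsilon>) u \<in> L2 (mu_plus \<epsilon>) \<and>
     cond_Q \<epsilon> (M_plus \<epsilon>) u}"

definition D_Q :: "real \<Rightarrow> real fun_graph" where
  "D_Q \<epsilon> = {(u, f) \<in> L2 (mu_plus \<epsilon>) \<times> L2 (mu_plus \<epsilon>).
     \<exists>v \<in> dom_Q \<epsilon>. (AE x in mu_plus \<epsilon>. u x = v x) \<and>
       (AE x in mu_plus \<epsilon>. f x = D_expr \<epsilon> (M_plus \<epsilon>) v x)}"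

end

theory Submission imports Defs begin

text \<open>On \<open>M_+\<close> the equation is a regular Sturm--Liouville problem: \<open>1 / p\<^sub>1\<close> and \<open>w\<^sub>1\<close> are integrable
  up to the endpoints, because the exponent \<open>\<alpha> = (4 + 2 \<surd>3) \<epsilon>\<close> of \<open>p\<^sub>1\<close> at \<open>x\<^sub>0\<close> lies in \<open>(0, 1)\<close>, and (Q) is
  the Neumann condition. With \<open>W f x = \<integral>\<^bsub>a\<^esub>\<^bsup>x\<^esup> w f\<close> and \<open>K f x = - \<integral>\<^bsub>a\<^esub>\<^bsup>x\<^esup> W f / p\<close> the operator is
  \<open>c + K f \<mapsto> f\<close> on \<open>W f b = 0\<close>. The Volterra equation \<open>u = 1 + z K u\<close> gives the solution with vanishing
  quasi-derivative at \<open>a\<close>, and \<open>z\<close> is in the resolvent set unless the quasi-derivative of this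
  solution also vanishes at \<open>b\<close>.

  On \<open>[0,1]\<close> a \<open>C\<^sup>2\<close> solution satisfies (Q) since \<open>p\<^sub>1\<close> vanishes at the two singular points. Conversely (Q)
  makes \<open>u' = (p\<^sub>1 u') / p\<^sub>1\<close> a quotient of two functions vanishing there, and l'Hopital's rule yields its
  limit \<open>z u / \<phi>\<^sub>1\<close>. Applied once more to \<open>u'' = \<bar>p\<^sub>1\<bar> (z u - \<phi>\<^sub>1 u') / (\<bar>p\<^sub>1\<bar> \<phi>\<^sub>2)\<close>, where the factor
  \<open>\<bar>p\<^sub>1\<bar>\<close> cancels \<open>u''\<close> from the derivative of the numerator, it yields the limit of \<open>u''\<close>.\<close>

section \<open>Absolutely continuous functions\<close>

text \<open>The quasi-derivative is only absolutely continuous, so passing between the equation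
  almost everywhere and integral identities needs two facts about absolutely continuous functions:
  they are differentiable almost everywhere, and they are the integral of their derivative. The
  former comes from a Vitali covering argument, the latter from a gauge argument. At the two
  singular points \<open>p1\<close> changes sign and \<open>1 / p1\<close> is unbounded, but
  \<open>phi2\<close> changes sign as well, so the weight \<open>w1\<close> is positive on both
  sides. The identity \<open>p1' / p1 = phi1 / phi2\<close>, for which the formula of
  \<open>g\<close> is made, links the differential expression with the Sturm-Liouville form and
  makes \<open>p1\<close> an antiderivative of \<open>- w1 phi1\<close>. On the spectral side,
  eigenvalues are nonnegative because the quadratic form of the operator is the integral of
  \<open>|W f|^2 / p\<close>, and isolated because eigenfunctions of distinct eigenvalues are
  orthogonal. Density of the domain comes from explicit domain elements that approximate indicators
  of half-lines.\<close>

definition nonoverlapping_intervals :: "real set \<Rightarrow> nat \<Rightarrow> (nat \<Rightarrow> real) \<Rightarrow> (nat \<Rightarrow> real) \<Rightarrow> bool" where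
  "nonoverlapping_intervals I n a b \<longleftrightarrow> (\<forall>i<n. a i \<le> b i \<and> {a i..b i} \<subseteq> I) \<and>
     (\<forall>i<n. \<forall>j<n. i \<noteq> j \<longrightarrow> {a i<..<b i} \<inter> {a j<..<b j} = {})"

lemma abs_cont_on_iff:
  "abs_cont_on I f \<longleftrightarrow> (\<forall>e>0. \<exists>d>0. \<forall>n a b. nonoverlapping_intervals I n a b \<longrightarrow>
     (\<Sum>i<n. b i - a i) < d \<longrightarrow> (\<Sum>i<n. norm (f (b i) - f (a i))) < e)"
  unfolding abs_cont_on_def nonoverlapping_intervals_def by (simp only: conj_assoc imp_conjL)

lemma abs_cont_onE:
  assumes "abs_cont_on I f" "e > 0"
  obtains d where "d > 0" "\<And>n a b. \<lbrakk>nonoverlapping_intervals I n a b; (\<Sum>i<n. b i - a i) < d\<rbrakk>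
      \<Longrightarrow> (\<Sum>i<n. norm (f (b i) - f (a i))) < e"
  using assms unfolding abs_cont_on_iff by blast

text \<open>Closure properties of absolute continuity (products, conjugates, tilts by a linear
  function, real parts) all bound the increments of a new function by those of old ones. Increments
  are compared only for \<open>x\<close> \<le> \<open>y\<close>, which is how they occur over
  intervals.\<close>

lemma abs_cont_on_dominated_sum:
  assumes F: "abs_cont_on I F" and G: "abs_cont_on I G"
    and dom: "\<And>x y. \<lbrakk>x \<in> I; y \<in> I; x \<le> y\<rbrakk> \<Longrightarrow>
      norm (H y - H x) \<le> A * norm (F y - F x) + B * norm (G y - G x)"
  shows "abs_cont_on I H"
  unfolding abs_cont_on_iff
proof (intro allI impI)
  fix e :: real assume "e > 0"
  define C where "C = \<bar>A\<bar> + \<bar>B\<bar> + 1"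
  have C: "C > 0" "A \<le> C" "B \<le> C" by (auto simp: C_def)
  have "e / (2 * C) > 0" using \<open>e > 0\<close> C by simp
  obtain d1 where "d1 > 0" and d1: "\<And>n a b. \<lbrakk>nonoverlapping_intervals I n a b; (\<Sum>i<n. b i - a i) < d1\<rbrakk>
      \<Longrightarrow> (\<Sum>i<n. norm (F (b i) - F (a i))) < e / (2 * C)"
    using abs_cont_onE[OF F \<open>e / (2 * C) > 0\<close>] by blast
  obtain d2 where "d2 > 0" and d2: "\<And>n a b. \<lbrakk>nonoverlapping_intervals I n a b; (\<Sum>i<n. b i - a i) < d2\<rbrakk>
      \<Longrightarrow> (\<Sum>i<n. norm (G (b i) - G (a i))) < e / (2 * C)"
    using abs_cont_onE[OF G \<open>e / (2 * C) > 0\<close>] by blast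
  have "(\<Sum>i<n. norm (H (b i) - H (a i))) < e"
    if ab: "nonoverlapping_intervals I n a b" and sm: "(\<Sum>i<n. b i - a i) < min d1 d2" for n a b
  proof -
    have "(\<Sum>i<n. norm (H (b i) - H (a i))) \<le> (\<Sum>i<n. C * norm (F (b i) - F (a i)) + C * norm (G (b i) - G (a i)))"
    proof (rule sum_mono)
      fix i assume i: "i \<in> {..<n}"
      then have *: "a i \<le> b i" "{a i..b i} \<subseteq> I" using ab by (auto simp: nonoverlapping_intervals_def)
      then have "a i \<in> I" "b i \<in> I" by auto
      then have "norm (H (b i) - H (a i)) \<le> A * norm (F (b i) - F (a i)) + B * norm (G (b i) - G (a i))"
        using dom * by blast
      also have "\<dots> \<le> C * norm (F (b i) - F (a i)) + C * norm (G (b i) - G (a i))"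
        using C by (intro add_mono mult_right_mono) auto
      finally show "norm (H (b i) - H (a i)) \<le> C * norm (F (b i) - F (a i)) + C * norm (G (b i) - G (a i))" .
    qed
    also have "\<dots> = C * ((\<Sum>i<n. norm (F (b i) - F (a i))) + (\<Sum>i<n. norm (G (b i) - G (a i))))"
      by (simp add: sum.distrib sum_distrib_left distrib_left)
    also have "\<dots> < C * (e / (2 * C) + e / (2 * C))"
      using d1[OF ab] d2[OF ab] sm C by (intro mult_strict_left_mono add_strict_mono) auto
    also have "\<dots> = e" using C by (simp add: field_simps)
    finally show ?thesis .
  qed
  moreover have "min d1 d2 > 0" using \<open>d1 > 0\<close> \<open>d2 > 0\<close> by simp
  ultimately show "\<exists>d>0. \<forall>n a b. nonoverlapping_intervals I n a b \<longrightarrow>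
     (\<Sum>i<n. b i - a i) < d \<longrightarrow> (\<Sum>i<n. norm (H (b i) - H (a i))) < e" by blast
qed

text \<open>Supplies the Lipschitz term in domination: \<open>C * (y - x)\<close> becomes the
  increment of an absolutely continuous function.\<close>

lemma abs_cont_on_of_real: "abs_cont_on I complex_of_real"
  unfolding abs_cont_on_iff
proof (intro allI impI)
  fix e :: real assume "e > 0"
  have "(\<Sum>i<n. norm (complex_of_real (b i) - complex_of_real (a i))) = (\<Sum>i<n. b i - a i)"
    if "nonoverlapping_intervals I n a b" for n a b
    using that by (intro sum.cong) (auto simp: nonoverlapping_intervals_def simp flip: of_real_diff)
  then show "\<exists>d>0. \<forall>n a b. nonoverlapping_intervals I n a b \<longrightarrow> (\<Sum>i<n. b i - a i) < d \<longrightarrow>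
      (\<Sum>i<n. norm (complex_of_real (b i) - complex_of_real (a i))) < e"
    using \<open>e > 0\<close> by (intro exI[of _ e]) simp
qed

lemma abs_cont_on_dominated:
  assumes F: "abs_cont_on I F"
    and dom: "\<And>x y. \<lbrakk>x \<in> I; y \<in> I; x \<le> y\<rbrakk> \<Longrightarrow> norm (G y - G x) \<le> norm (F y - F x) + C * (y - x)"
  shows "abs_cont_on I G"
  by (rule abs_cont_on_dominated_sum[OF F abs_cont_on_of_real, where A = 1 and B = C])
    (use dom in \<open>auto simp flip: of_real_diff\<close>)

lemma abs_cont_on_subset:
  assumes "abs_cont_on I F" "J \<subseteq> I"
  shows "abs_cont_on J F"
proof -
  have "nonoverlapping_intervals J n a b \<Longrightarrow> nonoverlapping_intervals I n a b" for n a b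
    using assms(2) unfolding nonoverlapping_intervals_def by (meson subset_trans)
  then show ?thesis using assms(1) unfolding abs_cont_on_iff by meson
qed

text \<open>The definition of absolute continuity numbers its intervals by natural numbers, whereas
  tagged divisions index them by an arbitrary finite set; a bijection with an initial segment of the
  naturals transfers the bound.\<close>

lemma nonoverlapping_family_sum_less:
  fixes a b :: "'i \<Rightarrow> real" and F :: "real \<Rightarrow> complex"
  assumes d: "\<And>n a b. \<lbrakk>nonoverlapping_intervals I n a b; (\<Sum>i<n. b i - a i) < d\<rbrakk>
      \<Longrightarrow> (\<Sum>i<n. norm (F (b i) - F (a i))) < e"
    and J: "finite J" and ab: "\<And>i. i \<in> J \<Longrightarrow> a i \<le> b i \<and> {a i..b i} \<subseteq> I"
    and disj: "\<And>i j. \<lbrakk>i \<in> J; j \<in> J; i \<noteq> j\<rbrakk> \<Longrightarrow> {a i<..<b i} \<inter> {a j<..<b j} = {}"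
    and sm: "(\<Sum>i\<in>J. b i - a i) < d"
  shows "(\<Sum>i\<in>J. norm (F (b i) - F (a i))) < e"
proof -
  obtain h where h: "bij_betw h {..<card J} J"
    using ex_bij_betw_nat_finite[OF J] by (auto simp: atLeast0LessThan)
  have hJ: "h i \<in> J" if "i < card J" for i using h that by (auto simp: bij_betw_def)
  have "(\<Sum>i<card J. norm (F ((b \<circ> h) i) - F ((a \<circ> h) i))) < e"
  proof (rule d)
    have "\<forall>i<card J. (a \<circ> h) i \<le> (b \<circ> h) i \<and> {(a \<circ> h) i..(b \<circ> h) i} \<subseteq> I" using ab hJ by auto
    moreover have "{(a \<circ> h) i<..<(b \<circ> h) i} \<inter> {(a \<circ> h) j<..<(b \<circ> h) j} = {}"
      if "i < card J" "j < card J" "i \<noteq> j" for i j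
    proof -
      have "h i \<noteq> h j" using h that by (auto simp: bij_betw_def inj_on_def)
      then show ?thesis using disj[OF hJ hJ] that by simp
    qed
    ultimately show "nonoverlapping_intervals I (card J) (a \<circ> h) (b \<circ> h)"
      unfolding nonoverlapping_intervals_def by blast
    show "(\<Sum>i<card J. (b \<circ> h) i - (a \<circ> h) i) < d"
      using sm sum.reindex_bij_betw[OF h, of "\<lambda>i. b i - a i"] by simp
  qed
  then show ?thesis
    using sum.reindex_bij_betw[OF h, of "\<lambda>i. norm (F (b i) - F (a i))"] by simp
qed

lemma abs_cont_on_imp_continuous_on:
  assumes "abs_cont_on {a..b} F"
  shows "continuous_on {a..b} F"
  unfolding continuous_on_iff
proof (intro ballI allI impI)
  fix x e :: real assume x: "x \<in> {a..b}" and "e > 0"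
  obtain d where "d > 0" and d: "\<And>n u v. \<lbrakk>nonoverlapping_intervals {a..b} n u v; (\<Sum>i<n. v i - u i) < d\<rbrakk>
      \<Longrightarrow> (\<Sum>i<n. norm (F (v i) - F (u i))) < e"
    using abs_cont_onE[OF assms \<open>e > 0\<close>] by blast
  show "\<exists>d>0. \<forall>x'\<in>{a..b}. dist x' x < d \<longrightarrow> dist (F x') (F x) < e"
  proof (intro exI[of _ d] conjI \<open>d > 0\<close> ballI impI)
    fix y assume y: "y \<in> {a..b}" "dist y x < d"
    have "nonoverlapping_intervals {a..b} 1 (\<lambda>_. min x y) (\<lambda>_. max x y)"
      using x y by (auto simp: nonoverlapping_intervals_def)
    from d[OF this] have "norm (F (max x y) - F (min x y)) < e"
      using y by (auto simp: dist_real_def max_def min_def split: if_splits)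
    then show "dist (F y) (F x) < e"
      by (auto simp: dist_norm max_def min_def norm_minus_commute split: if_splits)
  qed
qed

text \<open>\<open>vsum f a x s\<close>: \<open>s\<close> is the variation of \<open>f\<close> along some partition of \<open>[a, x]\<close>.\<close>

inductive vsum :: "(real \<Rightarrow> real) \<Rightarrow> real \<Rightarrow> real \<Rightarrow> real \<Rightarrow> bool" for f a where
  vsum_refl: "vsum f a a 0"
| vsum_step: "\<lbrakk>vsum f a x s; x \<le> y\<rbrakk> \<Longrightarrow> vsum f a y (s + \<bar>f y - f x\<bar>)"

lemma vsum_le: "vsum f a x s \<Longrightarrow> a \<le> x"
  by (induction rule: vsum.induct) auto

text \<open>Consecutive partition intervals are a nonoverlapping family of total length exactly
  \<open>x - c\<close>, which lets the delta of absolute continuity bound the variation along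
  partitions.\<close>

lemma vsum_family:
  assumes "vsum f c x s"
  shows "\<exists>n A B. nonoverlapping_intervals {c..x} n A B \<and>
     (\<Sum>i<n. B i - A i) = x - c \<and> (\<Sum>i<n. \<bar>f (B i) - f (A i)\<bar>) = s"
  using assms
proof (induction rule: vsum.induct)
  case vsum_refl
  show ?case by (rule exI[of _ 0]) (auto simp: nonoverlapping_intervals_def)
next
  case (vsum_step x s y)
  then obtain n A B where n: "nonoverlapping_intervals {c..x} n A B"
    and 3: "(\<Sum>i<n. B i - A i) = x - c" "(\<Sum>i<n. \<bar>f (B i) - f (A i)\<bar>) = s"
    by blast
  have cx: "c \<le> x" using vsum_step vsum_le by blast
  have 4: "A i \<le> B i" "B i \<le> x" "c \<le> A i" if "i < n" for i
    using n that unfolding nonoverlapping_intervals_def by force+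
  have 2: "{A i<..<B i} \<inter> {A j<..<B j} = {}" if "i < n" "j < n" "i \<noteq> j" for i j
    using n that unfolding nonoverlapping_intervals_def by blast
  have 5: "{A i<..<B i} \<inter> {x<..<y} = {}" if "i < n" for i
    using 4[OF that] by auto
  let ?A = "A(n := x)" and ?B = "B(n := y)"
  have "?A i \<le> ?B i \<and> {?A i..?B i} \<subseteq> {c..y}" if "i < Suc n" for i
    using 4[of i] cx vsum_step.hyps(2) that by (auto simp: less_Suc_eq)
  moreover have "{?A i<..<?B i} \<inter> {?A j<..<?B j} = {}" if "i < Suc n" "j < Suc n" "i \<noteq> j" for i j
    using 2[of i j] 5[of i] 5[of j] that by (auto simp: less_Suc_eq)
  ultimately have "nonoverlapping_intervals {c..y} (Suc n) ?A ?B"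
    unfolding nonoverlapping_intervals_def by blast
  moreover have "(\<Sum>i<n. ?B i - ?A i) = (\<Sum>i<n. B i - A i)"
    "(\<Sum>i<n. \<bar>f (?B i) - f (?A i)\<bar>) = (\<Sum>i<n. \<bar>f (B i) - f (A i)\<bar>)"
    by (intro sum.cong; simp)+
  ultimately show ?case using 3
    by (intro exI[of _ "Suc n"] exI[of _ ?A] exI[of _ ?B]) (simp del: fun_upd_apply, simp)
qed

section \<open>Vitali covering and differentiability almost everywhere\<close>

lemma sum_mono_on_disjoint_le:
  fixes h :: "real \<Rightarrow> real"
  assumes "finite C" and mono: "\<And>u v. \<lbrakk>x \<le> u; u \<le> v; v \<le> y\<rbrakk> \<Longrightarrow> h u \<le> h v" and "x \<le> y"
    and C: "\<And>u v. (u, v) \<in> C \<Longrightarrow> x \<le> u \<and> u \<le> v \<and> v \<le> y"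
    and disj: "pairwise (\<lambda>i j. disjnt {fst i..snd i} {fst j..snd j}) C"
  shows "(\<Sum>(u,v)\<in>C. h v - h u) \<le> h y - h x"
  using assms
proof (induction "card C" arbitrary: C y)
  case 0
  then show ?case by auto
next
  case (Suc n)
  then have "C \<noteq> {}" by auto
  \<comment> \<open>The interval with the largest left endpoint \<open>u\<close> is split off;
    disjointness forces all others to end before it begins, so the induction hypothesis applies on
    \<open>{x..u}\<close>.\<close>
  have "Max (fst ` C) \<in> fst ` C" using \<open>C \<noteq> {}\<close> Suc.prems(1) by (intro Max_in) auto
  then obtain i where "i \<in> C" "fst i = Max (fst ` C)" by auto
  then have i: "i \<in> C" "\<And>j. j \<in> C \<Longrightarrow> fst j \<le> fst i" using Suc.prems(1) by auto
  obtain u v where uv: "i = (u, v)" by fastforce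
  have xu: "x \<le> u" "u \<le> v" "v \<le> y" using Suc.prems(4) i(1) uv by auto
  have "(\<Sum>(u,v)\<in>C - {i}. h v - h u) \<le> h u - h x"
  proof (rule Suc.hyps(1))
    show "n = card (C - {i})" using Suc.hyps(2) i(1) Suc.prems(1) by simp
    show "x \<le> s \<and> s \<le> t \<and> t \<le> u" if "(s, t) \<in> C - {i}" for s t
    proof -
      have st: "x \<le> s" "s \<le> t" "s \<le> u" using that Suc.prems(4) i(2)[of "(s,t)"] uv by auto
      have "disjnt {s..t} {u..v}" using that i(1) Suc.prems(5) uv by (fastforce simp: pairwise_def)
      then have "t < u" using st xu by (auto simp: disjnt_def)
      then show ?thesis using st by auto
    qed
    show "pairwise (\<lambda>i j. disjnt {fst i..snd i} {fst j..snd j}) (C - {i})"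
      using Suc.prems(5) by (rule pairwise_subset) auto
  qed (use Suc.prems xu in auto)
  moreover have "(\<Sum>(u,v)\<in>C. h v - h u) = (h v - h u) + (\<Sum>(u,v)\<in>C - {i}. h v - h u)"
    using Suc.prems(1) i(1) uv by (simp add: sum.remove)
  moreover have "h v \<le> h y" using xu Suc.prems(2) by auto
  ultimately show ?case by linarith
qed

text \<open>The intervals of slope at least \<open>r\<close> cover \<open>S\<close> in the sense of
  Vitali, so countably many disjoint ones cover it up to a null set, and the increments of the
  monotone \<open>h\<close> over disjoint intervals add up to at most \<open>h y - h x\<close>.
  Since \<open>S\<close> need not be measurable, its outer measure is expressed through a measurable
  superset \<open>U\<close>.\<close>

lemma vitali_mono_slope:
  fixes h :: "real \<Rightarrow> real"
  assumes mono: "\<And>u v. \<lbrakk>x \<le> u; u \<le> v; v \<le> y\<rbrakk> \<Longrightarrow> h u \<le> h v" and "x \<le> y" "r > 0"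
    and S: "S \<subseteq> {x<..<y}"
    and slope: "\<And>t d. \<lbrakk>t \<in> S; d > 0\<rbrakk> \<Longrightarrow>
      \<exists>u v. u < v \<and> t \<in> {u..v} \<and> x \<le> u \<and> v \<le> y \<and> v - u < d \<and> r * (v - u) \<le> h v - h u"
  shows "\<exists>U\<in>lmeasurable. S \<subseteq> U \<and> measure lebesgue U \<le> (h y - h x) / r"
proof -
  define K where "K = {(u, v). u < v \<and> x \<le> u \<and> v \<le> y \<and> r * (v - u) \<le> h v - h u}"
  \<comment> \<open>The covering theorem speaks of balls, so an interval is written as the closed
    ball around its midpoint.\<close>
  have cb: "cball ((u + v)/2) ((v - u)/2) = {u..v}" for u v :: real
    by (auto simp: cball_eq_atLeastAtMost field_simps)
  have "\<exists>i. i \<in> K \<and> t \<in> cball ((fst i + snd i)/2) ((snd i - fst i)/2) \<and> (snd i - fst i)/2 < d"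
    if "t \<in> S" "d > 0" for t d
  proof -
    from slope[OF that] obtain u v where "u < v" "t \<in> {u..v}" "x \<le> u" "v \<le> y" "v - u < d" "r * (v - u) \<le> h v - h u"
      by blast
    then show ?thesis by (intro exI[of _ "(u, v)"]) (auto simp: K_def cb)
  qed
  note cover = this
  have pos: "0 < (snd i - fst i)/2" if "i \<in> K" for i using that by (auto simp: K_def)
  obtain C where C: "countable C" "C \<subseteq> K"
    and disj: "pairwise (\<lambda>i j. disjnt (cball ((fst i + snd i)/2) ((snd i - fst i)/2)) (cball ((fst j + snd j)/2) ((snd j - fst j)/2))) C"
    and neg: "negligible (S - (\<Union>i \<in> C. cball ((fst i + snd i)/2) ((snd i - fst i)/2)))"
    using Vitali_covering_theorem_cballs[OF pos cover] by blast
  let ?W = "\<Union>i\<in>C. {fst i..snd i}"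
  have bd: "measure lebesgue (\<Union>i\<in>C'. {fst i..snd i}) \<le> (h y - h x) / r" if C': "C' \<subseteq> C" "finite C'" for C'
  proof -
    have "measure lebesgue (\<Union>i\<in>C'. {fst i..snd i}) \<le> (\<Sum>i\<in>C'. measure lebesgue {fst i..snd i})"
      using C' by (intro measure_UNION_le) auto
    also have "\<dots> = (\<Sum>(u,v)\<in>C'. v - u)"
      using C' C by (intro sum.cong) (auto simp: K_def)
    also have "\<dots> \<le> (\<Sum>(u,v)\<in>C'. (h v - h u) / r)"
      using C' C \<open>r > 0\<close> by (intro sum_mono) (auto simp: K_def field_simps)
    also have "\<dots> = (\<Sum>(u,v)\<in>C'. h v - h u) / r"
      by (simp add: sum_divide_distrib case_prod_unfold)
    also have "\<dots> \<le> (h y - h x) / r"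
    proof (intro divide_right_mono sum_mono_on_disjoint_le)
      show "pairwise (\<lambda>i j. disjnt {fst i..snd i} {fst j..snd j}) C'"
        using pairwise_subset[OF disj C'(1)] unfolding cb .
    qed (use C' C \<open>r > 0\<close> mono \<open>x \<le> y\<close> in \<open>auto simp: K_def\<close>)
    finally show ?thesis .
  qed
  have W: "?W \<in> lmeasurable" "measure lebesgue ?W \<le> (h y - h x) / r"
    using bd by (auto intro!: fmeasurable_UN_bound[OF C(1)] measure_UN_bound[OF C(1)])
  let ?N = "S - ?W"
  have N: "negligible ?N" using neg unfolding cb .
  show ?thesis
  proof (intro bexI[of _ "?W \<union> ?N"] conjI)
    show "?W \<union> ?N \<in> lmeasurable" using W N by (intro fmeasurable.Un) (auto simp: negligible_imp_measurable)
    have "measure lebesgue (?W \<union> ?N) \<le> measure lebesgue ?W + measure lebesgue ?N"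
      using W N by (intro measure_Un_le) (auto simp: fmeasurableD negligible_imp_sets)
    then show "measure lebesgue (?W \<union> ?N) \<le> (h y - h x) / r"
      using W N by (simp add: negligible_imp_measure0)
  qed auto
qed

text \<open>An upper Dini derivate of size at least \<open>m\<close>, on either side of
  \<open>t\<close>. It is phrased through short intervals with endpoint \<open>t\<close> instead of
  limits because such intervals are what the covering argument collects.\<close>

definition steep :: "(real \<Rightarrow> real) \<Rightarrow> real \<Rightarrow> real set \<Rightarrow> real \<Rightarrow> bool" where
  "steep f m I t \<longleftrightarrow> (\<forall>d>0. \<exists>u v. u < v \<and> {u..v} \<subseteq> I \<and> (t = u \<or> t = v) \<and> v - u < d \<and> m * (v - u) < f v - f u)"

lemma steep_subset:
  assumes "steep f m I t" "t \<in> {x<..<y}"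
  shows "steep f m {x..y} t"
  unfolding steep_def
proof (intro allI impI)
  fix d :: real assume "d > 0"
  then have "min d (min (t - x) (y - t)) > 0" using assms(2) by auto
  then obtain u v where "u < v" "(t = u \<or> t = v)" "v - u < min d (min (t - x) (y - t))" "m * (v - u) < f v - f u"
    using assms(1) unfolding steep_def by blast
  then show "\<exists>u v. u < v \<and> {u..v} \<subseteq> {x..y} \<and> (t = u \<or> t = v) \<and> v - u < d \<and> m * (v - u) < f v - f u"
    by (intro exI[of _ u] exI[of _ v]) auto
qed

text \<open>If \<open>T\<close> dominates the increments of \<open>f\<close>, then
  \<open>T - f\<close> and \<open>T + f\<close> both increase. According to the sign of
  \<open>f y - f x\<close>, one of them has the total increment
  \<open>T y - T x - |f y - f x|\<close>, and it grows with slope at least \<open>r\<close> where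
  \<open>f\<close> is steep in the opposite direction; this is why steepness in both directions is
  assumed.\<close>

lemma cover_two_sided_steep:
  fixes f T :: "real \<Rightarrow> real"
  assumes T: "\<And>u v. \<lbrakk>x \<le> u; u \<le> v; v \<le> y\<rbrakk> \<Longrightarrow> \<bar>f v - f u\<bar> \<le> T v - T u" and "x \<le> y" "r > 0"
    and E: "\<And>t. t \<in> E \<Longrightarrow> steep f r I t \<and> steep (\<lambda>x. - f x) r I t"
  shows "\<exists>U\<in>lmeasurable. E \<inter> {x..y} \<subseteq> U \<and> measure lebesgue U \<le> (T y - T x - \<bar>f y - f x\<bar>) / r"
proof -
  have *: "\<exists>U\<in>lmeasurable. E \<inter> {x<..<y} \<subseteq> U \<and> measure lebesgue U \<le> (T y - T x - (f y - f x)) / r"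
    if T: "\<And>u v. \<lbrakk>x \<le> u; u \<le> v; v \<le> y\<rbrakk> \<Longrightarrow> \<bar>f v - f u\<bar> \<le> T v - T u"
      and E: "\<And>t. t \<in> E \<Longrightarrow> steep (\<lambda>x. - f x) r I t" for f
  proof -
    have "\<exists>U\<in>lmeasurable. E \<inter> {x<..<y} \<subseteq> U \<and>
        measure lebesgue U \<le> ((T y - f y) - (T x - f x)) / r"
    proof (rule vitali_mono_slope[where h = "\<lambda>x. T x - f x"])
      fix u v assume "x \<le> u" "u \<le> v" "v \<le> y"
      then show "T u - f u \<le> T v - f v" using T[of u v] by linarith
    next
      fix t d :: real assume "t \<in> E \<inter> {x<..<y}" "d > 0"
      then have "steep (\<lambda>x. - f x) r {x..y} t" using E steep_subset by blast
      then obtain u v where uv: "u < v" "{u..v} \<subseteq> {x..y}" "t = u \<or> t = v" "v - u < d"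
         "r * (v - u) < - f v - - f u"
        using \<open>d > 0\<close> unfolding steep_def by blast
      then have "x \<le> u" "v \<le> y" by auto
      moreover have "r * (v - u) \<le> (T v - f v) - (T u - f u)"
        using T[of u v] uv \<open>x \<le> u\<close> \<open>v \<le> y\<close> by linarith
      ultimately show "\<exists>u v. u < v \<and> t \<in> {u..v} \<and> x \<le> u \<and> v \<le> y \<and> v - u < d \<and>
          r * (v - u) \<le> (T v - f v) - (T u - f u)"
        using uv by (intro exI[of _ u] exI[of _ v]) auto
    qed (use \<open>x \<le> y\<close> \<open>r > 0\<close> in auto)
    then show ?thesis by (simp add: algebra_simps)
  qed
  have "\<exists>U\<in>lmeasurable. E \<inter> {x<..<y} \<subseteq> U \<and> measure lebesgue U \<le> (T y - T x - \<bar>f y - f x\<bar>) / r"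
  proof (cases "f y \<ge> f x")
    case True
    then show ?thesis using *[of f] T E by auto
  next
    case False
    have "\<exists>U\<in>lmeasurable. E \<inter> {x<..<y} \<subseteq> U \<and> measure lebesgue U \<le> (T y - T x - (- f y - - f x)) / r"
      by (rule *) (use T E in \<open>auto simp: abs_minus_commute\<close>)
    then show ?thesis using False by auto
  qed
  then obtain U where U: "U \<in> lmeasurable" "E \<inter> {x<..<y} \<subseteq> U" "measure lebesgue U \<le> (T y - T x - \<bar>f y - f x\<bar>) / r"
    by blast
  have "measure lebesgue (U \<union> {x,y}) \<le> measure lebesgue U + measure lebesgue {x,y}"
    using U by (intro measure_Un_le) auto
  moreover have "measure lebesgue {x,y} = 0"
    by (intro negligible_imp_measure0) simp
  ultimately have "measure lebesgue (U \<union> {x,y}) \<le> measure lebesgue U"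
    by linarith
  moreover have "E \<inter> {x..y} \<subseteq> U \<union> {x,y}" using U(2) by fastforce
  moreover have "U \<union> {x,y} \<in> lmeasurable"
    by (rule fmeasurable.Un[OF U(1)]) (simp add: negligible_imp_measurable)
  ultimately show ?thesis using U(3) by (meson order_trans)
qed

text \<open>The variation function \<open>T\<close> gains at least \<open>r\<close> times the measure of the set where \<open>f\<close> is
  steep in both directions on every partition interval; since \<open>T\<close> is already the supremum over
  partitions, that set is null. This is Austin's proof of Lebesgue's differentiation theorem.\<close>

lemma negligible_two_sided_steep:
  fixes f :: "real \<Rightarrow> real"
  assumes bound: "\<And>x s. \<lbrakk>vsum f c x s; x \<le> d\<rbrakk> \<Longrightarrow> s \<le> B" and "c \<le> d" "r > 0"
    and E: "\<And>t. t \<in> E \<Longrightarrow> steep f r I t \<and> steep (\<lambda>x. - f x) r I t"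
  shows "negligible (E \<inter> {c..d})"
proof -
  define T where "T x = Sup {s. vsum f c x s}" for x
  have ex: "\<exists>s. vsum f c x s" if "c \<le> x" for x
    using vsum_step[OF vsum_refl that] by blast
  have bdd: "bdd_above {s. vsum f c x s}" if "x \<le> d" for x
    using bound that by (intro bdd_aboveI[of _ B]) auto
  have T_upper: "s \<le> T x" if "vsum f c x s" "x \<le> d" for x s
    unfolding T_def using that by (intro cSup_upper bdd) auto
  have T: "\<bar>f v - f u\<bar> \<le> T v - T u" if "c \<le> u" "u \<le> v" "v \<le> d" for u v
  proof -
    have "T u \<le> T v - \<bar>f v - f u\<bar>"
      unfolding T_def[of u]
    proof (rule cSup_least)
      show "{s. vsum f c u s} \<noteq> {}" using ex \<open>c \<le> u\<close> by auto
      fix s assume "s \<in> {s. vsum f c u s}"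
      then have "vsum f c v (s + \<bar>f v - f u\<bar>)" using that by (auto intro: vsum_step)
      then show "s \<le> T v - \<bar>f v - f u\<bar>" using T_upper that by fastforce
    qed
    then show ?thesis by linarith
  qed
  have cover: "\<exists>U\<in>lmeasurable. E \<inter> {c..x} \<subseteq> U \<and> measure lebesgue U \<le> (T x - s) / r"
    if "vsum f c x s" "x \<le> d" for x s
    using that
  proof (induction rule: vsum.induct)
    case vsum_refl
    have "0 \<le> T c" using T_upper[OF vsum.vsum_refl \<open>c \<le> d\<close>] .
    then show ?case using \<open>r > 0\<close> by (intro bexI[of _ "{c}"]) (auto simp: negligible_imp_measure0 negligible_imp_measurable)
  next
    case (vsum_step x s y)
    obtain U where U: "U \<in> lmeasurable" "E \<inter> {c..x} \<subseteq> U" "measure lebesgue U \<le> (T x - s) / r"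
      using vsum_step by auto
    have "c \<le> x" using vsum_step vsum_le by blast
    have "\<exists>U\<in>lmeasurable. E \<inter> {x..y} \<subseteq> U \<and> measure lebesgue U \<le> (T y - T x - \<bar>f y - f x\<bar>) / r"
      by (rule cover_two_sided_steep[where I = I]) (use T vsum_step \<open>c \<le> x\<close> \<open>r > 0\<close> E in auto)
    then obtain V where V: "V \<in> lmeasurable" "E \<inter> {x..y} \<subseteq> V"
        "measure lebesgue V \<le> (T y - T x - \<bar>f y - f x\<bar>) / r"
      by blast
    have "measure lebesgue (U \<union> V) \<le> measure lebesgue U + measure lebesgue V"
      using U V by (intro measure_Un_le) auto
    also have "\<dots> \<le> (T x - s) / r + (T y - T x - \<bar>f y - f x\<bar>) / r" using U V by linarith
    also have "\<dots> = (T y - (s + \<bar>f y - f x\<bar>)) / r" by (simp add: add_divide_distrib[symmetric])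
    finally have "measure lebesgue (U \<union> V) \<le> (T y - (s + \<bar>f y - f x\<bar>)) / r" .
    moreover have "E \<inter> {c..y} \<subseteq> U \<union> V" using U V \<open>c \<le> x\<close> by fastforce
    ultimately show ?case using U V by (intro bexI[of _ "U \<union> V"]) auto
  qed
  show ?thesis
    unfolding negligible_outer_le
  proof (intro allI impI)
    fix e :: real assume "e > 0"
    \<comment> \<open>Some partition comes within \<open>e * r\<close> of the supremum
      \<open>T d\<close>, and the cover belonging to it has measure at most
      \<open>e\<close>.\<close>
    have "T d - e * r < Sup {s. vsum f c d s}" using \<open>e > 0\<close> \<open>r > 0\<close> unfolding T_def by simp
    then obtain s where s: "vsum f c d s" "T d - e * r < s"
      using less_cSup_iff[OF _ bdd[of d]] ex[OF \<open>c \<le> d\<close>] by auto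
    obtain U where "U \<in> lmeasurable" "E \<inter> {c..d} \<subseteq> U" "measure lebesgue U \<le> (T d - s) / r"
      using cover[OF s(1)] by auto
    moreover have "(T d - s) / r \<le> e" using s(2) \<open>r > 0\<close> by (simp add: divide_le_eq)
    ultimately show "\<exists>U. E \<inter> {c..d} \<subseteq> U \<and> U \<in> lmeasurable \<and> measure lebesgue U \<le> e"
      by (meson order_trans)
  qed
qed

text \<open>The variation function \<open>T\<close> is at least as steep as \<open>f\<close>, so
  \<open>vitali_mono_slope\<close> applies to \<open>T\<close> with every slope \<open>m\<close> and
  bounds the outer measure by \<open>(T d - T c) / m\<close>.\<close>

lemma negligible_infinitely_steep:
  fixes f :: "real \<Rightarrow> real"
  assumes bound: "\<And>x s. \<lbrakk>vsum f c x s; x \<le> d\<rbrakk> \<Longrightarrow> s \<le> B" and "c \<le> d"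
    and E: "\<And>t m. t \<in> E \<Longrightarrow> steep f m I t"
  shows "negligible (E \<inter> {c<..<d})"
proof -
  define T where "T x = Sup {s. vsum f c x s}" for x
  have ex: "\<exists>s. vsum f c x s" if "c \<le> x" for x
    using vsum_step[OF vsum_refl that] by blast
  have bdd: "bdd_above {s. vsum f c x s}" if "x \<le> d" for x
    using bound that by (intro bdd_aboveI[of _ B]) auto
  have T_upper: "s \<le> T x" if "vsum f c x s" "x \<le> d" for x s
    unfolding T_def using that by (intro cSup_upper bdd) auto
  have T: "\<bar>f v - f u\<bar> \<le> T v - T u" if "c \<le> u" "u \<le> v" "v \<le> d" for u v
  proof -
    have "T u \<le> T v - \<bar>f v - f u\<bar>"
      unfolding T_def[of u]
    proof (rule cSup_least)
      show "{s. vsum f c u s} \<noteq> {}" using ex \<open>c \<le> u\<close> by auto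
      fix s assume "s \<in> {s. vsum f c u s}"
      then have "vsum f c v (s + \<bar>f v - f u\<bar>)" using that by (auto intro: vsum_step)
      then show "s \<le> T v - \<bar>f v - f u\<bar>" using T_upper that by fastforce
    qed
    then show ?thesis by linarith
  qed
  show ?thesis
    unfolding negligible_outer_le
  proof (intro allI impI)
    fix e :: real assume "e > 0"
    define m where "m = (\<bar>T d - T c\<bar> + 1) / e"
    have "m > 0" using \<open>e > 0\<close> by (simp add: m_def add_pos_nonneg)
    have "\<exists>U\<in>lmeasurable. E \<inter> {c<..<d} \<subseteq> U \<and> measure lebesgue U \<le> (T d - T c) / m"
    proof (rule vitali_mono_slope[where h = T])
      fix u v assume "c \<le> u" "u \<le> v" "v \<le> d"
      then show "T u \<le> T v" using T[of u v] by linarith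
    next
      fix t h :: real assume "t \<in> E \<inter> {c<..<d}" "h > 0"
      then have "steep f m {c..d} t" using E steep_subset by blast
      then obtain u v where uv: "u < v" "{u..v} \<subseteq> {c..d}" "t = u \<or> t = v" "v - u < h"
         "m * (v - u) < f v - f u"
        using \<open>h > 0\<close> unfolding steep_def by blast
      then have "c \<le> u" "v \<le> d" by auto
      moreover have "m * (v - u) \<le> T v - T u"
        using T[of u v] uv \<open>c \<le> u\<close> \<open>v \<le> d\<close> by linarith
      ultimately show "\<exists>u v. u < v \<and> t \<in> {u..v} \<and> c \<le> u \<and> v \<le> d \<and> v - u < h \<and> m * (v - u) \<le> T v - T u"
        using uv by (intro exI[of _ u] exI[of _ v]) auto
    qed (use \<open>c \<le> d\<close> \<open>m > 0\<close> in auto)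
    moreover have "(T d - T c) / m \<le> e"
    proof -
      have "e * m = \<bar>T d - T c\<bar> + 1" using \<open>e > 0\<close> by (simp add: m_def)
      then show ?thesis using \<open>m > 0\<close> by (simp add: divide_le_eq)
    qed
    ultimately show "\<exists>U. E \<inter> {c<..<d} \<subseteq> U \<and> U \<in> lmeasurable \<and> measure lebesgue U \<le> e"
      by (meson order_trans)
  qed
qed

text \<open>Translates between the interval form of steepness and difference quotients at
  \<open>t\<close>: \<open>y\<close> is the second endpoint, to the right or to the left of
  \<open>t\<close>.\<close>

lemma slope_frequently_steep:
  fixes f :: "real \<Rightarrow> real"
  assumes fr: "\<exists>\<^sub>F y in at t. m < (f y - f t) / (y - t)" and t: "t \<in> {a<..<b}"
  shows "steep f m {a..b} t"
  unfolding steep_def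
proof (intro allI impI)
  fix d :: real assume "d > 0"
  define h where "h = min d (min (t - a) (b - t))"
  have "h > 0" using t \<open>d > 0\<close> by (auto simp: h_def)
  have "\<forall>\<^sub>F y in at t. y \<noteq> t \<and> dist y t < h"
    using \<open>h > 0\<close> unfolding eventually_at by (intro exI[of _ h]) auto
  from frequently_eventually_frequently[OF fr this]
  obtain y where y: "m < (f y - f t) / (y - t)" "y \<noteq> t" "dist y t < h"
    by (auto dest: frequently_ex)
  show "\<exists>u v. u < v \<and> {u..v} \<subseteq> {a..b} \<and> (t = u \<or> t = v) \<and> v - u < d \<and> m * (v - u) < f v - f u"
  proof (cases "y > t")
    case True
    then show ?thesis using y by (intro exI[of _ t] exI[of _ y]) (auto simp: h_def dist_real_def field_simps)
  next
    case False
    then have "y < t" using y by auto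
    moreover have "m * (t - y) < f t - f y"
      using y(1) \<open>y < t\<close> by (simp add: field_simps)
    ultimately show ?thesis using y by (intro exI[of _ y] exI[of _ t]) (auto simp: h_def dist_real_def)
  qed
qed

text \<open>The conditions on unbounded slopes make the lower and upper limits \<open>l\<close> and
  \<open>L\<close> of the difference quotient finite. If they differ, subtracting a line of slope
  \<open>q\<close> between them leaves quotients that exceed some \<open>r\<close> in both
  directions arbitrarily close to \<open>t\<close>. Both numbers can be rational, so only countably
  many exceptional sets arise.\<close>

lemma differentiable_if_not_steep:
  fixes f :: "real \<Rightarrow> real"
  assumes t: "t \<in> {a<..<b}"
    and fin: "\<not> (\<forall>m. steep f m {a..b} t)" "\<not> (\<forall>m. steep (\<lambda>x. - f x) m {a..b} t)"
    and osc: "\<And>q r. \<lbrakk>q \<in> \<rat>; r \<in> \<rat>; r > 0\<rbrakk> \<Longrightarrow>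
      \<not> (steep (\<lambda>x. f x - q * x) r {a..b} t \<and> steep (\<lambda>x. - (f x - q * x)) r {a..b} t)"
  shows "\<exists>D. (f has_real_derivative D) (at t)"
proof -
  define s where "s y = (f y - f t) / (y - t)" for y
  obtain m1 where "\<not> steep f m1 {a..b} t" using fin by blast
  then have up: "\<forall>\<^sub>F y in at t. s y \<le> m1"
    using slope_frequently_steep[of m1 f t a b] t unfolding s_def frequently_def by (auto simp: not_less)
  obtain m2 where "\<not> steep (\<lambda>x. - f x) m2 {a..b} t" using fin by blast
  then have "\<forall>\<^sub>F y in at t. (- f y - - f t) / (y - t) \<le> m2"
    using slope_frequently_steep[of m2 "\<lambda>x. - f x" t a b] t unfolding frequently_def by (auto simp: not_less)
  moreover have "(- f y - - f t) / (y - t) = - s y" for y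
  proof -
    have "- f y - - f t = - (f y - f t)" by simp
    then show ?thesis by (simp only: s_def minus_divide_left)
  qed
  ultimately have lo: "\<forall>\<^sub>F y in at t. - m2 \<le> s y"
    by (auto elim: eventually_mono)
  let ?L = "Limsup (at t) (\<lambda>y. ereal (s y))" and ?l = "Liminf (at t) (\<lambda>y. ereal (s y))"
  have nt: "at t \<noteq> bot" by simp
  have le: "?l \<le> ?L" by (rule Liminf_le_Limsup[OF nt])
  have L: "?L \<le> ereal m1" using up by (intro Limsup_bounded) (auto elim: eventually_mono)
  have l: "ereal (- m2) \<le> ?l" using lo by (intro Liminf_bounded) (auto elim: eventually_mono)
  have "?l = ?L"
  proof (rule ccontr)
    assume "?l \<noteq> ?L"
    then have "?l < ?L" using le by simp
    then obtain l L where lL: "?l = ereal l" "?L = ereal L" "l < L"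
      using l L by (cases ?l; cases ?L) auto
    obtain q1 where q1: "q1 \<in> \<rat>" "l < q1" "q1 < L" using Rats_dense_in_real[OF lL(3)] by blast
    obtain q2 where q2: "q2 \<in> \<rat>" "q1 < q2" "q2 < L" using Rats_dense_in_real[OF q1(3)] by blast
    \<comment> \<open>With \<open>q\<close> the midpoint and \<open>r\<close> half the distance,
      \<open>q - r = q1\<close> and \<open>q + r = q2\<close>, and \<open>s\<close> leaves the band
      between them on both sides.\<close>
    define q r where "q = (q1 + q2)/2" and "r = (q2 - q1)/2"
    have qr: "q \<in> \<rat>" "r \<in> \<rat>" "r > 0" using q1 q2 by (auto simp: q_def r_def)
    have "\<exists>\<^sub>F y in at t. q2 < s y"
    proof (rule ccontr)
      assume "\<not> ?thesis"
      then have "\<forall>\<^sub>F y in at t. ereal (s y) \<le> ereal q2" by (simp add: frequently_def not_less)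
      then have "?L \<le> ereal q2" by (rule Limsup_bounded)
      then show False using lL q2 by simp
    qed
    then have f1: "\<exists>\<^sub>F y in at t. r < ((f y - q * y) - (f t - q * t)) / (y - t)"
    proof (rule frequently_rev_mp)
      have "\<forall>\<^sub>F y in at t. y \<noteq> t" by (simp add: eventually_at_filter)
      then show "\<forall>\<^sub>F y in at t. q2 < s y \<longrightarrow> r < ((f y - q * y) - (f t - q * t)) / (y - t)"
      proof eventually_elim
        case (elim y)
        have "((f y - q * y) - (f t - q * t)) / (y - t) = s y - q"
          using elim by (simp add: s_def field_simps)
        then show ?case using q2 by (simp add: q_def r_def field_simps)
      qed
    qed
    have "\<exists>\<^sub>F y in at t. s y < q1"
    proof (rule ccontr)
      assume "\<not> ?thesis"
      then have "\<forall>\<^sub>F y in at t. ereal q1 \<le> ereal (s y)" by (simp add: frequently_def not_less)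
      then have "ereal q1 \<le> ?l" by (rule Liminf_bounded)
      then show False using lL q1 by simp
    qed
    then have f2: "\<exists>\<^sub>F y in at t. r < (- (f y - q * y) - - (f t - q * t)) / (y - t)"
    proof (rule frequently_rev_mp)
      have "\<forall>\<^sub>F y in at t. y \<noteq> t" by (simp add: eventually_at_filter)
      then show "\<forall>\<^sub>F y in at t. s y < q1 \<longrightarrow> r < (- (f y - q * y) - - (f t - q * t)) / (y - t)"
      proof eventually_elim
        case (elim y)
        have "(- (f y - q * y) - - (f t - q * t)) / (y - t) = q - s y"
          using elim by (simp add: s_def field_simps)
        then show ?case using q2 by (simp add: q_def r_def field_simps)
      qed
    qed
    show False
      using osc[OF qr] slope_frequently_steep[OF f1 t] slope_frequently_steep[OF f2 t] by blast
  qed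
  moreover obtain D where "?L = ereal D"
    using l L \<open>?l = ?L\<close> by (cases ?L) auto
  ultimately have "((\<lambda>y. ereal (s y)) \<longlongrightarrow> ereal D) (at t)"
    using tendsto_iff_Liminf_eq_Limsup[OF nt] by metis
  then have "(s \<longlongrightarrow> D) (at t)" by (simp add: lim_ereal)
  then show ?thesis unfolding has_field_derivative_iff s_def by blast
qed

text \<open>The delta belonging to the tolerance 1 bounds the variation by 1 on every interval
  shorter than it. Such local bounds are enough, because negligibility is local by
  \<open>negligible_locally_real\<close>.\<close>

lemma abs_cont_on_vsum_bounded:
  fixes f :: "real \<Rightarrow> real"
  assumes f: "abs_cont_on {a..b} (\<lambda>x. complex_of_real (f x))"
  obtains e where "e > 0" "\<And>c d. \<lbrakk>{c..d} \<subseteq> {a..b}; c \<le> d; d - c < e\<rbrakk> \<Longrightarrow>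
     (\<forall>x s. vsum f c x s \<longrightarrow> x \<le> d \<longrightarrow> s \<le> 1)"
proof -
  obtain e where "e > 0" and e: "\<And>n u v. \<lbrakk>nonoverlapping_intervals {a..b} n u v; (\<Sum>i<n. v i - u i) < e\<rbrakk>
      \<Longrightarrow> (\<Sum>i<n. norm (complex_of_real (f (v i)) - complex_of_real (f (u i)))) < 1"
    using abs_cont_onE[OF f zero_less_one] by blast
  have "s \<le> 1" if cd: "{c..d} \<subseteq> {a..b}" "c \<le> d" "d - c < e" and s: "vsum f c x s" "x \<le> d" for c d x s
  proof -
    obtain n A B where n: "nonoverlapping_intervals {c..x} n A B"
      and 3: "(\<Sum>i<n. B i - A i) = x - c" "(\<Sum>i<n. \<bar>f (B i) - f (A i)\<bar>) = s"
      using vsum_family[OF s(1)] by blast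
    have "{c..x} \<subseteq> {a..b}" using cd s(2) by fastforce
    then have "nonoverlapping_intervals {a..b} n A B"
      using n unfolding nonoverlapping_intervals_def by (meson subset_trans)
    from e[OF this] have "(\<Sum>i<n. norm (complex_of_real (f (B i)) - complex_of_real (f (A i)))) < 1"
      using 3 cd s by auto
    then show ?thesis using 3 by (simp flip: of_real_diff)
  qed
  with \<open>e > 0\<close> show thesis by (intro that[of e]) blast+
qed

text \<open>Covers the two modifications that are fed to the covering argument: tilting by a slope
  \<open>q\<close> (with \<open>k = 1\<close>) and reflecting (with \<open>k = -1\<close>).\<close>

lemma abs_cont_on_Re_affine:
  assumes "abs_cont_on I F"
  shows "abs_cont_on I (\<lambda>x. complex_of_real (k * Re (F x) - q * x))"
proof (rule abs_cont_on_dominated_sum[OF assms abs_cont_on_of_real, where A = "\<bar>k\<bar>" and B = "\<bar>q\<bar>"])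
  fix x y :: real
  have "norm (complex_of_real (k * Re (F y) - q * y) - complex_of_real (k * Re (F x) - q * x))
      = \<bar>k * Re (F y - F x) - q * (y - x)\<bar>"
    by (simp add: algebra_simps flip: of_real_diff of_real_mult)
  also have "\<dots> \<le> \<bar>k\<bar> * \<bar>Re (F y - F x)\<bar> + \<bar>q\<bar> * \<bar>y - x\<bar>"
    by (rule order_trans[OF abs_triangle_ineq4]) (simp add: abs_mult)
  also have "\<dots> \<le> \<bar>k\<bar> * norm (F y - F x) + \<bar>q\<bar> * norm (complex_of_real y - complex_of_real x)"
    by (intro add_mono mult_left_mono abs_Re_le_cmod) (auto simp flip: of_real_diff)
  finally show "norm (complex_of_real (k * Re (F y) - q * y) - complex_of_real (k * Re (F x) - q * x))
      \<le> \<bar>k\<bar> * norm (F y - F x) + \<bar>q\<bar> * norm (complex_of_real y - complex_of_real x)" .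
qed

text \<open>The intervals of length below \<open>e\<close> with rational endpoints are countable in
  number and cover the open interval.\<close>

lemma negligible_locally_real:
  fixes S :: "real set"
  assumes "e > 0" and "\<And>c d. \<lbrakk>{c..d} \<subseteq> {a..b}; c \<le> d; d - c < e\<rbrakk> \<Longrightarrow> negligible (S \<inter> {c<..<d})"
  shows "negligible (S \<inter> {a<..<b})"
proof -
  let ?P = "{(c, d). c \<in> \<rat> \<and> d \<in> \<rat> \<and> c \<le> d \<and> {c..d} \<subseteq> {a..b} \<and> d - c < e}"
  have "?P \<subseteq> \<rat> \<times> \<rat>" by auto
  then have "countable ?P" by (rule countable_subset) (intro countable_SIGMA countable_rat)
  then have "countable ((\<lambda>(c, d). S \<inter> {c<..<d}) ` ?P)" by simp
  moreover have "negligible X" if "X \<in> (\<lambda>(c, d). S \<inter> {c<..<d}) ` ?P" for X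
    using that assms(2) by auto
  ultimately have "negligible (\<Union>((\<lambda>(c, d). S \<inter> {c<..<d}) ` ?P))"
    by (intro negligible_countable_Union) auto
  moreover have "S \<inter> {a<..<b} \<subseteq> \<Union>((\<lambda>(c, d). S \<inter> {c<..<d}) ` ?P)"
  proof
    fix t assume t: "t \<in> S \<inter> {a<..<b}"
    have "max a (t - e/2) < t" "t < min b (t + e/2)" using t \<open>e > 0\<close> by auto
    then obtain c d where "c \<in> \<rat>" "max a (t - e/2) < c" "c < t" "d \<in> \<rat>" "t < d" "d < min b (t + e/2)"
      using Rats_dense_in_real by meson
    then have "(c, d) \<in> ?P" "t \<in> S \<inter> {c<..<d}" using t by auto
    then show "t \<in> \<Union>((\<lambda>(c, d). S \<inter> {c<..<d}) ` ?P)" by blast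
  qed
  ultimately show ?thesis by (rule negligible_subset)
qed

text \<open>The points of nondifferentiability lie in the union of two sets of unbounded slope and
  of countably many sets, indexed by rational pairs \<open>(q, r)\<close>, where the function tilted
  by \<open>q\<close> is steep in both directions. Each of these sets is null.\<close>

lemma abs_cont_on_Re_differentiable_ae:
  assumes F: "abs_cont_on {a..b} F"
  shows "negligible ({t. \<not> (\<exists>D. ((\<lambda>x. Re (F x)) has_real_derivative D) (at t))} \<inter> {a<..<b})"
proof -
  define f where "f x = Re (F x)" for x
  let ?osc = "\<lambda>q r. {t. steep (\<lambda>x. f x - q * x) r {a..b} t \<and> steep (\<lambda>x. - (f x - q * x)) r {a..b} t}"
  let ?up = "{t. \<forall>m. steep f m {a..b} t}" and ?dn = "{t. \<forall>m. steep (\<lambda>x. - f x) m {a..b} t}"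
  have ac1: "abs_cont_on {a..b} (\<lambda>x. complex_of_real (f x - q * x))" for q
    using abs_cont_on_Re_affine[OF F, of 1 q] by (simp add: f_def)
  have ac2: "abs_cont_on {a..b} (\<lambda>x. complex_of_real (- f x))"
    using abs_cont_on_Re_affine[OF F, of "-1" 0] by (simp add: f_def)
  have osc: "negligible (?osc q r \<inter> {a<..<b})" if r: "r > 0" for q r
  proof -
    obtain e where e: "e > 0" "\<And>c d. \<lbrakk>{c..d} \<subseteq> {a..b}; c \<le> d; d - c < e\<rbrakk> \<Longrightarrow>
     (\<forall>x s. vsum (\<lambda>x. f x - q * x) c x s \<longrightarrow> x \<le> d \<longrightarrow> s \<le> 1)"
      using abs_cont_on_vsum_bounded[OF ac1[of q]] by blast
    show ?thesis
    proof (rule negligible_locally_real[OF e(1)])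
      fix c d assume cd: "{c..d} \<subseteq> {a..b}" "c \<le> d" "d - c < e"
      have "negligible (?osc q r \<inter> {c..d})"
        using e(2)[OF cd] by (intro negligible_two_sided_steep[OF _ cd(2) r, where f = "\<lambda>x. f x - q * x"]) blast+
      then show "negligible (?osc q r \<inter> {c<..<d})" by (rule negligible_subset) auto
    qed
  qed
  have up: "negligible (?up \<inter> {a<..<b})"
  proof -
    obtain e where e: "e > 0" "\<And>c d. \<lbrakk>{c..d} \<subseteq> {a..b}; c \<le> d; d - c < e\<rbrakk> \<Longrightarrow>
     (\<forall>x s. vsum f c x s \<longrightarrow> x \<le> d \<longrightarrow> s \<le> 1)"
      using abs_cont_on_vsum_bounded[of a b f] ac1[of 0] by auto
    show ?thesis
    proof (rule negligible_locally_real[OF e(1)])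
      fix c d assume cd: "{c..d} \<subseteq> {a..b}" "c \<le> d" "d - c < e"
      show "negligible (?up \<inter> {c<..<d})"
        using e(2)[OF cd] by (intro negligible_infinitely_steep[OF _ cd(2), where f = f]) blast+
    qed
  qed
  have dn: "negligible (?dn \<inter> {a<..<b})"
  proof -
    obtain e where e: "e > 0" "\<And>c d. \<lbrakk>{c..d} \<subseteq> {a..b}; c \<le> d; d - c < e\<rbrakk> \<Longrightarrow>
     (\<forall>x s. vsum (\<lambda>x. - f x) c x s \<longrightarrow> x \<le> d \<longrightarrow> s \<le> 1)"
      using abs_cont_on_vsum_bounded[OF ac2] by blast
    show ?thesis
    proof (rule negligible_locally_real[OF e(1)])
      fix c d assume cd: "{c..d} \<subseteq> {a..b}" "c \<le> d" "d - c < e"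
      show "negligible (?dn \<inter> {c<..<d})"
        using e(2)[OF cd] by (intro negligible_infinitely_steep[OF _ cd(2), where f = "\<lambda>x. - f x"]) blast+
    qed
  qed
  let ?Q = "{(q, r). q \<in> \<rat> \<and> r \<in> \<rat> \<and> r > (0::real)}"
  have "countable ?Q" by (rule countable_subset[of _ "\<rat> \<times> \<rat>"]) (auto intro: countable_SIGMA countable_rat)
  then have "negligible (\<Union>((\<lambda>(q, r). ?osc q r \<inter> {a<..<b}) ` ?Q))"
    using osc by (intro negligible_countable_Union) auto
  then have "negligible ((\<Union>((\<lambda>(q, r). ?osc q r \<inter> {a<..<b}) ` ?Q)) \<union> (?up \<inter> {a<..<b}) \<union> (?dn \<inter> {a<..<b}))"
    using up dn by (intro negligible_Un)
  then show ?thesis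
  proof (rule negligible_subset, intro subsetI)
    fix t assume t: "t \<in> {t. \<not> (\<exists>D. ((\<lambda>x. Re (F x)) has_real_derivative D) (at t))} \<inter> {a<..<b}"
    show "t \<in> (\<Union>((\<lambda>(q, r). ?osc q r \<inter> {a<..<b}) ` ?Q)) \<union> (?up \<inter> {a<..<b}) \<union> (?dn \<inter> {a<..<b})"
    proof (rule ccontr)
      assume n: "\<not> ?thesis"
      have "\<exists>D. (f has_real_derivative D) (at t)"
      proof (rule differentiable_if_not_steep)
        fix q r :: real assume "q \<in> \<rat>" "r \<in> \<rat>" "r > 0"
        then show "\<not> (steep (\<lambda>x. f x - q * x) r {a..b} t \<and> steep (\<lambda>x. - (f x - q * x)) r {a..b} t)"
          using n t by blast
      qed (use n t in auto)
      then show False using t unfolding f_def by blast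
    qed
  qed
qed

theorem abs_cont_on_differentiable_ae:
  assumes F: "abs_cont_on {a..b} F"
  shows "negligible ({t. \<not> (\<exists>D. (F has_vector_derivative D) (at t))} \<inter> {a<..<b})"
proof -
  \<comment> \<open>The real part of \<open>- \<i> * F x\<close> is \<open>Im (F x)\<close>, so the
    real result serves both components.\<close>
  have "abs_cont_on {a..b} (\<lambda>x. - \<i> * F x)"
    by (rule abs_cont_on_dominated[OF F, where C = 0]) (simp add: norm_mult norm_minus_commute flip: minus_diff_minus right_diff_distrib)
  from abs_cont_on_Re_differentiable_ae[OF this] abs_cont_on_Re_differentiable_ae[OF F]
  have "negligible ({t. \<not> (\<exists>D. ((\<lambda>x. Re (F x)) has_real_derivative D) (at t))} \<inter> {a<..<b} \<union>
     {t. \<not> (\<exists>D. ((\<lambda>x. Im (F x)) has_real_derivative D) (at t))} \<inter> {a<..<b})"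
    by (simp add: negligible_Un)
  then show ?thesis
  proof (rule negligible_subset, intro subsetI)
    fix t assume t: "t \<in> {t. \<not> (\<exists>D. (F has_vector_derivative D) (at t))} \<inter> {a<..<b}"
    have "(F has_vector_derivative Complex D E) (at t)"
      if "((\<lambda>x. Re (F x)) has_real_derivative D) (at t)" "((\<lambda>x. Im (F x)) has_real_derivative E) (at t)" for D E
      using that by (subst has_vector_derivative_complex_iff) (simp add: has_field_derivative_def o_def)
    then show "t \<in> {t. \<not> (\<exists>D. ((\<lambda>x. Re (F x)) has_real_derivative D) (at t))} \<inter> {a<..<b} \<union>
     {t. \<not> (\<exists>D. ((\<lambda>x. Im (F x)) has_real_derivative D) (at t))} \<inter> {a<..<b}"
      using t by blast
  qed
qed

text \<open>With Henstock-Kurzweil sums, integrability of \<open>f\<close> is a conclusion. At tags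
  outside \<open>N\<close> the gauge makes the increment of \<open>F\<close> close to derivative
  times length; at tags in \<open>N\<close> it confines the intervals to an open set of small
  measure, where absolute continuity makes the total increment small.\<close>

theorem abs_cont_on_has_integral:
  assumes F: "abs_cont_on {a..b} F" and N: "negligible N" and "a \<le> b"
    and der: "\<And>x. x \<in> {a..b} - N \<Longrightarrow> (F has_vector_derivative f x) (at x within {a..b})"
  shows "(f has_integral F b - F a) {a..b}"
proof -
  \<comment> \<open>The values of \<open>f\<close> on \<open>N\<close> are arbitrary; setting them
    to zero leaves only increments of \<open>F\<close> to be controlled there.\<close>
  define g where "g x = (if x \<in> N then 0 else f x)" for x
  have "(g has_integral F b - F a) (cbox a b)"
    unfolding has_integral
  proof (intro allI impI)
    fix e :: real assume "e > 0"
    \<comment> \<open>Half of \<open>e\<close> is spent on tags outside \<open>N\<close> and half on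
      tags in \<open>N\<close>; adding 1 keeps the denominator positive when
      \<open>a = b\<close>.\<close>
    define e1 where "e1 = e / (2 * (b - a + 1))"
    have "e1 > 0" using \<open>e > 0\<close> \<open>a \<le> b\<close> by (simp add: e1_def)
    obtain d where "d > 0" and d: "\<And>n u v. \<lbrakk>nonoverlapping_intervals {a..b} n u v; (\<Sum>i<n. v i - u i) < d\<rbrakk>
      \<Longrightarrow> (\<Sum>i<n. norm (F (v i) - F (u i))) < e/2"
      using abs_cont_onE[OF F half_gt_zero[OF \<open>e > 0\<close>]] by blast
    obtain U where U: "open U" "N \<subseteq> U" "U - N \<in> lmeasurable" "emeasure lebesgue (U - N) < ennreal d"
      using sets_lebesgue_outer_open[OF negligible_imp_sets[OF N] \<open>d > 0\<close>] by blast
    have Ul: "U \<in> lmeasurable" "measure lebesgue U < d"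
    proof -
      have eq: "U = (U - N) \<union> N" using U(2) by auto
      have N0: "N \<in> lmeasurable" "measure lebesgue N = 0"
        using N by (auto simp: negligible_imp_measurable negligible_imp_measure0)
      show "U \<in> lmeasurable" by (subst eq) (intro fmeasurable.Un U(3) N0(1))
      have "measure lebesgue U \<le> measure lebesgue (U - N) + measure lebesgue N"
        by (subst eq) (intro measure_Un_le fmeasurableD U(3) N0(1))
      also have "\<dots> < d"
        using U(4) N0(2) by (simp add: emeasure_eq_measure2[OF U(3)] ennreal_less_iff)
      finally show "measure lebesgue U < d" .
    qed
    have "\<exists>r>0. \<forall>u v. u \<le> x \<longrightarrow> x \<le> v \<longrightarrow> {u..v} \<subseteq> {a..b} \<longrightarrow> {u..v} \<subseteq> ball x r \<longrightarrow>
        (if x \<in> N then {u..v} \<subseteq> U else norm (F v - F u - (v - u) *\<^sub>R f x) \<le> e1 * (v - u))"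
      if "x \<in> {a..b}" for x
    proof (cases "x \<in> N")
      case True
      then show ?thesis using U(1,2) by (meson open_contains_ball subset_trans subsetD)
    next
      case False
      then have "(F has_vector_derivative f x) (at x within {a..b})" using der that by auto
      then obtain r where r: "r > 0" "\<And>y. \<lbrakk>y \<in> {a..b}; norm (y - x) < r\<rbrakk> \<Longrightarrow>
          norm (F y - F x - (y - x) *\<^sub>R f x) \<le> e1 * norm (y - x)"
        unfolding has_vector_derivative_def has_derivative_within_alt using \<open>e1 > 0\<close> by blast
      \<comment> \<open>Straddle estimate: both endpoints are compared with the tag
        \<open>x\<close>, and since \<open>x\<close> lies between them the two distances add up to
        \<open>v - u\<close>.\<close>
      have "norm (F v - F u - (v - u) *\<^sub>R f x) \<le> e1 * (v - u)"
        if uv: "u \<le> x" "x \<le> v" "{u..v} \<subseteq> {a..b}" "{u..v} \<subseteq> ball x r" for u v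
      proof -
        have "u \<in> {u..v}" "v \<in> {u..v}" using uv by auto
        then have *: "u \<in> {a..b}" "v \<in> {a..b}" "norm (u - x) < r" "norm (v - x) < r"
          using uv by (auto simp: subset_iff dist_real_def abs_minus_commute simp del: atLeastAtMost_iff)
        have "F v - F u - (v - u) *\<^sub>R f x = (F v - F x - (v - x) *\<^sub>R f x) - (F u - F x - (u - x) *\<^sub>R f x)"
          by (simp add: algebra_simps)
        then have "norm (F v - F u - (v - u) *\<^sub>R f x) \<le> norm (F v - F x - (v - x) *\<^sub>R f x) + norm (F u - F x - (u - x) *\<^sub>R f x)"
          by (simp only: norm_triangle_ineq4)
        also have "\<dots> \<le> e1 * norm (v - x) + e1 * norm (u - x)" using r(2) * by (intro add_mono) auto
        also have "\<dots> = e1 * (v - u)" using uv by (simp add: algebra_simps)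
        finally show ?thesis .
      qed
      then show ?thesis using r(1) False by auto
    qed
    then obtain r where r: "\<And>x. x \<in> {a..b} \<Longrightarrow> r x > 0"
      "\<And>x u v. \<lbrakk>x \<in> {a..b}; u \<le> x; x \<le> v; {u..v} \<subseteq> {a..b}; {u..v} \<subseteq> ball x (r x)\<rbrakk> \<Longrightarrow>
        (if x \<in> N then {u..v} \<subseteq> U else norm (F v - F u - (v - u) *\<^sub>R f x) \<le> e1 * (v - u))"
      by metis
    define \<gamma> where "\<gamma> x = ball x (if x \<in> {a..b} then r x else 1)" for x
    have gauge: "gauge \<gamma>" using r(1) unfolding \<gamma>_def by (intro gauge_ball_dependent) auto
    have small: "norm ((\<Sum>(x,k)\<in>p. Henstock_Kurzweil_Integration.content k *\<^sub>R g x) - (F b - F a)) < e"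
      if p: "p tagged_division_of cbox a b" "\<gamma> fine p" for p
    proof -
      have fin: "finite p" using p by auto
      have mem: "x \<in> {a..b}" "Inf k \<le> x" "x \<le> Sup k" "k = {Inf k..Sup k}" "{Inf k..Sup k} \<subseteq> {a..b}"
          "{Inf k..Sup k} \<subseteq> ball x (r x)" "Henstock_Kurzweil_Integration.content k = Sup k - Inf k" if xk: "(x, k) \<in> p" for x k
      proof -
        obtain u v where k: "k = cbox u v" using p xk by blast
        have xk': "x \<in> k" "k \<subseteq> cbox a b" using p xk by blast+
        then show "x \<in> {a..b}" by auto
        then show "Inf k \<le> x" "x \<le> Sup k" "k = {Inf k..Sup k}" "{Inf k..Sup k} \<subseteq> {a..b}" "Henstock_Kurzweil_Integration.content k = Sup k - Inf k"
          using k xk' by (auto simp: content_real)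
        show "{Inf k..Sup k} \<subseteq> ball x (r x)"
          using fineD[OF p(2) xk] \<open>x \<in> {a..b}\<close> k xk' by (auto simp: \<gamma>_def)
      qed
      have tel: "(\<Sum>(x,k)\<in>p. F (Sup k) - F (Inf k)) = F b - F a"
        using additive_tagged_division_1[OF \<open>a \<le> b\<close>, of p F] p by simp
      define q where "q = {xk \<in> p. fst xk \<in> N}"
      have "(\<Sum>(x,k)\<in>p. Henstock_Kurzweil_Integration.content k *\<^sub>R g x) - (F b - F a) =
          (\<Sum>(x,k)\<in>p. Henstock_Kurzweil_Integration.content k *\<^sub>R g x - (F (Sup k) - F (Inf k)))"
        unfolding tel[symmetric] by (simp add: sum_subtractf case_prod_unfold)
      also have "norm \<dots> \<le> (\<Sum>(x,k)\<in>p. (if x \<in> N then norm (F (Sup k) - F (Inf k)) else 0) + e1 * Henstock_Kurzweil_Integration.content k)"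
      proof (rule sum_norm_le, clarify)
        fix x k assume xk: "(x, k) \<in> p"
        note m = mem[OF xk]
        show "norm (Henstock_Kurzweil_Integration.content k *\<^sub>R g x - (F (Sup k) - F (Inf k))) \<le>
          (if x \<in> N then norm (F (Sup k) - F (Inf k)) else 0) + e1 * Henstock_Kurzweil_Integration.content k"
        proof (cases "x \<in> N")
          case True
          then show ?thesis using \<open>e1 > 0\<close> by (simp add: g_def norm_minus_commute)
        next
          case False
          then have "norm (F (Sup k) - F (Inf k) - (Sup k - Inf k) *\<^sub>R f x) \<le> e1 * (Sup k - Inf k)"
            using r(2)[OF m(1,2,3,5,6)] by simp
          then show ?thesis using False m(7) by (simp add: g_def norm_minus_commute)
        qed
      qed
      also have "\<dots> = (\<Sum>xk\<in>q. norm (F (Sup (snd xk)) - F (Inf (snd xk)))) + e1 * (\<Sum>(x,k)\<in>p. Henstock_Kurzweil_Integration.content k)"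
        unfolding q_def by (simp add: sum.distrib sum_distrib_left case_prod_unfold sum.inter_filter[OF fin])
      also have "(\<Sum>(x,k)\<in>p. Henstock_Kurzweil_Integration.content k) = b - a"
        using additive_content_tagged_division[OF p(1)] \<open>a \<le> b\<close> by simp
      also have "e1 * (b - a) \<le> e/2"
        using \<open>e > 0\<close> \<open>a \<le> b\<close> by (simp add: e1_def field_simps)
      also have "(\<Sum>xk\<in>q. norm (F (Sup (snd xk)) - F (Inf (snd xk)))) < e/2"
      proof (rule nonoverlapping_family_sum_less[OF d])
        show "finite q" using fin by (simp add: q_def)
        show "Inf (snd i) \<le> Sup (snd i) \<and> {Inf (snd i)..Sup (snd i)} \<subseteq> {a..b}" if "i \<in> q" for i
          using mem[of "fst i" "snd i"] that by (auto simp: q_def)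
        show disj: "{Inf (snd i)<..<Sup (snd i)} \<inter> {Inf (snd j)<..<Sup (snd j)} = {}"
          if "i \<in> q" "j \<in> q" "i \<noteq> j" for i j
        proof -
          have ij: "(fst i, snd i) \<in> p" "(fst j, snd j) \<in> p" using that by (auto simp: q_def)
          then have "interior (snd i) \<inter> interior (snd j) = {}"
            using tagged_division_ofD(5)[OF p(1) ij] that(3) by (metis prod.collapse)
          then show ?thesis using mem(4)[OF ij(1)] mem(4)[OF ij(2)] by (metis interior_atLeastAtMost_real)
        qed
        \<comment> \<open>The lengths are summed as the measure of the union of the disjoint open
          interiors, all of which lie in \<open>U\<close>.\<close>
        have "(\<Sum>i\<in>q. Sup (snd i) - Inf (snd i)) = (\<Sum>i\<in>q. measure lebesgue {Inf (snd i)<..<Sup (snd i)})"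
        proof (rule sum.cong[OF refl])
          fix i assume "i \<in> q"
          then have "(fst i, snd i) \<in> p" by (auto simp: q_def)
          note m = mem[OF this]
          show "Sup (snd i) - Inf (snd i) = measure lebesgue {Inf (snd i)<..<Sup (snd i)}"
            using order_trans[OF m(2,3)] by simp
        qed
        also have "\<dots> = measure lebesgue (\<Union>i\<in>q. {Inf (snd i)<..<Sup (snd i)})"
        proof (rule measure_finite_Union[symmetric])
          show "finite q" using fin by (simp add: q_def)
          show "disjoint_family_on (\<lambda>i. {Inf (snd i)<..<Sup (snd i)}) q"
            using disj unfolding disjoint_family_on_def by blast
          have *: "{u<..<v} \<in> lmeasurable" for u v :: real by auto
          show "emeasure lebesgue {Inf (snd i)<..<Sup (snd i)} \<noteq> \<infinity>" for i :: "real \<times> real set"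
            using fmeasurableD2[OF *] by simp
        qed auto
        also have "\<dots> \<le> measure lebesgue U"
        proof (rule measure_mono_fmeasurable)
          show "(\<Union>i\<in>q. {Inf (snd i)<..<Sup (snd i)}) \<subseteq> U"
          proof (rule UN_least)
            fix i assume "i \<in> q"
            then have i: "(fst i, snd i) \<in> p" "fst i \<in> N" by (auto simp: q_def)
            note m = mem[OF i(1)]
            have "{Inf (snd i)..Sup (snd i)} \<subseteq> U" using r(2)[OF m(1,2,3,5,6)] i(2) by simp
            then show "{Inf (snd i)<..<Sup (snd i)} \<subseteq> U" by auto
          qed
          show "(\<Union>i\<in>q. {Inf (snd i)<..<Sup (snd i)}) \<in> sets lebesgue"
            using fin by (intro sets.finite_UN) (auto simp: q_def)
        qed (use Ul in auto)
        finally show "(\<Sum>i\<in>q. Sup (snd i) - Inf (snd i)) < d" using Ul by linarith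
      qed
      finally show ?thesis by simp
    qed
    show "\<exists>\<gamma>. gauge \<gamma> \<and> (\<forall>\<D>. \<D> tagged_division_of cbox a b \<and> \<gamma> fine \<D> \<longrightarrow>
         norm ((\<Sum>(x,k)\<in>\<D>. Henstock_Kurzweil_Integration.content k *\<^sub>R g x) - (F b - F a)) < e)"
      by (intro exI[of _ \<gamma>] conjI allI impI gauge) (elim conjE, rule small)
  qed
  then have "(g has_integral F b - F a) {a..b}" by simp
  then show ?thesis
    by (rule has_integral_spike[OF N, rotated]) (auto simp: g_def)
qed

section \<open>Indefinite Lebesgue integrals and their derivatives\<close>

lemma absolutely_integrable_imp_integrable_on_subinterval:
  fixes f :: "real \<Rightarrow> 'b::euclidean_space"
  assumes "f absolutely_integrable_on S" "{c..d} \<subseteq> S"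
  shows "f integrable_on {c..d}"
  by (rule set_lebesgue_integral_eq_integral(1)[OF absolutely_integrable_on_subinterval[OF assms]])

text \<open>Absolute continuity of the integral by truncation: the portion where \<phi> exceeds
  \<open>n\<close> has integral below \<open>e/2\<close> by dominated convergence, and the rest is
  at most \<open>n\<close> times the measure of \<open>A\<close>.\<close>

lemma integrable_small_on_small_sets:
  fixes \<phi> :: "real \<Rightarrow> real"
  assumes int: "integrable lebesgue \<phi>" and nonneg: "\<And>x. \<phi> x \<ge> 0" and "e > 0"
  obtains d where "d > 0" "\<And>A. \<lbrakk>A \<in> lmeasurable; measure lebesgue A < d\<rbrakk> \<Longrightarrow> (\<integral>x. indicator A x * \<phi> x \<partial>lebesgue) < e"
proof -
  have [measurable]: "\<phi> \<in> borel_measurable lebesgue" using int by auto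
  define s where "s n x = indicator {y. \<phi> y > real n} x * \<phi> x" for n x
  have s_meas: "s n \<in> borel_measurable lebesgue" for n
    unfolding s_def by measurable
  have "(\<lambda>n. integral\<^sup>L lebesgue (s n)) \<longlonglongrightarrow> integral\<^sup>L lebesgue (\<lambda>_::real. 0::real)"
  proof (rule integral_dominated_convergence[where w = \<phi>])
    show "AE x in lebesgue. (\<lambda>n. s n x) \<longlonglongrightarrow> 0"
    proof (rule AE_I2, rule tendsto_eventually)
      fix x
      obtain N :: nat where "\<phi> x \<le> real N" using real_arch_simple by blast
      then show "\<forall>\<^sub>F n in sequentially. s n x = 0"
        unfolding s_def eventually_sequentially
        by (intro exI[of _ N]) (auto simp: indicator_def)
    qed
    show "AE x in lebesgue. norm (s n x) \<le> \<phi> x" for n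
      using nonneg by (auto simp: s_def indicator_def)
  qed (use int s_meas in auto)
  then have "(\<lambda>n. integral\<^sup>L lebesgue (s n)) \<longlonglongrightarrow> 0" by simp
  then have "\<forall>\<^sub>F n in sequentially. integral\<^sup>L lebesgue (s n) < e/2"
    using \<open>e > 0\<close> by (intro order_tendstoD(2)) auto
  then obtain n where n: "integral\<^sup>L lebesgue (s n) < e/2"
    by (auto simp: eventually_sequentially)
  have s_int: "integrable lebesgue (s n)"
    by (rule Bochner_Integration.integrable_bound[OF int s_meas]) (use nonneg in \<open>auto simp: s_def indicator_def\<close>)
  show thesis
  proof (rule that[of "e / (2 * (real n + 1))"])
    show "e / (2 * (real n + 1)) > 0" using \<open>e > 0\<close> by simp
    fix A :: "real set" assume A: "A \<in> lmeasurable" "measure lebesgue A < e / (2 * (real n + 1))"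
    then have A_int: "integrable lebesgue (indicator A :: real \<Rightarrow> real)"
      by (simp add: lmeasurable_iff_integrable)
    have [measurable]: "A \<in> sets lebesgue" using A by auto
    have i1: "integrable lebesgue (\<lambda>x. indicator A x * \<phi> x)"
      using integrable_mult_indicator[OF _ int, of A] by simp
    have "(\<integral>x. indicator A x * \<phi> x \<partial>lebesgue) \<le> (\<integral>x. s n x + real n * indicator A x \<partial>lebesgue)"
    proof (rule integral_mono[OF i1])
      show "integrable lebesgue (\<lambda>x. s n x + real n * indicator A x)" using A_int s_int by auto
      show "indicator A x * \<phi> x \<le> s n x + real n * indicator A x" for x
        using nonneg[of x] by (auto simp: s_def indicator_def)
    qed
    also have "\<dots> = integral\<^sup>L lebesgue (s n) + real n * measure lebesgue A"
      using A_int s_int A(1) by (simp add: lmeasure_integral_UNIV[symmetric] )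
    also have "real n * measure lebesgue A \<le> (real n + 1) * (e / (2 * (real n + 1)))"
      using A(2) by (intro mult_mono) auto
    also have "(real n + 1) * (e / (2 * (real n + 1))) = e/2" by (simp add: field_simps)
    finally show "(\<integral>x. indicator A x * \<phi> x \<partial>lebesgue) < e" using n by linarith
  qed
qed

text \<open>Increments are integrals over the intervals; for a nonoverlapping family their norms add
  up to at most the integral of the norm of \<open>f\<close> over one set of small measure.\<close>

lemma abs_cont_on_indefinite_integral:
  fixes f :: "real \<Rightarrow> complex"
  assumes f: "f absolutely_integrable_on {a..b}"
  shows "abs_cont_on {a..b} (\<lambda>x. integral {a..x} f)"
  unfolding abs_cont_on_iff
proof (intro allI impI)
  fix e :: real assume "e > 0"
  define \<phi> where "\<phi> x = norm (indicator {a..b} x *\<^sub>R f x)" for x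
  have int: "integrable lebesgue \<phi>"
    using f unfolding \<phi>_def set_integrable_def by (rule integrable_norm)
  obtain d where "d > 0" and d: "\<And>A. \<lbrakk>A \<in> lmeasurable; measure lebesgue A < d\<rbrakk> \<Longrightarrow> (\<integral>x. indicator A x * \<phi> x \<partial>lebesgue) < e"
    using integrable_small_on_small_sets[OF int _ \<open>e > 0\<close>] by (auto simp: \<phi>_def)
  have "(\<Sum>i<n. norm (integral {a..v i} f - integral {a..u i} f)) < e"
    if uv: "nonoverlapping_intervals {a..b} n u v" and sm: "(\<Sum>i<n. v i - u i) < d" for n u v
  proof -
    let ?A = "\<Union>i<n. {u i<..<v i}"
    have le: "u i \<le> v i" "{u i..v i} \<subseteq> {a..b}" "a \<le> u i" "v i \<le> b" if "i < n" for i
      using uv that unfolding nonoverlapping_intervals_def by force+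
    have disj: "disjoint_family_on (\<lambda>i. {u i<..<v i}) {..<n}"
      using uv unfolding nonoverlapping_intervals_def disjoint_family_on_def by blast
    have "measure lebesgue ?A = (\<Sum>i<n. measure lebesgue {u i<..<v i})"
    proof (rule measure_finite_Union[OF _ _ disj])
      have *: "{u<..<v} \<in> lmeasurable" for u v :: real by auto
      show "emeasure lebesgue {u i<..<v i} \<noteq> \<infinity>" for i
        using fmeasurableD2[OF *] by simp
    qed auto
    also have "\<dots> = (\<Sum>i<n. v i - u i)" using le by (intro sum.cong) auto
    finally have mA: "measure lebesgue ?A < d" using sm by simp
    have A: "?A \<in> lmeasurable" by (intro fmeasurable.finite_UN) auto
    have ii: "integrable lebesgue (\<lambda>x. indicator {u i<..<v i} x * \<phi> x)" for i
      using integrable_mult_indicator[OF _ int, of "{u i<..<v i}"] by simp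
    have "(\<Sum>i<n. norm (integral {a..v i} f - integral {a..u i} f))
        \<le> (\<Sum>i<n. \<integral>x. indicator {u i<..<v i} x * \<phi> x \<partial>lebesgue)"
    proof (rule sum_mono)
      fix i assume "i \<in> {..<n}"
      then have i: "u i \<le> v i" "{u i..v i} \<subseteq> {a..b}" "a \<le> u i" "v i \<le> b" using le by auto
      have fi: "f integrable_on {a..v i}"
        by (rule absolutely_integrable_imp_integrable_on_subinterval[OF f]) (use i in auto)
      have fs: "set_integrable lebesgue {u i<..<v i} f"
        using f by (rule set_integrable_subset) (use i(2) in auto)
      have "integral {a..v i} f - integral {a..u i} f = integral {u i..v i} f"
        using Henstock_Kurzweil_Integration.integral_combine[OF i(3,1) fi] by (simp add: algebra_simps)
      also have "\<dots> = integral {u i<..<v i} f"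
        by (simp add: integral_open_interval_real)
      also have "\<dots> = (LINT x:{u i<..<v i}|lebesgue. f x)"
        using set_lebesgue_integral_eq_integral(2)[OF fs] by simp
      also have "norm \<dots> \<le> (\<integral>x. norm (indicator {u i<..<v i} x *\<^sub>R f x) \<partial>lebesgue)"
        unfolding set_lebesgue_integral_def by (rule integral_norm_bound)
      also have "\<dots> = (\<integral>x. indicator {u i<..<v i} x * \<phi> x \<partial>lebesgue)"
        using i by (intro Bochner_Integration.integral_cong) (auto simp: \<phi>_def indicator_def)
      finally show "norm (integral {a..v i} f - integral {a..u i} f)
        \<le> (\<integral>x. indicator {u i<..<v i} x * \<phi> x \<partial>lebesgue)" .
    qed
    also have "\<dots> = (\<integral>x. (\<Sum>i<n. indicator {u i<..<v i} x * \<phi> x) \<partial>lebesgue)"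
      using ii by (subst Bochner_Integration.integral_sum) auto
    also have "\<dots> = (\<integral>x. indicator ?A x * \<phi> x \<partial>lebesgue)"
      using disj by (intro Bochner_Integration.integral_cong)
        (auto simp: indicator_UN_disjoint sum_distrib_right)
    also have "\<dots> < e" by (rule d[OF A mA])
    finally show ?thesis .
  qed
  then show "\<exists>d>0. \<forall>n u v. nonoverlapping_intervals {a..b} n u v \<longrightarrow> (\<Sum>i<n. v i - u i) < d \<longrightarrow>
     (\<Sum>i<n. norm (integral {a..v i} f - integral {a..u i} f)) < e"
    using \<open>d > 0\<close> by blast
qed

text \<open>The positive and negative parts define two finite measures that agree on all half-lines
  and hence are equal, and densities of finite measures are unique almost everywhere.\<close>

lemma AE_zero_of_zero_tail_integrals:
  fixes h :: "real \<Rightarrow> real"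
  assumes int: "integrable lborel h" and zero: "\<And>x. (\<integral>y. indicator {x<..} y * h y \<partial>lborel) = 0"
  shows "AE y in lborel. h y = 0"
proof -
  have [measurable]: "h \<in> borel_measurable borel" using int by auto
  have fin: "(\<integral>\<^sup>+y. ennreal (k y) \<partial>lborel) < \<infinity>" if "integrable lborel k" for k :: "real \<Rightarrow> real"
    using that by (simp add: real_integrable_def less_top)
  have ip: "integrable lborel (\<lambda>y. max 0 (h y))" and im: "integrable lborel (\<lambda>y. max 0 (- h y))"
    using int by auto
  let ?P = "density lborel (\<lambda>y. ennreal (max 0 (h y)))" and ?M = "density lborel (\<lambda>y. ennreal (max 0 (- h y)))"
  have tail: "emeasure (density lborel (\<lambda>y. ennreal (k y))) {x<..} = ennreal (\<integral>y. indicator {x<..} y * k y \<partial>lborel)"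
    if k: "integrable lborel k" "\<And>y. k y \<ge> 0" for k :: "real \<Rightarrow> real" and x
  proof -
    have [measurable]: "k \<in> borel_measurable borel" using k by auto
    have "integrable lborel (\<lambda>y. indicator {x<..} y * k y)"
      using integrable_mult_indicator[OF _ k(1), of "{x<..}"] by simp
    then have "ennreal (\<integral>y. indicator {x<..} y * k y \<partial>lborel) = (\<integral>\<^sup>+y. ennreal (indicator {x<..} y * k y) \<partial>lborel)"
      using k(2) by (subst nn_integral_eq_integral) auto
    also have "\<dots> = (\<integral>\<^sup>+y. ennreal (k y) * indicator {x<..} y \<partial>lborel)"
      by (intro nn_integral_cong) (auto simp: indicator_def)
    finally show ?thesis by (simp add: emeasure_density)
  qed
  have eq: "(\<integral>y. indicator {x<..} y * max 0 (h y) \<partial>lborel) = (\<integral>y. indicator {x<..} y * max 0 (- h y) \<partial>lborel)" for x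
  proof -
    have "integrable lborel (\<lambda>y. indicator {x<..} y * max 0 (h y))" "integrable lborel (\<lambda>y. indicator {x<..} y * max 0 (- h y))"
      using integrable_mult_indicator[OF _ ip, of "{x<..}"] integrable_mult_indicator[OF _ im, of "{x<..}"] by simp_all
    then have "(\<integral>y. indicator {x<..} y * max 0 (h y) \<partial>lborel) - (\<integral>y. indicator {x<..} y * max 0 (- h y) \<partial>lborel)
      = (\<integral>y. indicator {x<..} y * max 0 (h y) - indicator {x<..} y * max 0 (- h y) \<partial>lborel)"
      by (rule Bochner_Integration.integral_diff[symmetric])
    also have "\<dots> = (\<integral>y. indicator {x<..} y * h y \<partial>lborel)"
      by (intro Bochner_Integration.integral_cong) (auto simp: indicator_def max_def)
    finally show ?thesis using zero by simp
  qed
  have "?P = ?M"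
  proof (rule measure_eqI_lessThan)
    fix x
    show "emeasure ?P {x<..} < \<infinity>" using tail[OF ip] by simp
    show "emeasure ?P {x<..} = emeasure ?M {x<..}"
      using tail[OF ip] tail[OF im] eq by simp
  qed auto
  then have "AE y in lborel. ennreal (max 0 (h y)) = ennreal (max 0 (- h y))"
    using fin[OF ip] by (subst (asm) finite_density_unique) auto
  then show ?thesis
  proof eventually_elim
    case (elim y)
    then have "max 0 (h y) = max 0 (- h y)" by simp
    then show ?case by (auto simp: max_def split: if_splits)
  qed
qed

text \<open>Half-lines generate only the Borel sets, so \<open>h\<close> is replaced by a Borel
  representative \<open>k\<close>.\<close>

lemma AE_zero_of_zero_tail_integrals_lebesgue:
  fixes h :: "real \<Rightarrow> real"
  assumes int: "integrable lebesgue h" and zero: "\<And>x. (\<integral>y. indicator {x<..} y * h y \<partial>lebesgue) = 0"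
  shows "AE y in lebesgue. h y = 0"
proof -
  obtain k where k: "k \<in> borel_measurable lborel" "AE x in lborel. h x = k x"
    using completion_ex_borel_measurable_real[of h lborel] int by auto
  then have hk: "AE x in lebesgue. h x = k x" by (simp add: AE_completion)
  have [measurable]: "h \<in> borel_measurable lebesgue" using int by auto
  have [measurable]: "k \<in> borel_measurable lebesgue" using k(1) by (simp add: measurable_completion)
  have "integrable lebesgue k"
    using int hk by (subst integrable_cong_AE[symmetric, of h]) auto
  then have ik: "integrable lborel k" using k(1) by (simp add: integrable_completion)
  have "(\<integral>y. indicator {x<..} y * k y \<partial>lborel) = 0" for x
  proof -
    have "(\<integral>y. indicator {x<..} y * k y \<partial>lborel) = (\<integral>y. indicator {x<..} y * k y \<partial>lebesgue)"
      using k(1) by (intro integral_completion[symmetric]) auto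
    also have "\<dots> = (\<integral>y. indicator {x<..} y * h y \<partial>lebesgue)"
      using hk by (intro integral_cong_AE borel_measurable_times borel_measurable_indicator) auto
    finally show ?thesis using zero by simp
  qed
  from AE_zero_of_zero_tail_integrals[OF ik this] have "AE y in lebesgue. k y = 0"
    by (simp add: AE_completion)
  with hk show ?thesis by eventually_elim simp
qed

text \<open>A tail integral is the total minus an initial integral, so all tails vanish; real and
  imaginary parts are treated separately.\<close>

lemma negligible_of_zero_indefinite_integral:
  fixes f :: "real \<Rightarrow> complex"
  assumes f: "f absolutely_integrable_on {a..b}" and zero: "\<And>x. x \<in> {a..b} \<Longrightarrow> integral {a..x} f = 0"
  shows "negligible {x \<in> {a..b}. f x \<noteq> 0}"
proof -
  define h where "h x = indicator {a..b} x *\<^sub>R f x" for x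
  have int: "integrable lebesgue h" using f unfolding h_def set_integrable_def .
  have tail: "(\<integral>y. indicator {x<..} y *\<^sub>R h y \<partial>lebesgue) = 0" for x
  proof -
    have sub: "(\<integral>y. indicator {a..z} y *\<^sub>R f y \<partial>lebesgue) = 0" "integrable lebesgue (\<lambda>y. indicator {a..z} y *\<^sub>R f y)"
      if "z \<in> {a..b}" for z
    proof -
      have "set_integrable lebesgue {a..z} f" using f by (rule set_integrable_subset) (use that in auto)
      then show "(\<integral>y. indicator {a..z} y *\<^sub>R f y \<partial>lebesgue) = 0" "integrable lebesgue (\<lambda>y. indicator {a..z} y *\<^sub>R f y)"
        using set_lebesgue_integral_eq_integral(2)[of "{a..z}" f] zero[OF that]
        unfolding set_lebesgue_integral_def set_integrable_def by auto
    qed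
    consider "b < a" | "a \<le> b" "x < a" | "a \<le> b" "x \<in> {a..b}" | "a \<le> b" "x > b" by fastforce
    then show ?thesis
    proof cases
      case 1
      then show ?thesis by (simp add: h_def)
    next
      case 2
      then have "indicator {x<..} y *\<^sub>R h y = indicator {a..b} y *\<^sub>R f y" for y by (auto simp: h_def indicator_def)
      then show ?thesis using sub(1)[of b] 2 by simp
    next
      case 3
      then have "indicator {x<..} y *\<^sub>R h y = indicator {a..b} y *\<^sub>R f y - indicator {a..x} y *\<^sub>R f y" for y
        by (auto simp: h_def indicator_def)
      then show ?thesis using sub[of b] sub[of x] 3 by (simp add: Bochner_Integration.integral_diff)
    next
      case 4
      then have "(\<lambda>y. indicator {x<..} y *\<^sub>R h y) = (\<lambda>_. 0)" by (auto simp: h_def indicator_def)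
      then show ?thesis by (simp only: integral_zero)
    qed
  qed
  have int_ind: "integrable lebesgue (\<lambda>y. indicator {x<..} y *\<^sub>R h y)" for x
    using integrable_mult_indicator[OF _ int] by simp
  have "AE y in lebesgue. Re (h y) = 0"
  proof (rule AE_zero_of_zero_tail_integrals_lebesgue)
    show "integrable lebesgue (\<lambda>y. Re (h y))" using int by auto
    fix x
    have "(\<integral>y. Re (indicator {x<..} y *\<^sub>R h y) \<partial>lebesgue) = Re (\<integral>y. indicator {x<..} y *\<^sub>R h y \<partial>lebesgue)"
      by (rule integral_Re[OF int_ind])
    then show "(\<integral>y. indicator {x<..} y * Re (h y) \<partial>lebesgue) = 0" using tail by simp
  qed
  moreover have "AE y in lebesgue. Im (h y) = 0"
  proof (rule AE_zero_of_zero_tail_integrals_lebesgue)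
    show "integrable lebesgue (\<lambda>y. Im (h y))" using int by auto
    fix x
    have "(\<integral>y. Im (indicator {x<..} y *\<^sub>R h y) \<partial>lebesgue) = Im (\<integral>y. indicator {x<..} y *\<^sub>R h y \<partial>lebesgue)"
      by (rule integral_Im[OF int_ind])
    then show "(\<integral>y. indicator {x<..} y * Im (h y) \<partial>lebesgue) = 0" using tail by simp
  qed
  ultimately have "AE y in lebesgue. h y = 0"
    by eventually_elim (simp add: complex_eq_iff)
  then obtain N where "N \<in> null_sets lebesgue" "{y. h y \<noteq> 0} \<subseteq> N"
    by (auto simp: eventually_ae_filter)
  then have "negligible {y. h y \<noteq> 0}" using negligible_iff_null_sets negligible_subset by blast
  then show ?thesis by (rule negligible_subset) (auto simp: h_def)
qed

text \<open>Divisions see a function only through its interval integrals, and those of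
  \<open>g\<close> and \<open>f\<close> agree. So \<open>g\<close> inherits the bounded variation of
  the indefinite integral and with it absolute integrability, which Henstock-Kurzweil integrability
  of \<open>g\<close> alone would not give.\<close>

lemma absolutely_integrable_if_integrals_agree:
  fixes f g :: "real \<Rightarrow> complex"
  assumes f: "f absolutely_integrable_on {a..b}"
    and g: "\<And>x. x \<in> {a..b} \<Longrightarrow> (g has_integral integral {a..x} f) {a..x}" and "a \<le> b"
  shows "g absolutely_integrable_on {a..b}"
proof -
  have agree: "integral K g = integral K f" if K: "K = cbox u v" "K \<subseteq> {a..b}" "K \<noteq> {}" for K u v
  proof -
    have uv: "a \<le> u" "u \<le> v" "v \<le> b" using K by auto
    have "f integrable_on {a..v}"
      by (rule absolutely_integrable_imp_integrable_on_subinterval[OF f]) (use uv in auto)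
    then have "integral {a..u} f + integral {u..v} f = integral {a..v} f"
      using uv by (intro Henstock_Kurzweil_Integration.integral_combine) auto
    moreover have "g integrable_on {a..v}" using g[of v] uv by auto
    then have "integral {a..u} g + integral {u..v} g = integral {a..v} g"
      using uv by (intro Henstock_Kurzweil_Integration.integral_combine) auto
    moreover have "integral {a..u} g = integral {a..u} f" "integral {a..v} g = integral {a..v} f"
      using g[of u] g[of v] uv by (auto intro: integral_unique)
    ultimately have "integral {u..v} g = integral {u..v} f" by (metis add_left_cancel)
    then show ?thesis using K by simp
  qed
  have f': "(\<lambda>x. if x \<in> {a..b} then f x else 0) absolutely_integrable_on UNIV"
    using f by (simp only: absolutely_integrable_restrict_UNIV)
  obtain B where B: "\<And>d. d division_of (\<Union>d) \<Longrightarrow> (\<Sum>k\<in>d. norm (integral k (\<lambda>x. if x \<in> {a..b} then f x else 0))) \<le> B"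
    using absolutely_integrable_bounded_variation[OF f'] by blast
  have "g absolutely_integrable_on cbox a b"
  proof (rule bounded_variation_absolutely_integrable_interval)
    show "g integrable_on cbox a b" using g[of b] \<open>a \<le> b\<close> by auto
    fix d assume d: "d division_of cbox a b"
    have "(\<Sum>K\<in>d. norm (integral K g)) = (\<Sum>k\<in>d. norm (integral k (\<lambda>x. if x \<in> {a..b} then f x else 0)))"
    proof (rule sum.cong[OF refl])
      fix K assume K: "K \<in> d"
      then obtain u v where uv: "K = cbox u v" using d by blast
      have sub: "K \<subseteq> {a..b}" "K \<noteq> {}" using d K by (auto simp: division_of_def)
      have "integral K (\<lambda>x. if x \<in> {a..b} then f x else 0) = integral K f"
        using sub by (intro integral_cong) auto
      then show "norm (integral K g) = norm (integral K (\<lambda>x. if x \<in> {a..b} then f x else 0))"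
        using agree[OF uv sub] by simp
    qed
    also have "\<dots> \<le> B" using B division_ofD(6)[OF d] d by auto
    finally show "(\<Sum>K\<in>d. norm (integral K g)) \<le> B" .
  qed
  then show ?thesis by simp
qed

text \<open>The indefinite integral \<open>F\<close> is absolutely continuous, hence has some
  derivative \<open>g\<close> almost everywhere, and is also the integral of \<open>g\<close>. So
  \<open>f\<close> and \<open>g\<close> have equal integrals over all \<open>{a..x}\<close> and
  agree off a null set.\<close>

theorem indefinite_integral_derivative_ae:
  fixes f :: "real \<Rightarrow> complex"
  assumes f: "f absolutely_integrable_on {a..b}"
  shows "negligible ({t. \<not> ((\<lambda>x. integral {a..x} f) has_vector_derivative f t) (at t)} \<inter> {a<..<b})"
proof (cases "a < b")
  case False
  then show ?thesis by simp
next
  case True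
  define F where "F x = integral {a..x} f" for x
  define N where "N = ({t. \<not> (\<exists>D. (F has_vector_derivative D) (at t))} \<inter> {a<..<b}) \<union> {a, b}"
  define g where "g t = (SOME D. (F has_vector_derivative D) (at t))" for t
  have ac: "abs_cont_on {a..b} F" unfolding F_def by (rule abs_cont_on_indefinite_integral[OF f])
  have N: "negligible N" unfolding N_def
    using abs_cont_on_differentiable_ae[OF ac] by (intro negligible_Un) auto
  have der: "(F has_vector_derivative g t) (at t)" if "t \<in> {a..b} - N" for t
    using that someI_ex[of "\<lambda>D. (F has_vector_derivative D) (at t)"] by (auto simp: N_def g_def)
  have gF: "(g has_integral integral {a..x} f) {a..x}" if "x \<in> {a..b}" for x
  proof -
    have "(g has_integral F x - F a) {a..x}"
      by (rule abs_cont_on_has_integral[OF abs_cont_on_subset[OF ac] N])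
        (use that der in \<open>auto intro: has_vector_derivative_at_within\<close>)
    then show ?thesis by (simp add: F_def)
  qed
  have g: "g absolutely_integrable_on {a..b}"
    using absolutely_integrable_if_integrals_agree[OF f gF] True by auto
  have "negligible {x \<in> {a..b}. g x - f x \<noteq> 0}"
  proof (rule negligible_of_zero_indefinite_integral)
    show "(\<lambda>x. g x - f x) absolutely_integrable_on {a..b}" using f g by (rule set_integral_diff(1)[rotated])
    fix x assume x: "x \<in> {a..b}"
    have "f integrable_on {a..x}"
      by (rule absolutely_integrable_imp_integrable_on_subinterval[OF f]) (use x in auto)
    then have "((\<lambda>x. g x - f x) has_integral integral {a..x} f - integral {a..x} f) {a..x}"
      by (intro has_integral_diff gF[OF x]) (simp add: has_integral_integral)
    then show "integral {a..x} (\<lambda>x. g x - f x) = 0" by (simp add: integral_unique)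
  qed
  then have "negligible ({x \<in> {a..b}. g x - f x \<noteq> 0} \<union> N)" using N by (rule negligible_Un)
  then show ?thesis
  proof (rule negligible_subset)
    show "{t. \<not> ((\<lambda>x. integral {a..x} f) has_vector_derivative f t) (at t)} \<inter> {a<..<b}
        \<subseteq> {x \<in> {a..b}. g x - f x \<noteq> 0} \<union> N"
    proof
      fix t assume t: "t \<in> {t. \<not> ((\<lambda>x. integral {a..x} f) has_vector_derivative f t) (at t)} \<inter> {a<..<b}"
      moreover have "F = (\<lambda>x. integral {a..x} f)" by (rule ext) (simp add: F_def)
      ultimately have "\<not> (F has_vector_derivative f t) (at t)" "t \<in> {a..b}" by auto
      then show "t \<in> {x \<in> {a..b}. g x - f x \<noteq> 0} \<union> N" using der[of t] by (cases "t \<in> N") auto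
    qed
  qed
qed

lemma abs_cont_on_derivative_absolutely_integrable:
  assumes F: "abs_cont_on {a..b} F" and f: "f absolutely_integrable_on {a..b}" and "a \<le> b"
  assumes "negligible N" "\<And>x. x \<in> {a<..<b} - N \<Longrightarrow> (F has_vector_derivative f x) (at x)"
  shows "F b - F a = integral {a..b} f"
proof -
  have "(f has_integral F b - F a) {a..b}"
  proof (rule abs_cont_on_has_integral[OF F _ \<open>a \<le> b\<close>])
    show "negligible (N \<union> {a, b})" using assms by simp
    show "(F has_vector_derivative f x) (at x within {a..b})" if "x \<in> {a..b} - (N \<union> {a, b})" for x
      using that assms(5)[of x] by (auto intro: has_vector_derivative_at_within)
  qed
  then show ?thesis by (simp add: integral_unique)
qed

section \<open>Closure properties of absolute continuity and products with a continuous
  factor\<close>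

lemma abs_cont_on_mult:
  assumes F: "abs_cont_on {a..b} F" and G: "abs_cont_on {a..b} G"
  shows "abs_cont_on {a..b} (\<lambda>x. F x * G x)"
proof -
  have "bounded (F ` {a..b})" "bounded (G ` {a..b})"
    using abs_cont_on_imp_continuous_on[OF F] abs_cont_on_imp_continuous_on[OF G]
    by (auto intro!: compact_imp_bounded compact_continuous_image)
  then obtain A B where A: "\<And>x. x \<in> {a..b} \<Longrightarrow> norm (F x) \<le> A" and B: "\<And>x. x \<in> {a..b} \<Longrightarrow> norm (G x) \<le> B"
    unfolding bounded_iff by (metis imageI)
  show ?thesis
  proof (rule abs_cont_on_dominated_sum[OF F G])
    fix x y assume xy: "x \<in> {a..b}" "y \<in> {a..b}"
    have "F y * G y - F x * G x = (F y - F x) * G y + F x * (G y - G x)" by (simp add: algebra_simps)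
    also have "norm \<dots> \<le> norm (F y - F x) * norm (G y) + norm (F x) * norm (G y - G x)"
      by (metis norm_mult norm_triangle_ineq)
    also have "\<dots> \<le> B * norm (F y - F x) + A * norm (G y - G x)"
      using A[OF xy(1)] B[OF xy(2)] by (intro add_mono) (auto simp: mult.commute intro: mult_right_mono)
    finally show "norm (F y * G y - F x * G x) \<le> B * norm (F y - F x) + A * norm (G y - G x)" .
  qed
qed

lemma abs_cont_on_cnj:
  assumes "abs_cont_on I F"
  shows "abs_cont_on I (\<lambda>x. cnj (F x))"
  using assms by (rule abs_cont_on_dominated[where C = 0]) (simp flip: complex_cnj_diff)

lemma abs_cont_on_add_const:
  assumes "abs_cont_on I F"
  shows "abs_cont_on I (\<lambda>x. c + F x)"
  using assms by (rule abs_cont_on_dominated[where C = 0]) simp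

lemma abs_cont_on_uminus:
  assumes "abs_cont_on I F"
  shows "abs_cont_on I (\<lambda>x. - F x)"
  using assms by (rule abs_cont_on_dominated[where C = 0]) (simp add: norm_minus_commute)

lemma abs_cont_on_cong:
  assumes "abs_cont_on I F" "\<And>x. x \<in> I \<Longrightarrow> F x = G x"
  shows "abs_cont_on I G"
  using assms(1) by (rule abs_cont_on_dominated[where C = 0]) (simp add: assms(2))

lemma absolutely_integrable_mult_continuous:
  fixes q :: "real \<Rightarrow> real" and f :: "real \<Rightarrow> complex"
  assumes "q absolutely_integrable_on {a..b}" "continuous_on {a..b} f"
  shows "(\<lambda>x. q x *\<^sub>R f x) absolutely_integrable_on {a..b}"
proof -
  show ?thesis
  proof (rule absolutely_integrable_bounded_measurable_product[where h = "\<lambda>(u::complex) (r::real). r *\<^sub>R u"])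
    show "bilinear (\<lambda>(u::complex) (r::real). r *\<^sub>R u)"
      by (auto simp: bilinear_def linear_iff algebra_simps)
    show "f \<in> borel_measurable (lebesgue_on {a..b})"
      using assms(2) by (intro continuous_imp_measurable_on_sets_lebesgue) auto
    show "bounded (f ` {a..b})"
      using assms(2) by (intro compact_imp_bounded compact_continuous_image) auto
  qed (use assms in auto)
qed

lemma AE_lebesgue_on_iff_negligible:
  assumes "S \<in> sets lebesgue"
  shows "(AE x in lebesgue_on S. P x) \<longleftrightarrow> negligible {x \<in> S. \<not> P x}"
proof -
  have "(AE x in lebesgue_on S. P x) \<longleftrightarrow> (AE x in lebesgue. x \<in> S \<longrightarrow> P x)"
    using assms by (intro AE_restrict_space_iff) auto
  also have "\<dots> \<longleftrightarrow> {x. \<not> (x \<in> S \<longrightarrow> P x)} \<in> null_sets lebesgue"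
    using AE_iff_null_sets by (auto simp: eventually_ae_filter)
       (metis (no_types, lifting) negligible_iff_null_sets negligible_subset)
  finally show ?thesis by (simp add: negligible_iff_null_sets)
qed

section \<open>Regular Sturm--Liouville operators with Neumann conditions\<close>

text \<open>At the endpoints only nonnegativity is asked, since \<open>p1\<close> vanishes at the
  singular points and \<open>w1\<close> has the value 0 there by division by zero. Integrability of
  \<open>1 / p\<close> and \<open>w\<close> over the closed interval is what makes the endpoints
  regular.\<close>

locale regular_sturm_liouville =
  fixes a b :: real and p w :: "real \<Rightarrow> real"
  assumes ab: "a < b"
    and p_pos: "\<And>x. x \<in> {a<..<b} \<Longrightarrow> p x > 0"
    and w_pos: "\<And>x. x \<in> {a<..<b} \<Longrightarrow> w x > 0"
    and p_nonneg: "\<And>x. x \<in> {a..b} \<Longrightarrow> p x \<ge> 0"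
    and w_nonneg: "\<And>x. x \<in> {a..b} \<Longrightarrow> w x \<ge> 0"
    and p_cont: "continuous_on {a<..<b} p"
    and w_cont: "continuous_on {a<..<b} w"
    and ip: "(\<lambda>x. 1 / p x) absolutely_integrable_on {a..b}"
    and iw: "w absolutely_integrable_on {a..b}"
begin

definition \<mu> :: "real measure" where
  "\<mu> = density (lebesgue_on {a<..<b}) (\<lambda>x. ennreal (w x))"

definition w_integrable :: "(real \<Rightarrow> complex) \<Rightarrow> bool" where
  "w_integrable f \<longleftrightarrow> (\<lambda>t. w t *\<^sub>R f t) absolutely_integrable_on {a..b}"

definition Wint :: "(real \<Rightarrow> complex) \<Rightarrow> real \<Rightarrow> complex" where
  "Wint f x = integral {a..x} (\<lambda>t. w t *\<^sub>R f t)"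

definition K :: "(real \<Rightarrow> complex) \<Rightarrow> real \<Rightarrow> complex" where
  "K f x = - integral {a..x} (\<lambda>t. (1 / p t) *\<^sub>R Wint f t)"

definition wnorm1 :: "(real \<Rightarrow> complex) \<Rightarrow> real" where
  "wnorm1 f = integral {a..b} (\<lambda>t. norm (w t *\<^sub>R f t))"

definition Pint :: "real \<Rightarrow> real" where
  "Pint x = integral {a..x} (\<lambda>t. 1 / p t)"

definition Wtot :: real where
  "Wtot = integral {a..b} w"

lemma space_mu [simp]: "space \<mu> = {a<..<b}"
  by (simp add: \<mu>_def)

lemma measurable_mu: "f \<in> borel_measurable \<mu> \<longleftrightarrow> f \<in> borel_measurable (lebesgue_on {a<..<b})"
  by (simp add: \<mu>_def)

lemma w_measurable [measurable]: "w \<in> borel_measurable (lebesgue_on {a<..<b})"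
  using w_cont by (intro continuous_imp_measurable_on_sets_lebesgue) auto

text \<open>Since \<open>w\<close> is positive on the open interval, \<mu> has the same null sets as
  Lebesgue measure there.\<close>

lemma AE_mu_iff: "(AE x in \<mu>. P x) \<longleftrightarrow> negligible {x \<in> {a<..<b}. \<not> P x}"
proof -
  have "(AE x in \<mu>. P x) \<longleftrightarrow> (AE x in lebesgue_on {a<..<b}. 0 < ennreal (w x) \<longrightarrow> P x)"
    unfolding \<mu>_def by (rule AE_density) measurable
  also have "\<dots> \<longleftrightarrow> (AE x in lebesgue_on {a<..<b}. P x)"
    using w_pos by (intro AE_cong) auto
  finally show ?thesis by (simp add: AE_lebesgue_on_iff_negligible)
qed

lemma negligible_Icc_iff_Ioo: "negligible {x \<in> {a..b}. P x} \<longleftrightarrow> negligible {x \<in> {a<..<b}. P x}"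
proof
  assume "negligible {x \<in> {a<..<b}. P x}"
  then have "negligible ({x \<in> {a<..<b}. P x} \<union> {a, b})" by (intro negligible_Un) auto
  then show "negligible {x \<in> {a..b}. P x}" by (rule negligible_subset) auto
qed (auto elim: negligible_subset)

lemma absolutely_integrable_Icc_iff_Ioo:
  fixes f :: "real \<Rightarrow> complex"
  shows "f absolutely_integrable_on {a..b} \<longleftrightarrow> f absolutely_integrable_on {a<..<b}"
  by (rule absolutely_integrable_spike_set_eq; rule negligible_subset[of "{a, b}"]) auto

lemma integrable_mu_iff:
  fixes f :: "real \<Rightarrow> complex"
  assumes "f \<in> borel_measurable \<mu>"
  shows "integrable \<mu> f \<longleftrightarrow> w_integrable f"
proof -
  have "integrable \<mu> f \<longleftrightarrow> integrable (lebesgue_on {a<..<b}) (\<lambda>x. w x *\<^sub>R f x)"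
    unfolding \<mu>_def using assms w_pos
    by (intro integrable_density) (auto simp: measurable_mu less_imp_le)
  also have "\<dots> \<longleftrightarrow> (\<lambda>x. w x *\<^sub>R f x) absolutely_integrable_on {a<..<b}"
    by (subst set_integrable_eq) auto
  finally show ?thesis unfolding w_integrable_def by (simp add: absolutely_integrable_Icc_iff_Ioo)
qed

lemma integral_mu_eq:
  fixes f :: "real \<Rightarrow> complex"
  assumes "f \<in> borel_measurable \<mu>" "integrable \<mu> f"
  shows "integral\<^sup>L \<mu> f = Wint f b"
proof -
  have int: "integrable (lebesgue_on {a<..<b}) (\<lambda>x. w x *\<^sub>R f x)"
    using assms(2) unfolding \<mu>_def using assms(1) w_pos
    by (subst (asm) integrable_density) (auto simp: measurable_mu less_imp_le)
  have "integral\<^sup>L \<mu> f = integral\<^sup>L (lebesgue_on {a<..<b}) (\<lambda>x. w x *\<^sub>R f x)"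
    unfolding \<mu>_def using assms(1) w_pos
    by (intro integral_density) (auto simp: measurable_mu less_imp_le)
  also have "\<dots> = integral {a<..<b} (\<lambda>x. w x *\<^sub>R f x)"
    using int by (intro lebesgue_integral_eq_integral) auto
  finally show ?thesis unfolding Wint_def by (simp add: integral_open_interval_real)
qed

lemma w_integrable_imp_measurable:
  assumes "w_integrable f"
  shows "f \<in> borel_measurable \<mu>"
proof -
  have "(\<lambda>x. w x *\<^sub>R f x) absolutely_integrable_on {a<..<b}"
    using assms by (simp add: w_integrable_def absolutely_integrable_Icc_iff_Ioo)
  then have "integrable (lebesgue_on {a<..<b}) (\<lambda>x. w x *\<^sub>R f x)"
    by (subst (asm) set_integrable_eq) auto
  then have "(\<lambda>x. w x *\<^sub>R f x) \<in> borel_measurable (lebesgue_on {a<..<b})" by auto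
  then have "(\<lambda>x. (1 / w x) *\<^sub>R (w x *\<^sub>R f x)) \<in> borel_measurable (lebesgue_on {a<..<b})" by measurable
  moreover have "(1 / w x) *\<^sub>R (w x *\<^sub>R f x) = f x" if "x \<in> space (lebesgue_on {a<..<b})" for x
    using w_pos[of x] that by simp
  ultimately show ?thesis
    unfolding measurable_mu using measurable_cong by (metis (no_types, lifting))
qed

lemma w_integrable_continuous: "continuous_on {a..b} f \<Longrightarrow> w_integrable f"
  unfolding w_integrable_def by (rule absolutely_integrable_mult_continuous[OF iw])

lemma w_integrable_lin:
  assumes "w_integrable f" "w_integrable h"
  shows "w_integrable (\<lambda>x. c * f x + h x)"
proof -
  have "(\<lambda>t. c * (w t *\<^sub>R f t)) absolutely_integrable_on {a..b}"
    using assms(1) unfolding w_integrable_def set_integrable_def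
    by (simp add: integrable_mult_right flip: mult_scaleR_right)
  then have "(\<lambda>t. c * (w t *\<^sub>R f t) + w t *\<^sub>R h t) absolutely_integrable_on {a..b}"
    using assms(2) unfolding w_integrable_def by (rule set_integral_add(1))
  then show ?thesis unfolding w_integrable_def by (simp add: scaleR_add_right)
qed

lemma w_integrable_integrable_on:
  assumes "w_integrable f" "a \<le> c" "d \<le> b"
  shows "(\<lambda>t. w t *\<^sub>R f t) integrable_on {c..d}"
  by (rule absolutely_integrable_imp_integrable_on_subinterval[OF assms(1)[unfolded w_integrable_def]])
    (use assms in auto)

lemma Wint_lin:
  assumes "w_integrable f" "w_integrable h" "x \<le> b"
  shows "Wint (\<lambda>x. c * f x + h x) x = c * Wint f x + Wint h x"
proof -
  note i = w_integrable_integrable_on[OF assms(1) order_refl assms(3)] w_integrable_integrable_on[OF assms(2) order_refl assms(3)]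
  have "((\<lambda>t. c * (w t *\<^sub>R f t) + w t *\<^sub>R h t) has_integral c * Wint f x + Wint h x) {a..x}"
    unfolding Wint_def using i by (intro has_integral_add has_integral_mult_right) (auto simp: has_integral_integral)
  then show ?thesis unfolding Wint_def by (simp add: scaleR_add_right integral_unique)
qed

lemma Wint_abs_cont: "w_integrable f \<Longrightarrow> abs_cont_on {a..b} (Wint f)"
  unfolding Wint_def w_integrable_def by (rule abs_cont_on_indefinite_integral)

lemma Wint_continuous: "w_integrable f \<Longrightarrow> continuous_on {a..b} (Wint f)"
  by (rule abs_cont_on_imp_continuous_on[OF Wint_abs_cont])

lemma Wint_a [simp]: "Wint f a = 0"
  by (simp add: Wint_def)

lemma wnorm1_integrable: "w_integrable f \<Longrightarrow> (\<lambda>t. norm (w t *\<^sub>R f t)) integrable_on {a..b}"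
  by (simp add: w_integrable_def absolutely_integrable_on_def)

lemma wnorm1_nonneg: "wnorm1 f \<ge> 0"
  unfolding wnorm1_def
  by (cases "(\<lambda>t. norm (w t *\<^sub>R f t)) integrable_on {a..b}")
    (auto intro: Henstock_Kurzweil_Integration.integral_nonneg simp: not_integrable_integral)

lemma norm_Wint_le:
  assumes "w_integrable f" "x \<in> {a..b}"
  shows "norm (Wint f x) \<le> wnorm1 f"
proof -
  have sub: "(\<lambda>t. norm (w t *\<^sub>R f t)) integrable_on {a..x}"
    using wnorm1_integrable[OF assms(1)] by (rule integrable_on_subinterval) (use assms in auto)
  have "norm (Wint f x) \<le> integral {a..x} (\<lambda>t. norm (w t *\<^sub>R f t))"
    unfolding Wint_def using w_integrable_integrable_on[OF assms(1)] assms(2) sub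
    by (intro Henstock_Kurzweil_Integration.integral_norm_bound_integral) auto
  also have "\<dots> \<le> wnorm1 f"
    unfolding wnorm1_def using sub wnorm1_integrable[OF assms(1)] assms(2)
    by (intro integral_subset_le) auto
  finally show ?thesis .
qed

lemma negligible_w_iff: "negligible {t \<in> {a..b}. w t *\<^sub>R f t \<noteq> w t *\<^sub>R (h t :: complex)} \<longleftrightarrow> negligible {t \<in> {a<..<b}. f t \<noteq> h t}"
proof -
  have "{t \<in> {a<..<b}. w t *\<^sub>R f t \<noteq> w t *\<^sub>R h t} = {t \<in> {a<..<b}. f t \<noteq> h t}"
    using w_pos by auto (metis greaterThanLessThan_iff less_irrefl)
  then show ?thesis by (simp only: negligible_Icc_iff_Ioo)
qed

lemma Wint_cong_ae:
  assumes "negligible {t \<in> {a<..<b}. f t \<noteq> h t}" "x \<le> b"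
  shows "Wint f x = Wint h x"
  unfolding Wint_def
  by (rule integral_spike[OF iffD2[OF negligible_w_iff assms(1)]]) (use assms(2) in auto)

lemma w_integrable_cong_ae:
  assumes "negligible {t \<in> {a<..<b}. f t \<noteq> h t}" "w_integrable f"
  shows "w_integrable h"
  using assms(2) unfolding w_integrable_def
  by (rule absolutely_integrable_spike[OF _ iffD2[OF negligible_w_iff assms(1)]]) auto

text \<open>Makes \<open>f\<close> recoverable from \<open>Wint f\<close>, on which
  single-valuedness of the operator will rest. Equality at interior points suffices by continuity on
  the closed interval.\<close>

lemma Wint_eq_imp_ae:
  assumes "w_integrable f" "w_integrable h" "\<And>x. x \<in> {a<..<b} \<Longrightarrow> Wint f x = Wint h x"
  shows "negligible {t \<in> {a<..<b}. f t \<noteq> h t}"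
proof -
  have int: "(\<lambda>t. w t *\<^sub>R f t - w t *\<^sub>R h t) absolutely_integrable_on {a..b}"
    using assms unfolding w_integrable_def by (intro set_integral_diff(1))
  have cont: "continuous_on {a..b} (\<lambda>x. Wint f x - Wint h x)"
    using assms by (intro continuous_intros Wint_continuous)
  have "Wint f x - Wint h x = 0" if "x \<in> {a..b}" for x
  proof -
    have "x \<in> closure {a<..<b}" using that ab by simp
    moreover have "continuous_on (closure {a<..<b}) (\<lambda>x. Wint f x - Wint h x)" using cont ab by simp
    ultimately show ?thesis
      using continuous_constant_on_closure[of "{a<..<b}" "\<lambda>x. Wint f x - Wint h x" 0 x] assms(3) by auto
  qed
  then have "integral {a..x} (\<lambda>t. w t *\<^sub>R f t - w t *\<^sub>R h t) = 0" if "x \<in> {a..b}" for x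
    using that w_integrable_integrable_on[OF assms(1), of a x] w_integrable_integrable_on[OF assms(2), of a x]
    by (simp add: Henstock_Kurzweil_Integration.integral_diff Wint_def)
  from negligible_of_zero_indefinite_integral[OF int this]
  have "negligible {t \<in> {a..b}. w t *\<^sub>R f t \<noteq> w t *\<^sub>R h t}" by (simp only: right_minus_eq)
  then show ?thesis by (simp only: negligible_w_iff)
qed

lemma K_integrand:
  assumes "w_integrable f"
  shows "(\<lambda>t. (1 / p t) *\<^sub>R Wint f t) absolutely_integrable_on {a..b}"
  by (rule absolutely_integrable_mult_continuous[OF ip Wint_continuous[OF assms]])

lemma K_integrand_integrable_on:
  assumes "w_integrable f" "a \<le> c" "d \<le> b"
  shows "(\<lambda>t. (1 / p t) *\<^sub>R Wint f t) integrable_on {c..d}"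
  by (rule absolutely_integrable_imp_integrable_on_subinterval[OF K_integrand[OF assms(1)]]) (use assms in auto)

lemma K_abs_cont: "w_integrable f \<Longrightarrow> abs_cont_on {a..b} (K f)"
  unfolding K_def by (intro abs_cont_on_uminus abs_cont_on_indefinite_integral K_integrand)

lemma K_continuous: "w_integrable f \<Longrightarrow> continuous_on {a..b} (K f)"
  by (rule abs_cont_on_imp_continuous_on[OF K_abs_cont])

lemma K_a [simp]: "K f a = 0"
  by (simp add: K_def)

text \<open>The integrands may blow up at the endpoints, so the classical theorem is applied on a
  compact interval \<open>{c..d}\<close> around \<open>x\<close>; the integral from \<open>a\<close>
  differs from the one from \<open>c\<close> by a constant.\<close>

lemma has_vector_derivative_indefinite_integral_open:
  fixes h :: "real \<Rightarrow> 'a::euclidean_space"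
  assumes "h absolutely_integrable_on {a..b}" "continuous_on {a<..<b} h" and x: "x \<in> {a<..<b}"
  shows "((\<lambda>y. integral {a..y} h) has_vector_derivative h x) (at x)"
proof -
  define c d where "c = (a + x)/2" and "d = (x + b)/2"
  have cd: "a < c" "c < x" "x < d" "d < b" using x by (auto simp: c_def d_def)
  have "continuous_on {c..d} h" using assms(2) by (rule continuous_on_subset) (use cd in auto)
  then have "((\<lambda>y. integral {c..y} h) has_vector_derivative h x) (at x within {c..d})"
    by (rule integral_has_vector_derivative) (use cd in auto)
  then have "((\<lambda>y. integral {c..y} h) has_vector_derivative h x) (at x)"
    using cd by (simp add: at_within_Icc_at)
  then have "((\<lambda>y. integral {a..c} h + integral {c..y} h) has_vector_derivative h x) (at x)"
    by (auto intro!: derivative_eq_intros)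
  then show ?thesis
  proof (rule has_vector_derivative_transform_within_open)
    show "open {c<..<d}" "x \<in> {c<..<d}" using cd by auto
    fix y assume "y \<in> {c<..<d}"
    then show "integral {a..c} h + integral {c..y} h = integral {a..y} h"
      using cd by (intro Henstock_Kurzweil_Integration.integral_combine
        absolutely_integrable_imp_integrable_on_subinterval[OF assms(1)]) auto
  qed
qed

lemma inverse_p_cont: "continuous_on {a<..<b} (\<lambda>x. 1 / p x)"
  using p_cont p_pos by (intro continuous_intros) (auto simp: less_imp_neq[symmetric])

lemma K_deriv:
  assumes "w_integrable f" "x \<in> {a<..<b}"
  shows "(K f has_vector_derivative - ((1 / p x) *\<^sub>R Wint f x)) (at x)"
proof -
  have "continuous_on {a<..<b} (\<lambda>t. (1 / p t) *\<^sub>R Wint f t)"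
    by (intro continuous_on_scaleR inverse_p_cont continuous_on_subset[OF Wint_continuous[OF assms(1)]]) auto
  from has_vector_derivative_indefinite_integral_open[OF K_integrand[OF assms(1)] this assms(2)]
  show ?thesis unfolding K_def by (auto intro!: derivative_eq_intros)
qed

lemma K_lin:
  assumes "w_integrable f" "w_integrable h" "x \<le> b"
  shows "K (\<lambda>x. c * f x + h x) x = c * K f x + K h x"
proof -
  note i = K_integrand_integrable_on[OF assms(1) order_refl assms(3)] K_integrand_integrable_on[OF assms(2) order_refl assms(3)]
  have "((\<lambda>t. c * ((1 / p t) *\<^sub>R Wint f t) + (1 / p t) *\<^sub>R Wint h t) has_integral c * (- K f x) + - K h x) {a..x}"
    unfolding K_def using i by (intro has_integral_add has_integral_mult_right) (auto simp: has_integral_integral)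
  then have "((\<lambda>t. (1 / p t) *\<^sub>R Wint (\<lambda>x. c * f x + h x) t) has_integral c * (- K f x) + - K h x) {a..x}"
    by (rule has_integral_eq[rotated]) (use assms in \<open>auto simp: Wint_lin scaleR_add_right\<close>)
  then show ?thesis unfolding K_def[of "\<lambda>x. c * f x + h x"] by (simp add: integral_unique)
qed

lemma K_cong_ae:
  assumes "negligible {t \<in> {a<..<b}. f t \<noteq> h t}" "x \<le> b"
  shows "K f x = K h x"
proof -
  have "integral {a..x} (\<lambda>t. (1 / p t) *\<^sub>R Wint f t) = integral {a..x} (\<lambda>t. (1 / p t) *\<^sub>R Wint h t)"
    using Wint_cong_ae[OF assms(1)] assms(2) by (intro Henstock_Kurzweil_Integration.integral_cong) auto
  then show ?thesis by (simp add: K_def)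
qed

lemma inverse_p_integrable: "a \<le> c \<Longrightarrow> d \<le> b \<Longrightarrow> (\<lambda>t. 1 / p t) integrable_on {c..d}"
  by (rule absolutely_integrable_imp_integrable_on_subinterval[OF ip]) auto

lemma w_integrable_real: "a \<le> c \<Longrightarrow> d \<le> b \<Longrightarrow> w integrable_on {c..d}"
  by (rule absolutely_integrable_imp_integrable_on_subinterval[OF iw]) auto

lemma Pint_continuous: "continuous_on {a..b} Pint"
  unfolding Pint_def by (rule indefinite_integral_continuous_1) (simp add: inverse_p_integrable)

lemma Pint_deriv: "x \<in> {a<..<b} \<Longrightarrow> (Pint has_real_derivative 1 / p x) (at x)"
  unfolding Pint_def has_real_derivative_iff_has_vector_derivative
  by (rule has_vector_derivative_indefinite_integral_open[OF ip inverse_p_cont])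

lemma Pint_a [simp]: "Pint a = 0"
  by (simp add: Pint_def)

lemma Pint_mono:
  assumes "a \<le> x" "x \<le> y" "y \<le> b"
  shows "Pint x \<le> Pint y"
proof (cases "x = y")
  case False
  show ?thesis
  proof (rule DERIV_nonneg_imp_increasing_open[where f = Pint and a = x and b = y])
    show "x \<le> y" by fact
    show "\<exists>D. DERIV Pint t :> D \<and> D \<ge> 0" if "x < t" "t < y" for t
      using Pint_deriv[of t] p_pos[of t] that assms by (intro exI[of _ "1 / p t"]) auto
    show "continuous_on {x..y} Pint" using Pint_continuous by (rule continuous_on_subset) (use assms in auto)
  qed
qed simp

lemma Pint_nonneg: "x \<in> {a..b} \<Longrightarrow> Pint x \<ge> 0"
  using Pint_mono[of a x] by auto

lemma Wtot_pos: "Wtot > 0"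
proof -
  have *: "continuous_on {(3*a+b)/4..(a+3*b)/4} w"
    using w_cont by (rule continuous_on_subset) (use ab in auto)
  have nonneg: "AE x in lebesgue. indicator {a<..<b} x * w x \<ge> 0"
    using w_pos by (auto simp: indicator_def less_imp_le)
  have io: "w absolutely_integrable_on {a<..<b}"
    using iw by (rule set_integrable_subset) auto
  then have int: "integrable lebesgue (\<lambda>x. indicator {a<..<b} x * w x)"
    by (simp add: set_integrable_def)
  have "Wtot = (\<integral>x. indicator {a<..<b} x * w x \<partial>lebesgue)"
    unfolding Wtot_def integral_open_interval_real
    using set_lebesgue_integral_eq_integral(2)[OF io] by (simp add: set_lebesgue_integral_def)
  moreover have "(\<integral>x. indicator {a<..<b} x * w x \<partial>lebesgue) \<ge> 0"
    using nonneg by (rule integral_nonneg_AE)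
  moreover have "(\<integral>x. indicator {a<..<b} x * w x \<partial>lebesgue) \<noteq> 0"
  proof
    assume "(\<integral>x. indicator {a<..<b} x * w x \<partial>lebesgue) = 0"
    then have "AE x in lebesgue. indicator {a<..<b} x * w x = 0"
      using integral_nonneg_eq_0_iff_AE[OF int nonneg] by simp
    then have "AE x in lebesgue. \<not> x \<in> {a<..<b}"
      by eventually_elim (use w_pos in \<open>fastforce simp: indicator_def split: if_splits\<close>)
    then have "{a<..<b} \<in> null_sets lebesgue"
      by (subst AE_iff_null_sets) (auto simp: AE_not_in)
    then have "measure lebesgue {a<..<b} = 0" by (simp add: measure_eq_0_null_sets)
    then show False using ab by simp
  qed
  ultimately show ?thesis by linarith
qed

subsection \<open>The fundamental solution\<close>

lemma norm_Wint_le_bound: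
  assumes f: "w_integrable f" and "x \<in> {a..b}" and C: "\<And>t. t \<in> {a..x} \<Longrightarrow> norm (f t) \<le> C"
  shows "norm (Wint f x) \<le> C * Wtot"
proof -
  have "C \<ge> 0" using order_trans[OF norm_ge_zero C[of a]] assms(2) by simp
  have i: "w integrable_on {a..x}" using assms(2) by (intro w_integrable_real) auto
  have "norm (Wint f x) \<le> integral {a..x} (\<lambda>t. C * w t)"
    unfolding Wint_def
  proof (rule Henstock_Kurzweil_Integration.integral_norm_bound_integral)
    show "(\<lambda>t. w t *\<^sub>R f t) integrable_on {a..x}"
      using assms(2) by (intro w_integrable_integrable_on f) auto
    show "(\<lambda>t. C * w t) integrable_on {a..x}"
      using integrable_on_cmult_left[OF i, of C] by simp
    show "norm (w t *\<^sub>R f t) \<le> C * w t" if "t \<in> {a..x}" for t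
      using mult_left_mono[OF C[OF that], of "w t"] w_nonneg[of t] that assms(2) by (simp add: mult.commute)
  qed
  also have "\<dots> = C * integral {a..x} w" by simp
  also have "\<dots> \<le> C * Wtot"
    unfolding Wtot_def using \<open>C \<ge> 0\<close> i assms(2) w_nonneg
    by (intro mult_left_mono integral_subset_le w_integrable_real) auto
  finally show ?thesis .
qed

text \<open>\<open>Pint\<close> acts as the independent variable: \<open>Pint^n / p\<close> is the
  derivative of \<open>Pint^(n+1) / (n+1)\<close>, so an application of \<open>K\<close> raises the
  power by one and produces the next factorial, while \<open>Wint\<close> contributes only the
  factor \<open>Wtot\<close> because the bound is monotone in \<open>x\<close>.\<close>

lemma norm_K_le_power:
  assumes f: "w_integrable f" and "C \<ge> 0"
    and le: "\<And>x. x \<in> {a..b} \<Longrightarrow> norm (f x) \<le> C * (Pint x ^ n / fact n)" and x: "x \<in> {a..b}"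
  shows "norm (K f x) \<le> (C * Wtot) * (Pint x ^ Suc n / fact (Suc n))"
proof -
  let ?D = "\<lambda>t. (C * Wtot) * (Pint t ^ n / fact n) * (1 / p t)"
  have W: "norm (Wint f t) \<le> (C * (Pint t ^ n / fact n)) * Wtot" if "t \<in> {a..b}" for t
  proof (rule norm_Wint_le_bound[OF f that])
    fix s assume s: "s \<in> {a..t}"
    then have "norm (f s) \<le> C * (Pint s ^ n / fact n)" using that by (intro le) auto
    also have "\<dots> \<le> C * (Pint t ^ n / fact n)"
      using s that \<open>C \<ge> 0\<close> by (intro mult_left_mono divide_right_mono power_mono Pint_mono Pint_nonneg) auto
    finally show "norm (f s) \<le> C * (Pint t ^ n / fact n)" .
  qed
  have hi: "(?D has_integral (C * Wtot) * (Pint x ^ Suc n / fact (Suc n)) - (C * Wtot) * (Pint a ^ Suc n / fact (Suc n))) {a..x}"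
  proof (rule fundamental_theorem_of_calculus_interior)
    show "a \<le> x" using x by simp
    show "continuous_on {a..x} (\<lambda>x. (C * Wtot) * (Pint x ^ Suc n / fact (Suc n)))"
      using x by (intro continuous_intros continuous_on_subset[OF Pint_continuous]) auto
    fix t assume t: "t \<in> {a<..<x}"
    then have "p t > 0" "t \<in> {a<..<b}" using x p_pos by auto
    then have "((\<lambda>x. (C * Wtot) * (Pint x ^ Suc n / fact (Suc n))) has_real_derivative
        (C * Wtot) * ((1 + real n) * (1 / p t * Pint t ^ n) / fact (Suc n))) (at t)"
      by (intro DERIV_cmult DERIV_cdivide DERIV_power_Suc Pint_deriv)
    also have "(C * Wtot) * ((1 + real n) * (1 / p t * Pint t ^ n) / fact (Suc n)) = ?D t"
    proof -
      have f: "fact (Suc n) = (1 + real n) * fact n" and nz: "1 + real n \<noteq> 0" by auto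
      show ?thesis unfolding f using nz by (simp add: mult_ac)
    qed
    finally show "((\<lambda>x. (C * Wtot) * (Pint x ^ Suc n / fact (Suc n))) has_vector_derivative ?D t) (at t)"
      by (simp add: has_real_derivative_iff_has_vector_derivative)
  qed
  have "norm (K f x) \<le> integral {a..x} ?D"
    unfolding K_def norm_minus_cancel
  proof (rule Henstock_Kurzweil_Integration.integral_norm_bound_integral)
    show "(\<lambda>t. (1 / p t) *\<^sub>R Wint f t) integrable_on {a..x}"
      using x by (intro K_integrand_integrable_on f) auto
    show "?D integrable_on {a..x}" using hi by blast
    fix t assume t: "t \<in> {a..x}"
    then have t': "t \<in> {a..b}" using x by auto
    have "norm ((1 / p t) *\<^sub>R Wint f t) = (1 / p t) * norm (Wint f t)"
      using p_nonneg[OF t'] by simp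
    also have "\<dots> \<le> (1 / p t) * ((C * (Pint t ^ n / fact n)) * Wtot)"
      using W[OF t'] p_nonneg[OF t'] by (intro mult_left_mono) auto
    finally show "norm ((1 / p t) *\<^sub>R Wint f t) \<le> ?D t" by (simp add: mult_ac)
  qed
  also have "\<dots> = (C * Wtot) * (Pint x ^ Suc n / fact (Suc n))"
    using integral_unique[OF hi] by simp
  finally show ?thesis .
qed

lemma norm_K_le_sup:
  assumes f: "w_integrable f" and le: "\<And>x. x \<in> {a..b} \<Longrightarrow> norm (f x) \<le> C" and x: "x \<in> {a..b}"
  shows "norm (K f x) \<le> C * Wtot * Pint b"
proof -
  have "C \<ge> 0" using order_trans[OF norm_ge_zero le[of a]] ab by simp
  have "norm (K f x) \<le> (C * Wtot) * (Pint x ^ Suc 0 / fact (Suc 0))"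
    by (rule norm_K_le_power[OF f \<open>C \<ge> 0\<close> _ x]) (simp add: le)
  also have "\<dots> \<le> (C * Wtot) * Pint b"
    using Pint_mono[of x b] x \<open>C \<ge> 0\<close> Wtot_pos by (auto intro!: mult_left_mono)
  finally show ?thesis .
qed

text \<open>For a right-hand side that is merely square integrable no sup bound is at hand, so
  \<open>Wint f\<close> is estimated by the weighted L^1 norm. This controls the inhomogeneous term
  \<open>K h\<close> of the resolvent equation.\<close>

lemma norm_K_le_wnorm1:
  assumes f: "w_integrable f" and x: "x \<in> {a..b}"
  shows "norm (K f x) \<le> wnorm1 f * Pint b"
proof -
  have "norm (K f x) \<le> integral {a..x} (\<lambda>t. wnorm1 f * (1 / p t))"
    unfolding K_def norm_minus_cancel
  proof (rule Henstock_Kurzweil_Integration.integral_norm_bound_integral)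
    show "(\<lambda>t. (1 / p t) *\<^sub>R Wint f t) integrable_on {a..x}"
      using x by (intro K_integrand_integrable_on f) auto
    show "(\<lambda>t. wnorm1 f * (1 / p t)) integrable_on {a..x}"
      using integrable_on_cmult_left[OF inverse_p_integrable[of a x], of "wnorm1 f"] x by simp
    fix t assume t: "t \<in> {a..x}"
    then have t': "t \<in> {a..b}" using x by auto
    have "(1 / p t) * norm (Wint f t) \<le> (1 / p t) * wnorm1 f"
      using norm_Wint_le[OF f t'] p_nonneg[OF t'] by (intro mult_left_mono) auto
    then show "norm ((1 / p t) *\<^sub>R Wint f t) \<le> wnorm1 f * (1 / p t)"
      using p_nonneg[OF t'] by (simp add: mult.commute)
  qed
  also have "\<dots> = wnorm1 f * Pint x" unfolding Pint_def by (rule integral_mult_right)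
  also have "\<dots> \<le> wnorm1 f * Pint b"
    using Pint_mono[of x b] x wnorm1_nonneg by (intro mult_left_mono) auto
  finally show ?thesis .
qed

text \<open>The \<open>n\<close>-th term \<open>(z K)^n h\<close> of the Neumann series of
  \<open>(1 - z K)^(-1) h\<close>.\<close>

definition volterra_iterate :: "complex \<Rightarrow> (real \<Rightarrow> complex) \<Rightarrow> nat \<Rightarrow> real \<Rightarrow> complex" where
  "volterra_iterate z h n = ((\<lambda>f x. z * K f x) ^^ n) h"

lemma volterra_iterate_0 [simp]: "volterra_iterate z h 0 = h"
  and volterra_iterate_Suc: "volterra_iterate z h (Suc n) = (\<lambda>x. z * K (volterra_iterate z h n) x)"
  by (simp_all add: volterra_iterate_def)

lemma volterra_iterate_continuous:
  assumes "continuous_on {a..b} h"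
  shows "continuous_on {a..b} (volterra_iterate z h n)"
  by (induction n) (auto simp: assms volterra_iterate_Suc intro!: continuous_intros K_continuous w_integrable_continuous)

lemma volterra_iterate_bound:
  assumes h: "continuous_on {a..b} h" and le: "\<And>x. x \<in> {a..b} \<Longrightarrow> norm (h x) \<le> C" and "x \<in> {a..b}"
  shows "norm (volterra_iterate z h n x) \<le> (C * (norm z * Wtot) ^ n) * (Pint x ^ n / fact n)"
  using \<open>x \<in> {a..b}\<close>
proof (induction n arbitrary: x)
  case 0
  then show ?case by (simp add: le)
next
  case (Suc n)
  have "C \<ge> 0" using order_trans[OF norm_ge_zero le[of a]] ab by simp
  have "norm (K (volterra_iterate z h n) x) \<le> ((C * (norm z * Wtot) ^ n) * Wtot) * (Pint x ^ Suc n / fact (Suc n))"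
    using Suc \<open>C \<ge> 0\<close> Wtot_pos
    by (intro norm_K_le_power w_integrable_continuous volterra_iterate_continuous h) auto
  from mult_left_mono[OF this, of "norm z"]
  show ?case by (simp add: volterra_iterate_Suc norm_mult mult_ac del: fact_Suc)
qed

lemma K_sum:
  assumes "\<And>i. i < (n::nat) \<Longrightarrow> w_integrable (f i)" "x \<le> b"
  shows "K (\<lambda>x. \<Sum>i<n. f i x) x = (\<Sum>i<n. K (f i) x) \<and> w_integrable (\<lambda>x. \<Sum>i<n. f i x)"
  using assms(1)
proof (induction n)
  case 0
  have "w_integrable (\<lambda>_. 0)" by (intro w_integrable_continuous continuous_intros)
  moreover have "K (\<lambda>_. 0) x = 0" by (simp add: K_def Wint_def)
  ultimately show ?case by simp
next
  case (Suc n)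
  then have i: "w_integrable (\<lambda>x. \<Sum>i<n. f i x)" "w_integrable (f n)" by auto
  from K_lin[OF i \<open>x \<le> b\<close>, of 1] w_integrable_lin[OF i, of 1] Suc show ?case by simp
qed

text \<open>The Neumann series converges uniformly for every \<open>z\<close>, since its majorant is
  an exponential series, and \<open>K\<close> passes to the limit because it is bounded in the sup
  norm.\<close>

lemma volterra_exists:
  assumes h: "continuous_on {a..b} h" and le: "\<And>x. x \<in> {a..b} \<Longrightarrow> norm (h x) \<le> C"
  obtains u where "continuous_on {a..b} u" "\<And>x. x \<in> {a..b} \<Longrightarrow> u x = h x + z * K u x"
    "\<And>x. x \<in> {a..b} \<Longrightarrow> norm (u x) \<le> C * exp (norm z * Wtot * Pint b)"
proof -
  let ?f = "volterra_iterate z h"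
  let ?q = "norm z * Wtot * Pint b"
  define M where "M n = C * (?q ^ n / fact n)" for n
  have "C \<ge> 0" using order_trans[OF norm_ge_zero le[of a]] ab by simp
  have fc: "continuous_on {a..b} (?f n)" for n by (rule volterra_iterate_continuous[OF h])
  have fw: "w_integrable (?f n)" for n by (rule w_integrable_continuous[OF fc])
  have bound: "norm (?f n x) \<le> M n" if "x \<in> {a..b}" for n x
  proof -
    have "norm (?f n x) \<le> (C * (norm z * Wtot) ^ n) * (Pint x ^ n / fact n)"
      by (rule volterra_iterate_bound[OF h le that])
    also have "\<dots> \<le> (C * (norm z * Wtot) ^ n) * (Pint b ^ n / fact n)"
      using that \<open>C \<ge> 0\<close> Wtot_pos
      by (intro mult_left_mono divide_right_mono power_mono Pint_mono Pint_nonneg mult_nonneg_nonneg zero_le_power) auto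
    also have "\<dots> = M n" by (simp add: M_def power_mult_distrib)
    finally show ?thesis .
  qed
  have M_sums: "M sums (C * exp ?q)"
    unfolding M_def using exp_converges[of ?q] by (intro sums_mult) (simp add: field_simps scaleR_conv_of_real)
  then have M_summ: "summable M" by (rule sums_summable)
  define u where "u x = (\<Sum>i. ?f i x)" for x
  have ul: "uniform_limit {a..b} (\<lambda>n x. \<Sum>i<n. ?f i x) u sequentially"
    unfolding u_def by (rule Weierstrass_m_test[OF bound M_summ])
  have cs: "continuous_on {a..b} (\<lambda>x. \<Sum>i<n. ?f i x)" for n
    by (intro continuous_on_sum fc)
  have uc: "continuous_on {a..b} u"
    by (rule uniform_limit_theorem[OF _ ul]) (auto simp: cs)
  have eq: "u x = h x + z * K u x" if x: "x \<in> {a..b}" for x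
  proof -
    have lim1: "(\<lambda>n. \<Sum>i<n. ?f i x) \<longlonglongrightarrow> u x" using ul x by (rule tendsto_uniform_limitI)
    have "(\<lambda>n. K (\<lambda>x. \<Sum>i<n. ?f i x) x) \<longlonglongrightarrow> K u x"
    proof (rule tendstoI)
      fix e :: real assume "e > 0"
      define d where "d = e / (Wtot * Pint b + 1)"
      have nn: "Wtot * Pint b \<ge> 0" using Wtot_pos Pint_nonneg[of b] ab by auto
      then have "d > 0" using \<open>e > 0\<close> by (simp add: d_def)
      have "\<forall>\<^sub>F n in sequentially. \<forall>y\<in>{a..b}. dist (\<Sum>i<n. ?f i y) (u y) < d"
        using ul \<open>d > 0\<close> by (auto simp: uniform_limit_iff)
      then show "\<forall>\<^sub>F n in sequentially. dist (K (\<lambda>x. \<Sum>i<n. ?f i x) x) (K u x) < e"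
      proof eventually_elim
        case (elim n)
        let ?D = "\<lambda>y. (-1) * u y + (\<Sum>i<n. ?f i y)"
        have "w_integrable ?D"
          by (intro w_integrable_lin w_integrable_continuous uc cs)
        then have "norm (K ?D x) \<le> d * Wtot * Pint b"
        proof (rule norm_K_le_sup[OF _ _ x])
          fix y assume "y \<in> {a..b}"
          then show "norm (?D y) \<le> d" using elim by (auto simp: dist_norm less_imp_le)
        qed
        moreover have "K ?D x = (-1) * K u x + K (\<lambda>y. \<Sum>i<n. ?f i y) x"
          using x by (intro K_lin w_integrable_continuous uc cs) auto
        moreover have "d * Wtot * Pint b < e"
          using nn \<open>e > 0\<close> by (simp add: d_def field_simps)
        ultimately show ?case by (simp add: dist_norm)
      qed
    qed
    then have "(\<lambda>n. h x + z * K (\<lambda>x. \<Sum>i<n. ?f i x) x) \<longlonglongrightarrow> h x + z * K u x"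
      by (intro tendsto_intros)
    \<comment> \<open>Applying \<open>h + z K\<close> to a partial sum produces the next partial
      sum.\<close>
    moreover have "h x + z * K (\<lambda>x. \<Sum>i<n. ?f i x) x = (\<Sum>i<Suc n. ?f i x)" for n
    proof -
      have "K (\<lambda>x. \<Sum>i<n. ?f i x) x = (\<Sum>i<n. K (?f i) x)"
        using K_sum[of n ?f x] fw x by auto
      then show ?thesis
        by (subst sum.lessThan_Suc_shift) (simp add: volterra_iterate_Suc sum_distrib_left)
    qed
    ultimately have "(\<lambda>n. \<Sum>i<Suc n. ?f i x) \<longlonglongrightarrow> h x + z * K u x" by simp
    then show ?thesis using LIMSEQ_Suc[OF lim1] LIMSEQ_unique by blast
  qed
  have "norm (u x) \<le> C * exp ?q" if "x \<in> {a..b}" for x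
  proof -
    have "norm (u x) \<le> suminf M" unfolding u_def
      by (rule norm_suminf_le[OF _ M_summ]) (rule bound[OF that])
    then show ?thesis using sums_unique[OF M_sums] by simp
  qed
  with uc eq show thesis by (rule that)
qed

text \<open>Iterating \<open>u = z K u\<close> gives \<open>u\<close> itself the bounds of the
  Neumann terms, and these tend to zero as terms of an exponential series.\<close>

lemma volterra_unique:
  assumes u: "continuous_on {a..b} u" and eq: "\<And>x. x \<in> {a..b} \<Longrightarrow> u x = z * K u x" and x: "x \<in> {a..b}"
  shows "u x = 0"
proof -
  obtain C where C: "\<And>x. x \<in> {a..b} \<Longrightarrow> norm (u x) \<le> C"
    using compact_imp_bounded[OF compact_continuous_image[OF u compact_Icc]] unfolding bounded_iff by (metis imageI)
  have "C \<ge> 0" using C[OF x] norm_ge_zero order_trans by blast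
  have it: "norm (u x) \<le> (C * (norm z * Wtot) ^ n) * (Pint x ^ n / fact n)" if "x \<in> {a..b}" for n x
    using that
  proof (induction n arbitrary: x)
    case 0
    then show ?case by (simp add: C)
  next
    case (Suc n)
    have "norm (K u x) \<le> ((C * (norm z * Wtot) ^ n) * Wtot) * (Pint x ^ Suc n / fact (Suc n))"
      using Suc \<open>C \<ge> 0\<close> Wtot_pos by (intro norm_K_le_power w_integrable_continuous u) auto
    from mult_left_mono[OF this, of "norm z"]
    have "norm z * norm (K u x) \<le> (C * (norm z * Wtot) ^ Suc n) * (Pint x ^ Suc n / fact (Suc n))"
      by (simp add: mult_ac del: fact_Suc)
    then show ?case using arg_cong[OF eq[OF Suc.prems], of norm] by (simp only: norm_mult)
  qed
  have "(\<lambda>n. inverse (fact n) * (norm z * Wtot * Pint x) ^ n) \<longlonglongrightarrow> 0"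
    using summable_LIMSEQ_zero[OF summable_exp] .
  then have "(\<lambda>n. C * (inverse (fact n) * (norm z * Wtot * Pint x) ^ n)) \<longlonglongrightarrow> C * 0"
    by (intro tendsto_intros)
  moreover have "norm (u x) \<le> C * (inverse (fact n) * (norm z * Wtot * Pint x) ^ n)" for n
    using it[OF x, of n] by (simp add: power_mult_distrib field_simps)
  ultimately have "norm (u x) \<le> C * 0"
    by (intro LIMSEQ_le_const) auto
  then show ?thesis by simp
qed

definition growth :: "complex \<Rightarrow> real" where
  "growth z = exp (norm z * Wtot * Pint b)"

text \<open>The chosen function is unspecified outside \<open>{a..b}\<close>; on the interval the
  equation determines it, by \<open>volterra_unique\<close>.\<close>

definition fundamental_solution :: "complex \<Rightarrow> real \<Rightarrow> complex" where
  "fundamental_solution z = (SOME u. continuous_on {a..b} u \<and> (\<forall>x\<in>{a..b}. u x = 1 + z * K u x) \<and>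
     (\<forall>x\<in>{a..b}. norm (u x) \<le> growth z))"

lemma fundamental_solution:
  shows "continuous_on {a..b} (fundamental_solution z)"
    and "\<And>x. x \<in> {a..b} \<Longrightarrow> fundamental_solution z x = 1 + z * K (fundamental_solution z) x"
    and "\<And>x. x \<in> {a..b} \<Longrightarrow> norm (fundamental_solution z x) \<le> growth z"
proof -
  obtain u where "continuous_on {a..b} u" "\<And>x. x \<in> {a..b} \<Longrightarrow> u x = 1 + z * K u x"
    "\<And>x. x \<in> {a..b} \<Longrightarrow> norm (u x) \<le> 1 * exp (norm z * Wtot * Pint b)"
    using volterra_exists[of "\<lambda>_. 1" 1 z] by auto
  then have "\<exists>u. continuous_on {a..b} u \<and> (\<forall>x\<in>{a..b}. u x = 1 + z * K u x) \<and>
     (\<forall>x\<in>{a..b}. norm (u x) \<le> growth z)" unfolding growth_def by (intro exI[of _ u]) auto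
  from someI_ex[OF this] show "continuous_on {a..b} (fundamental_solution z)"
    "\<And>x. x \<in> {a..b} \<Longrightarrow> fundamental_solution z x = 1 + z * K (fundamental_solution z) x"
    "\<And>x. x \<in> {a..b} \<Longrightarrow> norm (fundamental_solution z x) \<le> growth z"
    unfolding fundamental_solution_def by auto
qed

text \<open>Uniqueness turns the existence bound into an a priori bound.\<close>

lemma volterra_bound:
  assumes u: "continuous_on {a..b} u" and h: "continuous_on {a..b} h"
    and eq: "\<And>x. x \<in> {a..b} \<Longrightarrow> u x = h x + z * K u x"
    and le: "\<And>x. x \<in> {a..b} \<Longrightarrow> norm (h x) \<le> C" and x: "x \<in> {a..b}"
  shows "norm (u x) \<le> C * growth z"
proof -
  obtain v where v: "continuous_on {a..b} v" "\<And>x. x \<in> {a..b} \<Longrightarrow> v x = h x + z * K v x"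
    "\<And>x. x \<in> {a..b} \<Longrightarrow> norm (v x) \<le> C * exp (norm z * Wtot * Pint b)"
    using volterra_exists[OF h le, of z] by blast
  let ?d = "\<lambda>x. (-1) * v x + u x"
  have "?d x = 0"
  proof (rule volterra_unique[OF _ _ x])
    show "continuous_on {a..b} ?d" using u v by (intro continuous_intros)
    fix y assume y: "y \<in> {a..b}"
    have Kd: "K ?d y = (-1) * K v y + K u y"
      using y u v by (intro K_lin w_integrable_continuous) auto
    show "?d y = z * K ?d y" unfolding Kd using eq[OF y] v(2)[OF y] by (simp add: algebra_simps)
  qed
  then have "u x = v x" by simp
  then show ?thesis using v(3)[OF x] by (simp add: growth_def)
qed

section \<open>The weighted L^2 space\<close>

lemma integrable_mu_real_iff:
  fixes k :: "real \<Rightarrow> real"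
  assumes "k \<in> borel_measurable \<mu>"
  shows "integrable \<mu> k \<longleftrightarrow> w_integrable (\<lambda>x. complex_of_real (k x))"
  using integrable_mu_iff[of "\<lambda>x. complex_of_real (k x)"] assms by (simp add: complex_of_real_integrable_eq)

lemma integrable_mu_const [simp]: "integrable \<mu> (\<lambda>_. c :: real)"
  by (subst integrable_mu_real_iff) (auto intro!: w_integrable_continuous continuous_intros)

lemma Wint_const: "Wint (\<lambda>_. c) b = c * complex_of_real Wtot"
proof -
  have "((\<lambda>t. w t *\<^sub>R c) has_integral Wtot *\<^sub>R c) {a..b}"
    unfolding Wtot_def using w_integrable_real[of a b]
    by (intro has_integral_scaleR_left) (auto simp: has_integral_integral)
  then have "Wint (\<lambda>_. c) b = Wtot *\<^sub>R c" unfolding Wint_def by (rule integral_unique)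
  then show ?thesis by (simp add: scaleR_conv_of_real)
qed

lemma integral_mu_const: "(\<integral>x. (c::real) \<partial>\<mu>) = c * Wtot"
proof -
  have "complex_of_real (\<integral>x. c \<partial>\<mu>) = (\<integral>x. complex_of_real c \<partial>\<mu>)"
    by (rule integral_of_real[OF integrable_mu_const, symmetric])
  also have "\<dots> = Wint (\<lambda>_. complex_of_real c) b"
    by (rule integral_mu_eq) (auto simp: integrable_mu_iff intro!: w_integrable_continuous continuous_intros)
  also have "\<dots> = complex_of_real (c * Wtot)" by (simp add: Wint_const)
  finally show ?thesis using of_real_eq_iff by blast
qed

lemma L2_I:
  assumes "f \<in> borel_measurable \<mu>" "integrable \<mu> (\<lambda>x. (norm (f x))\<^sup>2)"
  shows "f \<in> L2 \<mu>"
  using assms by (simp add: L2_def)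

lemma L2_measurable [measurable_dest]: "f \<in> L2 \<mu> \<Longrightarrow> f \<in> borel_measurable \<mu>"
  and L2_square_integrable: "f \<in> L2 \<mu> \<Longrightarrow> integrable \<mu> (\<lambda>x. (norm (f x))\<^sup>2)"
  by (simp_all add: L2_def)

text \<open>The measure \<mu> is finite, so the pointwise bound \<open>|f|\<close> \<le>
  \<open>1 + |f|^2\<close> suffices.\<close>

lemma L2_integrable:
  assumes f: "f \<in> L2 \<mu>"
  shows "integrable \<mu> f"
proof (rule Bochner_Integration.integrable_bound)
  show "integrable \<mu> (\<lambda>x. 1 + (norm (f x))\<^sup>2)" using L2_square_integrable[OF f] by simp
  show "AE x in \<mu>. norm (f x) \<le> norm (1 + (norm (f x))\<^sup>2)"
  proof (rule AE_I2)
    fix x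
    have "2 * norm (f x) \<le> 1 + (norm (f x))\<^sup>2" using sum_squares_bound[of 1 "norm (f x)"] by simp
    then have "norm (f x) \<le> 1 + (norm (f x))\<^sup>2" using norm_ge_zero[of "f x"] by linarith
    then show "norm (f x) \<le> norm (1 + (norm (f x))\<^sup>2)" by simp
  qed
qed (rule L2_measurable[OF f])

lemma L2_w_integrable: "f \<in> L2 \<mu> \<Longrightarrow> w_integrable f"
  using L2_integrable L2_measurable integrable_mu_iff by blast

lemma L2_mult_integrable:
  assumes f: "f \<in> L2 \<mu>" and h: "h \<in> L2 \<mu>"
  shows "integrable \<mu> (\<lambda>x. f x * cnj (h x))"
proof (rule Bochner_Integration.integrable_bound)
  have [measurable]: "cnj \<in> borel_measurable borel"
    by (intro borel_measurable_continuous_onI continuous_intros)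
  have [measurable]: "f \<in> borel_measurable \<mu>" "h \<in> borel_measurable \<mu>" using f h by (auto intro: L2_measurable)
  show "integrable \<mu> (\<lambda>x. (norm (f x))\<^sup>2 + (norm (h x))\<^sup>2)"
    using L2_square_integrable[OF f] L2_square_integrable[OF h] by simp
  show "AE x in \<mu>. norm (f x * cnj (h x)) \<le> norm ((norm (f x))\<^sup>2 + (norm (h x))\<^sup>2)"
  proof (rule AE_I2)
    fix x
    have "2 * (norm (f x) * norm (h x)) \<le> (norm (f x))\<^sup>2 + (norm (h x))\<^sup>2"
      using sum_squares_bound[of "norm (f x)" "norm (h x)"] by (simp add: mult_ac)
    moreover have "0 \<le> norm (f x) * norm (h x)" by simp
    ultimately have "norm (f x) * norm (h x) \<le> (norm (f x))\<^sup>2 + (norm (h x))\<^sup>2" by linarith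
    then show "norm (f x * cnj (h x)) \<le> norm ((norm (f x))\<^sup>2 + (norm (h x))\<^sup>2)"
      by (simp add: norm_mult)
  qed
  show "(\<lambda>x. f x * cnj (h x)) \<in> borel_measurable \<mu>" by measurable
qed

lemma L2_lin:
  assumes f: "f \<in> L2 \<mu>" and h: "h \<in> L2 \<mu>"
  shows "(\<lambda>x. c * f x + h x) \<in> L2 \<mu>"
proof (rule L2_I)
  have [measurable]: "f \<in> borel_measurable \<mu>" "h \<in> borel_measurable \<mu>" using f h by (auto intro: L2_measurable)
  show "(\<lambda>x. c * f x + h x) \<in> borel_measurable \<mu>" by measurable
  show "integrable \<mu> (\<lambda>x. (norm (c * f x + h x))\<^sup>2)"
  proof (rule Bochner_Integration.integrable_bound)
    show "integrable \<mu> (\<lambda>x. (2 * (norm c)\<^sup>2) * (norm (f x))\<^sup>2 + 2 * (norm (h x))\<^sup>2)"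
      using L2_square_integrable[OF f] L2_square_integrable[OF h] by auto
    show "AE x in \<mu>. norm ((norm (c * f x + h x))\<^sup>2) \<le> norm ((2 * (norm c)\<^sup>2) * (norm (f x))\<^sup>2 + 2 * (norm (h x))\<^sup>2)"
    proof (rule AE_I2)
      fix x
      have "(norm (c * f x + h x))\<^sup>2 \<le> (norm (c * f x) + norm (h x))\<^sup>2"
        by (intro power_mono norm_triangle_ineq) auto
      also have "\<dots> \<le> 2 * (norm (c * f x))\<^sup>2 + 2 * (norm (h x))\<^sup>2"
        using sum_squares_bound[of "norm (c * f x)" "norm (h x)"] by (simp add: power2_sum)
      finally show "norm ((norm (c * f x + h x))\<^sup>2) \<le> norm ((2 * (norm c)\<^sup>2) * (norm (f x))\<^sup>2 + 2 * (norm (h x))\<^sup>2)"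
        by (simp add: norm_mult power_mult_distrib)
    qed
    show "(\<lambda>x. (norm (c * f x + h x))\<^sup>2) \<in> borel_measurable \<mu>" by measurable
  qed
qed

lemma L2_diff: "f \<in> L2 \<mu> \<Longrightarrow> h \<in> L2 \<mu> \<Longrightarrow> (\<lambda>x. f x - h x) \<in> L2 \<mu>"
  using L2_lin[of h f "-1"] by simp

lemma L2_bounded:
  assumes "f \<in> borel_measurable \<mu>" "\<And>x. x \<in> {a<..<b} \<Longrightarrow> norm (f x) \<le> C"
  shows "f \<in> L2 \<mu>"
proof (rule L2_I)
  have [measurable]: "f \<in> borel_measurable \<mu>" by fact
  show "integrable \<mu> (\<lambda>x. (norm (f x))\<^sup>2)"
  proof (rule Bochner_Integration.integrable_bound)
    show "integrable \<mu> (\<lambda>_. C\<^sup>2)" by simp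
    show "AE x in \<mu>. norm ((norm (f x))\<^sup>2) \<le> norm (C\<^sup>2)"
      using assms(2) by (intro AE_I2) (auto intro: power_mono)
    show "(\<lambda>x. (norm (f x))\<^sup>2) \<in> borel_measurable \<mu>" by measurable
  qed
qed (rule assms)

lemma L2_continuous:
  assumes "continuous_on {a..b} f"
  shows "f \<in> L2 \<mu>"
proof -
  obtain C where "\<And>x. x \<in> {a..b} \<Longrightarrow> norm (f x) \<le> C"
    using compact_imp_bounded[OF compact_continuous_image[OF assms compact_Icc]] unfolding bounded_iff by (metis imageI)
  then show ?thesis
    by (intro L2_bounded[of _ C] w_integrable_imp_measurable w_integrable_continuous assms) auto
qed

lemma L2_inner_eq_Wint:
  assumes "f \<in> L2 \<mu>" "h \<in> L2 \<mu>"
  shows "L2_inner \<mu> f h = Wint (\<lambda>x. f x * cnj (h x)) b"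
  unfolding L2_inner_def using L2_mult_integrable[OF assms] by (intro integral_mu_eq) auto

lemma L2_inner_mult_w_integrable:
  assumes "f \<in> L2 \<mu>" "h \<in> L2 \<mu>"
  shows "w_integrable (\<lambda>x. f x * cnj (h x))"
  using L2_mult_integrable[OF assms] by (subst integrable_mu_iff[symmetric]) auto

lemma L2_inner_lin_left:
  assumes "f \<in> L2 \<mu>" "h \<in> L2 \<mu>" "k \<in> L2 \<mu>"
  shows "L2_inner \<mu> (\<lambda>x. c * f x + h x) k = c * L2_inner \<mu> f k + L2_inner \<mu> h k"
  unfolding L2_inner_def using L2_mult_integrable[OF assms(1,3)] L2_mult_integrable[OF assms(2,3)]
  by (simp add: distrib_right mult.assoc)

lemma L2_inner_cnj: "L2_inner \<mu> f h = cnj (L2_inner \<mu> h f)"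
proof -
  have "(\<integral>x. cnj (h x * cnj (f x)) \<partial>\<mu>) = cnj (\<integral>x. h x * cnj (f x) \<partial>\<mu>)"
    by (rule Bochner_Integration.integral_cnj)
  then show ?thesis unfolding L2_inner_def by (simp add: mult.commute)
qed

lemma L2_inner_lin_right:
  assumes "f \<in> L2 \<mu>" "h \<in> L2 \<mu>" "k \<in> L2 \<mu>"
  shows "L2_inner \<mu> k (\<lambda>x. c * f x + h x) = cnj c * L2_inner \<mu> k f + L2_inner \<mu> k h"
  using L2_inner_lin_left[OF assms, of c]
  by (subst (1 2 3) L2_inner_cnj) simp

lemma L2_inner_cong_ae:
  assumes "AE x in \<mu>. f x = f' x" "AE x in \<mu>. h x = h' x"
    "f \<in> L2 \<mu>" "f' \<in> L2 \<mu>" "h \<in> L2 \<mu>" "h' \<in> L2 \<mu>"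
  shows "L2_inner \<mu> f h = L2_inner \<mu> f' h'"
  unfolding L2_inner_def
proof (rule integral_cong_AE)
  show "AE x in \<mu>. f x * cnj (h x) = f' x * cnj (h' x)"
    using assms(1,2) by eventually_elim simp
qed (use L2_mult_integrable[OF assms(3,5)] L2_mult_integrable[OF assms(4,6)] in auto)

lemma L2_inner_self:
  assumes "f \<in> L2 \<mu>"
  shows "L2_inner \<mu> f f = complex_of_real (\<integral>x. (norm (f x))\<^sup>2 \<partial>\<mu>)"
proof -
  have "L2_inner \<mu> f f = (\<integral>x. complex_of_real ((norm (f x))\<^sup>2) \<partial>\<mu>)"
    unfolding L2_inner_def by (simp only: complex_norm_square)
  then show ?thesis by (simp only: integral_of_real[OF L2_square_integrable[OF assms]])
qed

lemma L2_inner_self_zero: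
  assumes "f \<in> L2 \<mu>" "L2_inner \<mu> f f = 0"
  shows "AE x in \<mu>. f x = 0"
proof -
  have "(\<integral>x. (norm (f x))\<^sup>2 \<partial>\<mu>) = 0" using assms(2) unfolding L2_inner_self[OF assms(1)] by simp
  then have "AE x in \<mu>. (norm (f x))\<^sup>2 = 0"
    using L2_square_integrable[OF assms(1)] by (subst (asm) integral_nonneg_eq_0_iff_AE) auto
  then show ?thesis by simp
qed

lemma L2_norm_le_sup:
  assumes "f \<in> L2 \<mu>" "AE x in \<mu>. norm (f x) \<le> C" "C \<ge> 0"
  shows "L2_norm \<mu> f \<le> sqrt Wtot * C"
proof -
  have "(\<integral>x. (norm (f x))\<^sup>2 \<partial>\<mu>) \<le> (\<integral>x. C\<^sup>2 \<partial>\<mu>)"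
    using L2_square_integrable[OF assms(1)] assms(2)
    by (intro integral_mono_AE) (auto elim!: eventually_mono intro: power_mono)
  then have "L2_norm \<mu> f \<le> sqrt (C\<^sup>2 * Wtot)"
    unfolding L2_norm_def integral_mu_const by (rule real_sqrt_le_mono)
  then show ?thesis using assms(3) by (simp add: real_sqrt_mult mult.commute)
qed

lemma wnorm1_eq_integral_mu:
  assumes f: "w_integrable f"
  shows "wnorm1 f = (\<integral>x. norm (f x) \<partial>\<mu>)"
proof -
  have m: "f \<in> borel_measurable \<mu>" by (rule w_integrable_imp_measurable[OF f])
  then have [measurable]: "f \<in> borel_measurable (lebesgue_on {a<..<b})" by (simp add: measurable_mu)
  have "(\<lambda>x. w x *\<^sub>R f x) absolutely_integrable_on {a<..<b}"
    using f by (simp add: w_integrable_def absolutely_integrable_Icc_iff_Ioo)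
  then have "integrable (lebesgue_on {a<..<b}) (\<lambda>x. w x *\<^sub>R f x)"
    by (subst (asm) set_integrable_eq) auto
  then have int: "integrable (lebesgue_on {a<..<b}) (\<lambda>x. norm (w x *\<^sub>R f x))"
    by (rule integrable_norm)
  have "(\<integral>x. norm (f x) \<partial>\<mu>) = (\<integral>x. w x *\<^sub>R norm (f x) \<partial>lebesgue_on {a<..<b})"
    unfolding \<mu>_def using w_pos by (intro integral_density) (auto simp: less_imp_le)
  also have "\<dots> = (\<integral>x. norm (w x *\<^sub>R f x) \<partial>lebesgue_on {a<..<b})"
    by (intro Bochner_Integration.integral_cong) (auto simp: abs_of_pos w_pos)
  also have "\<dots> = integral {a<..<b} (\<lambda>x. norm (w x *\<^sub>R f x))"
    using int by (intro lebesgue_integral_eq_integral) auto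
  finally show ?thesis unfolding wnorm1_def by (simp add: integral_open_interval_real)
qed

text \<open>A parametrised Cauchy-Schwarz inequality: \<open>|f|\<close> \<le>
  \<open>s + |f|^2 / s\<close> is integrated and \<open>s\<close> is set to the norm itself, which
  gives the constant \<open>Wtot + 1\<close>.\<close>

lemma wnorm1_le_L2_norm:
  assumes f: "f \<in> L2 \<mu>"
  shows "wnorm1 f \<le> (Wtot + 1) * L2_norm \<mu> f"
proof -
  define n where "n = L2_norm \<mu> f"
  have n0: "n \<ge> 0" by (simp add: n_def L2_norm_def)
  have n2: "n\<^sup>2 = (\<integral>x. (norm (f x))\<^sup>2 \<partial>\<mu>)" by (simp add: n_def L2_norm_def)
  have *: "wnorm1 f \<le> s * Wtot + n\<^sup>2 / s" if "s > 0" for s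
  proof -
    have "wnorm1 f = (\<integral>x. norm (f x) \<partial>\<mu>)" by (rule wnorm1_eq_integral_mu[OF L2_w_integrable[OF f]])
    also have "\<dots> \<le> (\<integral>x. s + (norm (f x))\<^sup>2 / s \<partial>\<mu>)"
    proof (rule integral_mono)
      show "integrable \<mu> (\<lambda>x. norm (f x))" using L2_integrable[OF f] by (rule integrable_norm)
      show "integrable \<mu> (\<lambda>x. s + (norm (f x))\<^sup>2 / s)" using L2_square_integrable[OF f] by auto
      fix x
      have "2 * s * norm (f x) \<le> s\<^sup>2 + (norm (f x))\<^sup>2" by (rule sum_squares_bound)
      moreover have "0 \<le> s * norm (f x)" using that by simp
      ultimately have "s * norm (f x) \<le> s\<^sup>2 + (norm (f x))\<^sup>2" by linarith
      then show "norm (f x) \<le> s + (norm (f x))\<^sup>2 / s" using that by (simp add: field_simps power2_eq_square)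
    qed
    also have "\<dots> = s * Wtot + n\<^sup>2 / s"
      unfolding n2 integral_mu_const[symmetric] using L2_square_integrable[OF f]
      by (subst Bochner_Integration.integral_add) auto
    finally show ?thesis .
  qed
  show ?thesis
  proof (cases "n > 0")
    case True
    from *[OF this] True show ?thesis by (simp add: power2_eq_square algebra_simps n_def)
  next
    case False
    then have "n = 0" using n0 by simp
    have "wnorm1 f \<le> 0"
    proof (rule ccontr)
      assume "\<not> wnorm1 f \<le> 0"
      \<comment> \<open>For norm zero every positive \<open>s\<close> is available; this one makes
        the bound half of \<open>wnorm1 f\<close>, a contradiction.\<close>
      then have "wnorm1 f / (2 * Wtot) > 0" using Wtot_pos by simp
      from *[OF this] have "wnorm1 f \<le> wnorm1 f / 2" using Wtot_pos \<open>n = 0\<close> by simp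
      then show False using \<open>\<not> wnorm1 f \<le> 0\<close> by linarith
    qed
    then show ?thesis using \<open>n = 0\<close> by (simp add: n_def)
  qed
qed

lemma wnorm1_zero_ae:
  assumes "AE x in \<mu>. f x = 0" "w_integrable f"
  shows "wnorm1 f = 0"
proof -
  have "(\<integral>x. norm (f x) \<partial>\<mu>) = (\<integral>x. 0 \<partial>\<mu>)"
    using assms(1) w_integrable_imp_measurable[OF assms(2)] by (intro integral_cong_AE) auto
  then show ?thesis using wnorm1_eq_integral_mu[OF assms(2)] by simp
qed

text \<open>\<open>u = c + K f\<close> encodes \<open>- (p u')' = w f\<close> with \<open>p u'\<close> vanishing at \<open>a\<close>; then \<open>Wint f b = 0\<close> says that
  \<open>p u'\<close> vanishes at \<open>b\<close>.\<close>

definition T :: "real fun_graph" where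
  "T = {(u, f) \<in> L2 \<mu> \<times> L2 \<mu>. Wint f b = 0 \<and> (\<exists>c. AE x in \<mu>. u x = c + K f x)}"

lemma K_L2: "w_integrable f \<Longrightarrow> K f \<in> L2 \<mu>"
  by (intro L2_continuous K_continuous)

lemma const_L2: "(\<lambda>_. c) \<in> L2 \<mu>"
  by (intro L2_continuous continuous_intros)

lemma const_K_L2: "w_integrable f \<Longrightarrow> (\<lambda>x. c + K f x) \<in> L2 \<mu>"
  by (intro L2_continuous K_continuous continuous_intros)

lemma T_I: "f \<in> L2 \<mu> \<Longrightarrow> Wint f b = 0 \<Longrightarrow> (\<lambda>x. c + K f x) \<in> L2 \<mu> \<Longrightarrow> ((\<lambda>x. c + K f x), f) \<in> T"
  unfolding T_def by auto

lemma deriv_Wint_ae: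
  assumes "w_integrable f"
  shows "negligible ({t. \<not> (Wint f has_vector_derivative w t *\<^sub>R f t) (at t)} \<inter> {a<..<b})"
  using indefinite_integral_derivative_ae[OF assms[unfolded w_integrable_def]] unfolding Wint_def[abs_def] .

text \<open>Integration by parts for \<open>Wint f * cnj (K h)\<close>, whose derivative is the
  difference of the two integrands almost everywhere. The boundary terms vanish because
  \<open>Wint f\<close> is zero at \<open>a\<close> by construction and at \<open>b\<close> by
  hypothesis. The resulting form is hermitian in \<open>f\<close> and \<open>h\<close> and
  nonnegative for \<open>f = h\<close>; symmetry and positivity of the operator both come from
  it.\<close>

lemma integral_parts_K:
  assumes f: "f \<in> L2 \<mu>" and h: "h \<in> L2 \<mu>" and f0: "Wint f b = 0"
  shows "L2_inner \<mu> f (K h) = integral {a..b} (\<lambda>t. (1 / p t) *\<^sub>R (Wint f t * cnj (Wint h t)))"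
proof -
  have wf: "w_integrable f" and wh: "w_integrable h" using f h by (auto intro: L2_w_integrable)
  let ?N = "{t. \<not> (Wint f has_vector_derivative w t *\<^sub>R f t) (at t)} \<inter> {a<..<b}"
  let ?i1 = "\<lambda>t. w t *\<^sub>R (f t * cnj (K h t))" and ?i2 = "\<lambda>t. (1 / p t) *\<^sub>R (Wint f t * cnj (Wint h t))"
  have i1: "?i1 absolutely_integrable_on {a..b}"
    using L2_inner_mult_w_integrable[OF f K_L2[OF wh]] unfolding w_integrable_def .
  have i2: "?i2 absolutely_integrable_on {a..b}"
    by (intro absolutely_integrable_mult_continuous ip continuous_intros Wint_continuous wf wh)
  have "Wint f b * cnj (K h b) - Wint f a * cnj (K h a) = integral {a..b} (\<lambda>t. ?i1 t - ?i2 t)"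
  proof (rule abs_cont_on_derivative_absolutely_integrable)
    show "abs_cont_on {a..b} (\<lambda>t. Wint f t * cnj (K h t))"
      by (intro abs_cont_on_mult abs_cont_on_cnj Wint_abs_cont K_abs_cont wf wh)
    show "(\<lambda>t. ?i1 t - ?i2 t) absolutely_integrable_on {a..b}"
      using i1 i2 by (rule set_integral_diff(1))
    show "negligible ?N" by (rule deriv_Wint_ae[OF wf])
    fix t assume t: "t \<in> {a<..<b} - ?N"
    have "((\<lambda>t. cnj (K h t)) has_vector_derivative cnj (- ((1 / p t) *\<^sub>R Wint h t))) (at t)"
      using t by (intro bounded_linear.has_vector_derivative[OF bounded_linear_cnj] K_deriv wh) auto
    then have "((\<lambda>t. Wint f t * cnj (K h t)) has_vector_derivative
       (Wint f t * cnj (- ((1 / p t) *\<^sub>R Wint h t)) + (w t *\<^sub>R f t) * cnj (K h t))) (at t)"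
      using t by (intro has_vector_derivative_mult) auto
    then show "((\<lambda>t. Wint f t * cnj (K h t)) has_vector_derivative (?i1 t - ?i2 t)) (at t)"
      by (simp add: algebra_simps)
  qed (use ab in auto)
  then have "0 = integral {a..b} ?i1 - integral {a..b} ?i2"
    using f0 i1 i2 by (simp add: Henstock_Kurzweil_Integration.integral_diff set_lebesgue_integral_eq_integral(1))
  then show ?thesis using L2_inner_eq_Wint[OF f K_L2[OF wh]] by (simp add: Wint_def)
qed

lemma integral_cnj_commute:
  "integral {a..b} (\<lambda>t. (1 / p t) *\<^sub>R (Wint f t * cnj (Wint h t)))
   = cnj (integral {a..b} (\<lambda>t. (1 / p t) *\<^sub>R (Wint h t * cnj (Wint f t))))"
  by (simp add: integral_cnj mult.commute)

lemma K_symmetric: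
  assumes f: "f \<in> L2 \<mu>" and h: "h \<in> L2 \<mu>" and "Wint f b = 0" "Wint h b = 0"
  shows "L2_inner \<mu> f (K h) = L2_inner \<mu> (K f) h"
  using integral_parts_K[OF f h] integral_parts_K[OF h f] assms(3,4) integral_cnj_commute[of f h]
    L2_inner_cnj[of "K f" h] by simp

lemma L2_inner_const_right: "f \<in> L2 \<mu> \<Longrightarrow> L2_inner \<mu> f (\<lambda>_. c) = cnj c * Wint f b"
  using L2_inner_eq_Wint[OF _ const_L2, of f c] Wint_lin[of f "\<lambda>_. 0" b "cnj c"]
  by (simp add: L2_w_integrable w_integrable_continuous mult.commute Wint_const[of 0])

text \<open>Up to null sets \<open>u\<close> and \<open>v\<close> are a constant plus
  \<open>K\<close> of their image. Images have weighted mean zero, so the constants drop out of the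
  inner products and symmetry of \<open>K\<close> remains.\<close>

lemma T_symmetric:
  assumes "(u, f) \<in> T" "(v, h) \<in> T"
  shows "L2_inner \<mu> f v = L2_inner \<mu> u h"
proof -
  have L: "u \<in> L2 \<mu>" "f \<in> L2 \<mu>" "v \<in> L2 \<mu>" "h \<in> L2 \<mu>" and 0: "Wint f b = 0" "Wint h b = 0"
    using assms by (auto simp: T_def)
  obtain c where c: "AE x in \<mu>. u x = c + K f x" using assms by (auto simp: T_def)
  obtain d where d: "AE x in \<mu>. v x = d + K h x" using assms by (auto simp: T_def)
  have KL: "K f \<in> L2 \<mu>" "K h \<in> L2 \<mu>" using L by (auto intro: K_L2 L2_w_integrable)
  have "L2_inner \<mu> f v = L2_inner \<mu> f (\<lambda>x. 1 * d + K h x)"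
    using d L by (intro L2_inner_cong_ae const_K_L2[of h d, simplified] L2_lin const_L2 KL) auto
  also have "\<dots> = L2_inner \<mu> f (K h)"
    using L2_inner_lin_right[OF const_L2 KL(2) L(2), of 1 d] L2_inner_const_right[OF L(2), of d] 0 by simp
  also have "\<dots> = L2_inner \<mu> (K f) h" by (rule K_symmetric[OF L(2,4) 0])
  also have "\<dots> = L2_inner \<mu> (\<lambda>x. 1 * c + K f x) h"
    using L2_inner_lin_left[OF const_L2 KL(1) L(4), of 1 c] L2_inner_const_right[OF L(4), of c] 0
      L2_inner_cnj[of "\<lambda>_. c" h] by simp
  also have "\<dots> = L2_inner \<mu> u h"
    using c L by (intro L2_inner_cong_ae L2_lin const_L2 KL) (auto elim: eventually_mono)
  finally show ?thesis .
qed

lemma T_zero_in: "((\<lambda>_. 1), (\<lambda>_. 0)) \<in> T" "((\<lambda>_. 0), (\<lambda>_. 0)) \<in> T"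
  unfolding T_def using const_L2[of 0] const_L2[of 1] by (auto simp: Wint_const K_def Wint_def)

text \<open>For the inclusion of the adjoint in \<open>T\<close>, the pair \<open>(1, 0)\<close> of
  \<open>T\<close> forces \<open>h\<close> to have mean zero, and it remains to see that
  \<open>r = v - K h\<close> is constant. Its deviation \<open>f0\<close> from the mean
  \<open>m\<close> is an admissible image in \<open>T\<close>; testing with
  \<open>(K f0, f0)\<close> gives \<open><f0, r> = 0\<close>, hence
  \<open><f0, f0> = 0\<close>.\<close>

lemma T_adjoint: "L2_adjoint \<mu> T = T"
proof
  show "T \<subseteq> L2_adjoint \<mu> T"
  proof clarify
    fix u f assume uf: "(u, f) \<in> T"
    then have "u \<in> L2 \<mu>" "f \<in> L2 \<mu>" by (auto simp: T_def)
    moreover have "L2_inner \<mu> h u = L2_inner \<mu> v f" if "(v, h) \<in> T" for v h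
      by (rule T_symmetric[OF that uf])
    ultimately show "(u, f) \<in> L2_adjoint \<mu> T" by (auto simp: L2_adjoint_def)
  qed
  show "L2_adjoint \<mu> T \<subseteq> T"
  proof clarify
    fix v h assume vh: "(v, h) \<in> L2_adjoint \<mu> T"
    then have v: "v \<in> L2 \<mu>" and h: "h \<in> L2 \<mu>"
      and adj: "\<And>u f. (u, f) \<in> T \<Longrightarrow> L2_inner \<mu> f v = L2_inner \<mu> u h" by (auto simp: L2_adjoint_def)
    have "L2_inner \<mu> h (\<lambda>_. 1) = 0"
      using adj[OF T_zero_in(1)] L2_inner_cnj[of h "\<lambda>_. 1"] by (simp add: L2_inner_def)
    then have h0: "Wint h b = 0" using L2_inner_const_right[OF h, of 1] by simp
    define r where "r x = v x - K h x" for x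
    have KhL: "K h \<in> L2 \<mu>" by (rule K_L2[OF L2_w_integrable[OF h]])
    have r: "r \<in> L2 \<mu>" unfolding r_def by (rule L2_diff[OF v KhL])
    define m where "m = Wint r b / complex_of_real Wtot"
    define f0 where "f0 x = (-1) * m + r x" for x
    have f0: "f0 \<in> L2 \<mu>" unfolding f0_def by (rule L2_lin[OF const_L2 r])
    have f00: "Wint f0 b = 0"
      unfolding f0_def using Wtot_pos
      by (subst Wint_lin) (auto simp: L2_w_integrable const_L2 r Wint_const m_def)
    have "((\<lambda>x. 0 + K f0 x), f0) \<in> T"
      by (rule T_I[OF f0 f00 const_K_L2[OF L2_w_integrable[OF f0]]])
    then have "L2_inner \<mu> f0 v = L2_inner \<mu> (K f0) h" using adj by simp
    also have "\<dots> = L2_inner \<mu> f0 (K h)" by (rule K_symmetric[OF f0 h f00 h0, symmetric])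
    finally have "L2_inner \<mu> f0 r = 0"
      using L2_inner_lin_right[OF KhL v f0, of "-1"] by (simp add: r_def[abs_def])
    then have "L2_inner \<mu> f0 f0 = 0"
      using L2_inner_lin_right[OF const_L2 r f0, of "-1" m] L2_inner_const_right[OF f0, of m] f00
      by (simp add: f0_def[abs_def])
    then have "AE x in \<mu>. f0 x = 0" by (rule L2_inner_self_zero[OF f0])
    then have "AE x in \<mu>. v x = m + K h x"
      by eventually_elim (simp add: f0_def r_def algebra_simps)
    then show "(v, h) \<in> T" unfolding T_def using v h h0 by auto
  qed
qed

lemma AE_eq_imp_eq_on:
  assumes "continuous_on {a..b} f" "continuous_on {a..b} (h :: real \<Rightarrow> complex)" "AE x in \<mu>. f x = h x" "x \<in> {a..b}"
  shows "f x = h x"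
proof -
  have neg: "negligible {x \<in> {a<..<b}. f x \<noteq> h x}" using assms(3) by (simp add: AE_mu_iff)
  have "continuous_on {a<..<b} (\<lambda>x. f x - h x)"
    using assms(1,2) by (intro continuous_on_diff) (auto elim: continuous_on_subset)
  then have "open ((\<lambda>x. f x - h x) -` (- {0}) \<inter> {a<..<b})"
    using continuous_on_open_vimage[of "{a<..<b}" "\<lambda>x. f x - h x"] by auto
  also have "(\<lambda>x. f x - h x) -` (- {0}) \<inter> {a<..<b} = {x \<in> {a<..<b}. f x \<noteq> h x}" by auto
  finally have "open {x \<in> {a<..<b}. f x \<noteq> h x}" .
  with neg have "{x \<in> {a<..<b}. f x \<noteq> h x} = {}" using open_not_negligible by blast
  then have "f y - h y = 0" if "y \<in> {a<..<b}" for y using that by auto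
  moreover have "continuous_on (closure {a<..<b}) (\<lambda>x. f x - h x)" using assms ab by (auto intro!: continuous_intros)
  moreover have "x \<in> closure {a<..<b}" using assms(4) ab by simp
  ultimately have "f x - h x = 0"
    using continuous_constant_on_closure[of "{a<..<b}" "\<lambda>x. f x - h x" 0 x] by auto
  then show ?thesis by simp
qed

lemma T_operator: "L2_operator \<mu> T"
  unfolding L2_operator_def
proof (intro conjI)
  show "T \<subseteq> L2 \<mu> \<times> L2 \<mu>" by (auto simp: T_def)
  show "((\<lambda>_. 0), (\<lambda>_. 0)) \<in> T" by (rule T_zero_in)
  show "\<forall>(u, f)\<in>T. \<forall>v\<in>L2 \<mu>. \<forall>h\<in>L2 \<mu>. (AE x in \<mu>. u x = v x) \<and> (AE x in \<mu>. f x = h x) \<longrightarrow> (v, h) \<in> T"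
  proof (clarify)
    fix u f v h assume uf: "(u, f) \<in> T" and v: "v \<in> L2 \<mu>" and h: "h \<in> L2 \<mu>"
      and eq: "AE x in \<mu>. u x = v x" "AE x in \<mu>. f x = h x"
    then obtain c where c: "AE x in \<mu>. u x = c + K f x" by (auto simp: T_def)
    have neg: "negligible {t \<in> {a<..<b}. f t \<noteq> h t}" using eq(2) by (simp add: AE_mu_iff)
    have "AE x in \<mu>. x \<in> {a<..<b}" by (rule AE_I2) simp
    with c eq(1) have "AE x in \<mu>. v x = c + K h x"
      by eventually_elim (use K_cong_ae[OF neg] in auto)
    moreover have "Wint h b = 0" using Wint_cong_ae[OF neg, of b] uf by (simp add: T_def)
    ultimately show "(v, h) \<in> T" using v h by (auto simp: T_def)
  qed
  show "\<forall>(u, f)\<in>T. \<forall>(v, h)\<in>T. \<forall>c. (\<lambda>x. c * u x + v x, \<lambda>x. c * f x + h x) \<in> T"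
  proof (clarify)
    fix u f v h k assume uf: "(u, f) \<in> T" and vh: "(v, h) \<in> T"
    obtain c where c: "AE x in \<mu>. u x = c + K f x" using uf by (auto simp: T_def)
    obtain d where d: "AE x in \<mu>. v x = d + K h x" using vh by (auto simp: T_def)
    have L: "u \<in> L2 \<mu>" "f \<in> L2 \<mu>" "v \<in> L2 \<mu>" "h \<in> L2 \<mu>" and 0: "Wint f b = 0" "Wint h b = 0"
      using uf vh by (auto simp: T_def)
    have wi: "w_integrable f" "w_integrable h" using L by (auto intro: L2_w_integrable)
    have "AE x in \<mu>. x \<in> {a<..<b}" by (rule AE_I2) simp
    with c d have "AE x in \<mu>. k * u x + v x = (k * c + d) + K (\<lambda>x. k * f x + h x) x"
      by eventually_elim (use K_lin[OF wi] in \<open>auto simp: algebra_simps\<close>)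
    moreover have "Wint (\<lambda>x. k * f x + h x) b = 0" using Wint_lin[OF wi, of b k] 0 by simp
    ultimately show "(\<lambda>x. k * u x + v x, \<lambda>x. k * f x + h x) \<in> T"
      unfolding T_def using L2_lin[OF L(1,3)] L2_lin[OF L(2,4)] by auto
  qed
  \<comment> \<open>Single-valuedness: continuous representatives that agree almost everywhere agree
    everywhere, so differentiation identifies \<open>Wint f\<close> with \<open>Wint h\<close>, and
    these determine \<open>f\<close> and \<open>h\<close> almost everywhere.\<close>
  have "AE x in \<mu>. f x = h x" if uf: "(u, f) \<in> T" and vh: "(v, h) \<in> T" and eq: "AE x in \<mu>. u x = v x" for u f v h
  proof -
    obtain c where c: "AE x in \<mu>. u x = c + K f x" using uf by (auto simp: T_def)
    obtain d where d: "AE x in \<mu>. v x = d + K h x" using vh by (auto simp: T_def)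
    have wi: "w_integrable f" "w_integrable h" using uf vh by (auto simp: T_def intro: L2_w_integrable)
    have ae: "AE x in \<mu>. c + K f x = d + K h x" using c d eq by eventually_elim simp
    have eq': "c + K f x = d + K h x" if "x \<in> {a..b}" for x
      by (rule AE_eq_imp_eq_on[OF _ _ ae that]) (intro continuous_intros K_continuous wi)+
    have "Wint f x = Wint h x" if x: "x \<in> {a<..<b}" for x
    proof -
      have 1: "((\<lambda>x. c + K f x) has_vector_derivative - ((1 / p x) *\<^sub>R Wint f x)) (at x)"
        using K_deriv[OF wi(1) x] by (auto intro!: derivative_eq_intros)
      have 2: "((\<lambda>x. d + K h x) has_vector_derivative - ((1 / p x) *\<^sub>R Wint h x)) (at x)"
        using K_deriv[OF wi(2) x] by (auto intro!: derivative_eq_intros)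
      have 3: "((\<lambda>x. c + K f x) has_vector_derivative - ((1 / p x) *\<^sub>R Wint h x)) (at x)"
        by (rule has_vector_derivative_transform_within_open[OF 2, of "{a<..<b}"]) (use x eq' in auto)
      have "(1 / p x) *\<^sub>R Wint f x = (1 / p x) *\<^sub>R Wint h x"
        using vector_derivative_unique_at[OF 1 3] by (simp only: neg_equal_iff_equal)
      then show ?thesis using p_pos[OF x] by simp
    qed
    then show "AE x in \<mu>. f x = h x" unfolding AE_mu_iff by (rule Wint_eq_imp_ae[OF wi])
  qed
  then show "\<forall>(u, f)\<in>T. \<forall>(v, h)\<in>T. (AE x in \<mu>. u x = v x) \<longrightarrow> (AE x in \<mu>. f x = h x)"
    by blast
qed

subsection \<open>Resolvent and spectrum\<close>

text \<open>Minus the quasi-derivative at \<open>b\<close> of the fundamental solution.\<close>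

definition shooting :: "complex \<Rightarrow> complex" where
  "shooting z = z * Wint (fundamental_solution z) b"

lemma fundamental_solution_w_integrable: "w_integrable (fundamental_solution z)"
  by (intro w_integrable_continuous fundamental_solution)

text \<open>Variation of constants: with \<open>h = f - z u\<close>, the component \<psi> of
  \<open>u\<close> is the Volterra solution with inhomogeneity \<open>K h\<close> and obeys the a
  priori bound, while the multiple \<open>c\<close> of the fundamental solution is tied to the
  boundary condition at \<open>b\<close>. The last equation is \<open>Wint f b = 0\<close> with
  \<open>f = z u + h\<close> inserted.\<close>

lemma solution_decomposition:
  assumes uf: "(u, f) \<in> T"
  obtains c \<psi> where "continuous_on {a..b} \<psi>"
    "\<And>x. x \<in> {a..b} \<Longrightarrow> norm (\<psi> x) \<le> wnorm1 (\<lambda>x. f x - z * u x) * Pint b * growth z"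
    "AE x in \<mu>. u x = c * fundamental_solution z x + \<psi> x"
    "c * shooting z = - (z * Wint \<psi> b + Wint (\<lambda>x. f x - z * u x) b)"
proof -
  have L: "u \<in> L2 \<mu>" "f \<in> L2 \<mu>" and f0: "Wint f b = 0" using uf by (auto simp: T_def)
  obtain c where c: "AE x in \<mu>. u x = c + K f x" using uf by (auto simp: T_def)
  have wf: "w_integrable f" by (rule L2_w_integrable[OF L(2)])
  define U where "U x = c + K f x" for x
  define h where "h x = f x - z * u x" for x
  have h: "h \<in> L2 \<mu>" unfolding h_def using L2_lin[OF L, of "-z"] by simp
  have wh: "w_integrable h" by (rule L2_w_integrable[OF h])
  have Uc: "continuous_on {a..b} U" unfolding U_def by (intro continuous_intros K_continuous wf)
  have wU: "w_integrable U" by (rule w_integrable_continuous[OF Uc])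
  have "AE x in \<mu>. f x = z * U x + h x" using c by eventually_elim (simp add: h_def U_def)
  then have neg: "negligible {t \<in> {a<..<b}. f t \<noteq> z * U t + h t}" by (simp add: AE_mu_iff)
  have U_eq: "U x = c + z * K U x + K h x" if "x \<in> {a..b}" for x
    using K_cong_ae[OF neg, of x] K_lin[OF wU wh, of x z] that by (simp add: U_def)
  let ?\<phi> = "fundamental_solution z"
  note \<phi> = fundamental_solution[where z = z]
  \<comment> \<open>The fundamental solution starts from the constant 1, so subtracting
    \<open>c\<close> times it removes the constant from the equation for \<open>U\<close>.\<close>
  define \<psi> where "\<psi> x = (-c) * ?\<phi> x + U x" for x
  have \<psi>c: "continuous_on {a..b} \<psi>" unfolding \<psi>_def by (intro continuous_intros \<phi> Uc)
  have w\<psi>: "w_integrable \<psi>" by (rule w_integrable_continuous[OF \<psi>c])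
  have K\<psi>: "K \<psi> x = (-c) * K ?\<phi> x + K U x" if "x \<in> {a..b}" for x
    unfolding \<psi>_def using that by (intro K_lin fundamental_solution_w_integrable wU) auto
  have \<psi>_eq: "\<psi> x = K h x + z * K \<psi> x" if "x \<in> {a..b}" for x
    unfolding K\<psi>[OF that] unfolding \<psi>_def
    using U_eq[OF that] \<phi>(2)[OF that] by (simp add: algebra_simps)
  have W\<psi>: "Wint \<psi> b = (-c) * Wint ?\<phi> b + Wint U b"
    unfolding \<psi>_def by (intro Wint_lin fundamental_solution_w_integrable wU) auto
  have "0 = z * Wint U b + Wint h b"
    using f0 Wint_cong_ae[OF neg, of b] Wint_lin[OF wU wh, of b z] by simp
  then have c_eq: "c * shooting z = - (z * Wint \<psi> b + Wint h b)"
    unfolding W\<psi> shooting_def by (simp add: algebra_simps)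
  show thesis
  proof (rule that[of \<psi> c])
    show "continuous_on {a..b} \<psi>" by (rule \<psi>c)
    show "norm (\<psi> x) \<le> wnorm1 (\<lambda>x. f x - z * u x) * Pint b * growth z" if "x \<in> {a..b}" for x
      using volterra_bound[OF \<psi>c K_continuous[OF wh] \<psi>_eq norm_K_le_wnorm1[OF wh] that]
      by (simp add: h_def[abs_def])
    show "AE x in \<mu>. u x = c * ?\<phi> x + \<psi> x"
      using c by eventually_elim (simp add: \<psi>_def U_def)
    show "c * shooting z = - (z * Wint \<psi> b + Wint (\<lambda>x. f x - z * u x) b)"
      using c_eq by (simp add: h_def[abs_def])
  qed
qed

text \<open>A nonzero shooting value allows the boundary equation to be solved for \<open>c\<close>;
  \<open>A\<close> bounds \<open>c\<close> and \<open>B\<close> bounds \<psi>, both relative to the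
  weighted L^1 norm of \<open>f - z u\<close>.\<close>

lemma resolvent_estimate:
  assumes "shooting z \<noteq> 0"
  obtains C where "C \<ge> 0" "\<And>u f. (u, f) \<in> T \<Longrightarrow> AE x in \<mu>. norm (u x) \<le> C * wnorm1 (\<lambda>x. f x - z * u x)"
proof -
  define B where "B = Pint b * growth z"
  have B0: "B \<ge> 0" unfolding B_def growth_def using Pint_nonneg[of b] ab by simp
  define A where "A = (norm z * B * Wtot + 1) / norm (shooting z)"
  have A0: "A \<ge> 0" unfolding A_def using B0 Wtot_pos by simp
  show thesis
  proof (rule that[of "A * growth z + B"])
    have g0: "growth z \<ge> 0" by (simp add: growth_def)
    show "A * growth z + B \<ge> 0" using A0 B0 g0 by simp
    fix u f assume uf: "(u, f) \<in> T"
    define n where "n = wnorm1 (\<lambda>x. f x - z * u x)"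
    have n0: "n \<ge> 0" unfolding n_def by (rule wnorm1_nonneg)
    obtain c \<psi> where \<psi>: "continuous_on {a..b} \<psi>"
        "\<And>x. x \<in> {a..b} \<Longrightarrow> norm (\<psi> x) \<le> wnorm1 (\<lambda>x. f x - z * u x) * Pint b * growth z"
      and u: "AE x in \<mu>. u x = c * fundamental_solution z x + \<psi> x"
      and c: "c * shooting z = - (z * Wint \<psi> b + Wint (\<lambda>x. f x - z * u x) b)"
      by (rule solution_decomposition[OF uf, where z = z]) (rule that, assumption+)
    note \<psi> = \<psi>(1) \<psi>(2)[folded n_def, unfolded mult.assoc, folded B_def]
    have "(\<lambda>x. f x - z * u x) \<in> L2 \<mu>"
      using uf L2_lin[of u f "-z"] by (auto simp: T_def)
    then have "norm (Wint (\<lambda>x. f x - z * u x) b) \<le> n"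
      unfolding n_def using ab by (intro norm_Wint_le L2_w_integrable) auto
    moreover have "norm (Wint \<psi> b) \<le> (n * B) * Wtot"
      using ab \<psi> by (intro norm_Wint_le_bound w_integrable_continuous) auto
    then have "norm (z * Wint \<psi> b) \<le> norm z * ((n * B) * Wtot)"
      by (simp add: norm_mult mult_left_mono)
    moreover have "norm (c * shooting z) \<le> norm (z * Wint \<psi> b) + norm (Wint (\<lambda>x. f x - z * u x) b)"
      unfolding c by (metis norm_minus_cancel norm_triangle_ineq)
    ultimately have "norm c * norm (shooting z) \<le> (norm z * B * Wtot + 1) * n"
      by (simp add: norm_mult algebra_simps)
    then have cn: "norm c \<le> A * n"
      using assms by (simp add: A_def field_simps)
    have "AE x in \<mu>. x \<in> {a<..<b}" by (rule AE_I2) simp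
    with u show "AE x in \<mu>. norm (u x) \<le> (A * growth z + B) * wnorm1 (\<lambda>x. f x - z * u x)"
    proof eventually_elim
      case (elim x)
      then have x: "x \<in> {a..b}" by simp
      have "norm (u x) \<le> norm c * norm (fundamental_solution z x) + norm (\<psi> x)"
        unfolding elim(1) by (metis norm_mult norm_triangle_ineq)
      also have "\<dots> \<le> (A * n) * growth z + n * B"
        using cn \<psi>(2)[OF x] fundamental_solution(3)[OF x, of z] A0 n0 by (intro add_mono mult_mono) auto
      finally show ?case by (simp add: n_def algebra_simps)
    qed
  qed
qed

text \<open>The decomposition read backwards: \<psi> is built from \<open>h\<close>, and
  \<open>c\<close> is the number for which \<open>f = z u + h\<close> has weighted mean
  zero.\<close>

lemma resolvent_surj:
  assumes "shooting z \<noteq> 0" and h: "h \<in> L2 \<mu>"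
  shows "\<exists>(u, f)\<in>T. AE x in \<mu>. f x - z * u x = h x"
proof -
  have wh: "w_integrable h" by (rule L2_w_integrable[OF h])
  obtain \<psi> where \<psi>: "continuous_on {a..b} \<psi>" "\<And>x. x \<in> {a..b} \<Longrightarrow> \<psi> x = K h x + z * K \<psi> x"
    by (rule volterra_exists[OF K_continuous[OF wh] norm_K_le_wnorm1[OF wh], where z = z], assumption)
      (rule that, assumption+)
  have w\<psi>: "w_integrable \<psi>" by (rule w_integrable_continuous[OF \<psi>(1)])
  let ?\<phi> = "fundamental_solution z"
  note \<phi> = fundamental_solution[where z = z] and w\<phi> = fundamental_solution_w_integrable[of z]
  define c where "c = - (z * Wint \<psi> b + Wint h b) / shooting z"
  define u where "u x = c * ?\<phi> x + \<psi> x" for x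
  define f where "f x = z * u x + h x" for x
  have uc: "continuous_on {a..b} u" unfolding u_def by (intro continuous_intros \<phi> \<psi>)
  have wu: "w_integrable u" by (rule w_integrable_continuous[OF uc])
  have f: "f \<in> L2 \<mu>" unfolding f_def by (rule L2_lin[OF L2_continuous[OF uc] h])
  have Wu: "Wint u b = c * Wint ?\<phi> b + Wint \<psi> b"
    unfolding u_def by (intro Wint_lin w\<phi> w\<psi>) auto
  have Wf: "Wint f b = z * Wint u b + Wint h b"
    unfolding f_def by (intro Wint_lin wu wh) auto
  have "Wint f b = 0"
    unfolding Wf Wu using assms(1) by (simp add: c_def shooting_def field_simps)
  moreover have "u x = c + K f x" if x: "x \<in> {a..b}" for x
  proof -
    have Ku: "K u x = c * K ?\<phi> x + K \<psi> x" unfolding u_def using x by (intro K_lin w\<phi> w\<psi>) auto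
    have Kf: "K f x = z * K u x + K h x" unfolding f_def using x by (intro K_lin wu wh) auto
    have "u x = c * (1 + z * K ?\<phi> x) + (K h x + z * K \<psi> x)"
      unfolding u_def using \<phi>(2)[OF x] \<psi>(2)[OF x] by simp
    then show ?thesis unfolding Kf Ku by (simp add: algebra_simps)
  qed
  then have "AE x in \<mu>. u x = c + K f x" by (intro AE_I2) auto
  ultimately have "(u, f) \<in> T" unfolding T_def using f L2_continuous[OF uc] by auto
  then show ?thesis by (intro bexI[of _ "(u, f)"]) (auto simp: f_def)
qed

text \<open>The estimate by \<open>wnorm1\<close> gives injectivity, and it bounds the inverse in
  L^2 because on a finite measure the sup norm controls the L^2 norm and the L^2 norm controls the
  L^1 norm.\<close>

lemma shooting_nonzero_resolvent:
  assumes nz: "shooting z \<noteq> 0"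
  shows "z \<in> L2_resolvent_set \<mu> T"
proof -
  obtain C where "C \<ge> 0" and C: "\<And>u f. (u, f) \<in> T \<Longrightarrow> AE x in \<mu>. norm (u x) \<le> C * wnorm1 (\<lambda>x. f x - z * u x)"
    using resolvent_estimate[OF nz] by blast
  have hL: "(\<lambda>x. f x - z * u x) \<in> L2 \<mu>" if "(u, f) \<in> T" for u f
    using that L2_lin[of u f "-z"] by (auto simp: T_def)
  have inj: "AE x in \<mu>. u x = 0" if uf: "(u, f) \<in> T" and eq: "AE x in \<mu>. f x - z * u x = 0" for u f
  proof -
    have "wnorm1 (\<lambda>x. f x - z * u x) = 0" by (rule wnorm1_zero_ae[OF eq L2_w_integrable[OF hL[OF uf]]])
    then show ?thesis using C[OF uf] by (auto elim: eventually_mono)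
  qed
  have bd: "L2_norm \<mu> u \<le> (sqrt Wtot * (C * (Wtot + 1))) * L2_norm \<mu> (\<lambda>x. f x - z * u x)" if uf: "(u, f) \<in> T" for u f
  proof -
    have "L2_norm \<mu> u \<le> sqrt Wtot * (C * wnorm1 (\<lambda>x. f x - z * u x))"
      using uf \<open>C \<ge> 0\<close> wnorm1_nonneg by (intro L2_norm_le_sup C[OF uf]) (auto simp: T_def)
    also have "\<dots> \<le> sqrt Wtot * (C * ((Wtot + 1) * L2_norm \<mu> (\<lambda>x. f x - z * u x)))"
      using \<open>C \<ge> 0\<close> Wtot_pos by (intro mult_left_mono wnorm1_le_L2_norm hL[OF uf]) auto
    finally show ?thesis by (simp add: mult.assoc)
  qed
  show ?thesis
    unfolding L2_resolvent_set_def
  proof (intro CollectI conjI)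
    show "\<forall>(u, f)\<in>T. (AE x in \<mu>. f x - z * u x = 0) \<longrightarrow> (AE x in \<mu>. u x = 0)" using inj by blast
    show "\<forall>h\<in>L2 \<mu>. \<exists>(u, f)\<in>T. AE x in \<mu>. f x - z * u x = h x" using resolvent_surj[OF nz] by blast
    show "\<exists>C. \<forall>(u, f)\<in>T. L2_norm \<mu> u \<le> C * L2_norm \<mu> (\<lambda>x. f x - z * u x)" using bd by blast
  qed
qed

lemma spectrum_shooting_zero: "z \<in> L2_spectrum \<mu> T \<Longrightarrow> shooting z = 0"
  unfolding L2_spectrum_def using shooting_nonzero_resolvent by blast

lemma fundamental_solution_eigen:
  assumes "shooting z = 0"
  shows "(fundamental_solution z, \<lambda>x. z * fundamental_solution z x) \<in> T"
proof -
  let ?\<phi> = "fundamental_solution z"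
  note \<phi> = fundamental_solution[where z = z] and w\<phi> = fundamental_solution_w_integrable[of z]
  have w0: "w_integrable (\<lambda>_. 0)" by (intro w_integrable_continuous continuous_intros)
  have "Wint (\<lambda>x. z * ?\<phi> x + 0) b = z * Wint ?\<phi> b + Wint (\<lambda>_. 0) b"
    by (intro Wint_lin w\<phi> w0) auto
  then have "Wint (\<lambda>x. z * ?\<phi> x) b = 0" using assms by (simp add: shooting_def Wint_const)
  moreover have "?\<phi> x = 1 + K (\<lambda>x. z * ?\<phi> x) x" if "x \<in> {a..b}" for x
  proof -
    have "K (\<lambda>x. z * ?\<phi> x + 0) x = z * K ?\<phi> x + K (\<lambda>_. 0) x"
      using that by (intro K_lin w\<phi> w0) auto
    moreover have "K (\<lambda>_. 0) x = 0" by (simp add: K_def Wint_def)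
    ultimately show ?thesis using \<phi>(2)[OF that] by simp
  qed
  then have "AE x in \<mu>. ?\<phi> x = 1 + K (\<lambda>x. z * ?\<phi> x) x" by (intro AE_I2) auto
  moreover have "(\<lambda>x. z * ?\<phi> x) \<in> L2 \<mu>" by (intro L2_continuous continuous_intros \<phi>)
  ultimately show ?thesis unfolding T_def using L2_continuous[OF \<phi>(1)] by auto
qed

lemma fundamental_solution_L2: "fundamental_solution z \<in> L2 \<mu>"
  by (intro L2_continuous fundamental_solution)

lemma fundamental_solution_not_ae_zero: "\<not> (AE x in \<mu>. fundamental_solution z x = 0)"
proof
  assume "AE x in \<mu>. fundamental_solution z x = 0"
  then have "fundamental_solution z a = 0"
    by (intro AE_eq_imp_eq_on[of _ "\<lambda>_. 0"] fundamental_solution continuous_intros) (use ab in auto)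
  then show False using fundamental_solution(2)[of a z] ab by simp
qed

lemma fundamental_solution_norm_pos: "(\<integral>x. (norm (fundamental_solution z x))\<^sup>2 \<partial>\<mu>) > 0"
proof -
  have "(\<integral>x. (norm (fundamental_solution z x))\<^sup>2 \<partial>\<mu>) \<ge> 0" by simp
  moreover have "(\<integral>x. (norm (fundamental_solution z x))\<^sup>2 \<partial>\<mu>) \<noteq> 0"
    using fundamental_solution_not_ae_zero L2_inner_self_zero[OF fundamental_solution_L2]
      L2_inner_self[OF fundamental_solution_L2] by (metis of_real_0)
  ultimately show ?thesis by linarith
qed

text \<open>The constant in \<open>u\<close> is orthogonal to \<open>f\<close>, and what remains is
  the integral of \<open>|Wint f|^2 / p\<close>.\<close>

lemma T_nonneg:
  assumes "(u, f) \<in> T"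
  shows "L2_inner \<mu> f u \<in> complex_of_real ` {0..}"
proof -
  have L: "u \<in> L2 \<mu>" "f \<in> L2 \<mu>" and f0: "Wint f b = 0" using assms by (auto simp: T_def)
  obtain c where c: "AE x in \<mu>. u x = c + K f x" using assms by (auto simp: T_def)
  have wf: "w_integrable f" by (rule L2_w_integrable[OF L(2)])
  have KL: "K f \<in> L2 \<mu>" by (rule K_L2[OF wf])
  let ?q = "\<lambda>t. (1 / p t) * (norm (Wint f t))\<^sup>2"
  have eq: "(1 / p t) *\<^sub>R (Wint f t * cnj (Wint f t)) = complex_of_real (?q t)" for t
    unfolding complex_norm_square[symmetric] by (simp add: scaleR_conv_of_real)
  have "L2_inner \<mu> f u = L2_inner \<mu> f (\<lambda>x. 1 * c + K f x)"
    using c L by (intro L2_inner_cong_ae L2_lin const_L2 KL) auto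
  also have "\<dots> = L2_inner \<mu> f (K f)"
    using L2_inner_lin_right[OF const_L2 KL L(2), of 1 c] L2_inner_const_right[OF L(2), of c] f0 by simp
  also have "\<dots> = integral {a..b} (\<lambda>t. complex_of_real (?q t))"
    unfolding integral_parts_K[OF L(2,2) f0] eq ..
  also have "\<dots> = complex_of_real (integral {a..b} ?q)"
  proof (rule integral_unique)
    have "(\<lambda>t. (1 / p t) *\<^sub>R (Wint f t * cnj (Wint f t))) absolutely_integrable_on {a..b}"
      by (intro absolutely_integrable_mult_continuous ip continuous_intros Wint_continuous wf)
    then have "(\<lambda>t. complex_of_real (?q t)) integrable_on {a..b}"
      unfolding eq by (rule set_lebesgue_integral_eq_integral(1))
    then have "(Re \<circ> (\<lambda>t. complex_of_real (?q t))) integrable_on {a..b}"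
      by (rule integrable_linear) (rule bounded_linear_Re)
    then have "?q integrable_on {a..b}" by (simp add: o_def)
    then have "(?q has_integral integral {a..b} ?q) {a..b}" by (rule integrable_integral)
    from has_integral_linear[OF this bounded_linear_of_real]
    show "((\<lambda>t. complex_of_real (?q t)) has_integral complex_of_real (integral {a..b} ?q)) {a..b}"
      by (simp only: o_def)
  qed
  finally have "L2_inner \<mu> f u = complex_of_real (integral {a..b} ?q)" .
  moreover have "integral {a..b} ?q \<ge> 0"
    using p_nonneg
    by (cases "?q integrable_on {a..b}") (auto intro!: Henstock_Kurzweil_Integration.integral_nonneg simp: not_integrable_integral)
  ultimately show ?thesis by auto
qed

text \<open>Rayleigh quotient: pairing the eigenvalue equation with the eigenfunction gives
  \<open>z\<close> times a positive number on one side and a nonnegative number on the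
  other.\<close>

lemma shooting_zero_real:
  assumes "shooting z = 0"
  shows "z \<in> complex_of_real ` {0..}"
proof -
  let ?\<phi> = "fundamental_solution z"
  let ?n = "\<integral>x. (norm (?\<phi> x))\<^sup>2 \<partial>\<mu>"
  have "L2_inner \<mu> (\<lambda>x. z * ?\<phi> x + 0) ?\<phi> = z * L2_inner \<mu> ?\<phi> ?\<phi> + L2_inner \<mu> (\<lambda>_. 0) ?\<phi>"
    by (intro L2_inner_lin_left fundamental_solution_L2 const_L2)
  then have "z * complex_of_real ?n \<in> complex_of_real ` {0..}"
    using T_nonneg[OF fundamental_solution_eigen[OF assms]]
    unfolding L2_inner_self[OF fundamental_solution_L2] by (simp add: L2_inner_def)
  then obtain r where r: "r \<ge> 0" "z * complex_of_real ?n = complex_of_real r" by auto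
  then have "z = complex_of_real (r / ?n)" using fundamental_solution_norm_pos[of z] by (simp add: field_simps)
  moreover have "r / ?n \<ge> 0" using r fundamental_solution_norm_pos[of z] by simp
  ultimately show ?thesis by blast
qed

lemma T_spectrum_nonneg: "L2_spectrum \<mu> T \<subseteq> complex_of_real ` {0..}"
  using spectrum_shooting_zero shooting_zero_real by blast

text \<open>Symmetry makes \<open>z\<close> and \<open>cnj l\<close> act alike on the inner product,
  and \<open>l\<close> is real by \<open>shooting_zero_real\<close>.\<close>

lemma eigen_orthogonal:
  assumes "shooting z = 0" "shooting l = 0" "z \<noteq> l"
  shows "L2_inner \<mu> (fundamental_solution z) (fundamental_solution l) = 0"
proof -
  let ?z = "fundamental_solution z" and ?l = "fundamental_solution l"
  have "L2_inner \<mu> (\<lambda>x. z * ?z x + 0) ?l = z * L2_inner \<mu> ?z ?l + L2_inner \<mu> (\<lambda>_. 0) ?l"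
    by (intro L2_inner_lin_left fundamental_solution_L2 const_L2)
  moreover have "L2_inner \<mu> ?z (\<lambda>x. l * ?l x + 0) = cnj l * L2_inner \<mu> ?z ?l + L2_inner \<mu> ?z (\<lambda>_. 0)"
    by (intro L2_inner_lin_right fundamental_solution_L2 const_L2)
  ultimately have "z * L2_inner \<mu> ?z ?l = cnj l * L2_inner \<mu> ?z ?l"
    using T_symmetric[OF fundamental_solution_eigen[OF assms(1)] fundamental_solution_eigen[OF assms(2)]]
    by (simp add: L2_inner_def)
  moreover have "cnj l = l" using shooting_zero_real[OF assms(2)] by auto
  ultimately show ?thesis using assms(3) by simp
qed

text \<open>The difference solves the Volterra equation at parameter \<open>l\<close> with
  inhomogeneity \<open>(z - l) K\<close> applied to the solution at \<open>z\<close>, and so is of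
  order \<open>|z - l|\<close>. Staying in the unit disc around \<open>l\<close> makes the bound on
  the solution at \<open>z\<close> uniform.\<close>

lemma fundamental_solution_diff_bound:
  assumes x: "x \<in> {a..b}" and "norm (z - l) \<le> 1"
  shows "norm (fundamental_solution z x - fundamental_solution l x)
    \<le> norm (z - l) * (exp ((norm l + 1) * Wtot * Pint b) * Wtot * Pint b * growth l)"
proof -
  let ?z = "fundamental_solution z" and ?l = "fundamental_solution l"
  let ?E = "exp ((norm l + 1) * Wtot * Pint b)"
  note fz = fundamental_solution[where z = z] and fl = fundamental_solution[where z = l]
  have wz: "w_integrable ?z" and wl: "w_integrable ?l" by (rule fundamental_solution_w_integrable)+
  have P: "Pint b \<ge> 0" using Pint_nonneg[of b] ab by simp
  have "norm z \<le> norm l + 1"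
    using assms(2) norm_triangle_ineq2[of z l] by linarith
  then have E: "growth z \<le> ?E"
    unfolding growth_def using P Wtot_pos by (auto intro!: mult_right_mono)
  define d where "d x = (-1) * ?l x + ?z x" for x
  define h where "h x = (z - l) * K ?z x" for x
  have dc: "continuous_on {a..b} d" unfolding d_def by (intro continuous_intros fz fl)
  have hc: "continuous_on {a..b} h" unfolding h_def by (intro continuous_intros K_continuous wz)
  have "norm (d x) \<le> (norm (z - l) * (?E * Wtot * Pint b)) * growth l"
  proof (rule volterra_bound[OF dc hc _ _ x])
    fix y assume y: "y \<in> {a..b}"
    have Kd: "K d y = (-1) * K ?l y + K ?z y"
      unfolding d_def using y by (intro K_lin wz wl) auto
    show "d y = h y + l * K d y"
      unfolding Kd unfolding h_def d_def using fz(2)[OF y] fl(2)[OF y] by (simp add: algebra_simps)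
    have "norm (K ?z y) \<le> growth z * Wtot * Pint b"
      by (rule norm_K_le_sup[OF wz fz(3) y])
    also have "\<dots> \<le> ?E * Wtot * Pint b"
      using E P Wtot_pos by (intro mult_right_mono) auto
    finally show "norm (h y) \<le> norm (z - l) * (?E * Wtot * Pint b)"
      unfolding h_def norm_mult by (intro mult_left_mono) auto
  qed
  then show ?thesis by (simp add: d_def mult.assoc)
qed

text \<open>Distinct eigenvalues have orthogonal eigenfunctions, but nearby parameters have nearly equal
  fundamental solutions, so eigenvalues cannot accumulate.\<close>

lemma eigenvalues_isolated:
  assumes l: "shooting l = 0"
  obtains r where "r > 0" "\<And>z. \<lbrakk>shooting z = 0; norm (z - l) < r\<rbrakk> \<Longrightarrow> z = l"
proof -
  let ?l = "fundamental_solution l"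
  define N where "N = (\<integral>x. (norm (?l x))\<^sup>2 \<partial>\<mu>)"
  have N: "N > 0" unfolding N_def by (rule fundamental_solution_norm_pos)
  \<comment> \<open>\<open>B\<close> is the Lipschitz constant of
    \<open>fundamental_solution_diff_bound\<close>, and \<open>A\<close> bounds the pairing of the
    difference with the solution at \<open>l\<close> per unit of \<open>|z - l|\<close>.
    Orthogonality makes this pairing equal to \<open>- N\<close>, so every other zero has distance
    at least \<open>min 1 (N / (A + 1))\<close> from \<open>l\<close>.\<close>
  define B where "B = exp ((norm l + 1) * Wtot * Pint b) * Wtot * Pint b * growth l"
  define A where "A = B * growth l * Wtot"
  have "B \<ge> 0" unfolding B_def growth_def using Pint_nonneg[of b] ab Wtot_pos by simp
  then have A0: "A \<ge> 0" unfolding A_def growth_def using Wtot_pos by simp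
  show thesis
  proof (rule that[of "min 1 (N / (A + 1))"])
    show "min 1 (N / (A + 1)) > 0" using N A0 by simp
    fix z assume z: "shooting z = 0" and close: "norm (z - l) < min 1 (N / (A + 1))"
    show "z = l"
    proof (rule ccontr)
      assume "z \<noteq> l"
      let ?z = "fundamental_solution z"
      have dL: "(\<lambda>x. ?z x - ?l x) \<in> L2 \<mu>" by (intro L2_diff fundamental_solution_L2)
      have "L2_inner \<mu> (\<lambda>x. 1 * (?z x - ?l x) + ?l x) ?l
          = 1 * L2_inner \<mu> (\<lambda>x. ?z x - ?l x) ?l + L2_inner \<mu> ?l ?l"
        by (intro L2_inner_lin_left dL fundamental_solution_L2)
      then have "L2_inner \<mu> (\<lambda>x. ?z x - ?l x) ?l = - complex_of_real N"
        using eigen_orthogonal[OF z l \<open>z \<noteq> l\<close>] L2_inner_self[OF fundamental_solution_L2, of l]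
        by (simp add: N_def eq_neg_iff_add_eq_0)
      then have "N = norm (L2_inner \<mu> (\<lambda>x. ?z x - ?l x) ?l)" using N by simp
      also have "\<dots> = norm (Wint (\<lambda>x. (?z x - ?l x) * cnj (?l x)) b)"
        by (simp only: L2_inner_eq_Wint[OF dL fundamental_solution_L2])
      also have "\<dots> \<le> (norm (z - l) * B * growth l) * Wtot"
      proof (rule norm_Wint_le_bound)
        show "w_integrable (\<lambda>x. (?z x - ?l x) * cnj (?l x))"
          by (rule L2_inner_mult_w_integrable[OF dL fundamental_solution_L2])
        show "b \<in> {a..b}" using ab by simp
        fix t assume t: "t \<in> {a..b}"
        have "norm (?z t - ?l t) \<le> norm (z - l) * B"
          unfolding B_def using close by (intro fundamental_solution_diff_bound t) auto
        then show "norm ((?z t - ?l t) * cnj (?l t)) \<le> norm (z - l) * B * growth l"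
          unfolding norm_mult complex_mod_cnj using fundamental_solution(3)[OF t, of l] \<open>B \<ge> 0\<close>
          by (intro mult_mono) auto
      qed
      also have "\<dots> = norm (z - l) * A" by (simp add: A_def)
      also have "\<dots> \<le> norm (z - l) * (A + 1)" by (intro mult_left_mono) auto
      also have "\<dots> < N" using close A0 by (simp add: less_divide_eq)
      finally show False by simp
    qed
  qed
qed

text \<open>Eigenspaces are one-dimensional: for an eigenpair \<open>f - z u\<close> vanishes almost
  everywhere, so the \<psi> of the decomposition is zero and \<open>u\<close> is a multiple of the
  fundamental solution.\<close>

lemma T_discrete_spectrum: "discrete_spectrum \<mu> T"
  unfolding discrete_spectrum_def
proof (intro ballI conjI)
  fix z assume zs: "z \<in> L2_spectrum \<mu> T"
  then have z: "shooting z = 0" by (rule spectrum_shooting_zero)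
  let ?\<phi> = "fundamental_solution z"
  obtain r where r: "r > 0" "\<And>y. \<lbrakk>shooting y = 0; norm (y - z) < r\<rbrakk> \<Longrightarrow> y = z"
    using eigenvalues_isolated[OF z] by blast
  have "ball z r \<inter> L2_spectrum \<mu> T = {z}"
    using r zs spectrum_shooting_zero by (auto simp: dist_norm norm_minus_commute)
  then show "z isolated_in L2_spectrum \<mu> T"
    unfolding isolated_in_def using zs open_ball by blast
  have ef: "?\<phi> \<in> L2_eigenspace \<mu> T z"
    unfolding L2_eigenspace_def using fundamental_solution_eigen[OF z] by auto
  then show "\<exists>u\<in>L2_eigenspace \<mu> T z. \<not> (AE x in \<mu>. u x = 0)"
    using fundamental_solution_not_ae_zero by blast
  show "\<exists>B. finite B \<and> B \<subseteq> L2_eigenspace \<mu> T z \<and>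
        (\<forall>u\<in>L2_eigenspace \<mu> T z. \<exists>c. AE x in \<mu>. u x = (\<Sum>b\<in>B. c b * b x))"
  proof (intro exI[of _ "{?\<phi>}"] conjI ballI)
    fix u assume "u \<in> L2_eigenspace \<mu> T z"
    then obtain f where uf: "(u, f) \<in> T" and eq: "AE x in \<mu>. f x = z * u x"
      by (auto simp: L2_eigenspace_def)
    obtain c \<psi> where \<psi>: "continuous_on {a..b} \<psi>"
        "\<And>x. x \<in> {a..b} \<Longrightarrow> norm (\<psi> x) \<le> wnorm1 (\<lambda>x. f x - z * u x) * Pint b * growth z"
      and u: "AE x in \<mu>. u x = c * ?\<phi> x + \<psi> x"
      by (rule solution_decomposition[OF uf, where z = z]) (rule that, assumption+)
    have "(\<lambda>x. f x - z * u x) \<in> L2 \<mu>" using uf L2_lin[of u f "-z"] by (auto simp: T_def)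
    moreover have "AE x in \<mu>. f x - z * u x = 0" using eq by eventually_elim simp
    ultimately have "wnorm1 (\<lambda>x. f x - z * u x) = 0" by (intro wnorm1_zero_ae L2_w_integrable)
    then have "\<psi> x = 0" if "x \<in> {a..b}" for x using \<psi>(2)[OF that] by simp
    then have "AE x in \<mu>. \<psi> x = 0" by (intro AE_I2) auto
    with u have "AE x in \<mu>. u x = (\<Sum>b\<in>{?\<phi>}. c * b x)" by eventually_elim simp
    then show "\<exists>c. AE x in \<mu>. u x = (\<Sum>b\<in>{?\<phi>}. c b * b x)" by (intro exI[of _ "\<lambda>_. c"])
  qed (use ef in auto)
qed

lemma T_kernel: "L2_kernel \<mu> T = {u \<in> borel_measurable \<mu>. \<exists>c. AE x in \<mu>. u x = c}"
proof (intro equalityI subsetI)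
  fix u assume "u \<in> L2_kernel \<mu> T"
  then obtain f where uf: "(u, f) \<in> T" and f: "AE x in \<mu>. f x = 0" by auto
  obtain c where c: "AE x in \<mu>. u x = c + K f x" using uf by (auto simp: T_def)
  have neg: "negligible {t \<in> {a<..<b}. f t \<noteq> 0}" using f by (simp add: AE_mu_iff)
  have "K f x = 0" if "x \<in> {a..b}" for x
    using K_cong_ae[OF neg, of x] that by (simp add: K_def Wint_def)
  then have "AE x in \<mu>. K f x = 0" by (intro AE_I2) auto
  with c have "AE x in \<mu>. u x = c" by eventually_elim simp
  then show "u \<in> {u \<in> borel_measurable \<mu>. \<exists>c. AE x in \<mu>. u x = c}"
    using uf by (auto simp: T_def intro: L2_measurable)
next
  fix u :: "real \<Rightarrow> complex" assume "u \<in> {u \<in> borel_measurable \<mu>. \<exists>c. AE x in \<mu>. u x = c}"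
  then obtain c where u: "u \<in> borel_measurable \<mu>" and c: "AE x in \<mu>. u x = c" by auto
  have [measurable]: "u \<in> borel_measurable \<mu>" by (rule u)
  have "u \<in> L2 \<mu>"
  proof (rule L2_I[OF u])
    have "integrable \<mu> (\<lambda>_. (norm c)\<^sup>2)" by simp
    then show "integrable \<mu> (\<lambda>x. (norm (u x))\<^sup>2)"
      by (rule integrable_cong_AE_imp) (use c in \<open>auto elim: eventually_mono\<close>)
  qed
  moreover have "AE x in \<mu>. u x = c + K (\<lambda>_. 0) x" using c by (simp add: K_def Wint_def)
  ultimately have "(u, \<lambda>_. 0) \<in> T" unfolding T_def using const_L2[of 0] by (auto simp: Wint_const)
  then show "u \<in> L2_kernel \<mu> T" by auto
qed

subsection \<open>Density of the domain\<close>

text \<open>Approximation is measured by the squared norm, for which \<open>(s + t)^2\<close> \<le>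
  \<open>2 s^2 + 2 t^2\<close> takes the place of the triangle inequality.\<close>

definition sqnorm :: "(real \<Rightarrow> complex) \<Rightarrow> real" where
  "sqnorm f = (\<integral>x. (norm (f x))\<^sup>2 \<partial>\<mu>)"

definition T_closure :: "(real \<Rightarrow> complex) set" where
  "T_closure = {f \<in> L2 \<mu>. \<forall>e>0. \<exists>u\<in>Domain T. sqnorm (\<lambda>x. f x - u x) < e}"

lemma sqnorm_nonneg: "sqnorm f \<ge> 0"
  by (simp add: sqnorm_def)

lemma sqnorm_mult: "sqnorm (\<lambda>x. c * f x) = (norm c)\<^sup>2 * sqnorm f"
  by (simp add: sqnorm_def norm_mult power_mult_distrib)

lemma sqnorm_add_le:
  assumes f: "f \<in> L2 \<mu>" and h: "h \<in> L2 \<mu>"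
  shows "sqnorm (\<lambda>x. f x + h x) \<le> 2 * sqnorm f + 2 * sqnorm h"
proof -
  have "(\<lambda>x. 1 * f x + h x) \<in> L2 \<mu>" by (rule L2_lin[OF f h])
  then have i: "integrable \<mu> (\<lambda>x. (norm (f x + h x))\<^sup>2)" using L2_square_integrable by fastforce
  have "sqnorm (\<lambda>x. f x + h x) \<le> (\<integral>x. 2 * (norm (f x))\<^sup>2 + 2 * (norm (h x))\<^sup>2 \<partial>\<mu>)"
    unfolding sqnorm_def
  proof (rule integral_mono[OF i])
    show "integrable \<mu> (\<lambda>x. 2 * (norm (f x))\<^sup>2 + 2 * (norm (h x))\<^sup>2)"
      using L2_square_integrable[OF f] L2_square_integrable[OF h] by auto
    fix x
    have "(norm (f x + h x))\<^sup>2 \<le> (norm (f x) + norm (h x))\<^sup>2"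
      by (intro power_mono norm_triangle_ineq) auto
    also have "\<dots> \<le> 2 * (norm (f x))\<^sup>2 + 2 * (norm (h x))\<^sup>2"
      using sum_squares_bound[of "norm (f x)" "norm (h x)"] by (simp add: power2_sum)
    finally show "(norm (f x + h x))\<^sup>2 \<le> 2 * (norm (f x))\<^sup>2 + 2 * (norm (h x))\<^sup>2" .
  qed
  also have "\<dots> = 2 * sqnorm f + 2 * sqnorm h"
    unfolding sqnorm_def using L2_square_integrable[OF f] L2_square_integrable[OF h] by simp
  finally show ?thesis .
qed

lemma T_cong_ae:
  assumes "(u, f) \<in> T" "AE x in \<mu>. u x = v x" "AE x in \<mu>. f x = h x" "v \<in> L2 \<mu>" "h \<in> L2 \<mu>"
  shows "(v, h) \<in> T"
  using T_operator assms unfolding L2_operator_def by blast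

lemma Domain_T_L2: "u \<in> Domain T \<Longrightarrow> u \<in> L2 \<mu>"
  by (auto simp: T_def)

lemma Domain_T_lin:
  assumes "u \<in> Domain T" "v \<in> Domain T"
  shows "(\<lambda>x. c * u x + v x) \<in> Domain T"
  using assms T_operator unfolding L2_operator_def by blast

lemma Domain_T_subset_closure: "Domain T \<subseteq> T_closure"
proof
  fix u assume u: "u \<in> Domain T"
  have "sqnorm (\<lambda>x. u x - u x) = 0" by (simp add: sqnorm_def)
  then show "u \<in> T_closure" unfolding T_closure_def using u Domain_T_L2 by force
qed

lemma T_closureD: "f \<in> T_closure \<Longrightarrow> e > 0 \<Longrightarrow> \<exists>u\<in>Domain T. sqnorm (\<lambda>x. f x - u x) < e"
  unfolding T_closure_def by blast

lemma T_closure_lin: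
  assumes "f \<in> T_closure" "h \<in> T_closure"
  shows "(\<lambda>x. c * f x + h x) \<in> T_closure"
  unfolding T_closure_def
proof (intro CollectI conjI allI impI)
  have f: "f \<in> L2 \<mu>" and h: "h \<in> L2 \<mu>" using assms by (auto simp: T_closure_def)
  show "(\<lambda>x. c * f x + h x) \<in> L2 \<mu>" by (rule L2_lin[OF f h])
  fix e :: real assume "e > 0"
  define C where "C = (norm c)\<^sup>2 + 1"
  have "C > 0" by (simp add: C_def add_nonneg_pos)
  have pos: "e / (4 * C) > 0" "e / 4 > 0" using \<open>e > 0\<close> \<open>C > 0\<close> by auto
  obtain u where u: "u \<in> Domain T" "sqnorm (\<lambda>x. f x - u x) < e / (4 * C)"
    using T_closureD[OF assms(1) pos(1)] by blast
  obtain v where v: "v \<in> Domain T" "sqnorm (\<lambda>x. h x - v x) < e / 4"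
    using T_closureD[OF assms(2) pos(2)] by blast
  have fu: "(\<lambda>x. f x - u x) \<in> L2 \<mu>" and hv: "(\<lambda>x. h x - v x) \<in> L2 \<mu>"
    using f h u v by (auto intro: L2_diff Domain_T_L2)
  have cfu: "(\<lambda>x. c * (f x - u x)) \<in> L2 \<mu>" using L2_lin[OF fu const_L2[of 0], of c] by simp
  have "sqnorm (\<lambda>x. (c * f x + h x) - (c * u x + v x)) = sqnorm (\<lambda>x. c * (f x - u x) + (h x - v x))"
    by (simp add: algebra_simps)
  also have "\<dots> \<le> 2 * sqnorm (\<lambda>x. c * (f x - u x)) + 2 * sqnorm (\<lambda>x. h x - v x)"
    by (rule sqnorm_add_le[OF cfu hv])
  also have "\<dots> = 2 * ((norm c)\<^sup>2 * sqnorm (\<lambda>x. f x - u x)) + 2 * sqnorm (\<lambda>x. h x - v x)"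
    by (simp add: sqnorm_mult)
  also have "(norm c)\<^sup>2 * sqnorm (\<lambda>x. f x - u x) \<le> C * (e / (4 * C))"
    using u(2) \<open>C > 0\<close> sqnorm_nonneg by (intro mult_mono) (auto simp: C_def)
  also have "C * (e / (4 * C)) = e / 4" using \<open>C > 0\<close> by simp
  finally have "sqnorm (\<lambda>x. (c * f x + h x) - (c * u x + v x)) < e" using v(2) by linarith
  then show "\<exists>u\<in>Domain T. sqnorm (\<lambda>x. (c * f x + h x) - u x) < e"
    using Domain_T_lin[OF u(1) v(1), of c] by (intro bexI[of _ "\<lambda>x. c * u x + v x"])
qed

lemma T_closure_closed:
  assumes f: "f \<in> L2 \<mu>" and approx: "\<And>e. e > 0 \<Longrightarrow> \<exists>h\<in>T_closure. sqnorm (\<lambda>x. f x - h x) < e"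
  shows "f \<in> T_closure"
  unfolding T_closure_def
proof (intro CollectI conjI f allI impI)
  fix e :: real assume "e > 0"
  obtain h where h: "h \<in> T_closure" "sqnorm (\<lambda>x. f x - h x) < e/4" using approx[of "e/4"] \<open>e > 0\<close> by auto
  have "e / 4 > 0" using \<open>e > 0\<close> by simp
  then obtain u where u: "u \<in> Domain T" "sqnorm (\<lambda>x. h x - u x) < e / 4"
    using T_closureD[OF h(1)] by blast
  have hL: "h \<in> L2 \<mu>" using h by (auto simp: T_closure_def)
  have "sqnorm (\<lambda>x. (f x - h x) + (h x - u x)) \<le> 2 * sqnorm (\<lambda>x. f x - h x) + 2 * sqnorm (\<lambda>x. h x - u x)"
    by (intro sqnorm_add_le L2_diff f hL Domain_T_L2 u)
  then have "sqnorm (\<lambda>x. f x - u x) < e" using h(2) u(2) by simp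
  then show "\<exists>u\<in>Domain T. sqnorm (\<lambda>x. f x - u x) < e" using u(1) by blast
qed

lemma T_closure_LIMSEQ:
  assumes f: "f \<in> L2 \<mu>" and h: "\<And>n::nat. h n \<in> T_closure" and lim: "(\<lambda>n. sqnorm (\<lambda>x. f x - h n x)) \<longlonglongrightarrow> 0"
  shows "f \<in> T_closure"
proof (rule T_closure_closed[OF f])
  fix e :: real assume "e > 0"
  then have "\<forall>\<^sub>F n in sequentially. sqnorm (\<lambda>x. f x - h n x) < e" using lim by (intro order_tendstoD(2))
  then obtain n where "sqnorm (\<lambda>x. f x - h n x) < e" by (auto simp: eventually_sequentially)
  then show "\<exists>h\<in>T_closure. sqnorm (\<lambda>x. f x - h x) < e" using h by blast
qed

lemma T_closure_cong_ae:
  assumes "h \<in> T_closure" "f \<in> borel_measurable \<mu>" "AE x in \<mu>. f x = h x"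
  shows "f \<in> T_closure"
proof (rule T_closure_closed)
  have hL: "h \<in> L2 \<mu>" using assms(1) by (simp add: T_closure_def)
  have [measurable]: "f \<in> borel_measurable \<mu>" by fact
  have [measurable]: "h \<in> borel_measurable \<mu>" using hL by (rule L2_measurable)
  show "f \<in> L2 \<mu>"
  proof (rule L2_I)
    show "integrable \<mu> (\<lambda>x. (norm (f x))\<^sup>2)"
      using L2_square_integrable[OF hL]
      by (rule integrable_cong_AE_imp) (use assms(3) in \<open>auto elim: eventually_mono\<close>)
  qed (rule assms)
  fix e :: real assume "e > 0"
  have "sqnorm (\<lambda>x. f x - h x) = (\<integral>x. 0 \<partial>\<mu>)"
    unfolding sqnorm_def by (rule integral_cong_AE) (use assms(3) in \<open>auto elim: eventually_mono\<close>)
  then show "\<exists>h\<in>T_closure. sqnorm (\<lambda>x. f x - h x) < e" using assms(1) \<open>e > 0\<close> by (intro bexI[of _ h]) auto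
qed

text \<open>On \<open>{a..b}\<close> this is the distribution function of \<mu>; its continuity
  decides how short a ramp must be.\<close>

definition Wcum :: "real \<Rightarrow> real" where
  "Wcum x = integral {a..x} w"

lemma Wcum_continuous: "continuous_on {a..b} Wcum"
  unfolding Wcum_def by (rule indefinite_integral_continuous_1) (simp add: w_integrable_real)

lemma Wcum_deriv: "x \<in> {a<..<b} \<Longrightarrow> (Wcum has_real_derivative w x) (at x)"
  unfolding Wcum_def has_real_derivative_iff_has_vector_derivative
  by (rule has_vector_derivative_indefinite_integral_open[OF iw w_cont])

lemma Wcum_strict_mono:
  assumes "a \<le> x" "x < y" "y \<le> b"
  shows "Wcum x < Wcum y"
proof (rule DERIV_pos_imp_increasing_open[where f = Wcum and a = x and b = y])
  show "\<exists>D. DERIV Wcum t :> D \<and> D > 0" if "x < t" "t < y" for t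
    using Wcum_deriv[of t] w_pos[of t] that assms by (intro exI[of _ "w t"]) auto
  show "continuous_on {x..y} Wcum" using Wcum_continuous by (rule continuous_on_subset) (use assms in auto)
qed (use assms in auto)

lemma Wcum_mono: "a \<le> x \<Longrightarrow> x \<le> y \<Longrightarrow> y \<le> b \<Longrightarrow> Wcum x \<le> Wcum y"
  using Wcum_strict_mono[of x y] by (cases "x = y") auto

lemma indicator_measurable_mu:
  "s \<in> sets lebesgue \<Longrightarrow> (indicator s :: real \<Rightarrow> 'b::real_normed_algebra_1) \<in> borel_measurable \<mu>"
  unfolding measurable_mu by (intro measurable_restrict_space1 borel_measurable_indicator)

lemma indicator_L2: "s \<in> sets lebesgue \<Longrightarrow> (indicator s :: real \<Rightarrow> complex) \<in> L2 \<mu>"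
  by (rule L2_bounded[of _ 1]) (auto intro: indicator_measurable_mu simp: indicator_def)

lemma Wint_indicator:
  assumes "x \<in> {a..b}" "s \<ge> a"
  shows "Wint (indicator {..s}) x = complex_of_real (Wcum (min x s))"
proof -
  have i: "w integrable_on {a..min x s}" by (rule w_integrable_real) (use assms in auto)
  have "((\<lambda>t. if t \<in> {a..min x s} then complex_of_real (w t) else 0) has_integral complex_of_real (Wcum (min x s))) {a..x}"
  proof (rule has_integral_restrict[THEN iffD2])
    show "{a..min x s} \<subseteq> {a..x}" by auto
    show "((\<lambda>t. complex_of_real (w t)) has_integral complex_of_real (Wcum (min x s))) {a..min x s}"
      unfolding Wcum_def using has_integral_linear[OF integrable_integral[OF i] bounded_linear_of_real] by (simp only: o_def)
  qed
  then have "((\<lambda>t. w t *\<^sub>R indicator {..s} t) has_integral complex_of_real (Wcum (min x s))) {a..x}"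
    by (rule has_integral_eq[rotated]) (auto simp: scaleR_conv_of_real)
  then show ?thesis unfolding Wint_def by (rule integral_unique)
qed

text \<open>A domain element that equals 1 left of \<open>c\<close>, 0 right of \<open>d\<close>, and is monotone in between:
  its quasi-derivative is a tent with vertex \<open>m\<close>.\<close>

lemma ramp_in_domain:
  assumes "a < c" "c < d" "d < b"
  obtains u where "(\<lambda>x. complex_of_real (u x)) \<in> Domain T"
    "\<And>x. x \<in> {a..c} \<Longrightarrow> u x = 1" "\<And>x. x \<in> {d..b} \<Longrightarrow> u x = 0" "\<And>x. x \<in> {a..b} \<Longrightarrow> u x \<in> {0..1}"
proof -
  define m where "m = (c + d) / 2"
  have m: "c < m" "m < d" using assms by (auto simp: m_def)
  define A B where "A = Wcum m - Wcum c" and "B = Wcum d - Wcum m"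
  have AB: "A > 0" "B > 0" using Wcum_strict_mono m assms by (auto simp: A_def B_def)
  define F where "F x = (Wcum (min x m) - Wcum (min x c)) / A - (Wcum (min x d) - Wcum (min x m)) / B" for x
  let ?I = "\<lambda>s. indicator {..s} :: real \<Rightarrow> complex"
  \<comment> \<open>\<open>h\<close> is \<open>1/A\<close> on \<open>{c<..m}\<close>,
    \<open>-1/B\<close> on \<open>{m<..d}\<close> and 0 elsewhere. The masses \<open>A\<close> and
    \<open>B\<close> of the two pieces normalise the tent \<open>F = Wint h\<close> to height 1 at
    \<open>m\<close> and bring it back to 0 at \<open>d\<close>.\<close>
  define h where "h x = complex_of_real (1/A) * ((-1) * ?I c x + ?I m x) + (complex_of_real (-(1/B)) * ((-1) * ?I m x + ?I d x) + 0)" for x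
  have IL: "?I s \<in> L2 \<mu>" for s by (rule indicator_L2) auto
  have Iw: "w_integrable (?I s)" for s by (rule L2_w_integrable[OF IL])
  have w0: "w_integrable (\<lambda>_. 0)" by (intro w_integrable_continuous continuous_intros)
  have hL: "h \<in> L2 \<mu>" unfolding h_def by (intro L2_lin IL const_L2)
  have hw: "w_integrable h" by (rule L2_w_integrable[OF hL])
  have Wh: "Wint h x = complex_of_real (F x)" if "x \<in> {a..b}" for x
  proof -
    have "Wint h x = complex_of_real (1/A) * ((-1) * Wint (?I c) x + Wint (?I m) x)
        + (complex_of_real (-(1/B)) * ((-1) * Wint (?I m) x + Wint (?I d) x) + Wint (\<lambda>_. 0) x)"
      unfolding h_def using that by (simp only: Wint_lin Iw w_integrable_lin w0 atLeastAtMost_iff)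
    also have "\<dots> = complex_of_real (F x)"
      using that assms m by (simp add: Wint_indicator F_def) (simp add: Wint_def field_simps)
    finally show ?thesis .
  qed
  have F_left: "F x = 0" if "x \<le> c" for x using that m assms by (simp add: F_def min_def)
  have F_right: "F x = 0" if "d \<le> x" for x using that m assms AB by (simp add: F_def min_def A_def B_def)
  have F_m: "F m = 1" using m AB by (simp add: F_def min_def A_def)
  have F_nonneg: "F x \<ge> 0" if x: "x \<in> {a..b}" for x
  proof -
    consider "x \<le> c" | "c \<le> x" "x \<le> m" | "m \<le> x" "x \<le> d" | "d \<le> x" by linarith
    then show ?thesis
    proof cases
      case 2
      then have "F x = (Wcum x - Wcum c) / A" using m by (simp add: F_def min_def)
      then show ?thesis using Wcum_mono[of c x] 2 assms x AB by simp
    next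
      case 3
      then have "F x = 1 - (Wcum x - Wcum m) / B" using m AB by (simp add: F_def min_def A_def)
      moreover have "Wcum x - Wcum m \<le> B" unfolding B_def using Wcum_mono[of x d] 3 assms x by simp
      ultimately show ?thesis using AB by simp
    qed (auto simp: F_left F_right)
  qed
  define k where "k x = integral {a..x} (\<lambda>t. F t / p t)" for x
  have Fp: "(\<lambda>t. F t / p t) integrable_on {a..b}"
  proof -
    have "(Re \<circ> (\<lambda>t. (1 / p t) *\<^sub>R Wint h t)) integrable_on {a..b}"
      by (intro integrable_linear K_integrand_integrable_on hw bounded_linear_Re) auto
    then show ?thesis by (rule integrable_eq) (auto simp: Wh)
  qed
  have Fp': "(\<lambda>t. F t / p t) integrable_on {x..y}" if "a \<le> x" "y \<le> b" for x y
    by (rule integrable_on_subinterval[OF Fp]) (use that in auto)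
  have Kh: "K h x = - complex_of_real (k x)" if x: "x \<in> {a..b}" for x
  proof -
    have "(\<lambda>t. F t / p t) integrable_on {a..x}" by (rule Fp') (use x in auto)
    from has_integral_linear[OF integrable_integral[OF this] bounded_linear_of_real]
    have "((\<lambda>t. complex_of_real (F t / p t)) has_integral complex_of_real (k x)) {a..x}"
      unfolding k_def by (simp only: o_def)
    then have "((\<lambda>t. (1 / p t) *\<^sub>R Wint h t) has_integral complex_of_real (k x)) {a..x}"
      by (rule has_integral_eq[rotated]) (use x in \<open>auto simp: Wh scaleR_conv_of_real\<close>)
    then show ?thesis unfolding K_def by (simp add: integral_unique)
  qed
  have Fp_nonneg: "F t / p t \<ge> 0" if "t \<in> {a..b}" for t using F_nonneg[OF that] p_nonneg[OF that] by simp
  have k_mono: "k x \<le> k y" if "a \<le> x" "x \<le> y" "y \<le> b" for x y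
    unfolding k_def using that Fp_nonneg by (intro integral_subset_le Fp') auto
  have k_left: "k x = 0" if "x \<in> {a..c}" for x
  proof -
    have "k x = integral {a..x} (\<lambda>t. 0)" unfolding k_def
      by (rule Henstock_Kurzweil_Integration.integral_cong) (use that F_left in auto)
    then show ?thesis by simp
  qed
  have k_right: "k x = k d" if "x \<in> {d..b}" for x
  proof -
    have "integral {d..x} (\<lambda>t. F t / p t) = integral {d..x} (\<lambda>t. 0)"
      by (rule Henstock_Kurzweil_Integration.integral_cong) (use that F_right in auto)
    moreover have "integral {a..d} (\<lambda>t. F t / p t) + integral {d..x} (\<lambda>t. F t / p t) = k x"
      unfolding k_def using that assms by (intro Henstock_Kurzweil_Integration.integral_combine Fp') auto
    ultimately show ?thesis by (simp add: k_def)
  qed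
  \<comment> \<open>If the total rise were zero, the monotone \<open>k\<close> and with it
    \<open>K h\<close> would vanish, contradicting the nonzero slope at the vertex
    \<open>m\<close>.\<close>
  have "k d \<noteq> 0"
  proof
    assume "k d = 0"
    then have k0: "k x = 0" if "x \<in> {a..b}" for x
      using k_mono[of a x] k_mono[of x b] k_left[of a] k_right[of b] that assms ab by auto
    have "m \<in> {a<..<b}" using m assms by auto
    then have "(K h has_vector_derivative - ((1 / p m) *\<^sub>R Wint h m)) (at m)" by (rule K_deriv[OF hw])
    then have "((\<lambda>_. 0) has_vector_derivative - ((1 / p m) *\<^sub>R Wint h m)) (at m)"
      by (rule has_vector_derivative_transform_within_open[of _ _ _ "{a<..<b}"])
        (use \<open>m \<in> {a<..<b}\<close> in \<open>auto simp: Kh k0\<close>)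
    then have "- ((1 / p m) *\<^sub>R Wint h m) = 0"
      using vector_derivative_unique_at has_vector_derivative_const by blast
    then show False using Wh[of m] F_m p_pos[OF \<open>m \<in> {a<..<b}\<close>] \<open>m \<in> {a<..<b}\<close> by simp
  qed
  moreover have "k d \<ge> 0" using k_mono[of a d] k_left[of a] assms by auto
  ultimately have kd: "k d > 0" by simp
  define u where "u x = 1 - k x / k d" for x
  have "((\<lambda>x. 0 + K h x), h) \<in> T"
    by (rule T_I[OF hL _ const_K_L2[OF hw]]) (use Wh[of b] F_right[of b] ab assms in auto)
  then have "K h \<in> Domain T" by auto
  moreover have "(\<lambda>_. 1) \<in> Domain T" using T_zero_in(1) by blast
  ultimately have "(\<lambda>x. complex_of_real (1 / k d) * K h x + 1) \<in> Domain T" by (rule Domain_T_lin)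
  moreover have "(\<lambda>x. complex_of_real (u x)) \<in> Domain T"
    if dom: "(\<lambda>x. complex_of_real (1 / k d) * K h x + 1) \<in> Domain T"
  proof -
    obtain f where f: "((\<lambda>x. complex_of_real (1 / k d) * K h x + 1), f) \<in> T" using dom by blast
    have ae: "AE x in \<mu>. complex_of_real (1 / k d) * K h x + 1 = complex_of_real (u x)"
      by (rule AE_I2) (auto simp: Kh u_def)
    have uL: "(\<lambda>x. complex_of_real (u x)) \<in> L2 \<mu>"
    proof (rule L2_continuous)
      have "continuous_on {a..b} (\<lambda>x. complex_of_real (1 / k d) * K h x + 1)"
        by (intro continuous_intros K_continuous hw)
      then show "continuous_on {a..b} (\<lambda>x. complex_of_real (u x))"
        by (rule continuous_on_eq) (auto simp: Kh u_def)
    qed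
    have "((\<lambda>x. complex_of_real (u x)), f) \<in> T"
      by (rule T_cong_ae[OF f ae _ uL]) (use f in \<open>auto simp: T_def\<close>)
    then show ?thesis by blast
  qed
  ultimately have "(\<lambda>x. complex_of_real (u x)) \<in> Domain T" by blast
  moreover have "u x = 1" if "x \<in> {a..c}" for x using k_left[OF that] by (simp add: u_def)
  moreover have "u x = 0" if "x \<in> {d..b}" for x using k_right[OF that] kd by (simp add: u_def)
  moreover have "u x \<in> {0..1}" if "x \<in> {a..b}" for x
    using k_mono[of a x] k_mono[of x b] k_left[of a] k_right[of b] that kd assms ab
    by (auto simp: u_def)
  ultimately show thesis by (rule that)
qed

lemma integral_mu_indicator_Ioc:
  assumes "a < c" "c \<le> d" "d < b"
  shows "(\<integral>x. indicator {c<..d} x \<partial>\<mu>) = Wcum d - Wcum c"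
proof -
  have IL: "(indicator {..s} :: real \<Rightarrow> complex) \<in> L2 \<mu>" for s by (rule indicator_L2) auto
  have Iw: "w_integrable (indicator {..s})" for s by (rule L2_w_integrable[OF IL])
  have "complex_of_real (\<integral>x. indicator {c<..d} x \<partial>\<mu>) = (\<integral>x. complex_of_real (indicator {c<..d} x) \<partial>\<mu>)"
    by simp
  also have "\<dots> = (\<integral>x. (-1) * indicator {..c} x + indicator {..d} x \<partial>\<mu>)"
    using assms by (intro Bochner_Integration.integral_cong) (auto simp: indicator_def)
  also have "\<dots> = Wint (\<lambda>x. (-1) * indicator {..c} x + indicator {..d} x) b"
    using L2_lin[OF IL IL, of "-1" c d] by (intro integral_mu_eq L2_integrable L2_measurable)
  also have "\<dots> = (-1) * Wint (indicator {..c}) b + Wint (indicator {..d}) b"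
    by (intro Wint_lin Iw) auto
  also have "\<dots> = complex_of_real (Wcum d - Wcum c)"
    using assms ab by (simp add: Wint_indicator)
  finally show ?thesis using of_real_eq_iff by blast
qed

text \<open>A ramp descending on \<open>{c..d}\<close> differs from the indicator only on
  \<open>{c<..d}\<close>, and there by at most 1, so the squared distance is at most the mass
  \<open>Wcum d - Wcum c\<close>.\<close>

lemma indicator_atMost_in_closure: "(indicator {..c} :: real \<Rightarrow> complex) \<in> T_closure"
proof -
  have const: "(\<lambda>_. 1) \<in> T_closure" "(\<lambda>_. 0) \<in> T_closure"
    using T_zero_in Domain_T_subset_closure by blast+
  have Im: "(indicator {..c} :: real \<Rightarrow> complex) \<in> borel_measurable \<mu>"
    by (rule indicator_measurable_mu) auto
  consider "c \<le> a" | "c \<ge> b" | "a < c" "c < b" by linarith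
  then show ?thesis
  proof cases
    case 1
    then show ?thesis by (intro T_closure_cong_ae[OF const(2) Im] AE_I2) (auto simp: indicator_def)
  next
    case 2
    then show ?thesis by (intro T_closure_cong_ae[OF const(1) Im] AE_I2) (auto simp: indicator_def)
  next
    case 3
    show ?thesis
    proof (rule T_closure_closed)
      show IL: "(indicator {..c} :: real \<Rightarrow> complex) \<in> L2 \<mu>" by (rule indicator_L2) auto
      fix e :: real assume "e > 0"
      have "isCont Wcum c"
        using Wcum_deriv[of c] 3 by (auto intro: DERIV_isCont)
      then obtain r where r: "r > 0" "\<And>y. \<bar>y - c\<bar> < r \<Longrightarrow> \<bar>Wcum y - Wcum c\<bar> < e"
        using \<open>e > 0\<close> unfolding continuous_at_eps_delta by (auto simp: dist_real_def)
      define d where "d = min (c + r / 2) ((c + b) / 2)"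
      have d: "c < d" "d < b" "\<bar>d - c\<bar> < r" using 3 r by (auto simp: d_def min_def)
      obtain u where u: "(\<lambda>x. complex_of_real (u x)) \<in> Domain T"
        "\<And>x. x \<in> {a..c} \<Longrightarrow> u x = 1" "\<And>x. x \<in> {d..b} \<Longrightarrow> u x = 0" "\<And>x. x \<in> {a..b} \<Longrightarrow> u x \<in> {0..1}"
        using ramp_in_domain[OF 3(1) d(1,2)] by metis
      have dL: "(\<lambda>x. indicator {..c} x - complex_of_real (u x)) \<in> L2 \<mu>"
        by (intro L2_diff IL Domain_T_L2 u)
      have "sqnorm (\<lambda>x. indicator {..c} x - complex_of_real (u x)) \<le> (\<integral>x. indicator {c<..d} x \<partial>\<mu>)"
        unfolding sqnorm_def
      proof (rule integral_mono)
        show "integrable \<mu> (\<lambda>x. (norm (indicator {..c} x - complex_of_real (u x)))\<^sup>2)"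
          by (rule L2_square_integrable[OF dL])
        have "(\<lambda>x. (norm (indicator {c<..d} x :: complex))\<^sup>2) = (indicator {c<..d} :: real \<Rightarrow> real)"
          by (auto simp: indicator_def)
        then show "integrable \<mu> (indicator {c<..d} :: real \<Rightarrow> real)"
          using L2_square_integrable[OF indicator_L2[of "{c<..d}"]] by simp
        fix x assume "x \<in> space \<mu>"
        then have x: "x \<in> {a..b}" by simp
        consider "x \<le> c" | "c < x" "x \<le> d" | "d < x" by linarith
        then show "(norm (indicator {..c} x - complex_of_real (u x)))\<^sup>2 \<le> indicator {c<..d} x"
        proof cases
          case 2
          then have "(norm (indicator {..c} x - complex_of_real (u x)))\<^sup>2 = (u x)\<^sup>2" by (simp add: indicator_def)
          also have "\<dots> \<le> 1" using u(4)[OF x] by (auto intro: power_le_one)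
          finally show ?thesis using 2 by simp
        qed (use u(2)[of x] u(3)[of x] x d in \<open>auto simp: indicator_def\<close>)
      qed
      also have "\<dots> = Wcum d - Wcum c" using 3 d by (intro integral_mu_indicator_Ioc) auto
      also have "\<dots> < e" using r(2)[OF d(3)] by linarith
      finally show "\<exists>h\<in>T_closure. sqnorm (\<lambda>x. indicator {..c} x - h x) < e"
        using u(1) Domain_T_subset_closure by (intro bexI[of _ "\<lambda>x. complex_of_real (u x)"]) auto
    qed
  qed
qed

lemma T_closure_sum:
  assumes "\<And>i. i \<in> I \<Longrightarrow> h i \<in> T_closure"
  shows "(\<lambda>x. \<Sum>i\<in>I. c i * h i x) \<in> T_closure"
  using assms
proof (induction I rule: infinite_finite_induct)
  case (insert i I)
  then show ?case using T_closure_lin[of "h i" "\<lambda>x. \<Sum>i\<in>I. c i * h i x" "c i"] by simp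
qed (use T_zero_in Domain_T_subset_closure in auto)

text \<open>Half-lines are an intersection-stable generator of the Borel sets, and the sets whose
  indicator lies in \<open>T_closure\<close> are closed under complements by linearity and under
  disjoint unions by dominated convergence.\<close>

lemma indicator_borel_in_closure:
  assumes "A \<in> sets borel"
  shows "(indicator A :: real \<Rightarrow> complex) \<in> T_closure"
proof -
  have one: "(\<lambda>_. 1) \<in> T_closure" using T_zero_in Domain_T_subset_closure by blast
  have "Int_stable (range (\<lambda>c::real. {..c}))" by (auto simp: Int_stable_def)
  moreover have "range (\<lambda>c::real. {..c}) \<subseteq> Pow UNIV" by simp
  moreover have "A \<in> sigma_sets UNIV (range (\<lambda>c::real. {..c}))"
    using assms unfolding borel_eq_atMost by simp
  ultimately show ?thesis
  proof (induction rule: sigma_sets_induct_disjoint)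
    case (basic A)
    then show ?case using indicator_atMost_in_closure by auto
  next
    case empty
    then show ?case using T_zero_in Domain_T_subset_closure by auto
  next
    case (compl A)
    have "(indicator (UNIV - A) :: real \<Rightarrow> complex) = (\<lambda>x. (-1) * indicator A x + 1)"
      by (auto simp: indicator_def)
    then show ?case using T_closure_lin[OF compl(2) one, of "-1"] by simp
  next
    case (union A)
    have AB: "A i \<in> sets lebesgue" for i
    proof -
      have "A i \<in> sets (borel :: real measure)" using union(2) unfolding borel_eq_atMost by auto
      then show ?thesis by simp
    qed
    have UL: "(\<Union>i. A i) \<in> sets lebesgue" using AB by auto
    show ?case
    proof (rule T_closure_LIMSEQ)
      show "(indicator (\<Union>i. A i) :: real \<Rightarrow> complex) \<in> L2 \<mu>" by (rule indicator_L2[OF UL])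
      show "(\<lambda>x. \<Sum>i<n. 1 * indicator (A i) x) \<in> T_closure" for n
        by (rule T_closure_sum) (rule union)
      have eq: "(\<Sum>i<n. 1 * indicator (A i) x) = (indicator (\<Union>i<n. A i) x :: complex)" for n x
        using union(1) by (subst indicator_UN_disjoint) (auto simp: disjoint_family_on_def)
      have sq: "(norm (indicator (\<Union>i. A i) x - indicator (\<Union>i<n. A i) x :: complex))\<^sup>2
          = indicator ((\<Union>i. A i) - (\<Union>i<n. A i)) x" for n x
        by (auto simp: indicator_def)
      have "(\<lambda>n. \<integral>x. indicator ((\<Union>i. A i) - (\<Union>i<n. A i)) x \<partial>\<mu>) \<longlonglongrightarrow> (\<integral>x. (0::real) \<partial>\<mu>)"
      proof (rule integral_dominated_convergence[where w = "\<lambda>_. 1"])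
        show "AE x in \<mu>. (\<lambda>n. indicator ((\<Union>i. A i) - (\<Union>i<n. A i)) x) \<longlonglongrightarrow> (0::real)"
        proof (intro AE_I2 tendsto_eventually)
          fix x
          show "\<forall>\<^sub>F n in sequentially. indicator ((\<Union>i. A i) - (\<Union>i<n. A i)) x = (0::real)"
          proof (cases "x \<in> (\<Union>i. A i)")
            case True
            then obtain i where "x \<in> A i" by blast
            then show ?thesis unfolding eventually_sequentially
              by (intro exI[of _ "Suc i"]) (auto simp: indicator_def intro: less_le_trans)
          qed auto
        qed
        show "(\<lambda>x. indicator ((\<Union>i. A i) - (\<Union>i<n. A i)) x :: real) \<in> borel_measurable \<mu>" for n
          by (intro indicator_measurable_mu sets.Diff sets.finite_UN UL AB) simp
      qed (auto simp: indicator_def)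
      then show "(\<lambda>n. sqnorm (\<lambda>x. indicator (\<Union>i. A i) x - (\<Sum>i<n. 1 * indicator (A i) x))) \<longlonglongrightarrow> 0"
        unfolding sqnorm_def eq sq by simp
    qed
  qed
qed

text \<open>A Lebesgue set is a Borel set up to a null set, which \<mu> does not see.\<close>

lemma indicator_lebesgue_in_closure:
  assumes "A \<in> sets lebesgue"
  shows "(indicator A :: real \<Rightarrow> complex) \<in> T_closure"
proof -
  obtain S N N' where A: "A = S \<union> N" "N \<subseteq> N'" "N' \<in> null_sets lborel" "S \<in> sets lborel"
    using assms by (rule sets_completionE)
  have "negligible N'" using A(3) by (simp add: negligible_iff_null_sets null_sets_completionI)
  then have "negligible {x \<in> {a<..<b}. indicator A x \<noteq> (indicator S x :: complex)}"
    by (rule negligible_subset) (use A in \<open>auto simp: indicator_def\<close>)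
  then have "AE x in \<mu>. indicator A x = (indicator S x :: complex)" by (simp add: AE_mu_iff)
  with indicator_borel_in_closure[of S] A(4) show ?thesis
    by (intro T_closure_cong_ae[OF _ indicator_measurable_mu[OF assms]]) auto
qed

text \<open>Simple functions are finite combinations of indicators. A sequence of them tends
  pointwise to \<open>f\<close> with norms at most \<open>2 |f|\<close>, so the squared errors are
  dominated by \<open>9 |f|^2\<close>.\<close>

lemma L2_subset_closure: "L2 \<mu> \<subseteq> T_closure"
proof
  fix f assume f: "f \<in> L2 \<mu>"
  have [measurable]: "f \<in> borel_measurable \<mu>" by (rule L2_measurable[OF f])
  obtain F where F0: "\<forall>i. simple_function \<mu> (F i)" "\<forall>x\<in>space \<mu>. (\<lambda>i. F i x) \<longlonglongrightarrow> f x"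
      "\<forall>i. \<forall>x\<in>space \<mu>. dist (F i x) 0 \<le> 2 * dist (f x) 0"
    using borel_measurable_implies_sequence_metric[OF \<open>f \<in> borel_measurable \<mu>\<close>, of 0] by blast
  have F: "\<And>i. simple_function \<mu> (F i)" "\<And>x. x \<in> space \<mu> \<Longrightarrow> (\<lambda>i. F i x) \<longlonglongrightarrow> f x"
      "\<And>i x. x \<in> space \<mu> \<Longrightarrow> norm (F i x) \<le> 2 * norm (f x)"
    using F0 by auto
  have [measurable]: "F i \<in> borel_measurable \<mu>" for i using F(1) by (rule borel_measurable_simple_function)
  have FC: "F i \<in> T_closure" for i
  proof -
    have fin: "finite (F i ` space \<mu>)" using F(1) by (rule simple_functionD)
    have C: "(\<lambda>x. \<Sum>y\<in>F i ` space \<mu>. y * indicator (F i -` {y} \<inter> space \<mu>) x) \<in> T_closure"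
    proof (rule T_closure_sum)
      fix y
      have "F i -` {y} \<inter> space \<mu> \<in> sets \<mu>" using F(1) by (rule simple_functionD)
      then have "F i -` {y} \<inter> space \<mu> \<in> sets lebesgue"
      proof -
        from \<open>F i -` {y} \<inter> space \<mu> \<in> sets \<mu>\<close>
        obtain B where "B \<in> sets lebesgue" "F i -` {y} \<inter> space \<mu> = {a<..<b} \<inter> B"
          by (auto simp: \<mu>_def sets_restrict_space)
        moreover have "{a<..<b} \<in> sets lebesgue" by simp
        ultimately show ?thesis by (metis sets.Int)
      qed
      then show "(indicator (F i -` {y} \<inter> space \<mu>) :: real \<Rightarrow> complex) \<in> T_closure"
        by (rule indicator_lebesgue_in_closure)
    qed
    have "F i x = (\<Sum>y\<in>F i ` space \<mu>. y * indicator (F i -` {y} \<inter> space \<mu>) x)" if x: "x \<in> space \<mu>" for x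
    proof -
      have "(\<Sum>y\<in>F i ` space \<mu>. y * indicator (F i -` {y} \<inter> space \<mu>) x) = (\<Sum>y\<in>F i ` space \<mu>. if y = F i x then y else 0)"
        using x by (intro sum.cong) (auto simp: indicator_def)
      also have "\<dots> = F i x" using fin x by simp
      finally show ?thesis ..
    qed
    then have "AE x in \<mu>. F i x = (\<Sum>y\<in>F i ` space \<mu>. y * indicator (F i -` {y} \<inter> space \<mu>) x)" by (rule AE_I2)
    then show ?thesis by (rule T_closure_cong_ae[OF C borel_measurable_simple_function[OF F(1)]])
  qed
  show "f \<in> T_closure"
  proof (rule T_closure_LIMSEQ[OF f FC])
    have "(\<lambda>i. \<integral>x. (norm (f x - F i x))\<^sup>2 \<partial>\<mu>) \<longlonglongrightarrow> (\<integral>x. (0::real) \<partial>\<mu>)"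
    proof (rule integral_dominated_convergence[where w = "\<lambda>x. 9 * (norm (f x))\<^sup>2"])
      show "integrable \<mu> (\<lambda>x. 9 * (norm (f x))\<^sup>2)" using L2_square_integrable[OF f] by simp
      show "AE x in \<mu>. (\<lambda>i. (norm (f x - F i x))\<^sup>2) \<longlonglongrightarrow> 0"
      proof (rule AE_I2)
        fix x assume "x \<in> space \<mu>"
        then have "(\<lambda>i. (norm (f x - F i x))\<^sup>2) \<longlonglongrightarrow> (norm (f x - f x))\<^sup>2"
          by (intro tendsto_intros F)
        then show "(\<lambda>i. (norm (f x - F i x))\<^sup>2) \<longlonglongrightarrow> 0" by simp
      qed
      show "AE x in \<mu>. norm ((norm (f x - F i x))\<^sup>2) \<le> 9 * (norm (f x))\<^sup>2" for i
      proof (rule AE_I2)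
        fix x assume "x \<in> space \<mu>"
        then have "norm (f x - F i x) \<le> 3 * norm (f x)"
          using F(3)[of x i] norm_triangle_ineq4[of "f x" "F i x"] by linarith
        then have "(norm (f x - F i x))\<^sup>2 \<le> (3 * norm (f x))\<^sup>2" by (intro power_mono) auto
        then show "norm ((norm (f x - F i x))\<^sup>2) \<le> 9 * (norm (f x))\<^sup>2" by (simp add: power_mult_distrib)
      qed
    qed measurable
    then show "(\<lambda>n. sqnorm (\<lambda>x. f x - F n x)) \<longlonglongrightarrow> 0" by (simp add: sqnorm_def)
  qed
qed

lemma T_densely_defined: "densely_defined \<mu> T"
  unfolding densely_defined_def
proof (intro ballI allI impI)
  fix f and e :: real assume f: "f \<in> L2 \<mu>" and "e > 0"
  then obtain u where u: "u \<in> Domain T" "sqnorm (\<lambda>x. f x - u x) < e\<^sup>2"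
    using L2_subset_closure unfolding T_closure_def by (force dest: spec[of _ "e\<^sup>2"])
  then have "L2_norm \<mu> (\<lambda>x. f x - u x) < e"
    unfolding L2_norm_def sqnorm_def using \<open>e > 0\<close> real_sqrt_less_mono by fastforce
  then show "\<exists>u\<in>Domain T. L2_norm \<mu> (\<lambda>x. f x - u x) < e" using u(1) by blast
qed

theorem T_self_adjoint: "self_adjoint \<mu> T"
  unfolding self_adjoint_def using T_operator T_densely_defined T_adjoint by blast

end

text \<open>The product \<open>w k\<close> is integrable by the fundamental theorem and, being
  nonnegative, absolutely so; the factor \<open>1 / k\<close> is bounded. Applied to
  \<open>w1\<close> and to \<open>1 / p1\<close>, this replaces estimates of their singularities by
  an antiderivative that stays continuous.\<close>

lemma absolutely_integrable_of_derivative: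
  fixes q k w :: "real \<Rightarrow> real"
  assumes "c \<le> d" and q: "continuous_on {c..d} q" and S: "finite S"
    and der: "\<And>x. x \<in> {c<..<d} - S \<Longrightarrow> (q has_real_derivative w x * k x) (at x)"
    and k: "continuous_on {c..d} k" "\<And>x. x \<in> {c..d} \<Longrightarrow> k x > 0"
    and w: "\<And>x. x \<in> {c..d} \<Longrightarrow> w x \<ge> 0"
  shows "w absolutely_integrable_on {c..d}"
proof -
  have "((\<lambda>x. w x * k x) has_integral q d - q c) {c..d}"
    by (rule fundamental_theorem_of_calculus_interior_strong[OF S \<open>c \<le> d\<close> _ q])
      (use der in \<open>auto simp: has_real_derivative_iff_has_vector_derivative\<close>)
  then have "(\<lambda>x. w x * k x) absolutely_integrable_on {c..d}"
    using w k by (intro nonnegative_absolutely_integrable_1) (auto simp: less_imp_le)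
  moreover have "continuous_on {c..d} (\<lambda>x. 1 / k x)"
    using k by (intro continuous_intros) (auto simp: less_imp_neq[symmetric])
  ultimately have "(\<lambda>x. 1 / k x * (w x * k x)) absolutely_integrable_on {c..d}"
    by (intro absolutely_integrable_bounded_measurable_product_real[where f = "\<lambda>x. 1 / k x" and g = "\<lambda>x. w x * k x"]
        continuous_imp_measurable_on_sets_lebesgue compact_imp_bounded compact_continuous_image) auto
  then show ?thesis
    by (rule absolutely_integrable_spike[of _ _ "{}"]) (use k(2) in \<open>auto simp: less_imp_neq[symmetric]\<close>)
qed

lemma absolutely_integrable_combine_real:
  fixes f :: "real \<Rightarrow> 'b::euclidean_space"
  assumes "f absolutely_integrable_on {a..c}" "f absolutely_integrable_on {c..b}" "a \<le> c" "c \<le> b"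
  shows "f absolutely_integrable_on {a..b}"
proof -
  have "f absolutely_integrable_on {a..c} \<union> {c..b}"
    using assms(1,2) by (rule set_integrable_Un) auto
  moreover have "{a..c} \<union> {c..b} = {a..b}" using assms by auto
  ultimately show ?thesis by simp
qed

section \<open>The coefficients\<close>

text \<open>The theorem is proved with 1/100 as bound on \<epsilon>. It makes (4 + 2 sqrt 3)
  \<epsilon> less than 1, which integrability of \<open>1 / p1\<close> at the singular points
  depends on, and keeps the boundary layers \<open>[0, \<epsilon>]\<close> and
  \<open>[1 - \<epsilon>, 1]\<close> apart.\<close>

locale small_eps =
  fixes \<epsilon> :: real
  assumes eps_pos: "0 < \<epsilon>" and eps_le: "\<epsilon> \<le> 1 / 100"
begin

abbreviation y0 :: real where "y0 \<equiv> x0 \<epsilon>"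
text \<open>The second root (2 + sqrt 3) \<epsilon> of the quadratic in \<open>phi2\<close>; it lies
  to the right of \<epsilon>, outside the layer. The exponents of \<open>g\<close> at the two roots
  are \<alpha> and \<beta>.\<close>

definition r0 :: real where "r0 = 4 * \<epsilon> - y0"
definition \<alpha> :: real where "\<alpha> = (4 + 2 * sqrt 3) * \<epsilon>"
definition \<beta> :: real where "\<beta> = (4 - 2 * sqrt 3) * \<epsilon>"

lemma sqrt3: "17 / 10 < sqrt 3" "sqrt 3 < 18 / 10"
proof -
  show "17 / 10 < sqrt 3" by (rule real_less_rsqrt) (simp add: power2_eq_square)
  show "sqrt 3 < 18 / 10" by (rule real_less_lsqrt) (simp_all add: power2_eq_square)
qed

lemma y0_bounds: "\<epsilon> / 5 < y0" "y0 < 3 * \<epsilon> / 10" "0 < y0" "y0 < \<epsilon> / 2" "y0 < \<epsilon>" "y0 < 1 / 2"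
proof -
  show 1: "\<epsilon> / 5 < y0" "y0 < 3 * \<epsilon> / 10"
    using eps_pos sqrt3 mult_strict_right_mono[of "1/5" "2 - sqrt 3" \<epsilon>] mult_strict_right_mono[of "2 - sqrt 3" "3/10" \<epsilon>]
    by (auto simp: x0_def)
  then show "0 < y0" "y0 < \<epsilon> / 2" "y0 < \<epsilon>" "y0 < 1 / 2" using eps_pos eps_le by auto
qed

lemma r0_gt: "r0 > 3 * \<epsilon>"
  using y0_bounds eps_pos by (auto simp: r0_def)

lemma y0_r0: "y0 + r0 = 4 * \<epsilon>" "y0 * r0 = \<epsilon>\<^sup>2"
proof -
  show "y0 + r0 = 4 * \<epsilon>" by (simp add: r0_def)
  have "(2 - sqrt 3) * (2 + sqrt 3) = 1" by (simp add: algebra_simps)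
  moreover have "y0 * r0 = ((2 - sqrt 3) * (2 + sqrt 3)) * \<epsilon>\<^sup>2"
    by (simp add: r0_def x0_def power2_eq_square algebra_simps)
  ultimately show "y0 * r0 = \<epsilon>\<^sup>2" by simp
qed

lemma alpha_bounds: "0 < \<alpha>" "\<alpha> < 1" "0 < \<beta>"
proof -
  show "0 < \<alpha>" unfolding \<alpha>_def using eps_pos sqrt3 by (intro mult_pos_pos) auto
  show "0 < \<beta>" unfolding \<beta>_def using eps_pos sqrt3 by (intro mult_pos_pos) auto
  have "\<alpha> \<le> (4 + 2 * sqrt 3) * (1 / 100)" unfolding \<alpha>_def using eps_le sqrt3 by (intro mult_left_mono) auto
  also have "\<dots> < 1" using sqrt3 by (simp add: field_simps)
  finally show "\<alpha> < 1" .
qed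

text \<open>The formulas of the left layer without the case split. Both \<open>phi2\<close> and
  \<open>p1\<close> are these functions evaluated at \<open>min (min x (1 - x)) \<epsilon>\<close>,
  which folds the interval at 1/2 and clamps it to the layer, so that signs and continuity need to
  be studied on the layer only.\<close>

definition Q2 :: "real \<Rightarrow> real" where "Q2 x = (1/12) * (1 - 4 * (x/\<epsilon>) + (x/\<epsilon>)\<^sup>2)"
definition Q1 :: "real \<Rightarrow> real" where "Q1 x = - 6 * (1 - x/\<epsilon>) / (1 + x/\<epsilon>) ^ 3"
definition Qp :: "real \<Rightarrow> real" where "Qp x = g \<epsilon> x / (6 * g \<epsilon> \<epsilon>)"

lemma Q_eps: "Q2 \<epsilon> = - (1/6)" "Q1 \<epsilon> = 0"
  using eps_pos by (auto simp: Q2_def Q1_def)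

lemma Q2_factor: "Q2 x = (x - y0) * (x - r0) / (12 * \<epsilon>\<^sup>2)"
proof -
  have "(x - y0) * (x - r0) = x\<^sup>2 - (y0 + r0) * x + y0 * r0" by (simp add: power2_eq_square algebra_simps)
  also have "\<dots> = x\<^sup>2 - 4 * \<epsilon> * x + \<epsilon>\<^sup>2" by (simp add: y0_r0)
  finally show ?thesis using eps_pos by (simp add: Q2_def field_simps power2_eq_square)
qed

lemma phi2_left: "x \<le> \<epsilon> \<Longrightarrow> phi2 \<epsilon> x = Q2 x"
  and phi1_left: "x \<le> \<epsilon> \<Longrightarrow> phi1 \<epsilon> x = Q1 x"
  and p1_left: "x \<le> \<epsilon> \<Longrightarrow> p1 \<epsilon> x = Qp x"
  by (simp_all add: phi2_def phi1_def p1_def Q2_def Q1_def Qp_def)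

lemma g_eps_pos: "g \<epsilon> \<epsilon> > 0"
proof -
  have "\<bar>\<epsilon> - 4 * \<epsilon> + y0\<bar> > 0" using y0_bounds eps_pos by auto
  then show ?thesis unfolding g_def using y0_bounds eps_pos by (auto simp: sgn_if intro!: mult_pos_pos)
qed

lemma Qp_eps: "Qp \<epsilon> = 1/6"
  using g_eps_pos by (simp add: Qp_def)

lemma phi2_eq: "phi2 \<epsilon> x = Q2 (min (min x (1 - x)) \<epsilon>)"
proof -
  have d: "phi2 \<epsilon> x = (if x \<le> \<epsilon> then Q2 x else if x \<le> 1 - \<epsilon> then - (1/6) else Q2 (1 - x))"
    by (simp only: phi2_def Q2_def)
  consider "x \<le> \<epsilon>" | "\<epsilon> < x" "x < 1 - \<epsilon>" | "x = 1 - \<epsilon>" | "1 - \<epsilon> < x" by linarith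
  then show ?thesis
    using eps_le eps_pos Q_eps unfolding d by cases (auto simp: min_def)
qed

text \<open>\<open>phi1\<close> is odd under reflection, so one folded argument cannot represent it;
  since \<open>Q1\<close> vanishes at \<epsilon>, at most one of the two terms is nonzero.\<close>

lemma phi1_eq: "phi1 \<epsilon> x = Q1 (min x \<epsilon>) - Q1 (min (1 - x) \<epsilon>)"
proof -
  have m: "6 * (1 - y/\<epsilon>) / (1 + y/\<epsilon>) ^ 3 = - Q1 y" for y
    by (simp only: Q1_def minus_divide_left minus_mult_left minus_minus)
  have d: "phi1 \<epsilon> x = (if x \<le> \<epsilon> then Q1 x else if x \<le> 1 - \<epsilon> then 0 else - Q1 (1 - x))"
    unfolding phi1_def m by (simp only: Q1_def)
  consider "x \<le> \<epsilon>" | "\<epsilon> < x" "x < 1 - \<epsilon>" | "x = 1 - \<epsilon>" | "1 - \<epsilon> < x" by linarith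
  then show ?thesis
    using eps_le eps_pos Q_eps unfolding d by cases (auto simp: min_def)
qed

lemma p1_eq: "p1 \<epsilon> x = Qp (min (min x (1 - x)) \<epsilon>)"
proof -
  consider "x \<le> \<epsilon>" | "\<epsilon> < x" "x < 1 - \<epsilon>" | "x = 1 - \<epsilon>" | "1 - \<epsilon> < x" by linarith
  then show ?thesis
    using eps_le eps_pos Qp_eps by cases (auto simp: p1_def Qp_def[symmetric] min_def)
qed

lemma phi2_reflect: "phi2 \<epsilon> (1 - x) = phi2 \<epsilon> x"
  and phi1_reflect: "phi1 \<epsilon> (1 - x) = - phi1 \<epsilon> x"
  and p1_reflect: "p1 \<epsilon> (1 - x) = p1 \<epsilon> x"
  by (simp_all add: phi2_eq phi1_eq p1_eq min.commute)

text \<open>The factor of \<open>Qp\<close> that is smooth and positive near \<open>y0\<close>; the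
  singular behaviour of \<open>p1\<close> sits entirely in
  \<open>sgn (x - y0) * |x - y0| powr \<alpha>\<close>.\<close>

definition hfac :: "real \<Rightarrow> real" where
  "hfac x = \<bar>x - r0\<bar> powr \<beta> * (x + \<epsilon>) powr (- 8 * \<epsilon>)
     * exp (12 * \<epsilon> ^ 3 / (\<epsilon> + x)\<^sup>2 + 12 * \<epsilon>\<^sup>2 / (\<epsilon> + x)) / (6 * g \<epsilon> \<epsilon>)"

lemma Qp_factor: "Qp x = sgn (x - y0) * \<bar>x - y0\<bar> powr \<alpha> * hfac x"
proof -
  have "x - 4 * \<epsilon> + y0 = x - r0" by (simp add: r0_def)
  then show ?thesis unfolding Qp_def g_def[of \<epsilon> x] hfac_def \<alpha>_def \<beta>_def
    by (simp only: mult.assoc times_divide_eq_right)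
qed

lemma hfac_pos: "- \<epsilon> < x \<Longrightarrow> x < r0 \<Longrightarrow> hfac x > 0"
  unfolding hfac_def using g_eps_pos by (intro divide_pos_pos mult_pos_pos) auto

lemma hfac_continuous: "continuous_on {- \<epsilon> <..< r0} hfac"
  unfolding hfac_def using alpha_bounds g_eps_pos eps_pos
  by (intro continuous_intros continuous_on_powr') auto

text \<open>Logarithmic differentiation: on this range \<open>hfac\<close> is the exponential of
  \<open>H\<close>, whose terms have elementary derivatives.\<close>

lemma hfac_deriv:
  assumes x: "- \<epsilon> < x" "x < r0"
  shows "(hfac has_real_derivative hfac x * (\<beta> / (x - r0) - 8 * \<epsilon> / (x + \<epsilon>)
     - 24 * \<epsilon> ^ 3 / (x + \<epsilon>) ^ 3 - 12 * \<epsilon>\<^sup>2 / (x + \<epsilon>)\<^sup>2)) (at x)"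
proof -
  define H where "H y = \<beta> * ln (r0 - y) + (- 8 * \<epsilon>) * ln (y + \<epsilon>)
     + (12 * \<epsilon> ^ 3 / (\<epsilon> + y)\<^sup>2 + 12 * \<epsilon>\<^sup>2 / (\<epsilon> + y)) - ln (6 * g \<epsilon> \<epsilon>)" for y
  have eq: "hfac y = exp (H y)" if "- \<epsilon> < y" "y < r0" for y
    using that g_eps_pos by (simp add: hfac_def H_def powr_def exp_add exp_diff exp_minus field_simps)
  let ?D = "\<beta> / (x - r0) - 8 * \<epsilon> / (x + \<epsilon>) - 24 * \<epsilon> ^ 3 / (x + \<epsilon>) ^ 3 - 12 * \<epsilon>\<^sup>2 / (x + \<epsilon>)\<^sup>2"
  have d1: "((\<lambda>y. \<beta> * ln (r0 - y)) has_real_derivative \<beta> / (x - r0)) (at x)"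
    using x by (auto intro!: derivative_eq_intros simp: field_simps)
  have d2: "((\<lambda>y. (- 8 * \<epsilon>) * ln (y + \<epsilon>)) has_real_derivative - (8 * \<epsilon> / (x + \<epsilon>))) (at x)"
    using x by (auto intro!: derivative_eq_intros)
  have d3: "((\<lambda>y. 12 * \<epsilon> ^ 3 / (\<epsilon> + y)\<^sup>2) has_real_derivative - (24 * \<epsilon> ^ 3 / (x + \<epsilon>) ^ 3)) (at x)"
  proof -
    have nz: "\<epsilon> + x \<noteq> 0" using x by simp
    have "((\<lambda>y. 12 * \<epsilon> ^ 3 / (\<epsilon> + y)\<^sup>2) has_real_derivative
       (0 * (\<epsilon> + x)\<^sup>2 - 12 * \<epsilon> ^ 3 * (2 * (\<epsilon> + x))) / ((\<epsilon> + x)\<^sup>2 * (\<epsilon> + x)\<^sup>2)) (at x)"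
      by (rule DERIV_divide) (use nz in \<open>auto intro!: derivative_eq_intros\<close>)
    moreover have "(0 * (\<epsilon> + x)\<^sup>2 - 12 * \<epsilon> ^ 3 * (2 * (\<epsilon> + x))) / ((\<epsilon> + x)\<^sup>2 * (\<epsilon> + x)\<^sup>2) = - (24 * \<epsilon> ^ 3 / (x + \<epsilon>) ^ 3)"
    proof -
      define d where "d = x + \<epsilon>"
      have d: "\<epsilon> + x = d" "d \<noteq> 0" using nz by (auto simp: d_def)
      show ?thesis unfolding d_def[symmetric] d(1) using d(2)
        by (simp add: field_simps power2_eq_square power3_eq_cube)
    qed
    ultimately show ?thesis by simp
  qed
  have d4: "((\<lambda>y. 12 * \<epsilon>\<^sup>2 / (\<epsilon> + y)) has_real_derivative - (12 * \<epsilon>\<^sup>2 / (x + \<epsilon>)\<^sup>2)) (at x)"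
    using x by (auto intro!: derivative_eq_intros simp: power2_eq_square add.commute)
  have "(H has_real_derivative \<beta> / (x - r0) + - (8 * \<epsilon> / (x + \<epsilon>))
      + (- (24 * \<epsilon> ^ 3 / (x + \<epsilon>) ^ 3) + - (12 * \<epsilon>\<^sup>2 / (x + \<epsilon>)\<^sup>2)) - 0) (at x)"
    unfolding H_def by (intro DERIV_add DERIV_diff d1 d2 d3 d4 DERIV_const)
  then have "(H has_real_derivative ?D) (at x)" by (rule DERIV_cong) simp
  then have "((\<lambda>y. exp (H y)) has_real_derivative exp (H x) * ?D) (at x)" by (rule DERIV_fun_exp)
  then have "(hfac has_real_derivative exp (H x) * ?D) (at x)"
    by (rule has_field_derivative_transform_within_open[where S = "{- \<epsilon> <..< r0}"]) (use x eq in auto)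
  then show ?thesis using eq[OF x] by simp
qed

text \<open>The reason for the form of \<open>g\<close>: its logarithmic derivative, written in
  partial fractions, equals \<open>phi1 / phi2\<close>. After rescaling to
  \<open>t = x / \<epsilon>\<close> and clearing denominators the claim is a polynomial identity in
  \<open>t\<close>.\<close>

lemma log_derivative_identity:
  assumes x: "- \<epsilon> < x" "x < r0" "x \<noteq> y0"
  shows "\<alpha> / (x - y0) + (\<beta> / (x - r0) - 8 * \<epsilon> / (x + \<epsilon>)
     - 24 * \<epsilon> ^ 3 / (x + \<epsilon>) ^ 3 - 12 * \<epsilon>\<^sup>2 / (x + \<epsilon>)\<^sup>2) = Q1 x / Q2 x"
proof -
  define t where "t = x / \<epsilon>"
  define q where "q = 1 - 4 * t + t\<^sup>2"
  have xt: "x = \<epsilon> * t" using eps_pos by (simp add: t_def)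
  have t1: "1 + t > 0" using x eps_pos by (simp add: t_def field_simps)
  have Q2q: "Q2 x = q / 12" by (simp add: Q2_def q_def t_def)
  have nz: "x - y0 \<noteq> 0" "x - r0 \<noteq> 0" using x by auto
  then have "Q2 x \<noteq> 0" using eps_pos by (simp add: Q2_factor)
  then have q0: "q \<noteq> 0" by (simp add: Q2q)
  have prod: "(x - y0) * (x - r0) = \<epsilon>\<^sup>2 * q"
    using Q2_factor[of x] Q2q eps_pos by (simp add: field_simps)
  \<comment> \<open>With \<open>s = sqrt 3\<close> the constant 28 is
    \<open>(4 + 2 s) (2 + s) + (4 - 2 s) (2 - s)\<close>, in which the irrational terms
    cancel.\<close>
  have ar: "\<alpha> * r0 + \<beta> * y0 = 28 * \<epsilon>\<^sup>2"
  proof -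
    have "\<alpha> * r0 + \<beta> * y0 = ((4 + 2 * sqrt 3) * (2 + sqrt 3) + (4 - 2 * sqrt 3) * (2 - sqrt 3)) * \<epsilon>\<^sup>2"
      by (simp add: \<alpha>_def \<beta>_def r0_def x0_def power2_eq_square algebra_simps)
    also have "(4 + 2 * sqrt 3) * (2 + sqrt 3) + (4 - 2 * sqrt 3) * (2 - sqrt 3) = 28"
      by (simp add: algebra_simps)
    finally show ?thesis .
  qed
  have "\<alpha> / (x - y0) + \<beta> / (x - r0) = (\<alpha> * (x - r0) + \<beta> * (x - y0)) / ((x - y0) * (x - r0))"
    using nz by (simp add: add_frac_eq mult.commute)
  also have "\<alpha> * (x - r0) + \<beta> * (x - y0) = (\<alpha> + \<beta>) * x - (\<alpha> * r0 + \<beta> * y0)" by (simp add: algebra_simps)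
  also have "\<dots> = \<epsilon>\<^sup>2 * (8 * t - 28)"
    unfolding ar xt by (simp add: \<alpha>_def \<beta>_def power2_eq_square algebra_simps)
  also have "\<epsilon>\<^sup>2 * (8 * t - 28) / ((x - y0) * (x - r0)) = (8 * t - 28) / q"
    unfolding prod using eps_pos by simp
  finally have A: "\<alpha> / (x - y0) + \<beta> / (x - r0) = (8 * t - 28) / q" .
  have xe: "x + \<epsilon> = \<epsilon> * (1 + t)" unfolding xt by (simp add: algebra_simps)
  have B: "8 * \<epsilon> / (x + \<epsilon>) = 8 / (1 + t)" "24 * \<epsilon> ^ 3 / (x + \<epsilon>) ^ 3 = 24 / (1 + t) ^ 3"
    "12 * \<epsilon>\<^sup>2 / (x + \<epsilon>)\<^sup>2 = 12 / (1 + t)\<^sup>2"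
    unfolding xe power_mult_distrib using eps_pos by auto
  have C: "Q1 x / Q2 x = - 72 * (1 - t) / ((1 + t) ^ 3 * q)"
    unfolding Q2q by (simp add: Q1_def t_def)
  have D: "(8 * t - 28) / q - 8 / (1 + t) - 24 / (1 + t) ^ 3 - 12 / (1 + t)\<^sup>2
      = ((8 * t - 28) * (1 + t) ^ 3 - q * (8 * (1 + t)\<^sup>2 + 24 + 12 * (1 + t))) / ((1 + t) ^ 3 * q)"
  proof -
    have c: "(1 + t) ^ 3 * q \<noteq> 0" using t1 q0 by auto
    define d where "d = 1 + t"
    have "d \<noteq> 0" using t1 by (simp add: d_def)
    then have "8 / d = q * (8 * d\<^sup>2) / (d ^ 3 * q)" "24 / d ^ 3 = q * 24 / (d ^ 3 * q)"
      "12 / d\<^sup>2 = q * (12 * d) / (d ^ 3 * q)" "(8 * t - 28) / q = (8 * t - 28) * d ^ 3 / (d ^ 3 * q)"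
      using q0 by (simp_all add: field_simps power2_eq_square power3_eq_cube)
    note this[unfolded d_def]
    then show ?thesis by (simp only: diff_divide_distrib[symmetric] distrib_left) (simp add: algebra_simps)
  qed
  have E: "(8 * t - 28) * (1 + t) ^ 3 - q * (8 * (1 + t)\<^sup>2 + 24 + 12 * (1 + t)) = - 72 * (1 - t)"
    unfolding q_def by (simp add: power2_eq_square power3_eq_cube algebra_simps)
  have "\<alpha> / (x - y0) + (\<beta> / (x - r0) - 8 * \<epsilon> / (x + \<epsilon>) - 24 * \<epsilon> ^ 3 / (x + \<epsilon>) ^ 3 - 12 * \<epsilon>\<^sup>2 / (x + \<epsilon>)\<^sup>2)
      = (\<alpha> / (x - y0) + \<beta> / (x - r0)) - 8 * \<epsilon> / (x + \<epsilon>) - 24 * \<epsilon> ^ 3 / (x + \<epsilon>) ^ 3 - 12 * \<epsilon>\<^sup>2 / (x + \<epsilon>)\<^sup>2" by simp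
  also have "\<dots> = - 72 * (1 - t) / ((1 + t) ^ 3 * q)" unfolding A B D E ..
  finally show ?thesis unfolding C .
qed

text \<open>On each side of \<open>y0\<close> the sign \<tau> is constant, which turns the signed
  power into the differentiable expression
  \<open>\<tau> * (\<tau> * (y - y0)) powr \<alpha>\<close>.\<close>

lemma Qp_deriv:
  assumes x: "- \<epsilon> < x" "x < r0" "x \<noteq> y0"
  shows "(Qp has_real_derivative Qp x * (Q1 x / Q2 x)) (at x)"
proof -
  define \<tau> where "\<tau> = sgn (x - y0)"
  have \<tau>: "\<tau> = 1 \<or> \<tau> = -1" "\<tau> * (x - y0) > 0" using x(3) by (auto simp: \<tau>_def sgn_if)
  let ?S = "{y. \<tau> * (y - y0) > 0}"
  have op: "open ?S" by (intro open_Collect_less continuous_intros)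
  have eq: "Qp y = \<tau> * (\<tau> * (y - y0)) powr \<alpha> * hfac y" if "y \<in> ?S" for y
    using that \<tau>(1) by (auto simp: Qp_factor sgn_if)
  have "((\<lambda>y. (\<tau> * (y - y0)) powr \<alpha>) has_real_derivative \<alpha> * (\<tau> * (x - y0)) powr (\<alpha> - 1) * \<tau>) (at x)"
    using \<tau>(2) by (auto intro!: derivative_eq_intros has_real_derivative_powr[THEN DERIV_chain2])
  moreover have "\<alpha> * (\<tau> * (x - y0)) powr (\<alpha> - 1) * \<tau> = (\<tau> * (x - y0)) powr \<alpha> * (\<alpha> / (x - y0))"
    using \<tau> by (auto simp: powr_diff field_simps)
  ultimately have d1: "((\<lambda>y. (\<tau> * (y - y0)) powr \<alpha>) has_real_derivative (\<tau> * (x - y0)) powr \<alpha> * (\<alpha> / (x - y0))) (at x)" by simp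
  let ?A = "(\<tau> * (x - y0)) powr \<alpha>" and ?L = "\<beta> / (x - r0) - 8 * \<epsilon> / (x + \<epsilon>) - 24 * \<epsilon> ^ 3 / (x + \<epsilon>) ^ 3 - 12 * \<epsilon>\<^sup>2 / (x + \<epsilon>)\<^sup>2"
  have "((\<lambda>y. \<tau> * (\<tau> * (y - y0)) powr \<alpha> * hfac y) has_real_derivative
      (\<tau> * (?A * (\<alpha> / (x - y0)))) * hfac x + (hfac x * ?L) * (\<tau> * ?A)) (at x)"
    by (intro DERIV_mult DERIV_cmult d1 hfac_deriv x)
  also have "(\<tau> * (?A * (\<alpha> / (x - y0)))) * hfac x + (hfac x * ?L) * (\<tau> * ?A) = (\<tau> * ?A * hfac x) * (\<alpha> / (x - y0) + ?L)"
    by (simp add: algebra_simps)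
  also have "\<alpha> / (x - y0) + ?L = Q1 x / Q2 x" by (rule log_derivative_identity[OF x])
  also have "\<tau> * ?A * hfac x = Qp x" using \<tau>(2) eq by simp
  finally show ?thesis
    by (rule has_field_derivative_transform_within_open[OF _ op]) (use \<tau>(2) eq in auto)
qed

text \<open>At \<open>y0\<close> the modulus is \<open>|y - y0| powr \<alpha>\<close> times a factor
  with a finite limit, and \<alpha> is positive.\<close>

lemma Qp_isCont:
  assumes x: "- \<epsilon> < x" "x < r0"
  shows "isCont Qp x"
proof (cases "x = y0")
  case False
  then show ?thesis using Qp_deriv[OF x] DERIV_isCont by blast
next
  case True
  have "hfac \<midarrow>y0\<rightarrow> hfac y0"
    using hfac_deriv[of y0] x True DERIV_isCont isContD by blast
  moreover have "((\<lambda>y. \<bar>y - y0\<bar> powr \<alpha>) \<longlongrightarrow> \<bar>y0 - y0\<bar> powr \<alpha>) (at y0)"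
    using alpha_bounds by (intro tendsto_powr' tendsto_intros) auto
  ultimately have "((\<lambda>y. \<bar>y - y0\<bar> powr \<alpha> * hfac y) \<longlongrightarrow> 0) (at y0)"
    using tendsto_mult[of "\<lambda>y. \<bar>y - y0\<bar> powr \<alpha>" 0 "at y0" hfac "hfac y0"] by simp
  then have "(Qp \<longlongrightarrow> 0) (at y0)"
    by (rule Lim_null_comparison[rotated, OF tendsto_norm_zero])
      (auto simp: Qp_factor abs_mult sgn_if intro!: always_eventually)
  moreover have "Qp y0 = 0" by (simp add: Qp_factor)
  ultimately show ?thesis using True by (simp add: isCont_def)
qed

lemma min_range: "x \<in> {0..1} \<Longrightarrow> min (min x (1 - x)) \<epsilon> \<in> {0..\<epsilon>}"
  using eps_pos by auto

lemma Q2_continuous: "continuous_on UNIV Q2"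
  unfolding Q2_def by (intro continuous_intros) (use eps_pos in auto)

lemma Q1_continuous: "continuous_on {- \<epsilon> <..} Q1"
proof -
  have "1 + x / \<epsilon> \<noteq> 0" if "x \<in> {- \<epsilon> <..}" for x
    using that eps_pos by (auto simp: field_simps)
  then show ?thesis unfolding Q1_def by (intro continuous_intros) (use eps_pos in auto)
qed

lemma phi2_continuous: "continuous_on S (phi2 \<epsilon>)"
proof -
  have "continuous_on S (\<lambda>x. Q2 (min (min x (1 - x)) \<epsilon>))"
    by (intro continuous_on_compose2[OF Q2_continuous] continuous_intros) auto
  then show ?thesis by (simp add: phi2_eq[abs_def])
qed

lemma phi1_continuous: "continuous_on {0..1} (phi1 \<epsilon>)"
proof -
  have "continuous_on {0..1} (\<lambda>x. Q1 (min x \<epsilon>) - Q1 (min (1 - x) \<epsilon>))"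
    by (intro continuous_on_diff continuous_on_compose2[OF Q1_continuous] continuous_intros) (use eps_pos in auto)
  then show ?thesis by (simp add: phi1_eq[abs_def])
qed

lemma p1_continuous: "continuous_on {0..1} (p1 \<epsilon>)"
proof -
  have "continuous_on {0..\<epsilon>} Qp"
    by (intro continuous_at_imp_continuous_on ballI Qp_isCont) (use r0_gt eps_pos in auto)
  then have "continuous_on {0..1} (\<lambda>x. Qp (min (min x (1 - x)) \<epsilon>))"
    by (rule continuous_on_compose2) (use min_range in \<open>auto intro!: continuous_intros\<close>)
  then show ?thesis by (simp add: p1_eq[abs_def])
qed

lemma Q2_sign: "x < y0 \<Longrightarrow> Q2 x > 0" "y0 < x \<Longrightarrow> x < r0 \<Longrightarrow> Q2 x < 0" "Q2 y0 = 0"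
proof -
  have e: "12 * \<epsilon>\<^sup>2 > 0" using eps_pos by simp
  show "Q2 x > 0" if "x < y0"
  proof -
    have "(x - y0) * (x - r0) > 0" by (rule mult_neg_neg) (use that r0_gt y0_bounds in auto)
    then show ?thesis unfolding Q2_factor using e by (rule divide_pos_pos)
  qed
  show "Q2 x < 0" if "y0 < x" "x < r0"
  proof -
    have "(x - y0) * (x - r0) < 0" by (rule mult_pos_neg) (use that in auto)
    then show ?thesis unfolding Q2_factor using e by (rule divide_neg_pos)
  qed
  show "Q2 y0 = 0" by (simp add: Q2_factor)
qed

lemma Qp_sign: "- \<epsilon> < x \<Longrightarrow> x < y0 \<Longrightarrow> Qp x < 0" "y0 < x \<Longrightarrow> x < r0 \<Longrightarrow> Qp x > 0" "Qp y0 = 0"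
proof -
  show "Qp x < 0" if x: "- \<epsilon> < x" "x < y0"
  proof -
    have "x < r0" using x r0_gt y0_bounds by auto
    then have "hfac x > 0" using x by (intro hfac_pos) auto
    then show ?thesis unfolding Qp_factor using x by (simp add: sgn_if mult_pos_pos)
  qed
  show "Qp x > 0" if x: "y0 < x" "x < r0"
  proof -
    have "hfac x > 0" using x y0_bounds eps_pos by (intro hfac_pos) auto
    then show ?thesis unfolding Qp_factor using x by (simp add: sgn_if mult_pos_pos)
  qed
  show "Qp y0 = 0" by (simp add: Qp_factor)
qed

lemma inner_min:
  assumes "x \<in> {y0<..<1 - y0}"
  shows "y0 < min (min x (1 - x)) \<epsilon>" "min (min x (1 - x)) \<epsilon> < r0"
  using assms y0_bounds r0_gt eps_pos by (auto simp: min_def)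

lemma outer_min:
  assumes "x \<in> {0..1}" "x \<notin> {y0..1 - y0}"
  shows "- \<epsilon> < min (min x (1 - x)) \<epsilon>" "min (min x (1 - x)) \<epsilon> < y0"
  using assms y0_bounds eps_pos by (auto simp: min_def)

lemma inner_sign:
  assumes "x \<in> {y0<..<1 - y0}"
  shows "p1 \<epsilon> x > 0" "phi2 \<epsilon> x < 0"
  unfolding p1_eq phi2_eq using inner_min[OF assms] by (auto intro: Qp_sign Q2_sign)

lemma outer_sign:
  assumes "x \<in> {0..1}" "x \<notin> {y0..1 - y0}"
  shows "p1 \<epsilon> x < 0" "phi2 \<epsilon> x > 0"
  unfolding p1_eq phi2_eq using outer_min[OF assms] by (auto intro: Qp_sign Q2_sign)

lemma zero_points:
  assumes "y \<in> {y0, 1 - y0}"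
  shows "p1 \<epsilon> y = 0" "phi2 \<epsilon> y = 0"
proof -
  have "min (min y (1 - y)) \<epsilon> = y0" using assms y0_bounds by auto
  then show "p1 \<epsilon> y = 0" "phi2 \<epsilon> y = 0" unfolding p1_eq phi2_eq using Q2_sign(3) Qp_sign(3) by simp_all
qed

lemma sign_cases:
  assumes "x \<in> {0..1} - {y0, 1 - y0}"
  shows "(p1 \<epsilon> x > 0 \<and> phi2 \<epsilon> x < 0) \<or> (p1 \<epsilon> x < 0 \<and> phi2 \<epsilon> x > 0)"
  using inner_sign[of x] outer_sign[of x] assms by (cases "x \<in> {y0..1 - y0}") auto

lemma M_plus_eq: "M_plus \<epsilon> = {y0<..<1 - y0}"
proof
  show "M_plus \<epsilon> \<subseteq> {y0<..<1 - y0}"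
  proof
    fix x assume x: "x \<in> M_plus \<epsilon>"
    then have x: "x \<in> {0..1}" "p1 \<epsilon> x > 0" by (auto simp: M_plus_def)
    show "x \<in> {y0<..<1 - y0}"
    proof (rule ccontr)
      assume "x \<notin> {y0<..<1 - y0}"
      then consider "x \<in> {y0, 1 - y0}" | "x \<notin> {y0..1 - y0}" by fastforce
      then show False using x zero_points outer_sign[of x] by cases force+
    qed
  qed
  show "{y0<..<1 - y0} \<subseteq> M_plus \<epsilon>" using inner_sign y0_bounds by (auto simp: M_plus_def)
qed

lemma frontier_M_plus: "frontier (M_plus \<epsilon>) = {y0, 1 - y0}"
  unfolding M_plus_eq using y0_bounds by (auto simp: frontier_def)

text \<open>\<open>p1\<close> and \<open>phi2\<close> change sign together, so the weight is
  positive even where \<open>p1\<close> is negative.\<close>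

lemma w1_pos: "x \<in> {0..1} - {y0, 1 - y0} \<Longrightarrow> w1 \<epsilon> x > 0"
  using sign_cases[of x] by (auto simp: w1_def divide_neg_pos divide_pos_neg)

lemma w1_nonneg: "x \<in> {0..1} \<Longrightarrow> w1 \<epsilon> x \<ge> 0"
  using w1_pos[of x] zero_points[of x] by (cases "x \<in> {y0, 1 - y0}") (auto simp: w1_def less_imp_le)

lemma w1_continuous: "continuous_on ({0..1} - {y0, 1 - y0}) (w1 \<epsilon>)"
  unfolding w1_def using sign_cases
  by (intro continuous_intros continuous_on_subset[OF p1_continuous] phi2_continuous) force+

text \<open>At the junction \<open>x = \<epsilon>\<close> the left piece arrives with derivative 0,
  because \<open>Q1\<close> vanishes there, and so fits the constant middle piece.\<close>

lemma p1_deriv_left: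
  assumes x: "- \<epsilon> < x" "x < 1 - \<epsilon>" "x \<noteq> y0"
  shows "(p1 \<epsilon> has_real_derivative p1 \<epsilon> x * (phi1 \<epsilon> x / phi2 \<epsilon> x)) (at x)"
proof -
  consider "x < \<epsilon>" | "x = \<epsilon>" | "\<epsilon> < x" by linarith
  then show ?thesis
  proof cases
    case 1
    then have "(Qp has_real_derivative Qp x * (Q1 x / Q2 x)) (at x)"
      using r0_gt eps_pos x by (intro Qp_deriv) auto
    then have "(p1 \<epsilon> has_real_derivative Qp x * (Q1 x / Q2 x)) (at x)"
      by (rule has_field_derivative_transform_within_open[where S = "{..<\<epsilon>}"]) (use 1 in \<open>auto simp: p1_left\<close>)
    then show ?thesis using 1 by (simp add: p1_left phi1_left phi2_left)
  next
    case 2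
    have "(Qp has_real_derivative Qp \<epsilon> * (Q1 \<epsilon> / Q2 \<epsilon>)) (at \<epsilon>)"
      using r0_gt eps_pos y0_bounds by (intro Qp_deriv) auto
    then have "(Qp has_real_derivative 0) (at \<epsilon>)" by (simp add: Q_eps)
    then have lim: "((\<lambda>y. (Qp y - Qp \<epsilon>) / (y - \<epsilon>)) \<longlongrightarrow> 0) (at \<epsilon>)" by (simp add: has_field_derivative_iff)
    \<comment> \<open>Left of \<epsilon> the quotient of \<open>p1\<close> is that of
      \<open>Qp\<close> and right of it the quotient is zero, so that of \<open>Qp\<close> dominates
      in both cases.\<close>
    have "((\<lambda>y. (p1 \<epsilon> y - p1 \<epsilon> \<epsilon>) / (y - \<epsilon>)) \<longlongrightarrow> 0) (at \<epsilon>)"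
    proof (rule Lim_null_comparison[OF _ tendsto_norm_zero[OF lim]])
      have "\<forall>\<^sub>F y in at \<epsilon>. y \<in> {..<1 - \<epsilon>}"
        using eps_le by (intro eventually_at_in_open') auto
      then show "\<forall>\<^sub>F y in at \<epsilon>. norm ((p1 \<epsilon> y - p1 \<epsilon> \<epsilon>) / (y - \<epsilon>)) \<le> norm ((Qp y - Qp \<epsilon>) / (y - \<epsilon>))"
      proof eventually_elim
        case (elim y)
        then show ?case
        proof (cases "y \<le> \<epsilon>")
          case False
          then have "p1 \<epsilon> y = 1/6" using elim by (simp add: p1_def)
          moreover have "p1 \<epsilon> \<epsilon> = 1/6" by (simp add: p1_left Qp_eps)
          ultimately have "p1 \<epsilon> y - p1 \<epsilon> \<epsilon> = 0" by simp
          then show ?thesis by (simp only: div_0 norm_zero norm_ge_zero)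
        qed (simp add: p1_left)
      qed
    qed
    then show ?thesis using 2 by (simp add: has_field_derivative_iff phi1_left Q_eps)
  next
    case 3
    have "((\<lambda>_. 1/6) has_real_derivative 0) (at x)" by simp
    then have "(p1 \<epsilon> has_real_derivative 0) (at x)"
      by (rule has_field_derivative_transform_within_open[where S = "{\<epsilon><..<1 - \<epsilon>}"])
        (use 3 x in \<open>auto simp: p1_def\<close>)
    moreover have "phi1 \<epsilon> x = 0" using 3 x by (simp add: phi1_def)
    ultimately show ?thesis by simp
  qed
qed

lemma p1_deriv:
  assumes x: "x \<in> {0..1} - {y0, 1 - y0}"
  shows "(p1 \<epsilon> has_real_derivative p1 \<epsilon> x * (phi1 \<epsilon> x / phi2 \<epsilon> x)) (at x)"
proof (cases "x < 1 - \<epsilon>")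
  case True
  then show ?thesis using x eps_pos by (intro p1_deriv_left) auto
next
  case False
  have "(p1 \<epsilon> has_real_derivative p1 \<epsilon> (1 - x) * (phi1 \<epsilon> (1 - x) / phi2 \<epsilon> (1 - x))) (at (1 - x))"
    using False x eps_le eps_pos by (intro p1_deriv_left) auto
  then have "((\<lambda>y. p1 \<epsilon> (1 - y)) has_real_derivative p1 \<epsilon> (1 - x) * (phi1 \<epsilon> (1 - x) / phi2 \<epsilon> (1 - x)) * (- 1)) (at x)"
    by (rule DERIV_chain2) (auto intro!: derivative_eq_intros)
  then show ?thesis by (simp add: p1_reflect phi1_reflect phi2_reflect)
qed

lemma phi1_neg: "x \<in> {0..<\<epsilon>} \<Longrightarrow> phi1 \<epsilon> x < 0"
  using eps_pos by (simp add: phi1_left Q1_def field_simps)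

lemma p1_deriv_w1:
  assumes x: "x \<in> {0..1} - {y0, 1 - y0}"
  shows "(p1 \<epsilon> has_real_derivative w1 \<epsilon> x * (- phi1 \<epsilon> x)) (at x)"
  using p1_deriv[OF x] by (simp add: w1_def)

text \<open>Near a singular point \<open>w1 = p1' / (- phi1)\<close> with \<open>phi1\<close>
  bounded away from zero, so \<open>p1\<close> or \<open>- p1\<close> is the required
  antiderivative. It is continuous but not differentiable at the singular point, which therefore
  goes into the exceptional set \<open>S\<close>. The cut at \<epsilon>/2 lies between
  \<open>y0\<close> and the zero of \<open>phi1\<close> at \<epsilon>.\<close>

lemma w1_integrable: "w1 \<epsilon> absolutely_integrable_on {0..1}"
proof -
  have half: "\<epsilon> / 2 \<le> 1 - \<epsilon> / 2" using eps_le by simp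
  have 1: "w1 \<epsilon> absolutely_integrable_on {0..\<epsilon> / 2}"
  proof (rule absolutely_integrable_of_derivative[where q = "p1 \<epsilon>" and k = "\<lambda>x. - phi1 \<epsilon> x" and S = "{y0}"])
    show "continuous_on {0..\<epsilon> / 2} (p1 \<epsilon>)" by (rule continuous_on_subset[OF p1_continuous]) (use eps_le in auto)
    show "continuous_on {0..\<epsilon> / 2} (\<lambda>x. - phi1 \<epsilon> x)"
      by (intro continuous_intros continuous_on_subset[OF phi1_continuous]) (use eps_le in auto)
    show "(p1 \<epsilon> has_real_derivative w1 \<epsilon> x * (- phi1 \<epsilon> x)) (at x)" if "x \<in> {0<..<\<epsilon> / 2} - {y0}" for x
      by (rule p1_deriv_w1) (use that y0_bounds eps_le in auto)
    show "- phi1 \<epsilon> x > 0" if "x \<in> {0..\<epsilon> / 2}" for x using phi1_neg[of x] that eps_pos by auto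
    show "w1 \<epsilon> x \<ge> 0" if "x \<in> {0..\<epsilon> / 2}" for x using that eps_le by (intro w1_nonneg) auto
  qed (use eps_pos in auto)
  have 2: "w1 \<epsilon> absolutely_integrable_on {\<epsilon> / 2..1 - \<epsilon> / 2}"
    by (intro absolutely_integrable_continuous_real continuous_on_subset[OF w1_continuous])
      (use y0_bounds eps_le eps_pos in auto)
  have 3: "w1 \<epsilon> absolutely_integrable_on {1 - \<epsilon> / 2..1}"
  proof (rule absolutely_integrable_of_derivative[where q = "\<lambda>x. - p1 \<epsilon> x" and k = "phi1 \<epsilon>" and S = "{1 - y0}"])
    show "continuous_on {1 - \<epsilon> / 2..1} (\<lambda>x. - p1 \<epsilon> x)"
      by (intro continuous_intros continuous_on_subset[OF p1_continuous]) (use eps_le in auto)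
    show "continuous_on {1 - \<epsilon> / 2..1} (phi1 \<epsilon>)"
      by (rule continuous_on_subset[OF phi1_continuous]) (use eps_le in auto)
    show "((\<lambda>x. - p1 \<epsilon> x) has_real_derivative w1 \<epsilon> x * phi1 \<epsilon> x) (at x)" if "x \<in> {1 - \<epsilon> / 2<..<1} - {1 - y0}" for x
    proof -
      have "x \<in> {0..1} - {y0, 1 - y0}" using that y0_bounds eps_le by auto
      from DERIV_minus[OF p1_deriv_w1[OF this]] show ?thesis by simp
    qed
    show "phi1 \<epsilon> x > 0" if "x \<in> {1 - \<epsilon> / 2..1}" for x
      using phi1_neg[of "1 - x"] that eps_pos by (auto simp: phi1_reflect)
    show "w1 \<epsilon> x \<ge> 0" if "x \<in> {1 - \<epsilon> / 2..1}" for x using that eps_le by (intro w1_nonneg) auto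
  qed (use eps_pos in auto)
  show ?thesis
    by (rule absolutely_integrable_combine_real[OF 1 absolutely_integrable_combine_real[OF 2 3]])
      (use half eps_pos in auto)
qed

text \<open>Near \<open>y0\<close> the quotient \<open>hfac / p1\<close> is
  \<open>(x - y0) powr (- \<alpha>)\<close>, whose antiderivative
  \<open>(x - y0) powr (1 - \<alpha>) / (1 - \<alpha>)\<close> is continuous up to \<open>y0\<close>
  because \<alpha> < 1. Reflection handles the other endpoint.\<close>

lemma inverse_p1_integrable: "(\<lambda>x. 1 / p1 \<epsilon> x) absolutely_integrable_on {y0..1 - y0}"
proof -
  have p_nonneg: "p1 \<epsilon> x \<ge> 0" if "x \<in> {y0..1 - y0}" for x
    using inner_sign(1)[of x] zero_points[of x] that by (cases "x \<in> {y0, 1 - y0}") auto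
  have der: "((\<lambda>x. (x - y0) powr (1 - \<alpha>) / (1 - \<alpha>)) has_real_derivative 1 / p1 \<epsilon> x * hfac x) (at x)"
    if x: "x \<in> {y0<..<\<epsilon>}" for x
  proof -
    have "((\<lambda>x. (x - y0) powr (1 - \<alpha>) / (1 - \<alpha>)) has_real_derivative ((1 - \<alpha>) * (x - y0) powr (1 - \<alpha> - 1) * 1) / (1 - \<alpha>)) (at x)"
      by (intro DERIV_cdivide DERIV_chain2[OF has_real_derivative_powr])
        (use x in \<open>auto intro!: derivative_eq_intros\<close>)
    moreover have "((1 - \<alpha>) * (x - y0) powr (1 - \<alpha> - 1) * 1) / (1 - \<alpha>) = (x - y0) powr (- \<alpha>)"
      using alpha_bounds by simp
    moreover have "hfac x > 0" using x r0_gt y0_bounds eps_pos by (intro hfac_pos) auto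
    then have "(x - y0) powr (- \<alpha>) = 1 / p1 \<epsilon> x * hfac x"
      using x by (simp add: p1_left Qp_factor powr_minus field_simps)
    ultimately show ?thesis by simp
  qed
  have hc: "continuous_on {y0..\<epsilon> / 2} hfac"
    by (rule continuous_on_subset[OF hfac_continuous]) (use y0_bounds r0_gt eps_pos in auto)
  have hp: "hfac x > 0" if "x \<in> {y0..\<epsilon> / 2}" for x
    using that y0_bounds r0_gt eps_pos by (intro hfac_pos) auto
  have qc: "continuous_on {y0..\<epsilon> / 2} (\<lambda>x. (x - y0) powr (1 - \<alpha>) / (1 - \<alpha>))"
    using alpha_bounds by (intro continuous_intros continuous_on_powr') auto
  have 1: "(\<lambda>x. 1 / p1 \<epsilon> x) absolutely_integrable_on {y0..\<epsilon> / 2}"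
    by (rule absolutely_integrable_of_derivative[OF _ qc finite.emptyI der hc hp])
      (use p_nonneg y0_bounds eps_pos eps_le in auto)
  have 2: "(\<lambda>x. 1 / p1 \<epsilon> x) absolutely_integrable_on {\<epsilon> / 2..1 - \<epsilon> / 2}"
  proof (intro absolutely_integrable_continuous_real continuous_intros)
    show "continuous_on {\<epsilon> / 2..1 - \<epsilon> / 2} (p1 \<epsilon>)"
      by (rule continuous_on_subset[OF p1_continuous]) (use eps_pos in auto)
    show "\<forall>x\<in>{\<epsilon> / 2..1 - \<epsilon> / 2}. p1 \<epsilon> x \<noteq> 0"
    proof
      fix x assume "x \<in> {\<epsilon> / 2..1 - \<epsilon> / 2}"
      then have "x \<in> {y0<..<1 - y0}" using y0_bounds by auto
      from inner_sign(1)[OF this] show "p1 \<epsilon> x \<noteq> 0" by simp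
    qed
  qed
  have 3: "(\<lambda>x. 1 / p1 \<epsilon> x) absolutely_integrable_on {1 - \<epsilon> / 2..1 - y0}"
  proof (rule absolutely_integrable_of_derivative[where
        q = "\<lambda>x. - ((1 - x - y0) powr (1 - \<alpha>) / (1 - \<alpha>))" and k = "\<lambda>x. hfac (1 - x)" and S = "{}"])
    show "continuous_on {1 - \<epsilon> / 2..1 - y0} (\<lambda>x. - ((1 - x - y0) powr (1 - \<alpha>) / (1 - \<alpha>)))"
      using alpha_bounds by (intro continuous_intros continuous_on_powr') auto
    show "continuous_on {1 - \<epsilon> / 2..1 - y0} (\<lambda>x. hfac (1 - x))"
      by (rule continuous_on_compose2[OF hc]) (auto intro!: continuous_intros)
    show "hfac (1 - x) > 0" if "x \<in> {1 - \<epsilon> / 2..1 - y0}" for x using that by (intro hp) auto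
    show "1 / p1 \<epsilon> x \<ge> 0" if "x \<in> {1 - \<epsilon> / 2..1 - y0}" for x
      using that y0_bounds eps_le p_nonneg[of x] by auto
    fix x assume x: "x \<in> {1 - \<epsilon> / 2<..<1 - y0} - {}"
    then have "((\<lambda>x. (x - y0) powr (1 - \<alpha>) / (1 - \<alpha>)) has_real_derivative 1 / p1 \<epsilon> (1 - x) * hfac (1 - x)) (at (1 - x))"
      using eps_pos by (intro der) auto
    then have "((\<lambda>x. (1 - x - y0) powr (1 - \<alpha>) / (1 - \<alpha>)) has_real_derivative 1 / p1 \<epsilon> (1 - x) * hfac (1 - x) * (- 1)) (at x)"
      by (rule DERIV_chain2) (auto intro!: derivative_eq_intros)
    from DERIV_minus[OF this]
    show "((\<lambda>x. - ((1 - x - y0) powr (1 - \<alpha>) / (1 - \<alpha>))) has_real_derivative 1 / p1 \<epsilon> x * hfac (1 - x)) (at x)"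
      by (simp add: p1_reflect)
  qed (use y0_bounds in auto)
  show ?thesis
    by (rule absolutely_integrable_combine_real[OF 1 absolutely_integrable_combine_real[OF 2 3]])
      (use y0_bounds eps_le in auto)
qed

section \<open>Derivatives and signs of the coefficients near the singular points\<close>

definition Q2' :: "real \<Rightarrow> real" where "Q2' x = (2 * x - 4 * \<epsilon>) / (12 * \<epsilon>\<^sup>2)"
definition Q1' :: "real \<Rightarrow> real" where
  "Q1' x = (6 / \<epsilon>) / (1 + x/\<epsilon>) ^ 3 + 18 * (1 - x/\<epsilon>) / \<epsilon> / (1 + x/\<epsilon>) ^ 4"

lemma Q2_deriv: "(Q2 has_real_derivative Q2' x) (at x)"
proof -
  have "((\<lambda>x. (1/12) * (1 - 4 * (x/\<epsilon>) + (x/\<epsilon>)\<^sup>2)) has_real_derivative (1/12) * (0 - 4 * (1/\<epsilon>) + 2 * (x/\<epsilon>) * (1/\<epsilon>))) (at x)"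
    by (rule derivative_eq_intros refl | use eps_pos in simp)+
  moreover have "(1/12) * (0 - 4 * (1/\<epsilon>) + 2 * (x/\<epsilon>) * (1/\<epsilon>)) = Q2' x"
    using eps_pos by (simp add: Q2'_def field_simps power2_eq_square)
  ultimately show ?thesis by (simp add: Q2_def[abs_def])
qed

lemma Q1_deriv:
  assumes "- \<epsilon> < x"
  shows "(Q1 has_real_derivative Q1' x) (at x)"
proof -
  define d where "d = 1 + x / \<epsilon>"
  have d: "d \<noteq> 0" using assms eps_pos by (simp add: d_def field_simps)
  have n: "((\<lambda>x. - 6 * (1 - x/\<epsilon>)) has_real_derivative 6 / \<epsilon>) (at x)"
    using eps_pos by (auto intro!: derivative_eq_intros)
  have "((\<lambda>x. 1 + x/\<epsilon>) has_real_derivative 1 / \<epsilon>) (at x)"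
    using eps_pos by (auto intro!: derivative_eq_intros)
  from DERIV_power_Suc[OF this, of 2]
  have dd: "((\<lambda>x. (1 + x/\<epsilon>) ^ 3) has_real_derivative 3 * (1 / \<epsilon> * d\<^sup>2)) (at x)"
    by (simp add: d_def numeral_3_eq_3)
  have "((\<lambda>x. - 6 * (1 - x/\<epsilon>) / (1 + x/\<epsilon>) ^ 3) has_real_derivative
     (6 / \<epsilon> * (1 + x/\<epsilon>) ^ 3 - - 6 * (1 - x/\<epsilon>) * (3 * (1 / \<epsilon> * d\<^sup>2))) / ((1 + x/\<epsilon>) ^ 3 * (1 + x/\<epsilon>) ^ 3)) (at x)"
    by (rule DERIV_divide[OF n dd]) (use d in \<open>simp add: d_def\<close>)
  moreover have "(6 / \<epsilon> * (1 + x/\<epsilon>) ^ 3 - - 6 * (1 - x/\<epsilon>) * (3 * (1 / \<epsilon> * d\<^sup>2))) / ((1 + x/\<epsilon>) ^ 3 * (1 + x/\<epsilon>) ^ 3) = Q1' x"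
  proof -
    have gen: "(A * d ^ 3 - - 6 * B * (3 * (C * d\<^sup>2))) / (d ^ 3 * d ^ 3) = A / d ^ 3 + 18 * B * C / d ^ 4" for A B C
      using d by (simp add: field_simps power2_eq_square power3_eq_cube power4_eq_xxxx)
    show ?thesis unfolding Q1'_def d_def[symmetric] gen by simp
  qed
  ultimately show ?thesis by (simp add: Q1_def[abs_def])
qed

lemma Q2'_continuous: "isCont Q2' x"
  unfolding Q2'_def by (intro continuous_intros) (use eps_pos in auto)

lemma Q1'_continuous: "- \<epsilon> < x \<Longrightarrow> isCont Q1' x"
  unfolding Q1'_def by (intro continuous_intros) (use eps_pos in \<open>auto simp: field_simps\<close>)

text \<open>These are the derivatives of \<open>phi2\<close> and \<open>phi1\<close> near the
  singular points. Each \<open>nbhd\<close> lies on one side of 1/2, so the switch merely selects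
  the left formula or its reflection.\<close>

definition phi2' :: "real \<Rightarrow> real" where "phi2' x = (if x < 1/2 then Q2' x else - Q2' (1 - x))"
definition phi1' :: "real \<Rightarrow> real" where "phi1' x = (if x < 1/2 then Q1' x else Q1' (1 - x))"

text \<open>As \<epsilon>/5 < \<open>y0\<close> < 3 \<epsilon>/10, this radius keeps the
  neighbourhood of \<open>y0\<close> inside \<open>(0, \<epsilon>/2)\<close>, where the left
  formulas are valid and \<open>phi1\<close> is negative.\<close>

abbreviation nbhd :: "real \<Rightarrow> real set" where "nbhd y \<equiv> {y - \<epsilon> / 5<..<y + \<epsilon> / 5}"

text \<open>The sign facts make the limits at \<open>y\<close> possible: \<open>phi1\<close> keeps
  its sign, so it can be divided by, and \<open>phi1 * phi2'\<close> > 0 prevents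
  \<open>phi1 + phi2'\<close> from vanishing, which is the denominator in the limit of the second
  derivative. Both factors are negative near \<open>y0\<close> and positive near
  \<open>1 - y0\<close>.\<close>

lemma nbhd_facts:
  assumes y: "y \<in> {y0, 1 - y0}" and x: "x \<in> nbhd y"
  shows "x \<in> {0..1}" "x \<noteq> y \<Longrightarrow> x \<in> {0..1} - {y0, 1 - y0}"
    "(phi2 \<epsilon> has_real_derivative phi2' x) (at x)" "(phi1 \<epsilon> has_real_derivative phi1' x) (at x)"
    "isCont phi2' x" "isCont phi1' x" "phi1 \<epsilon> x \<noteq> 0" "phi1 \<epsilon> x * phi2' x > 0"
    "phi1 \<epsilon> x * phi1 \<epsilon> y > 0"
proof -
  note yb = y0_bounds and e = eps_pos eps_le
  show "x \<in> {0..1}" "x \<noteq> y \<Longrightarrow> x \<in> {0..1} - {y0, 1 - y0}" using y x yb e by auto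
  have left: "(phi2 \<epsilon> has_real_derivative Q2' t) (at t)" "(phi1 \<epsilon> has_real_derivative Q1' t) (at t)"
    "isCont Q2' t" "isCont Q1' t" "phi1 \<epsilon> t < 0" "Q2' t < 0"
    if t: "0 < t" "t < \<epsilon>" for t
  proof -
    show "(phi2 \<epsilon> has_real_derivative Q2' t) (at t)"
      by (rule has_field_derivative_transform_within_open[OF Q2_deriv, of "{..<\<epsilon>}"]) (use t in \<open>auto simp: phi2_left\<close>)
    have "(Q1 has_real_derivative Q1' t) (at t)" by (rule Q1_deriv) (use t e in auto)
    then show "(phi1 \<epsilon> has_real_derivative Q1' t) (at t)"
      by (rule has_field_derivative_transform_within_open[of _ _ _ "{..<\<epsilon>}"]) (use t in \<open>auto simp: phi1_left\<close>)
    show "isCont Q2' t" by (rule Q2'_continuous)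
    show "isCont Q1' t" by (rule Q1'_continuous) (use t e in auto)
    show "phi1 \<epsilon> t < 0" by (rule phi1_neg) (use t in auto)
    show "Q2' t < 0" unfolding Q2'_def using t e by (intro divide_neg_pos) auto
  qed
  consider "y = y0" | "y = 1 - y0" using y by auto
  then have "(phi2 \<epsilon> has_real_derivative phi2' x) (at x) \<and> (phi1 \<epsilon> has_real_derivative phi1' x) (at x) \<and>
    isCont phi2' x \<and> isCont phi1' x \<and> phi1 \<epsilon> x * phi2' x > 0 \<and> phi1 \<epsilon> x * phi1 \<epsilon> y > 0"
  proof cases
    case 1
    then have x': "0 < x" "x < \<epsilon>" "x < 1/2" using x yb e by auto
    have eq: "phi2' x = Q2' x" "phi1' x = Q1' x" using x' by (auto simp: phi2'_def phi1'_def)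
    have "\<forall>\<^sub>F t in nhds x. t < 1/2" using x' by (intro eventually_nhds_in_open[of "{..<1/2}", simplified]) auto
    then have ev: "\<forall>\<^sub>F t in nhds x. phi2' t = Q2' t" "\<forall>\<^sub>F t in nhds x. phi1' t = Q1' t"
      by (auto elim!: eventually_mono simp: phi2'_def phi1'_def)
    show ?thesis using left[OF x'(1,2)] left(5)[of y] 1 yb eq
      isCont_cong[OF ev(1)] isCont_cong[OF ev(2)] by (auto intro: mult_neg_neg)
  next
    case 2
    then have x': "0 < 1 - x" "1 - x < \<epsilon>" "\<not> x < 1/2" "x > 1/2" using x yb e by auto
    have eq: "phi2' x = - Q2' (1 - x)" "phi1' x = Q1' (1 - x)" using x' by (auto simp: phi2'_def phi1'_def)
    have "\<forall>\<^sub>F t in nhds x. t > 1/2" using x' by (intro eventually_nhds_in_open[of "{1/2<..}", simplified]) auto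
    then have ev: "\<forall>\<^sub>F t in nhds x. phi2' t = - Q2' (1 - t)" "\<forall>\<^sub>F t in nhds x. phi1' t = Q1' (1 - t)"
      by (auto elim!: eventually_mono simp: phi2'_def phi1'_def)
    have c: "isCont (\<lambda>t. - Q2' (1 - t)) x" "isCont (\<lambda>t. Q1' (1 - t)) x"
      using left(3,4)[OF x'(1,2)] by (auto intro!: isCont_minus isCont_o2[where g = Q2'] isCont_o2[where g = Q1'] continuous_intros)
    have "((\<lambda>t. phi2 \<epsilon> (1 - t)) has_real_derivative Q2' (1 - x) * (- 1)) (at x)"
      by (rule DERIV_chain2[where f = "phi2 \<epsilon>" and g = "\<lambda>t. 1 - t"])
        (use left(1)[OF x'(1,2)] in \<open>auto intro!: derivative_eq_intros\<close>)
    then have d2: "(phi2 \<epsilon> has_real_derivative - Q2' (1 - x)) (at x)" by (simp add: phi2_reflect)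
    have "((\<lambda>t. - phi1 \<epsilon> (1 - t)) has_real_derivative - (Q1' (1 - x) * (- 1))) (at x)"
      by (intro DERIV_minus DERIV_chain2[where f = "phi1 \<epsilon>" and g = "\<lambda>t. 1 - t"])
        (use left(2)[OF x'(1,2)] in \<open>auto intro!: derivative_eq_intros\<close>)
    then have d1: "(phi1 \<epsilon> has_real_derivative Q1' (1 - x)) (at x)" by (simp add: phi1_reflect)
    have s: "phi1 \<epsilon> x > 0" "phi1 \<epsilon> y > 0"
      using left(5)[OF x'(1,2)] left(5)[of "1 - y"] 2 yb by (auto simp: phi1_reflect)
    show ?thesis using d1 d2 s left(6)[OF x'(1,2)] eq c isCont_cong[OF ev(1)] isCont_cong[OF ev(2)]
      by (auto simp: mult_pos_neg)
  qed
  then show "(phi2 \<epsilon> has_real_derivative phi2' x) (at x)" "(phi1 \<epsilon> has_real_derivative phi1' x) (at x)"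
    "isCont phi2' x" "isCont phi1' x" "phi1 \<epsilon> x \<noteq> 0" "phi1 \<epsilon> x * phi2' x > 0" "phi1 \<epsilon> x * phi1 \<epsilon> y > 0" by auto
qed

end

section \<open>Solutions near the singular points\<close>

text \<open>Cauchy's mean value theorem fails for complex values, so \<open>F = N - q L\<close> is
  bounded by a mean value inequality instead: \<open>|F'|\<close> \<le> \<open>(e/2) q'\<close>
  gives \<open>|F|\<close> \<le> \<open>(e/2) |q|\<close> on each side of \<open>y\<close>, because
  \<open>F\<close> and \<open>q\<close> vanish at \<open>y\<close>.\<close>

lemma complex_lhospital_pos:
  fixes N r :: "real \<Rightarrow> complex" and q q' :: "real \<Rightarrow> real"
  assumes "\<delta> > 0" and N: "continuous_on {y - \<delta><..<y + \<delta>} N" and q: "continuous_on {y - \<delta><..<y + \<delta>} q"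
    and zero: "N y = 0" "q y = 0"
    and N': "\<And>x. \<lbrakk>\<bar>x - y\<bar> < \<delta>; x \<noteq> y\<rbrakk> \<Longrightarrow> (N has_vector_derivative q' x *\<^sub>R r x) (at x)"
    and q': "\<And>x. \<lbrakk>\<bar>x - y\<bar> < \<delta>; x \<noteq> y\<rbrakk> \<Longrightarrow> (q has_real_derivative q' x) (at x)"
    and pos: "\<And>x. \<lbrakk>\<bar>x - y\<bar> < \<delta>; x \<noteq> y\<rbrakk> \<Longrightarrow> q' x > 0"
    and r: "(r \<longlongrightarrow> L) (at y)"
  shows "((\<lambda>x. (1 / q x) *\<^sub>R N x) \<longlongrightarrow> L) (at y)"
proof (rule tendstoI)
  fix e :: real assume "e > 0"
  then have "\<forall>\<^sub>F x in at y. dist (r x) L < e / 2" using r by (intro tendstoD) auto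
  then obtain d0 where "d0 > 0" and d0: "\<And>x. \<lbrakk>x \<noteq> y; dist x y < d0\<rbrakk> \<Longrightarrow> dist (r x) L < e / 2"
    unfolding eventually_at by auto
  define d where "d = min d0 \<delta>"
  have d: "d > 0" "d \<le> \<delta>" using \<open>d0 > 0\<close> \<open>\<delta> > 0\<close> by (auto simp: d_def)
  define F where "F x = N x - q x *\<^sub>R L" for x
  have diff: "norm (F v - F u) \<le> (e/2) * q v - (e/2) * q u"
    if uv: "u < v" "\<bar>u - y\<bar> < d" "\<bar>v - y\<bar> < d" and out: "v \<le> y \<or> y \<le> u" for u v
  proof (rule differentiable_bound_general[OF \<open>u < v\<close>, where f' = "\<lambda>x. q' x *\<^sub>R r x - q' x *\<^sub>R L" and \<phi>' = "\<lambda>x. (e/2) * q' x"])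
    have sub: "{u..v} \<subseteq> {y - \<delta><..<y + \<delta>}" using uv d by auto
    show "continuous_on {u..v} F" unfolding F_def
      by (intro continuous_intros continuous_on_subset[OF N sub] continuous_on_subset[OF q sub])
    show "continuous_on {u..v} (\<lambda>x. (e/2) * q x)"
      by (intro continuous_intros continuous_on_subset[OF q sub])
    fix x assume x: "u < x" "x < v"
    then have x': "\<bar>x - y\<bar> < \<delta>" "x \<noteq> y" "\<bar>x - y\<bar> < d0" using uv d out by (auto simp: d_def)
    have qd: "(q has_vector_derivative q' x) (at x)"
      using q'[OF x'(1,2)] by (simp add: has_real_derivative_iff_has_vector_derivative)
    show "(F has_vector_derivative q' x *\<^sub>R r x - q' x *\<^sub>R L) (at x)"
      unfolding F_def by (intro has_vector_derivative_diff N'[OF x'(1,2)]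
        bounded_linear.has_vector_derivative[OF bounded_linear_scaleR_left qd])
    show "((\<lambda>x. (e/2) * q x) has_vector_derivative (e/2) * q' x) (at x)"
      using DERIV_cmult[OF q'[OF x'(1,2)], of "e/2"] by (simp add: has_real_derivative_iff_has_vector_derivative)
    have "norm (r x - L) \<le> e/2" using d0[of x] x' by (simp add: dist_norm less_imp_le)
    then have "q' x * norm (r x - L) \<le> q' x * (e/2)"
      using pos[OF x'(1,2)] by (intro mult_left_mono) auto
    then show "norm (q' x *\<^sub>R r x - q' x *\<^sub>R L) \<le> (e/2) * q' x"
      using pos[OF x'(1,2)] by (simp add: mult.commute flip: scaleR_diff_right)
  qed
  have qmono: "q u < q v" if uv: "u < v" "\<bar>u - y\<bar> < d" "\<bar>v - y\<bar> < d" and out: "v \<le> y \<or> y \<le> u" for u v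
  proof (rule DERIV_pos_imp_increasing_open[where f = q and a = u and b = v])
    show "continuous_on {u..v} q" by (rule continuous_on_subset[OF q]) (use uv d in auto)
    fix x assume x: "u < x" "x < v"
    then have x': "\<bar>x - y\<bar> < \<delta>" "x \<noteq> y" using uv d out by auto
    then show "\<exists>D. DERIV q x :> D \<and> D > 0" using q' pos by blast
  qed (use uv in auto)
  have F0: "F y = 0" by (simp add: F_def zero)
  show "\<forall>\<^sub>F x in at y. dist ((1 / q x) *\<^sub>R N x) L < e"
    unfolding eventually_at
  proof (intro exI[of _ d] conjI \<open>d > 0\<close> ballI impI)
    fix x assume "x \<noteq> y \<and> dist x y < d"
    then have x: "x \<noteq> y" "\<bar>x - y\<bar> < d" by (auto simp: dist_real_def)
    have *: "norm (F x) \<le> (e/2) * \<bar>q x\<bar> \<and> q x \<noteq> 0"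
    proof (cases "y < x")
      case True
      then show ?thesis using diff[of y x] qmono[of y x] x d F0 zero by simp
    next
      case False
      then have "x < y" using x by simp
      then show ?thesis using diff[of x y] qmono[of x y] x d F0 zero by simp
    qed
    have "(1 / q x) *\<^sub>R N x - L = (1 / q x) *\<^sub>R F x" using * by (simp add: F_def scaleR_diff_right)
    also have "norm \<dots> = norm (F x) / \<bar>q x\<bar>" by simp
    also have "\<dots> \<le> e / 2" using * by (simp add: divide_le_eq)
    also have "\<dots> < e" using \<open>e > 0\<close> by simp
    finally show "dist ((1 / q x) *\<^sub>R N x) L < e" by (simp add: dist_norm)
  qed
qed

text \<open>The number \<open>s\<close> certifies that \<open>q'\<close> keeps one sign; multiplying
  \<open>N\<close> and \<open>q\<close> by it makes the denominator increasing and leaves the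
  quotient unchanged.\<close>

lemma complex_lhospital:
  fixes N r :: "real \<Rightarrow> complex" and q q' :: "real \<Rightarrow> real"
  assumes "\<delta> > 0" and N: "continuous_on {y - \<delta><..<y + \<delta>} N" and q: "continuous_on {y - \<delta><..<y + \<delta>} q"
    and zero: "N y = 0" "q y = 0"
    and N': "\<And>x. \<lbrakk>\<bar>x - y\<bar> < \<delta>; x \<noteq> y\<rbrakk> \<Longrightarrow> (N has_vector_derivative q' x *\<^sub>R r x) (at x)"
    and q': "\<And>x. \<lbrakk>\<bar>x - y\<bar> < \<delta>; x \<noteq> y\<rbrakk> \<Longrightarrow> (q has_real_derivative q' x) (at x)"
    and sign: "\<And>x. \<lbrakk>\<bar>x - y\<bar> < \<delta>; x \<noteq> y\<rbrakk> \<Longrightarrow> q' x * s > 0"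
    and r: "(r \<longlongrightarrow> L) (at y)"
  shows "((\<lambda>x. (1 / q x) *\<^sub>R N x) \<longlongrightarrow> L) (at y)"
proof -
  have "s \<noteq> 0" using sign[of "y + \<delta>/2"] \<open>\<delta> > 0\<close> by auto
  have "((\<lambda>x. (1 / (s * q x)) *\<^sub>R (s *\<^sub>R N x)) \<longlongrightarrow> L) (at y)"
  proof (rule complex_lhospital_pos[OF \<open>\<delta> > 0\<close>, where q' = "\<lambda>x. s * q' x" and r = r])
    show "continuous_on {y - \<delta><..<y + \<delta>} (\<lambda>x. s *\<^sub>R N x)" "continuous_on {y - \<delta><..<y + \<delta>} (\<lambda>x. s * q x)"
      by (intro continuous_intros N q)+
    fix x assume x: "\<bar>x - y\<bar> < \<delta>" "x \<noteq> y"
    have "((\<lambda>x. s *\<^sub>R N x) has_vector_derivative s *\<^sub>R (q' x *\<^sub>R r x)) (at x)"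
      by (rule bounded_linear.has_vector_derivative[OF bounded_linear_scaleR_right N'[OF x]])
    then show "((\<lambda>x. s *\<^sub>R N x) has_vector_derivative (s * q' x) *\<^sub>R r x) (at x)" by simp
    show "((\<lambda>x. s * q x) has_real_derivative s * q' x) (at x)" by (rule DERIV_cmult[OF q'[OF x]])
    show "s * q' x > 0" using sign[OF x] by (simp add: mult.commute)
  qed (use zero r in auto)
  moreover have "(\<lambda>x. (1 / (s * q x)) *\<^sub>R (s *\<^sub>R N x)) = (\<lambda>x. (1 / q x) *\<^sub>R N x)"
    by (rule ext) (use \<open>s \<noteq> 0\<close> in simp)
  ultimately show ?thesis by (simp only:)
qed

text \<open>The rule with denominator \<open>x - y\<close>; it turns the limits of \<open>u'\<close>
  and \<open>u''\<close> at the singular points into derivatives there.\<close>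

lemma has_vector_derivative_from_limit:
  fixes f f' :: "real \<Rightarrow> complex"
  assumes "\<delta> > 0" and f: "continuous_on {y - \<delta><..<y + \<delta>} f"
    and der: "\<And>x. \<lbrakk>\<bar>x - y\<bar> < \<delta>; x \<noteq> y\<rbrakk> \<Longrightarrow> (f has_vector_derivative f' x) (at x)"
    and lim: "(f' \<longlongrightarrow> L) (at y)"
  shows "(f has_vector_derivative L) (at y)"
proof -
  have "((\<lambda>x. (1 / (x - y)) *\<^sub>R (f x - f y)) \<longlongrightarrow> L) (at y)"
  proof (rule complex_lhospital[OF \<open>\<delta> > 0\<close>, where q' = "\<lambda>_. 1" and r = f' and s = 1])
    fix x assume x: "\<bar>x - y\<bar> < \<delta>" "x \<noteq> y"
    show "((\<lambda>x. f x - f y) has_vector_derivative 1 *\<^sub>R f' x) (at x)"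
      using der[OF x] by (auto intro!: derivative_eq_intros)
    show "((\<lambda>x. x - y) has_real_derivative 1) (at x)" by (auto intro!: derivative_eq_intros)
  qed (use f lim in \<open>auto intro!: continuous_intros\<close>)
  then have "((\<lambda>x. norm ((1 / (x - y)) *\<^sub>R (f x - f y) - L)) \<longlongrightarrow> 0) (at y)"
    by (intro tendsto_norm_zero) (rule LIM_zero)
  then have "((\<lambda>x. (1 / norm (x - y)) *\<^sub>R (f x - (f y + (x - y) *\<^sub>R L))) \<longlongrightarrow> 0) (at y)"
  proof (rule Lim_null_comparison[rotated])
    have "norm ((1 / norm (x - y)) *\<^sub>R (f x - (f y + (x - y) *\<^sub>R L))) \<le> norm ((1 / (x - y)) *\<^sub>R (f x - f y) - L)"
      if "x \<noteq> y" for x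
    proof -
      have "(1 / (x - y)) *\<^sub>R (f x - f y) - L = (1 / (x - y)) *\<^sub>R (f x - (f y + (x - y) *\<^sub>R L))"
        using that by (simp add: scaleR_diff_right scaleR_add_right)
      then show ?thesis by simp
    qed
    then show "\<forall>\<^sub>F x in at y. norm ((1 / norm (x - y)) *\<^sub>R (f x - (f y + (x - y) *\<^sub>R L)))
        \<le> norm ((1 / (x - y)) *\<^sub>R (f x - f y) - L)"
      by (simp add: eventually_at_filter)
  qed
  then show ?thesis
    unfolding has_vector_derivative_def has_derivative_within by (simp add: bounded_linear_scaleR_left)
qed

text \<open>On a short interval missing \<open>S\<close> the function is the integral of the
  continuous \<open>h\<close>, which upgrades the equation from almost every point to every point.
  The interval is cut off at 0 and 1 so that one-sided derivatives at the endpoints are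
  included.\<close>

lemma abs_cont_on_derivative_everywhere:
  fixes f h :: "real \<Rightarrow> complex"
  assumes f: "abs_cont_on {0..1} f" and S: "finite S"
    and der: "negligible {x \<in> {0..1}. \<not> (f has_vector_derivative h x) (at x within {0..1})}"
    and h: "continuous_on ({0..1} - S) h" and x: "x \<in> {0..1} - S"
  shows "(f has_vector_derivative h x) (at x within {0..1})"
proof -
  obtain r where r: "r > 0" "\<And>s. s \<in> S \<Longrightarrow> s \<noteq> x \<Longrightarrow> r \<le> dist x s"
    using finite_set_avoid[OF S, of x] by blast
  define c d where "c = max 0 (x - r/2)" and "d = min 1 (x + r/2)"
  have cd: "0 \<le> c" "c \<le> x" "x \<le> d" "d \<le> 1" "c < d" using x r by (auto simp: c_def d_def)
  have sub: "{c..d} \<subseteq> {0..1} - S"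
  proof
    fix t assume t: "t \<in> {c..d}"
    then have "dist x t < r" using r by (auto simp: c_def d_def dist_real_def)
    then show "t \<in> {0..1} - S" using r(2)[of t] t cd x by auto
  qed
  have hc: "continuous_on {c..d} h" by (rule continuous_on_subset[OF h sub])
  let ?N = "{x \<in> {0..1}. \<not> (f has_vector_derivative h x) (at x within {0..1})}"
  have int: "f y - f c = integral {c..y} h" if y: "y \<in> {c..d}" for y
  proof -
    have "(h has_integral f y - f c) {c..y}"
    proof (rule abs_cont_on_has_integral[OF abs_cont_on_subset[OF f] der])
      fix t assume t: "t \<in> {c..y} - ?N"
      then have "(f has_vector_derivative h t) (at t within {0..1})" using cd y by auto
      then show "(f has_vector_derivative h t) (at t within {c..y})"
        by (rule has_vector_derivative_within_subset) (use cd y in auto)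
    qed (use cd y in auto)
    then show ?thesis by (simp add: integral_unique)
  qed
  have eq: "f y = f c + integral {c..y} h" if "y \<in> {c..d}" for y
    using int[OF that] by (simp add: diff_eq_eq add.commute)
  have der': "((\<lambda>y. f c + integral {c..y} h) has_vector_derivative h x) (at x within {c..d})"
    using integral_has_vector_derivative[OF hc, of x] cd by (auto intro!: derivative_eq_intros)
  have "(f has_vector_derivative h x) (at x within {c..d})"
    by (rule has_vector_derivative_transform[OF _ eq der']) (use cd in auto)
  moreover have "at x within {c..d} = at x within {0..1}"
    by (rule at_within_nhd[where S = "{x - r/2<..<x + r/2}"])
      (use r(1) cd in \<open>auto simp: c_def d_def\<close>)
  ultimately show ?thesis by simp
qed

section \<open>C^2 solutions and eigenfunctions on [0,1]\<close>

context small_eps begin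

abbreviation U :: "real set" where "U \<equiv> {0..1} - {y0, 1 - y0}"

lemma AE_unit_iff: "(AE x in lebesgue_on {0..1::real}. P x) \<longleftrightarrow> negligible {x \<in> {0..1}. \<not> P x}"
  by (rule AE_lebesgue_on_iff_negligible) auto

lemma unit_nontrivial: "x \<in> {0..1::real} \<Longrightarrow> at x within {0..1} \<noteq> bot"
  using islimpt_Icc[of 0 1 x] by (simp add: trivial_limit_within)

lemma deriv_on_unit_eq:
  assumes "x \<in> {0..1}" "(f has_vector_derivative D) (at x within {0..1})"
  shows "deriv_on {0..1} f x = D"
  unfolding deriv_on_def using vector_derivative_within[OF unit_nontrivial[OF assms(1)] assms(2)] .

lemma second_deriv_on_unit_eq:
  assumes f: "\<And>t. t \<in> {0..1} \<Longrightarrow> (f has_vector_derivative D t) (at t within {0..1})" and x: "x \<in> {0..1}"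
    and D: "(D has_vector_derivative D2) (at x within {0..1})"
  shows "deriv_on {0..1} (deriv_on {0..1} f) x = D2"
proof (rule deriv_on_unit_eq[OF x])
  show "(deriv_on {0..1} f has_vector_derivative D2) (at x within {0..1})"
    by (rule has_vector_derivative_transform[OF x _ D]) (simp add: deriv_on_unit_eq[OF _ f])
qed

lemma loc_abs_cont_unit_iff: "loc_abs_cont_on {0..1} f \<longleftrightarrow> abs_cont_on {0..1} f"
  unfolding loc_abs_cont_on_def using abs_cont_on_subset by blast

text \<open>The fundamental theorem tolerates finitely many points without derivative where the
  function is continuous, which admits the singular points.\<close>

lemma abs_cont_on_of_derivative:
  fixes f f' :: "real \<Rightarrow> complex"
  assumes f: "continuous_on {0..1} f" and S: "finite S"
    and der: "\<And>x. x \<in> {0..1} - S \<Longrightarrow> (f has_vector_derivative f' x) (at x within {0..1})"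
    and int: "f' absolutely_integrable_on {0..1}"
  shows "abs_cont_on {0..1} f"
proof -
  have "f 0 + integral {0..x} f' = f x" if x: "x \<in> {0..1}" for x
  proof -
    have "(f' has_integral f x - f 0) {0..x}"
    proof (rule fundamental_theorem_of_calculus_interior_strong[OF S])
      show "continuous_on {0..x} f" by (rule continuous_on_subset[OF f]) (use x in auto)
      fix t assume t: "t \<in> {0<..<x} - S"
      then have "(f has_vector_derivative f' t) (at t within {0..1})" using x by (intro der) auto
      moreover have "at t within {0..1} = at t" using t x by (intro at_within_Icc_at) auto
      ultimately show "(f has_vector_derivative f' t) (at t)" by simp
    qed (use x in auto)
    then show ?thesis by (simp add: integral_unique)
  qed
  with abs_cont_on_add_const[OF abs_cont_on_indefinite_integral[OF int], of "f 0"]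
  show ?thesis by (rule abs_cont_on_cong)
qed

text \<open>Off the singular points
  \<open>(p1 u')' = (p1 / phi2) (phi2 u'' + phi1 u') = - z w1 u\<close>, and integrability of
  \<open>w1\<close> makes \<open>p1 u'\<close> absolutely continuous across them.\<close>

lemma C2_solution_is_eigenfunction:
  assumes u: "C2_on {0..1} u" and nz: "\<exists>x\<in>{0..1}. u x \<noteq> 0"
    and eq: "\<And>x. x \<in> {0..1} \<Longrightarrow> D_expr \<epsilon> {0..1} u x = z * u x"
  shows "eigenfunction \<epsilon> z u \<and> cond_Q \<epsilon> {0..1} u"
proof -
  obtain u' u'' where u': "\<And>x. x \<in> {0..1} \<Longrightarrow> (u has_vector_derivative u' x) (at x within {0..1})"
    and u'': "\<And>x. x \<in> {0..1} \<Longrightarrow> (u' has_vector_derivative u'' x) (at x within {0..1})"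
    and cont: "continuous_on {0..1} u''"
    using u unfolding C2_on_def by blast
  have c0: "continuous_on {0..1} u" and c1: "continuous_on {0..1} u'"
    by (rule continuous_on_vector_derivative[OF u'], assumption, rule continuous_on_vector_derivative[OF u''], assumption)
  have eq': "phi2 \<epsilon> x *\<^sub>R u'' x + phi1 \<epsilon> x *\<^sub>R u' x = z * u x" if x: "x \<in> {0..1}" for x
  proof -
    have "deriv_on {0..1} (deriv_on {0..1} u) x = u'' x"
      by (rule second_deriv_on_unit_eq[OF _ x u''[OF x]]) (rule u')
    then show ?thesis using eq[OF x] unfolding D_expr_def deriv_on_unit_eq[OF x u'[OF x]] by simp
  qed
  define v where "v x = p1 \<epsilon> x *\<^sub>R u' x" for x
  have cv: "continuous_on {0..1} v" unfolding v_def by (intro continuous_intros p1_continuous c1)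
  have dv: "(v has_vector_derivative - (z * (w1 \<epsilon> x *\<^sub>R u x))) (at x within {0..1})" if x: "x \<in> U" for x
  proof -
    have x': "x \<in> {0..1}" using x by simp
    have nz: "phi2 \<epsilon> x \<noteq> 0" using sign_cases[OF x] by auto
    have "(v has_vector_derivative (p1 \<epsilon> x *\<^sub>R u'' x + (p1 \<epsilon> x * (phi1 \<epsilon> x / phi2 \<epsilon> x)) *\<^sub>R u' x)) (at x within {0..1})"
      unfolding v_def using has_vector_derivative_scaleR[OF p1_deriv[OF x, THEN has_field_derivative_at_within] u''[OF x']] .
    also have "p1 \<epsilon> x *\<^sub>R u'' x + (p1 \<epsilon> x * (phi1 \<epsilon> x / phi2 \<epsilon> x)) *\<^sub>R u' x
        = (p1 \<epsilon> x / phi2 \<epsilon> x) *\<^sub>R (phi2 \<epsilon> x *\<^sub>R u'' x + phi1 \<epsilon> x *\<^sub>R u' x)"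
      using nz by (simp add: scaleR_add_right)
    also have "\<dots> = - (z * (w1 \<epsilon> x *\<^sub>R u x))"
      unfolding eq'[OF x'] by (simp add: w1_def)
    finally show ?thesis .
  qed
  have int: "(\<lambda>x. - (z * (w1 \<epsilon> x *\<^sub>R u x))) absolutely_integrable_on {0..1}"
  proof -
    have "(\<lambda>x. w1 \<epsilon> x *\<^sub>R (- (z * u x))) absolutely_integrable_on {0..1}"
      by (intro absolutely_integrable_mult_continuous w1_integrable continuous_intros c0)
    then show ?thesis by simp
  qed
  have "abs_cont_on {0..1} v"
    by (rule abs_cont_on_of_derivative[OF cv _ _ int, where S = "{y0, 1 - y0}"]) (simp, rule dv)
  moreover have "abs_cont_on {0..1} u"
    by (rule abs_cont_on_of_derivative[OF c0 finite.emptyI u']) (auto intro: absolutely_integrable_continuous_real c1)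
  moreover have "AE x in lebesgue_on {0..1}. \<exists>u'. (u has_vector_derivative u') (at x within {0..1}) \<and> v x = p1 \<epsilon> x *\<^sub>R u'"
    by (rule AE_I2) (use u' v_def in auto)
  ultimately have "quasi_derivative (p1 \<epsilon>) {0..1} u v"
    unfolding quasi_derivative_def loc_abs_cont_unit_iff by blast
  moreover have "AE x in lebesgue_on {0..1}. \<exists>v'. (v has_vector_derivative v') (at x within {0..1}) \<and> - v' = z * (w1 \<epsilon> x *\<^sub>R u x)"
  proof -
    have "negligible {y0, 1 - y0}" by simp
    then have "negligible {x \<in> {0..1}. \<not> (\<exists>v'. (v has_vector_derivative v') (at x within {0..1}) \<and> - v' = z * (w1 \<epsilon> x *\<^sub>R u x))}"
    proof (rule negligible_subset)
      show "{x \<in> {0..1}. \<not> (\<exists>v'. (v has_vector_derivative v') (at x within {0..1}) \<and> - v' = z * (w1 \<epsilon> x *\<^sub>R u x))} \<subseteq> {y0, 1 - y0}"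
      proof
        fix x assume x: "x \<in> {x \<in> {0..1}. \<not> (\<exists>v'. (v has_vector_derivative v') (at x within {0..1}) \<and> - v' = z * (w1 \<epsilon> x *\<^sub>R u x))}"
        show "x \<in> {y0, 1 - y0}"
        proof (rule ccontr)
          assume "x \<notin> {y0, 1 - y0}"
          then have "x \<in> U" using x by auto
          from dv[OF this] show False using x by fastforce
        qed
      qed
    qed
    then show ?thesis by (simp only: AE_unit_iff)
  qed
  ultimately have "eigenfunction \<epsilon> z u" unfolding eigenfunction_def using nz by blast
  moreover have "cond_Q \<epsilon> {0..1} u"
    unfolding cond_Q_def frontier_M_plus
  proof
    fix y assume y: "y \<in> {y0, 1 - y0}"
    then have y': "y \<in> {0..1}" using y0_bounds by auto
    have "(v \<longlongrightarrow> v y) (at y within {0..1})" using cv y' by (auto simp: continuous_on_def)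
    then have lim: "(v \<longlongrightarrow> 0) (at y within {0..1})" using zero_points[OF y] by (simp add: v_def)
    have ev: "\<forall>\<^sub>F x in at y within {0..1}. v x = p1 \<epsilon> x *\<^sub>R deriv_on {0..1} u x"
      unfolding eventually_at_filter v_def by (intro always_eventually) (auto simp: deriv_on_unit_eq[OF _ u'])
    show "((\<lambda>x. p1 \<epsilon> x *\<^sub>R deriv_on {0..1} u x) \<longlongrightarrow> 0) (at y within {0..1})"
      by (rule Lim_transform_eventually[OF lim ev])
  qed
  ultimately show ?thesis by blast
qed

text \<open>On \<open>U\<close> the coefficients of the first-order system for \<open>u\<close> and
  \<open>v = p1 u'\<close> are continuous, so the equations that hold almost everywhere hold at
  every point. (Q) then forces the continuous \<open>v\<close> to vanish at the singular
  points.\<close>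

lemma eigenfunction_derivatives:
  assumes ef: "eigenfunction \<epsilon> z u" and Q: "cond_Q \<epsilon> {0..1} u"
  obtains v where "continuous_on {0..1} u" "continuous_on {0..1} v"
    "\<And>x. x \<in> U \<Longrightarrow> (u has_vector_derivative (1 / p1 \<epsilon> x) *\<^sub>R v x) (at x within {0..1})"
    "\<And>x. x \<in> U \<Longrightarrow> (v has_vector_derivative - (z * (w1 \<epsilon> x *\<^sub>R u x))) (at x within {0..1})"
    "\<And>y. y \<in> {y0, 1 - y0} \<Longrightarrow> v y = 0"
proof -
  obtain v where qd: "quasi_derivative (p1 \<epsilon>) {0..1} u v"
    and vAE: "AE x in lebesgue_on {0..1}. \<exists>v'. (v has_vector_derivative v') (at x within {0..1}) \<and> - v' = z * (w1 \<epsilon> x *\<^sub>R u x)"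
    using ef unfolding eigenfunction_def by blast
  have ac: "abs_cont_on {0..1} u" "abs_cont_on {0..1} v"
    and uAE: "AE x in lebesgue_on {0..1}. \<exists>u'. (u has_vector_derivative u') (at x within {0..1}) \<and> v x = p1 \<epsilon> x *\<^sub>R u'"
    using qd unfolding quasi_derivative_def loc_abs_cont_unit_iff by auto
  have cu: "continuous_on {0..1} u" and cv: "continuous_on {0..1} v"
    using ac by (auto intro: abs_cont_on_imp_continuous_on)
  have fin: "finite {y0, 1 - y0}" by simp
  have dv: "(v has_vector_derivative - (z * (w1 \<epsilon> x *\<^sub>R u x))) (at x within {0..1})" if "x \<in> U" for x
  proof (rule abs_cont_on_derivative_everywhere[OF ac(2) fin _ _ that])
    have "AE x in lebesgue_on {0..1}. (v has_vector_derivative - (z * (w1 \<epsilon> x *\<^sub>R u x))) (at x within {0..1})"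
      using vAE by eventually_elim (metis minus_minus)
    then show "negligible {x \<in> {0..1}. \<not> (v has_vector_derivative - (z * (w1 \<epsilon> x *\<^sub>R u x))) (at x within {0..1})}"
      by (simp only: AE_unit_iff)
    show "continuous_on U (\<lambda>x. - (z * (w1 \<epsilon> x *\<^sub>R u x)))"
      by (intro continuous_intros w1_continuous continuous_on_subset[OF cu]) auto
  qed
  have p_nz: "p1 \<epsilon> x \<noteq> 0" if "x \<in> U" for x using sign_cases[OF that] by auto
  have du: "(u has_vector_derivative (1 / p1 \<epsilon> x) *\<^sub>R v x) (at x within {0..1})" if "x \<in> U" for x
  proof (rule abs_cont_on_derivative_everywhere[OF ac(1) fin _ _ that])
    have "negligible ({x \<in> {0..1}. \<not> (\<exists>u'. (u has_vector_derivative u') (at x within {0..1}) \<and> v x = p1 \<epsilon> x *\<^sub>R u')} \<union> {y0, 1 - y0})"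
      using uAE unfolding AE_unit_iff by (intro negligible_Un) auto
    then show "negligible {x \<in> {0..1}. \<not> (u has_vector_derivative (1 / p1 \<epsilon> x) *\<^sub>R v x) (at x within {0..1})}"
    proof (rule negligible_subset, intro subsetI)
      fix x assume x: "x \<in> {x \<in> {0..1}. \<not> (u has_vector_derivative (1 / p1 \<epsilon> x) *\<^sub>R v x) (at x within {0..1})}"
      show "x \<in> {x \<in> {0..1}. \<not> (\<exists>u'. (u has_vector_derivative u') (at x within {0..1}) \<and> v x = p1 \<epsilon> x *\<^sub>R u')} \<union> {y0, 1 - y0}"
      proof (rule ccontr)
        assume n: "\<not> ?thesis"
        then obtain u' where "(u has_vector_derivative u') (at x within {0..1})" "v x = p1 \<epsilon> x *\<^sub>R u'" "x \<in> U"
          using x by blast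
        then show False using x p_nz[of x] by simp
      qed
    qed
    show "continuous_on U (\<lambda>x. (1 / p1 \<epsilon> x) *\<^sub>R v x)"
      using p_nz by (intro continuous_intros continuous_on_subset[OF cv] continuous_on_subset[OF p1_continuous]) auto
  qed
  have v0: "v y = 0" if y: "y \<in> {y0, 1 - y0}" for y
  proof -
    have y': "y \<in> {0..1}" using y y0_bounds by auto
    have "(v \<longlongrightarrow> v y) (at y within {0..1})" using cv y' by (auto simp: continuous_on_def)
    moreover have "((\<lambda>x. p1 \<epsilon> x *\<^sub>R deriv_on {0..1} u x) \<longlongrightarrow> 0) (at y within {0..1})"
      using Q y unfolding cond_Q_def frontier_M_plus by blast
    moreover have "\<forall>\<^sub>F x in at y within {0..1}. p1 \<epsilon> x *\<^sub>R deriv_on {0..1} u x = v x"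
    proof -
      have "\<forall>\<^sub>F x in at y within {0..1}. x \<in> U"
        \<comment> \<open>The radius \<open>1 - 2 * y0\<close> is the distance between the two
          singular points, so the punctured ball around either contains neither.\<close>
        using y y0_bounds unfolding eventually_at
        by (intro exI[of _ "1 - 2 * y0"]) (auto simp: dist_real_def)
      then show ?thesis
      proof eventually_elim
        case (elim x)
        then have "deriv_on {0..1} u x = (1 / p1 \<epsilon> x) *\<^sub>R v x" by (intro deriv_on_unit_eq du) auto
        then show ?case using p_nz[OF elim] by simp
      qed
    qed
    ultimately have "(v \<longlongrightarrow> 0) (at y within {0..1})" using Lim_transform_eventually by blast
    with \<open>(v \<longlongrightarrow> v y) (at y within {0..1})\<close> show ?thesis
      using tendsto_unique[OF unit_nontrivial[OF y']] by blast
  qed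
  show thesis by (rule that[OF cu cv du dv v0])
qed

lemma nbhd_at:
  assumes "y \<in> {y0, 1 - y0}" "x \<in> nbhd y"
  shows "at x within {0..1} = at x"
  using nbhd_facts(1)[OF assms] assms y0_bounds eps_pos eps_le
  by (intro at_within_Icc_at) auto

lemma nbhd_iff: "x \<in> nbhd y \<longleftrightarrow> \<bar>x - y\<bar> < \<epsilon> / 5"
proof
  assume "x \<in> nbhd y"
  then have "y - \<epsilon> / 5 < x" "x < y + \<epsilon> / 5" by auto
  then show "\<bar>x - y\<bar> < \<epsilon> / 5" by linarith
next
  assume "\<bar>x - y\<bar> < \<epsilon> / 5"
  then have "y - \<epsilon> / 5 < x" "x < y + \<epsilon> / 5" by linarith+
  then show "x \<in> nbhd y" by simp
qed

lemma eigenfunction_is_C2_solution: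
  assumes ef: "eigenfunction \<epsilon> z u" and Q: "cond_Q \<epsilon> {0..1} u"
  shows "C2_on {0..1} u \<and> (\<forall>x\<in>{0..1}. D_expr \<epsilon> {0..1} u x = z * u x)"
proof -
  obtain v where cu: "continuous_on {0..1} u" and cv: "continuous_on {0..1} v"
    and du: "\<And>x. x \<in> U \<Longrightarrow> (u has_vector_derivative (1 / p1 \<epsilon> x) *\<^sub>R v x) (at x within {0..1})"
    and dv: "\<And>x. x \<in> U \<Longrightarrow> (v has_vector_derivative - (z * (w1 \<epsilon> x *\<^sub>R u x))) (at x within {0..1})"
    and v0: "\<And>y. y \<in> {y0, 1 - y0} \<Longrightarrow> v y = 0"
    by (rule eigenfunction_derivatives[OF ef Q]) (rule that, assumption+)
  have e5: "\<epsilon> / 5 > 0" using eps_pos by simp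
  have nzU: "p1 \<epsilon> x \<noteq> 0" "phi2 \<epsilon> x \<noteq> 0" if "x \<in> U" for x using sign_cases[OF that] by auto
  \<comment> \<open>The value at a singular point is read off from the equation, where
    \<open>phi2 = 0\<close> leaves \<open>phi1 u' = z u\<close>.\<close>
  define D where "D x = (if x \<in> {y0, 1 - y0} then (z / complex_of_real (phi1 \<epsilon> x)) * u x else (1 / p1 \<epsilon> x) *\<^sub>R v x)" for x
  \<comment> \<open>Formally differentiating the equation and setting \<open>phi2 = 0\<close> gives
    \<open>(phi1 + phi2') u'' = (z - phi1') u'\<close>.\<close>
  define D2 where "D2 x = (if x \<in> {y0, 1 - y0}
      then (1 / (phi1 \<epsilon> x + phi2' x)) *\<^sub>R ((z - complex_of_real (phi1' x)) * D x)
      else (1 / phi2 \<epsilon> x) *\<^sub>R (z * u x - phi1 \<epsilon> x *\<^sub>R D x))" for x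
  have DU: "D x = (1 / p1 \<epsilon> x) *\<^sub>R v x" "D2 x = (1 / phi2 \<epsilon> x) *\<^sub>R (z * u x - phi1 \<epsilon> x *\<^sub>R D x)" if "x \<in> U" for x
    using that by (auto simp: D_def D2_def)
  have sub: "nbhd y \<subseteq> {0..1}" if "y \<in> {y0, 1 - y0}" for y using nbhd_facts(1)[OF that] by blast
  have nU: "x \<in> U" if "y \<in> {y0, 1 - y0}" "\<bar>x - y\<bar> < \<epsilon> / 5" "x \<noteq> y" for x y
    using nbhd_facts(2)[OF that(1) _ that(3)] that(2) unfolding nbhd_iff by blast
  have at_nbhd: "at x within {0..1} = at x" if "y \<in> {y0, 1 - y0}" "\<bar>x - y\<bar> < \<epsilon> / 5" for x y
    using nbhd_at[OF that(1)] that(2) unfolding nbhd_iff by blast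
  have isC: "isCont f y" if f: "continuous_on {0..1} f" and y: "y \<in> {y0, 1 - y0}" for f :: "real \<Rightarrow> 'b::topological_space" and y
    using f y0_bounds y by (intro continuous_on_interior[OF f]) auto
  have ev: "\<forall>\<^sub>F x in at y. x \<in> U" if y: "y \<in> {y0, 1 - y0}" for y
    unfolding eventually_at by (rule exI[of _ "\<epsilon> / 5"]) (use nU[OF y] e5 in \<open>auto simp: dist_real_def\<close>)
  have D_lim: "(D \<longlongrightarrow> D y) (at y)" if y: "y \<in> {y0, 1 - y0}" for y
  proof -
    let ?r = "\<lambda>x. (z / complex_of_real (phi1 \<epsilon> x)) * u x"
    have "((\<lambda>x. (1 / p1 \<epsilon> x) *\<^sub>R v x) \<longlongrightarrow> ?r y) (at y)"
    \<comment> \<open>Here \<open>q' = p1' = - w1 phi1\<close> and \<open>v' = - z w1 u\<close>, so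
      the quotient of derivatives is \<open>z u / phi1\<close>; multiplication by
      \<open>- phi1 y\<close> makes \<open>q'\<close> positive on both sides of
      \<open>y\<close>.\<close>
    proof (rule complex_lhospital[OF e5, where r = ?r and q' = "\<lambda>x. p1 \<epsilon> x * (phi1 \<epsilon> x / phi2 \<epsilon> x)" and s = "- phi1 \<epsilon> y"])
      show "continuous_on (nbhd y) v" "continuous_on (nbhd y) (p1 \<epsilon>)"
        using sub[OF y] by (auto intro: continuous_on_subset[OF cv] continuous_on_subset[OF p1_continuous])
      show "v y = 0" "p1 \<epsilon> y = 0" using v0[OF y] zero_points[OF y] by auto
      fix x assume x: "\<bar>x - y\<bar> < \<epsilon> / 5" "x \<noteq> y"
      note xU = nU[OF y x]
      have p: "phi1 \<epsilon> x \<noteq> 0" "phi1 \<epsilon> x * phi1 \<epsilon> y > 0" using nbhd_facts(7,9)[OF y] x(1) unfolding nbhd_iff by auto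
      have "(v has_vector_derivative - (z * (w1 \<epsilon> x *\<^sub>R u x))) (at x)"
        using dv[OF xU] at_nbhd[OF y x(1)] by simp
      moreover have "- (z * (w1 \<epsilon> x *\<^sub>R u x)) = (p1 \<epsilon> x * (phi1 \<epsilon> x / phi2 \<epsilon> x)) *\<^sub>R ?r x"
        using p(1) nzU[OF xU] by (simp add: w1_def scaleR_conv_of_real field_simps)
      ultimately show "(v has_vector_derivative (p1 \<epsilon> x * (phi1 \<epsilon> x / phi2 \<epsilon> x)) *\<^sub>R ?r x) (at x)" by simp
      show "(p1 \<epsilon> has_real_derivative p1 \<epsilon> x * (phi1 \<epsilon> x / phi2 \<epsilon> x)) (at x)" by (rule p1_deriv[OF xU])
      have "p1 \<epsilon> x * (phi1 \<epsilon> x / phi2 \<epsilon> x) * (- phi1 \<epsilon> y) = w1 \<epsilon> x * (phi1 \<epsilon> x * phi1 \<epsilon> y)"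
        by (simp add: w1_def)
      also have "\<dots> > 0" using w1_pos[OF xU] p(2) by (rule mult_pos_pos)
      finally show "p1 \<epsilon> x * (phi1 \<epsilon> x / phi2 \<epsilon> x) * (- phi1 \<epsilon> y) > 0" .
    next
      have "phi1 \<epsilon> y \<noteq> 0" using nbhd_facts(7)[OF y, of y] e5 by auto
      then show "(?r \<longlongrightarrow> ?r y) (at y)"
        using isC[OF cu y] isC[OF phi1_continuous y] unfolding isCont_def by (intro tendsto_intros) auto
    qed
    moreover have "?r y = D y" using y by (auto simp: D_def)
    moreover have "\<forall>\<^sub>F x in at y. (1 / p1 \<epsilon> x) *\<^sub>R v x = D x" using ev[OF y] by eventually_elim (simp add: DU)
    ultimately show ?thesis using Lim_transform_eventually by fastforce
  qed
  have cD: "continuous_on {0..1} D"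
    unfolding continuous_on_eq_continuous_within
  proof
    fix x :: real assume x: "x \<in> {0..1}"
    show "continuous (at x within {0..1}) D"
    proof (cases "x \<in> {y0, 1 - y0}")
      case True
      then show ?thesis using D_lim unfolding continuous_within by (metis tendsto_within_subset top_greatest)
    next
      case False
      then have xU: "x \<in> U" using x by auto
      have op: "open (- {y0, 1 - y0})" by auto
      have "continuous_on U (\<lambda>x. (1 / p1 \<epsilon> x) *\<^sub>R v x)"
        using nzU by (intro continuous_intros continuous_on_subset[OF cv] continuous_on_subset[OF p1_continuous]) auto
      then have "continuous_on U D" by (rule continuous_on_eq) (simp add: DU)
      then have "continuous (at x within U) D" using xU by (simp add: continuous_on_eq_continuous_within)
      moreover have "at x within U = at x within {0..1}"
        by (rule at_within_nhd[where S = "- {y0, 1 - y0}"]) (use xU op in auto)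
      ultimately show ?thesis by (simp add: continuous_within)
    qed
  qed
  have du': "(u has_vector_derivative D x) (at x within {0..1})" if x: "x \<in> {0..1}" for x
  proof (cases "x \<in> {y0, 1 - y0}")
    case True
    have "(u has_vector_derivative D x) (at x)"
    proof (rule has_vector_derivative_from_limit[OF e5 _ _ D_lim[OF True]])
      show "continuous_on (nbhd x) u" using sub[OF True] by (rule continuous_on_subset[OF cu])
      fix t assume t: "\<bar>t - x\<bar> < \<epsilon> / 5" "t \<noteq> x"
      show "(u has_vector_derivative D t) (at t)"
        using du[OF nU[OF True t]] at_nbhd[OF True t(1)] DU(1)[OF nU[OF True t]] by simp
    qed
    then show ?thesis by (rule has_vector_derivative_at_within)
  next
    case False
    then show ?thesis using du[of x] x by (simp add: DU)
  qed
  have dD: "(D has_vector_derivative D2 x) (at x within {0..1})" if xU: "x \<in> U" for x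
  proof -
    have x: "x \<in> {0..1}" using xU by simp
    note nz = nzU[OF xU]
    have "((\<lambda>t. inverse (p1 \<epsilon> t)) has_real_derivative - (inverse (p1 \<epsilon> x) * (p1 \<epsilon> x * (phi1 \<epsilon> x / phi2 \<epsilon> x)) * inverse (p1 \<epsilon> x))) (at x within {0..1})"
      by (rule DERIV_inverse'[OF has_field_derivative_at_within[OF p1_deriv[OF xU]] nz(1)])
    from has_vector_derivative_scaleR[OF this dv[OF xU]]
    have "((\<lambda>t. inverse (p1 \<epsilon> t) *\<^sub>R v t) has_vector_derivative
      inverse (p1 \<epsilon> x) *\<^sub>R - (z * (w1 \<epsilon> x *\<^sub>R u x)) +
      - (inverse (p1 \<epsilon> x) * (p1 \<epsilon> x * (phi1 \<epsilon> x / phi2 \<epsilon> x)) * inverse (p1 \<epsilon> x)) *\<^sub>R v x) (at x within {0..1})" .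
    also have "inverse (p1 \<epsilon> x) *\<^sub>R - (z * (w1 \<epsilon> x *\<^sub>R u x)) +
      - (inverse (p1 \<epsilon> x) * (p1 \<epsilon> x * (phi1 \<epsilon> x / phi2 \<epsilon> x)) * inverse (p1 \<epsilon> x)) *\<^sub>R v x = D2 x"
      unfolding DU(2)[OF xU] DU(1)[OF xU] using nz
      by (simp add: w1_def scaleR_conv_of_real field_simps)
    finally have 1: "((\<lambda>t. inverse (p1 \<epsilon> t) *\<^sub>R v t) has_vector_derivative D2 x) (at x within {0..1})" .
    have op: "open (- {y0, 1 - y0})" by auto
    have eqw: "at x within U = at x within {0..1}"
      by (rule at_within_nhd[where S = "- {y0, 1 - y0}"]) (use xU op in auto)
    have "(D has_vector_derivative D2 x) (at x within U)"
      by (rule has_vector_derivative_transform[OF xU _ 1[folded eqw]]) (simp add: DU inverse_eq_divide)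
    then show ?thesis using eqw by simp
  qed
  have D2_lim: "(D2 \<longlongrightarrow> D2 y) (at y)" if y: "y \<in> {y0, 1 - y0}" for y
  proof -
    \<comment> \<open>\<open>p1 * phi2\<close> is negative on both sides of \<open>y\<close> and
      zero at \<open>y\<close>, so it is not monotone there. \<open>|p1|\<close> has the same
      logarithmic derivative as \<open>p1\<close>, and \<open>|p1| * phi2\<close> changes sign at
      \<open>y\<close> with a derivative \<open>|p1| (phi1 + phi2')\<close> of one sign.\<close>
    define P where "P x = \<bar>p1 \<epsilon> x\<bar>" for x
    let ?r = "\<lambda>x. (1 / (phi1 \<epsilon> x + phi2' x)) *\<^sub>R ((z - complex_of_real (phi1' x)) * D x)"
    let ?q = "\<lambda>x. P x * phi2 \<epsilon> x" and ?N = "\<lambda>x. P x *\<^sub>R (z * u x - phi1 \<epsilon> x *\<^sub>R D x)"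
    have cP: "continuous_on {0..1} P" unfolding P_def by (intro continuous_intros p1_continuous)
    have dP: "(P has_real_derivative P x * (phi1 \<epsilon> x / phi2 \<epsilon> x)) (at x)" if xU: "x \<in> U" for x
    proof -
      define \<sigma> where "\<sigma> = sgn (p1 \<epsilon> x)"
      have \<sigma>: "\<sigma> * p1 \<epsilon> x = P x" "\<sigma> * p1 \<epsilon> x > 0" using nzU[OF xU] by (auto simp: \<sigma>_def P_def sgn_if)
      have d: "((\<lambda>t. \<sigma> * p1 \<epsilon> t) has_real_derivative \<sigma> * (p1 \<epsilon> x * (phi1 \<epsilon> x / phi2 \<epsilon> x))) (at x)"
        by (rule DERIV_cmult[OF p1_deriv[OF xU]])
      have "isCont (\<lambda>t. \<sigma> * p1 \<epsilon> t) x"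
        by (intro continuous_intros DERIV_isCont[OF p1_deriv[OF xU]])
      then have "((\<lambda>t. \<sigma> * p1 \<epsilon> t) \<longlongrightarrow> \<sigma> * p1 \<epsilon> x) (nhds x)"
        unfolding isCont_def by (rule iffD1[OF tendsto_at_iff_tendsto_nhds])
      then have "\<forall>\<^sub>F t in nhds x. \<sigma> * p1 \<epsilon> t > 0"
        using \<sigma>(2) by (rule order_tendstoD(1))
      then have ev: "\<forall>\<^sub>F t in nhds x. \<sigma> * p1 \<epsilon> t = P t"
        by eventually_elim (auto simp: \<sigma>_def P_def sgn_if split: if_splits)
      have "(P has_real_derivative \<sigma> * (p1 \<epsilon> x * (phi1 \<epsilon> x / phi2 \<epsilon> x))) (at x)"
        by (rule iffD1[OF DERIV_cong_ev[OF refl ev refl] d])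
      then show ?thesis using \<sigma>(1) by (simp flip: mult.assoc)
    qed
    have "((\<lambda>x. (1 / ?q x) *\<^sub>R ?N x) \<longlongrightarrow> ?r y) (at y)"
    proof (rule complex_lhospital[OF e5, where r = ?r and q' = "\<lambda>x. P x * (phi1 \<epsilon> x + phi2' x)" and s = "phi1 \<epsilon> y"])
      have "continuous_on {0..1} ?N" "continuous_on {0..1} ?q"
        by (intro continuous_intros cP phi1_continuous phi2_continuous cu cD)+
      then show "continuous_on (nbhd y) ?N" "continuous_on (nbhd y) ?q"
        using sub[OF y] by (auto elim: continuous_on_subset)
      show "?N y = 0" "?q y = 0" using zero_points[OF y] by (auto simp: P_def)
      fix x assume x: "\<bar>x - y\<bar> < \<epsilon> / 5" "x \<noteq> y"
      then have xn: "x \<in> nbhd y" unfolding nbhd_iff by simp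
      note xU = nU[OF y x] and nf = nbhd_facts[OF y xn]
      have x01: "x \<in> {0..1}" using xU by simp
      have sq: "phi1 \<epsilon> x * (phi1 \<epsilon> x + phi2' x) > 0"
        unfolding distrib_left using nf(7,8) by (intro add_pos_pos) (simp_all add: zero_less_mult_iff neq_iff disj_commute)
      then have s_nz: "phi1 \<epsilon> x + phi2' x \<noteq> 0" by auto
      have Pp: "P x > 0" using nzU[OF xU] by (simp add: P_def)
      have 1: "((\<lambda>t. z * u t) has_vector_derivative z * D x) (at x)"
        using du'[OF x01] at_nbhd[OF y x(1)] by (auto intro!: derivative_eq_intros)
      have 2: "((\<lambda>t. phi1 \<epsilon> t *\<^sub>R D t) has_vector_derivative phi1 \<epsilon> x *\<^sub>R D2 x + phi1' x *\<^sub>R D x) (at x)"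
        using has_vector_derivative_scaleR[OF nf(4)] dD[OF xU] at_nbhd[OF y x(1)] by simp
      have "(?N has_vector_derivative P x *\<^sub>R (z * D x - (phi1 \<epsilon> x *\<^sub>R D2 x + phi1' x *\<^sub>R D x))
          + (P x * (phi1 \<epsilon> x / phi2 \<epsilon> x)) *\<^sub>R (z * u x - phi1 \<epsilon> x *\<^sub>R D x)) (at x)"
        by (rule has_vector_derivative_scaleR[OF dP[OF xU] has_vector_derivative_diff[OF 1 2]])
      also have "P x *\<^sub>R (z * D x - (phi1 \<epsilon> x *\<^sub>R D2 x + phi1' x *\<^sub>R D x))
          + (P x * (phi1 \<epsilon> x / phi2 \<epsilon> x)) *\<^sub>R (z * u x - phi1 \<epsilon> x *\<^sub>R D x)
          = P x *\<^sub>R ((z - complex_of_real (phi1' x)) * D x)"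
        unfolding DU(2)[OF xU] using nzU[OF xU]
        by (simp add: scaleR_conv_of_real field_simps)
      also have "\<dots> = (P x * (phi1 \<epsilon> x + phi2' x)) *\<^sub>R ?r x" using s_nz by simp
      finally show "(?N has_vector_derivative (P x * (phi1 \<epsilon> x + phi2' x)) *\<^sub>R ?r x) (at x)" .
      have "(?q has_real_derivative (P x * (phi1 \<epsilon> x / phi2 \<epsilon> x)) * phi2 \<epsilon> x + phi2' x * P x) (at x)"
        by (rule DERIV_mult[OF dP[OF xU] nf(3)])
      then show "(?q has_real_derivative P x * (phi1 \<epsilon> x + phi2' x)) (at x)"
        by (rule DERIV_cong) (use nzU[OF xU] in \<open>simp add: algebra_simps\<close>)
      have "(phi1 \<epsilon> x * (phi1 \<epsilon> x + phi2' x)) * (phi1 \<epsilon> x * phi1 \<epsilon> y) > 0"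
        using sq nf(9) by (rule mult_pos_pos)
      moreover have "(phi1 \<epsilon> x * (phi1 \<epsilon> x + phi2' x)) * (phi1 \<epsilon> x * phi1 \<epsilon> y)
          = (phi1 \<epsilon> x)\<^sup>2 * ((phi1 \<epsilon> x + phi2' x) * phi1 \<epsilon> y)" by (simp add: power2_eq_square mult_ac)
      ultimately have "(phi1 \<epsilon> x + phi2' x) * phi1 \<epsilon> y > 0"
        by (metis zero_le_power2 zero_less_mult_pos less_le mult_zero_left)
      from mult_pos_pos[OF Pp this] show "P x * (phi1 \<epsilon> x + phi2' x) * phi1 \<epsilon> y > 0" by (simp add: mult.assoc)
    next
      have yn: "y \<in> nbhd y" using e5 by simp
      note nf = nbhd_facts[OF y yn]
      have "phi1 \<epsilon> y * (phi1 \<epsilon> y + phi2' y) > 0"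
        unfolding distrib_left using nf(7,8) by (intro add_pos_pos) (simp_all add: zero_less_mult_iff neq_iff disj_commute)
      then have "phi1 \<epsilon> y + phi2' y \<noteq> 0" by auto
      then show "(?r \<longlongrightarrow> ?r y) (at y)"
        using isC[OF cD y] isC[OF phi1_continuous y] nf(5,6) unfolding isCont_def by (intro tendsto_intros) auto
    qed
    moreover have "?r y = D2 y" using y by (auto simp: D2_def)
    moreover have "\<forall>\<^sub>F x in at y. (1 / ?q x) *\<^sub>R ?N x = D2 x"
      using ev[OF y]
    proof eventually_elim
      case (elim x)
      then have "P x \<noteq> 0" using nzU[OF elim] by (simp add: P_def)
      then show ?case unfolding DU(2)[OF elim] by simp
    qed
    ultimately show ?thesis using Lim_transform_eventually by fastforce
  qed
  have dD': "(D has_vector_derivative D2 x) (at x within {0..1})" if x: "x \<in> {0..1}" for x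
  proof (cases "x \<in> {y0, 1 - y0}")
    case True
    have "(D has_vector_derivative D2 x) (at x)"
    proof (rule has_vector_derivative_from_limit[OF e5 _ _ D2_lim[OF True]])
      show "continuous_on (nbhd x) D" using sub[OF True] by (rule continuous_on_subset[OF cD])
      fix t assume t: "\<bar>t - x\<bar> < \<epsilon> / 5" "t \<noteq> x"
      show "(D has_vector_derivative D2 t) (at t)"
        using dD[OF nU[OF True t]] at_nbhd[OF True t(1)] by simp
    qed
    then show ?thesis by (rule has_vector_derivative_at_within)
  next
    case False
    then show ?thesis using dD[of x] x by simp
  qed
  have cD2: "continuous_on {0..1} D2"
    unfolding continuous_on_eq_continuous_within
  proof
    fix x :: real assume x: "x \<in> {0..1}"
    show "continuous (at x within {0..1}) D2"
    proof (cases "x \<in> {y0, 1 - y0}")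
      case True
      then show ?thesis using D2_lim unfolding continuous_within by (metis tendsto_within_subset top_greatest)
    next
      case False
      then have xU: "x \<in> U" using x by auto
      have op: "open (- {y0, 1 - y0})" by auto
      have "continuous_on U (\<lambda>x. (1 / phi2 \<epsilon> x) *\<^sub>R (z * u x - phi1 \<epsilon> x *\<^sub>R D x))"
        using nzU by (intro continuous_intros phi2_continuous continuous_on_subset[OF cu]
            continuous_on_subset[OF cD] continuous_on_subset[OF phi1_continuous]) auto
      then have "continuous_on U D2" by (rule continuous_on_eq) (simp add: DU(2))
      then have "continuous (at x within U) D2" using xU by (simp add: continuous_on_eq_continuous_within)
      moreover have "at x within U = at x within {0..1}"
        by (rule at_within_nhd[where S = "- {y0, 1 - y0}"]) (use xU op in auto)
      ultimately show ?thesis by (simp add: continuous_within)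
    qed
  qed
  have "D_expr \<epsilon> {0..1} u x = z * u x" if x: "x \<in> {0..1}" for x
  proof -
    have "deriv_on {0..1} (deriv_on {0..1} u) x = D2 x"
      by (rule second_deriv_on_unit_eq[OF _ x dD'[OF x]]) (rule du')
    then have "D_expr \<epsilon> {0..1} u x = phi2 \<epsilon> x *\<^sub>R D2 x + phi1 \<epsilon> x *\<^sub>R D x"
      unfolding D_expr_def deriv_on_unit_eq[OF x du'[OF x]] by simp
    also have "\<dots> = z * u x"
    proof (cases "x \<in> {y0, 1 - y0}")
      case True
      have "phi1 \<epsilon> x \<noteq> 0" using nbhd_facts(7)[OF True, of x] e5 by auto
      then show ?thesis using zero_points(2)[OF True] True by (auto simp: D_def scaleR_conv_of_real)
    next
      case False
      then show ?thesis using x nzU(2)[of x] by (simp add: DU(2))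
    qed
    finally show ?thesis .
  qed
  moreover have "C2_on {0..1} u" unfolding C2_on_def using du' dD' cD2 by blast
  ultimately show ?thesis by blast
qed

section \<open>The operator on M_+ as a regular Sturm-Liouville operator\<close>

sublocale SL: regular_sturm_liouville y0 "1 - y0" "p1 \<epsilon>" "w1 \<epsilon>"
proof
  have sub: "{y0<..<1 - y0} \<subseteq> U" "{y0..1 - y0} \<subseteq> {0..1}" using y0_bounds by auto
  show "y0 < 1 - y0" using y0_bounds by simp
  show "p1 \<epsilon> x > 0" if "x \<in> {y0<..<1 - y0}" for x using inner_sign[OF that] by simp
  show "w1 \<epsilon> x > 0" if "x \<in> {y0<..<1 - y0}" for x using w1_pos[of x] that sub by auto
  show "p1 \<epsilon> x \<ge> 0" if "x \<in> {y0..1 - y0}" for x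
    using inner_sign(1)[of x] zero_points(1)[of x] that by (cases "x \<in> {y0, 1 - y0}") auto
  show "w1 \<epsilon> x \<ge> 0" if "x \<in> {y0..1 - y0}" for x using w1_nonneg[of x] that sub by auto
  show "continuous_on {y0<..<1 - y0} (p1 \<epsilon>)"
    by (rule continuous_on_subset[OF p1_continuous]) (use y0_bounds in auto)
  show "continuous_on {y0<..<1 - y0} (w1 \<epsilon>)" by (rule continuous_on_subset[OF w1_continuous sub(1)])
  show "(\<lambda>x. 1 / p1 \<epsilon> x) absolutely_integrable_on {y0..1 - y0}" by (rule inverse_p1_integrable)
  show "w1 \<epsilon> absolutely_integrable_on {y0..1 - y0}"
    by (rule absolutely_integrable_on_subinterval[OF w1_integrable sub(2)])
qed

abbreviation M :: "real set" where "M \<equiv> {y0<..<1 - y0}"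

lemma mu_plus_eq: "mu_plus \<epsilon> = SL.\<mu>"
  by (simp add: mu_plus_def SL.\<mu>_def M_plus_eq)

lemma at_within_M: "x \<in> M \<Longrightarrow> at x within M = at x"
  by (rule at_within_open) auto

lemma M_interval:
  assumes "x \<in> M"
  obtains c d where "c < x" "x < d" "{c..d} \<subseteq> M"
proof (rule that[of "(y0 + x) / 2" "(x + (1 - y0)) / 2"])
  show "(y0 + x) / 2 < x" "x < (x + (1 - y0)) / 2" using assms by auto
  show "{(y0 + x) / 2..(x + (1 - y0)) / 2} \<subseteq> M"
  proof
    fix t assume "t \<in> {(y0 + x) / 2..(x + (1 - y0)) / 2}"
    then have "(y0 + x) / 2 \<le> t" "t \<le> (x + (1 - y0)) / 2" by auto
    moreover have "y0 < x" "x < 1 - y0" using assms by auto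
    ultimately show "t \<in> M" by simp
  qed
qed

lemma deriv_on_M_eq: "x \<in> M \<Longrightarrow> (f has_vector_derivative D) (at x) \<Longrightarrow> deriv_on M f x = D"
  unfolding deriv_on_def by (simp add: at_within_M vector_derivative_at)

text \<open>Pointwise, the expression \<open>D\<^sub>\<epsilon>\<close> recovers \<open>f\<close> from \<open>(p u')' = - w f\<close>.\<close>

lemma D_expr_M_eq:
  assumes du: "\<And>t. t \<in> M \<Longrightarrow> (u has_vector_derivative (1 / p1 \<epsilon> t) *\<^sub>R v t) (at t)"
    and x: "x \<in> M" and dv: "(v has_vector_derivative v') (at x)"
  shows "v' = - (w1 \<epsilon> x *\<^sub>R D_expr \<epsilon> M u x)"
proof -
  have xU: "x \<in> U" using x y0_bounds by auto
  have nz: "p1 \<epsilon> x \<noteq> 0" "phi2 \<epsilon> x \<noteq> 0" using inner_sign[OF x] by auto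
  have "((\<lambda>t. inverse (p1 \<epsilon> t)) has_real_derivative - (inverse (p1 \<epsilon> x) * (p1 \<epsilon> x * (phi1 \<epsilon> x / phi2 \<epsilon> x)) * inverse (p1 \<epsilon> x))) (at x)"
    by (rule DERIV_inverse'[OF p1_deriv[OF xU] nz(1)])
  from has_vector_derivative_scaleR[OF this dv]
  have 1: "((\<lambda>t. inverse (p1 \<epsilon> t) *\<^sub>R v t) has_vector_derivative inverse (p1 \<epsilon> x) *\<^sub>R v' +
      - (inverse (p1 \<epsilon> x) * (p1 \<epsilon> x * (phi1 \<epsilon> x / phi2 \<epsilon> x)) * inverse (p1 \<epsilon> x)) *\<^sub>R v x) (at x)" .
  have d1: "deriv_on M u t = inverse (p1 \<epsilon> t) *\<^sub>R v t" if "t \<in> M" for t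
    using deriv_on_M_eq[OF that du[OF that]] by (simp add: inverse_eq_divide)
  have "(deriv_on M u has_vector_derivative inverse (p1 \<epsilon> x) *\<^sub>R v' +
      - (inverse (p1 \<epsilon> x) * (p1 \<epsilon> x * (phi1 \<epsilon> x / phi2 \<epsilon> x)) * inverse (p1 \<epsilon> x)) *\<^sub>R v x) (at x)"
    by (rule has_vector_derivative_transform_within_open[OF 1, of M]) (use x d1 in auto)
  from deriv_on_M_eq[OF x this]
  have "D_expr \<epsilon> M u x = phi2 \<epsilon> x *\<^sub>R (inverse (p1 \<epsilon> x) *\<^sub>R v' +
      - (inverse (p1 \<epsilon> x) * (p1 \<epsilon> x * (phi1 \<epsilon> x / phi2 \<epsilon> x)) * inverse (p1 \<epsilon> x)) *\<^sub>R v x)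
      + phi1 \<epsilon> x *\<^sub>R (inverse (p1 \<epsilon> x) *\<^sub>R v x)"
    unfolding D_expr_def d1[OF x] by simp
  also have "\<dots> = (phi2 \<epsilon> x / p1 \<epsilon> x) *\<^sub>R v'"
    using nz by (simp add: scaleR_conv_of_real field_simps)
  finally show ?thesis using nz by (simp add: w1_def)
qed

lemma loc_abs_cont_on_M: "abs_cont_on {y0..1 - y0} f \<Longrightarrow> loc_abs_cont_on M f"
  unfolding loc_abs_cont_on_def
proof (intro allI impI)
  fix a b assume f: "abs_cont_on {y0..1 - y0} f" and ab: "{a..b} \<subseteq> M"
  show "abs_cont_on {a..b} f" by (rule abs_cont_on_subset[OF f]) (use ab in auto)
qed

text \<open>The representative \<open>u = c + K f\<close> is differentiable at every point of
  \<open>M\<close> with quasi-derivative \<open>- Wint f\<close>, which is continuous up to the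
  endpoints and zero there; this is (Q).\<close>

lemma T_subset_D_Q: "SL.T \<subseteq> D_Q \<epsilon>"
proof clarify
  fix u0 f assume "(u0, f) \<in> SL.T"
  then have L: "u0 \<in> L2 SL.\<mu>" "f \<in> L2 SL.\<mu>" and f0: "SL.Wint f (1 - y0) = 0"
    and "\<exists>c. AE x in SL.\<mu>. u0 x = c + SL.K f x" by (auto simp: SL.T_def)
  then obtain c where c: "AE x in SL.\<mu>. u0 x = c + SL.K f x" by blast
  have wf: "SL.w_integrable f" by (rule SL.L2_w_integrable[OF L(2)])
  define u where "u x = c + SL.K f x" for x
  define v where "v x = - SL.Wint f x" for x
  have du: "(u has_vector_derivative (1 / p1 \<epsilon> x) *\<^sub>R v x) (at x)" if "x \<in> M" for x
    unfolding u_def v_def using SL.K_deriv[OF wf that] by (auto intro!: derivative_eq_intros)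
  have acu: "abs_cont_on {y0..1 - y0} u" unfolding u_def by (intro abs_cont_on_add_const SL.K_abs_cont wf)
  have acv: "abs_cont_on {y0..1 - y0} v" unfolding v_def by (intro abs_cont_on_uminus SL.Wint_abs_cont wf)
  have uL: "u \<in> L2 SL.\<mu>" by (rule SL.L2_continuous[OF abs_cont_on_imp_continuous_on[OF acu]])
  \<comment> \<open>Where \<open>Wint f\<close> has the derivative \<open>w1 f\<close>, the
    expression \<open>D_expr\<close> returns \<open>f\<close>. On the remaining null set the second
    derivative may fail to exist and \<open>D_expr\<close> may be unspecified, so the claim is an
    equality almost everywhere.\<close>
  have D_ae: "negligible {x \<in> M. f x \<noteq> D_expr \<epsilon> M u x}"
  proof (rule negligible_subset[OF SL.deriv_Wint_ae[OF wf]], intro subsetI)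
    fix x assume x: "x \<in> {x \<in> M. f x \<noteq> D_expr \<epsilon> M u x}"
    show "x \<in> {t. \<not> (SL.Wint f has_vector_derivative w1 \<epsilon> t *\<^sub>R f t) (at t)} \<inter> M"
    proof (rule ccontr)
      assume "\<not> ?thesis"
      then have "(SL.Wint f has_vector_derivative w1 \<epsilon> x *\<^sub>R f x) (at x)" using x by auto
      then have "(v has_vector_derivative - (w1 \<epsilon> x *\<^sub>R f x)) (at x)"
        unfolding v_def by (rule has_vector_derivative_minus)
      from D_expr_M_eq[OF du _ this] x have "w1 \<epsilon> x *\<^sub>R f x = w1 \<epsilon> x *\<^sub>R D_expr \<epsilon> M u x" by simp
      then show False using x SL.w_pos[of x] by auto
    qed
  qed
  have eqf: "AE x in SL.\<mu>. f x = D_expr \<epsilon> M u x" using D_ae by (simp add: SL.AE_mu_iff)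
  have Dm: "D_expr \<epsilon> M u \<in> borel_measurable SL.\<mu>"
    by (rule SL.w_integrable_imp_measurable[OF SL.w_integrable_cong_ae[OF D_ae wf]])
  have DL: "D_expr \<epsilon> M u \<in> L2 SL.\<mu>"
  proof (rule SL.L2_I[OF Dm])
    have [measurable]: "D_expr \<epsilon> M u \<in> borel_measurable SL.\<mu>" by (rule Dm)
    show "integrable SL.\<mu> (\<lambda>x. (norm (D_expr \<epsilon> M u x))\<^sup>2)"
      using SL.L2_square_integrable[OF L(2)]
      by (rule integrable_cong_AE_imp) (use eqf in \<open>auto elim: eventually_mono\<close>)
  qed
  have "quasi_derivative (p1 \<epsilon>) M u v"
    unfolding quasi_derivative_def
  proof (intro conjI loc_abs_cont_on_M acu acv AE_I2)
    fix x assume "x \<in> space (lebesgue_on M)"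
    then have x: "x \<in> M" by simp
    then have "v x = p1 \<epsilon> x *\<^sub>R ((1 / p1 \<epsilon> x) *\<^sub>R v x)" using SL.p_pos[OF x] by simp
    then show "\<exists>u'. (u has_vector_derivative u') (at x within M) \<and> v x = p1 \<epsilon> x *\<^sub>R u'"
      using du[OF x] at_within_M[OF x] by auto
  qed
  moreover have "cond_Q \<epsilon> M u"
    unfolding cond_Q_def frontier_M_plus
  proof
    fix y assume y: "y \<in> {y0, 1 - y0}"
    then have y': "y \<in> {y0..1 - y0}" using y0_bounds by auto
    have "(v \<longlongrightarrow> v y) (at y within {y0..1 - y0})"
      using abs_cont_on_imp_continuous_on[OF acv] y' by (auto simp: continuous_on_def)
    moreover have "v y = 0" using y f0 by (auto simp: v_def)
    ultimately have v0: "(v \<longlongrightarrow> 0) (at y within {y0..1 - y0})" by simp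
    have "(v \<longlongrightarrow> 0) (at y within M)" by (rule tendsto_within_subset[OF v0]) auto
    moreover have "\<forall>\<^sub>F x in at y within M. v x = p1 \<epsilon> x *\<^sub>R deriv_on M u x"
      unfolding eventually_at_filter
    proof (intro always_eventually allI impI)
      fix x assume x: "x \<in> M"
      show "v x = p1 \<epsilon> x *\<^sub>R deriv_on M u x"
        unfolding deriv_on_M_eq[OF x du[OF x]] using SL.p_pos[OF x] by simp
    qed
    ultimately show "((\<lambda>x. p1 \<epsilon> x *\<^sub>R deriv_on M u x) \<longlongrightarrow> 0) (at y within M)"
      by (rule Lim_transform_eventually)
  qed
  ultimately have "u \<in> dom_Q \<epsilon>"
    unfolding dom_Q_def mu_plus_eq M_plus_eq using uL DL by blast
  then show "(u0, f) \<in> D_Q \<epsilon>"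
    unfolding D_Q_def mu_plus_eq M_plus_eq using L c eqf by (auto simp: u_def[abs_def])
qed

text \<open>Absolute continuity is given on compact subintervals of \<open>M\<close> only, so the
  constant in \<open>v = k - Wint f\<close> cannot be read off from a value at an endpoint. (Q) at
  the left end yields \<open>k = 0\<close>, and (Q) at the right end then yields
  \<open>Wint f (1 - y0) = 0\<close>; finally \<open>u - K f\<close> has derivative zero.\<close>

lemma D_Q_subset_T: "D_Q \<epsilon> \<subseteq> SL.T"
proof clarify
  fix u0 f0 assume "(u0, f0) \<in> D_Q \<epsilon>"
  then have L: "u0 \<in> L2 SL.\<mu>" "f0 \<in> L2 SL.\<mu>" and "\<exists>u\<in>dom_Q \<epsilon>. (AE x in SL.\<mu>. u0 x = u x) \<and> (AE x in SL.\<mu>. f0 x = D_expr \<epsilon> M u x)"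
    unfolding D_Q_def mu_plus_eq M_plus_eq by auto
  then obtain u where u: "u \<in> dom_Q \<epsilon>" and uu: "AE x in SL.\<mu>. u0 x = u x" and ff: "AE x in SL.\<mu>. f0 x = D_expr \<epsilon> M u x"
    by blast
  obtain v where uL: "u \<in> L2 SL.\<mu>" and qd: "quasi_derivative (p1 \<epsilon>) M u v"
    and fL: "D_expr \<epsilon> M u \<in> L2 SL.\<mu>" and Q: "cond_Q \<epsilon> M u"
    using u unfolding dom_Q_def mu_plus_eq M_plus_eq by blast
  define f where "f = D_expr \<epsilon> M u"
  have wf: "SL.w_integrable f" unfolding f_def by (rule SL.L2_w_integrable[OF fL])
  have acu: "abs_cont_on {c..d} u" and acv: "abs_cont_on {c..d} v" if "{c..d} \<subseteq> M" for c d
    using qd that unfolding quasi_derivative_def loc_abs_cont_on_def by blast+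
  have uAE: "AE x in lebesgue_on M. \<exists>u'. (u has_vector_derivative u') (at x within M) \<and> v x = p1 \<epsilon> x *\<^sub>R u'"
    using qd unfolding quasi_derivative_def by blast
  let ?N = "{x \<in> M. \<not> (\<exists>u'. (u has_vector_derivative u') (at x within M) \<and> v x = p1 \<epsilon> x *\<^sub>R u')}"
  have N: "negligible ?N" using uAE by (subst (asm) AE_lebesgue_on_iff_negligible) auto
  have cv: "continuous_on {c..d} v" if "{c..d} \<subseteq> M" for c d
    by (rule abs_cont_on_imp_continuous_on[OF acv[OF that]])
  have isCv: "isCont v x" if x: "x \<in> M" for x
  proof -
    obtain c d where cd: "c < x" "x < d" "{c..d} \<subseteq> M" by (rule M_interval[OF x])
    show ?thesis using cv[OF cd(3)] cd(1,2) by (intro continuous_on_interior[OF cv[OF cd(3)]]) auto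
  qed
  have cvM: "continuous_on M v" using isCv by (intro continuous_at_imp_continuous_on) auto
  have u_int: "((\<lambda>t. (1 / p1 \<epsilon> t) *\<^sub>R v t) has_integral u d - u c) {c..d}" if cd: "c \<le> d" "{c..d} \<subseteq> M" for c d
  proof (rule abs_cont_on_has_integral[OF acu[OF cd(2)] N cd(1)])
    fix x assume x: "x \<in> {c..d} - ?N"
    then have xM: "x \<in> M" using cd by auto
    then obtain u' where "(u has_vector_derivative u') (at x)" "v x = p1 \<epsilon> x *\<^sub>R u'"
      using x at_within_M[OF xM] by auto
    then show "(u has_vector_derivative (1 / p1 \<epsilon> x) *\<^sub>R v x) (at x within {c..d})"
      using SL.p_pos[OF xM] by (auto intro: has_vector_derivative_at_within)
  qed
  \<comment> \<open>Continuity of \<open>v / p1\<close> on \<open>M\<close> makes \<open>u\<close>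
    differentiable at every point, so that \<open>deriv_on\<close> in (Q) and in
    \<open>D_expr\<close> is \<open>v / p1\<close> throughout.\<close>
  have du: "(u has_vector_derivative (1 / p1 \<epsilon> x) *\<^sub>R v x) (at x)" if x: "x \<in> M" for x
  proof -
    obtain c d where cd: "c < x" "x < d" "{c..d} \<subseteq> M" by (rule M_interval[OF x])
    have pc: "continuous_on {c..d} (\<lambda>t. 1 / p1 \<epsilon> t)" by (rule continuous_on_subset[OF SL.inverse_p_cont cd(3)])
    have "continuous_on {c..d} (\<lambda>t. (1 / p1 \<epsilon> t) *\<^sub>R v t)"
      by (intro continuous_on_scaleR pc cv cd)
    then have "((\<lambda>y. integral {c..y} (\<lambda>t. (1 / p1 \<epsilon> t) *\<^sub>R v t)) has_vector_derivative (1 / p1 \<epsilon> x) *\<^sub>R v x) (at x within {c..d})"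
      by (rule integral_has_vector_derivative) (use cd in auto)
    then have "((\<lambda>y. integral {c..y} (\<lambda>t. (1 / p1 \<epsilon> t) *\<^sub>R v t)) has_vector_derivative (1 / p1 \<epsilon> x) *\<^sub>R v x) (at x)"
      using cd by (simp add: at_within_Icc_at)
    then have 1: "((\<lambda>y. u c + integral {c..y} (\<lambda>t. (1 / p1 \<epsilon> t) *\<^sub>R v t)) has_vector_derivative (1 / p1 \<epsilon> x) *\<^sub>R v x) (at x)"
      by (auto intro!: derivative_eq_intros)
    show ?thesis
    proof (rule has_vector_derivative_transform_within_open[OF 1, of "{c<..<d}"])
      fix y assume y: "y \<in> {c<..<d}"
      have "integral {c..y} (\<lambda>t. (1 / p1 \<epsilon> t) *\<^sub>R v t) = u y - u c"
        by (rule integral_unique[OF u_int]) (use y cd in auto)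
      then show "u c + integral {c..y} (\<lambda>t. (1 / p1 \<epsilon> t) *\<^sub>R v t) = u y" by simp
    qed (use cd in auto)
  qed
  \<comment> \<open>Absolute continuity provides a derivative of \<open>v\<close> almost everywhere,
    and wherever it exists \<open>D_expr_M_eq\<close> identifies it as
    \<open>- w1 f\<close>.\<close>
  have v_int: "v d - v c = - (SL.Wint f d - SL.Wint f c)" if cd: "c \<le> d" "{c..d} \<subseteq> M" for c d
  proof -
    have cdI: "y0 \<le> c" "d \<le> 1 - y0" using cd by auto
    let ?B = "{t. \<not> (\<exists>D. (v has_vector_derivative D) (at t))} \<inter> {c<..<d}"
    have B: "negligible (?B \<union> {c, d})"
      using abs_cont_on_differentiable_ae[OF acv[OF cd(2)]] by (intro negligible_Un) auto
    have "((\<lambda>t. - (w1 \<epsilon> t *\<^sub>R f t)) has_integral v d - v c) {c..d}"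
    proof (rule abs_cont_on_has_integral[OF acv[OF cd(2)] B cd(1)])
      fix x assume x: "x \<in> {c..d} - (?B \<union> {c, d})"
      then obtain D where D: "(v has_vector_derivative D) (at x)" by auto
      have "D = - (w1 \<epsilon> x *\<^sub>R f x)"
        unfolding f_def by (rule D_expr_M_eq[OF du _ D]) (use x cd in auto)
      then show "(v has_vector_derivative - (w1 \<epsilon> x *\<^sub>R f x)) (at x within {c..d})"
        using D by (auto intro: has_vector_derivative_at_within)
    qed
    from integral_unique[OF this] have "v d - v c = - integral {c..d} (\<lambda>t. w1 \<epsilon> t *\<^sub>R f t)"
      by simp
    moreover have W: "SL.Wint f c + integral {c..d} (\<lambda>t. w1 \<epsilon> t *\<^sub>R f t) = SL.Wint f d"
      unfolding SL.Wint_def using cd cdI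
      by (intro Henstock_Kurzweil_Integration.integral_combine SL.w_integrable_integrable_on wf) auto
    ultimately show ?thesis by (simp flip: W)
  qed
  obtain m where m: "m \<in> M" using SL.ab dense[of y0 "1 - y0"] by auto
  define k where "k = v m + SL.Wint f m"
  have v_eq: "v x = k - SL.Wint f x" if x: "x \<in> M" for x
  proof (cases "x \<le> m")
    case True
    then have "v m - v x = - (SL.Wint f m - SL.Wint f x)" by (rule v_int) (use x m in auto)
    then show ?thesis by (simp add: k_def algebra_simps)
  next
    case False
    then have "v x - v m = - (SL.Wint f x - SL.Wint f m)" by (intro v_int) (use x m in auto)
    then show ?thesis by (simp add: k_def algebra_simps)
  qed
  have lim: "k - SL.Wint f y = 0" if y: "y \<in> {y0, 1 - y0}" for y
  proof -
    have y': "y \<in> {y0..1 - y0}" using y y0_bounds by auto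
    have "((\<lambda>x. k - SL.Wint f x) \<longlongrightarrow> k - SL.Wint f y) (at y within {y0..1 - y0})"
      using SL.Wint_continuous[OF wf] y' by (intro tendsto_intros) (auto simp: continuous_on_def)
    then have 1: "((\<lambda>x. k - SL.Wint f x) \<longlongrightarrow> k - SL.Wint f y) (at y within M)"
      by (rule tendsto_within_subset) auto
    have "((\<lambda>x. p1 \<epsilon> x *\<^sub>R deriv_on M u x) \<longlongrightarrow> 0) (at y within M)"
      using Q y unfolding cond_Q_def frontier_M_plus by blast
    moreover have "\<forall>\<^sub>F x in at y within M. p1 \<epsilon> x *\<^sub>R deriv_on M u x = k - SL.Wint f x"
      unfolding eventually_at_filter
    proof (intro always_eventually allI impI)
      fix x assume x: "x \<in> M"
      show "p1 \<epsilon> x *\<^sub>R deriv_on M u x = k - SL.Wint f x"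
        unfolding deriv_on_M_eq[OF x du[OF x]] using SL.p_pos[OF x] v_eq[OF x] by simp
    qed
    ultimately have 2: "((\<lambda>x. k - SL.Wint f x) \<longlongrightarrow> 0) (at y within M)"
      by (rule Lim_transform_eventually)
    have "y islimpt M"
      using y SL.ab by (simp add: islimpt_greaterThanLessThan1 islimpt_greaterThanLessThan2) (auto simp: islimpt_greaterThanLessThan1 islimpt_greaterThanLessThan2)
    then have "at y within M \<noteq> bot" by (simp add: trivial_limit_within)
    then show ?thesis using tendsto_unique[OF _ 1 2] by blast
  qed
  have k0: "k = 0" using lim[of y0] by simp
  have Wb: "SL.Wint f (1 - y0) = 0" using lim[of "1 - y0"] k0 by simp
  have "u x - SL.K f x = u m - SL.K f m" if x: "x \<in> M" for x
  proof -
    have "((\<lambda>t. u t - SL.K f t) has_vector_derivative 0) (at t within M)" if t: "t \<in> M" for t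
    proof -
      have "((\<lambda>t. u t - SL.K f t) has_vector_derivative (1 / p1 \<epsilon> t) *\<^sub>R v t - - ((1 / p1 \<epsilon> t) *\<^sub>R SL.Wint f t)) (at t within M)"
        by (intro has_vector_derivative_diff has_vector_derivative_at_within[OF du] has_vector_derivative_at_within[OF SL.K_deriv] wf t)
      then show ?thesis using v_eq[OF t] k0 by simp
    qed
    from has_vector_derivative_zero_constant[OF convex_real_interval(8) this]
    obtain c where "\<And>t. t \<in> M \<Longrightarrow> u t - SL.K f t = c" by blast
    from this[OF x] this[OF m] show ?thesis by simp
  qed
  then have "u x = (u m - SL.K f m) + SL.K f x" if "x \<in> M" for x using that by (simp add: algebra_simps)
  then have "AE x in SL.\<mu>. u x = (u m - SL.K f m) + SL.K f x" by (intro AE_I2) auto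
  then have "(u, f) \<in> SL.T" unfolding SL.T_def using uL fL Wb by (auto simp: f_def)
  then show "(u0, f0) \<in> SL.T"
    by (rule SL.T_cong_ae) (use uu ff L in \<open>auto simp: f_def elim: eventually_mono\<close>)
qed

lemma D_Q_eq: "D_Q \<epsilon> = SL.T"
  using T_subset_D_Q D_Q_subset_T by blast

end

theorem theorem1p1:
  shows "\<exists>\<epsilon>0>0. \<forall>\<epsilon>::real. 0 < \<epsilon> \<and> \<epsilon> \<le> \<epsilon>0 \<longrightarrow>
    (\<forall>z::complex.
       {u. C2_on {0..1} u \<and> (\<exists>x\<in>{0..1}. u x \<noteq> 0) \<and> (\<forall>x\<in>{0..1}. D_expr \<epsilon> {0..1} u x = z * u x)}
       = {u. eigenfunction \<epsilon> z u \<and> cond_Q \<epsilon> {0..1} u}) \<and>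
    self_adjoint (mu_plus \<epsilon>) (D_Q \<epsilon>) \<and>
    discrete_spectrum (mu_plus \<epsilon>) (D_Q \<epsilon>) \<and>
    L2_spectrum (mu_plus \<epsilon>) (D_Q \<epsilon>) \<subseteq> complex_of_real ` {0..} \<and>
    L2_kernel (mu_plus \<epsilon>) (D_Q \<epsilon>)
      = {u \<in> borel_measurable (mu_plus \<epsilon>). \<exists>c. AE x in mu_plus \<epsilon>. u x = c}"
proof (intro exI[of _ "1 / 100"] conjI[of "0 < (1 / 100 :: real)"] allI impI)
  show "0 < (1 / 100 :: real)" by simp
next
  fix \<epsilon> :: real assume "0 < \<epsilon> \<and> \<epsilon> \<le> 1 / 100"
  then interpret small_eps \<epsilon> by unfold_locales auto
  have "{u. C2_on {0..1} u \<and> (\<exists>x\<in>{0..1}. u x \<noteq> 0) \<and> (\<forall>x\<in>{0..1}. D_expr \<epsilon> {0..1} u x = z * u x)}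
       = {u. eigenfunction \<epsilon> z u \<and> cond_Q \<epsilon> {0..1} u}" for z
  proof (intro equalityI subsetI CollectI; elim CollectE conjE)
    fix u assume "C2_on {0..1} u" "\<exists>x\<in>{0..1}. u x \<noteq> 0" "\<forall>x\<in>{0..1}. D_expr \<epsilon> {0..1} u x = z * u x"
    then show "eigenfunction \<epsilon> z u \<and> cond_Q \<epsilon> {0..1} u" by (intro C2_solution_is_eigenfunction) auto
  next
    fix u assume u: "eigenfunction \<epsilon> z u" "cond_Q \<epsilon> {0..1} u"
    moreover have "\<exists>x\<in>{0..1}. u x \<noteq> 0" using u unfolding eigenfunction_def by blast
    ultimately show "C2_on {0..1} u \<and> (\<exists>x\<in>{0..1}. u x \<noteq> 0) \<and> (\<forall>x\<in>{0..1}. D_expr \<epsilon> {0..1} u x = z * u x)"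
      using eigenfunction_is_C2_solution by blast
  qed
  then show "(\<forall>z::complex.
       {u. C2_on {0..1} u \<and> (\<exists>x\<in>{0..1}. u x \<noteq> 0) \<and> (\<forall>x\<in>{0..1}. D_expr \<epsilon> {0..1} u x = z * u x)}
       = {u. eigenfunction \<epsilon> z u \<and> cond_Q \<epsilon> {0..1} u}) \<and>
    self_adjoint (mu_plus \<epsilon>) (D_Q \<epsilon>) \<and>
    discrete_spectrum (mu_plus \<epsilon>) (D_Q \<epsilon>) \<and>
    L2_spectrum (mu_plus \<epsilon>) (D_Q \<epsilon>) \<subseteq> complex_of_real ` {0..} \<and>
    L2_kernel (mu_plus \<epsilon>) (D_Q \<epsilon>)
      = {u \<in> borel_measurable (mu_plus \<epsilon>). \<exists>c. AE x in mu_plus \<epsilon>. u x = c}"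
    unfolding mu_plus_eq D_Q_eq
    using SL.T_self_adjoint SL.T_discrete_spectrum SL.T_spectrum_nonneg SL.T_kernel by blast
qed

end
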